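(* Let $n\ge1$ and let $\lambda\in\mathbb{Z}^n$ with $\lambda_1\ge\cdots\ge\lambda_n$. The symmetric (bosonic) Macdonald polynomial $P_\lambda=P_\lambda(q,t)$ is the unique element of $K[X]^{S_n}$ such that (a) $P_\lambda(q,t)=m_\lambda+(\text{a linear combination of } m_\gamma \text{ with } \gamma<\lambda \text{ in dominance order})$; (b) if $\gamma\in\mathbb{Z}^n$ is weakly decreasing and $\gamma<\lambda$ in dominance order, then $(P_\lambda(q,t),m_\gamma)_{q,t}=0$.
   Context: Let $q,t^{1/2}$ be independent indeterminates over $\mathbb{C}$, $t=(t^{1/2})^2$, $K=\mathbb{C}(q,t^{1/2})$, $K[X]=K[x_1^{\pm1},\ldots,x_n^{\pm1}]$, $x^\mu=x_1^{\mu_1}\cdots x_n^{\mu_n}$. $S_n$ acts on $K[X]$ by permuting variables and on $\mathbb{Z}^n$ by $(w\mu)_{w(i)}=\mu_i$; $s_i=(i,i+1)$; $\partial_if=\frac{f-s_if}{x_i-x_{i+1}}$. For weakly decreasing $\gamma\in\mathbb{Z}^n$, $m_\gamma=\sum_{\mu\in S_n\gamma}x^\mu$ (sum over distinct rearrangements of $\gamma$). Dominance order on weakly decreasing sequences: $\gamma\le\lambda$ iff $\gamma_1+\cdots+\gamma_i\le\lambda_1+\cdots+\lambda_i$ for all $i\in\{1,\ldots,n\}$. For $\mu\in\mathbb{Z}^n$, $v_\mu\in S_n$ is the minimal length permutation such that $v_\mu\mu$ is weakly increasing; explicitly $v_\mu(r)=1+\#\{r'<r:\mu_{r'}\le\mu_r\}+\#\{r'>r:\mu_{r'}<\mu_r\}$.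 The electronic (nonsymmetric) Macdonald polynomials $E_\mu\in K[X]$, $\mu\in\mathbb{Z}^n$, are determined by: (E0) $E_{(0,\ldots,0)}=1$; (E1) $E_{(\mu_n+1,\mu_1,\ldots,\mu_{n-1})}=q^{\mu_n}x_1E_\mu(x_2,\ldots,x_n,q^{-1}x_1)$; (E2) if $\mu\in\mathbb{Z}_{\ge0}^n$ and $\mu_i>\mu_{i+1}$ then $E_{s_i\mu}=\partial_i(x_iE_\mu)-tx_i\partial_iE_\mu+\frac{(1-t)a}{1-a}E_\mu$ with $a=q^{\mu_i-\mu_{i+1}}t^{v_\mu(i)-v_\mu(i+1)}$; (E3) $E_{(\mu_1-1,\ldots,\mu_n-1)}=x_1^{-1}\cdots x_n^{-1}E_\mu$. Then $P_\lambda=\frac1{W_\lambda(t)}\sum_{w\in S_n}w\big(E_\lambda\prod_{i<j}\frac{x_i-tx_j}{x_i-x_j}\big)$, where $W_\lambda(t)$ is the constant making the coefficient of $x^\lambda$ in $P_\lambda$ equal to $1$. Inner product: the bar involution on $K[X]$ is the $\mathbb{C}$-algebra automorphism $x_i\mapsto x_i^{-1}$, $q\mapsto q^{-1}$, $t^{1/2}\mapsto t^{-1/2}$. With $(z;q)_\infty=\prod_{r\ge0}(1-q^rz)$, $J_{q,t}=\prod_{i<j}\frac{(x_ix_j^{-1};q)_\infty}{(tx_ix_j^{-1};q)_\infty}\frac{(qx_i^{-1}x_j;q)_\infty}{(qtx_i^{-1}x_j;q)_\infty}$ is expanded as a formal power series, with coefficients in $\mathbb{Z}[t]$, in $x_ix_{i+1}^{-1}$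 ($1\le i\le n-1$) and $qx_1^{-1}x_n$ (so the coefficient of each $x^\mu$ lies in $\mathbb{Z}[t][[q]]$); $(f_1,f_2)_{q,t}=\mathrm{ct}(f_1\overline{f_2}J_{q,t})\in\mathbb{C}(t^{1/2})((q))\supset K$, where $\mathrm{ct}$ is the coefficient of $x^0$. *)

theory Defs
  imports
    "HOL-Library.Poly_Mapping"
    "HOL-Computational_Algebra.Computational_Algebra"
    "HOL-Combinatorics.Permutations"
begin

section \<open>The coefficient field\<close>

text \<open>
  \<open>coeff0\<close> is \<open>\<complex>(t\<^sup>1\<^sup>/\<^sup>2)\<close>, and \<open>K = \<complex>(q, t\<^sup>1\<^sup>/\<^sup>2)\<close> is presented as \<open>\<complex>(t\<^sup>1\<^sup>/\<^sup>2)(q)\<close>,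
  so that it embeds into the field \<open>coeff0 fls\<close> \<open>= \<complex>(t\<^sup>1\<^sup>/\<^sup>2)((q))\<close> of Laurent series in \<open>q\<close>.
\<close>

type_synonym coeff0 = "complex poly fract"
type_synonym K = "coeff0 poly fract"

definition fract_const :: "'a::field \<Rightarrow> 'a poly fract" where
  "fract_const c = Fraction_Field.Fract [:c:] 1"

definition fract_var :: "'a::field poly fract" where
  "fract_var = Fraction_Field.Fract [:0, 1:] 1"

definition qK :: K where "qK = fract_var"
definition tK_half :: K where "tK_half = fract_const fract_var"
definition tK :: K where "tK = tK_half ^ 2"

text \<open>
  The field homomorphism out of \<open>F(z)\<close> that is \<open>c\<close> on the field \<open>F\<close> and sends \<open>z\<close> to \<open>u\<close>.
  It is only used for \<open>u\<close> transcendental over the image of \<open>c\<close>, where no denominator vanishes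
  and the value does not depend on the chosen fraction.
\<close>

definition subst_fract :: "('a::field \<Rightarrow> 'b::field) \<Rightarrow> 'b \<Rightarrow> 'a poly fract \<Rightarrow> 'b" where
  "subst_fract c u r =
     (THE y. \<exists>a b. b \<noteq> 0 \<and> r = Fraction_Field.Fract a b \<and>
                   y = poly (map_poly c a) u / poly (map_poly c b) u)"

definition bar_coeff0 :: "coeff0 \<Rightarrow> coeff0" where
  "bar_coeff0 = subst_fract fract_const (inverse fract_var)"

definition bar_K :: "K \<Rightarrow> K" where
  "bar_K = subst_fract (\<lambda>c. fract_const (bar_coeff0 c)) (inverse qK)"

definition K_to_fls :: "K \<Rightarrow> coeff0 fls" where
  "K_to_fls = subst_fract fls_const fls_X"


section \<open>Laurent polynomials\<close>

text \<open>
  Exponents are finitely supported functions \<open>nat \<Rightarrow> int\<close>, and \<open>\<int>\<^sup>n\<close> consists of those supported in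
  \<open>{1..n}\<close>.  The type \<open>laurent\<close> thus has variables indexed by all natural numbers (it is an
  integral domain), and \<open>K[x\<^sub>1\<^sup>\<plusminus>\<^sup>1, \<dots>, x\<^sub>n\<^sup>\<plusminus>\<^sup>1]\<close> is its subring \<open>laurent_ring n\<close>.
\<close>

type_synonym expo = "nat \<Rightarrow>\<^sub>0 int"
type_synonym laurent = "expo \<Rightarrow>\<^sub>0 K"

abbreviation cmp :: "expo \<Rightarrow> nat \<Rightarrow> int" where
  "cmp \<equiv> Poly_Mapping.lookup"

definition weights :: "nat \<Rightarrow> expo set" where
  "weights n = {\<mu>. Poly_Mapping.keys \<mu> \<subseteq> {1..n}}"

definition mk_expo :: "nat \<Rightarrow> (nat \<Rightarrow> int) \<Rightarrow> expo" where
  "mk_expo n f = (\<Sum>i=1..n. Poly_Mapping.single i (f i))"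

definition laurent_ring :: "nat \<Rightarrow> laurent set" where
  "laurent_ring n = {f. Poly_Mapping.keys f \<subseteq> weights n}"

definition lconst :: "K \<Rightarrow> laurent" where
  "lconst c = Poly_Mapping.single 0 c"

definition lmonom :: "expo \<Rightarrow> laurent" where
  "lmonom \<mu> = Poly_Mapping.single \<mu> 1"

definition Xvar :: "nat \<Rightarrow> laurent" where
  "Xvar i = lmonom (Poly_Mapping.single i 1)"

text \<open>The monomial \<open>x\<^sub>i x\<^sub>j\<^sup>-\<^sup>1\<close>.\<close>

definition Xratio :: "nat \<Rightarrow> nat \<Rightarrow> laurent" where
  "Xratio i j = lmonom (Poly_Mapping.single i 1 - Poly_Mapping.single j 1)"

text \<open>\<open>(w\<mu>)\<^sub>w\<^sub>(\<^sub>i\<^sub>) = \<mu>\<^sub>i\<close> for a permutation \<open>w\<close>, and \<open>w x\<^sup>\<mu> = x\<^sup>w\<^sup>\<mu>\<close>.\<close>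

definition act_expo :: "(nat \<Rightarrow> nat) \<Rightarrow> expo \<Rightarrow> expo" where
  "act_expo w \<mu> = Poly_Mapping.map_key (inv w) \<mu>"

definition act :: "(nat \<Rightarrow> nat) \<Rightarrow> laurent \<Rightarrow> laurent" where
  "act w f = (\<Sum>\<nu>\<in>Poly_Mapping.keys f.
                Poly_Mapping.single (act_expo w \<nu>) (Poly_Mapping.lookup f \<nu>))"

definition simple_refl :: "nat \<Rightarrow> nat \<Rightarrow> nat" where
  "simple_refl i = transpose i (Suc i)"

definition ddiff :: "nat \<Rightarrow> laurent \<Rightarrow> laurent" where
  "ddiff i f = (THE g. g * (Xvar i - Xvar (Suc i)) = f - act (simple_refl i) f)"

definition sym_ring :: "nat \<Rightarrow> laurent set" where
  "sym_ring n = {f \<in> laurent_ring n. \<forall>w. w permutes {1..n} \<longrightarrow> act w f = f}"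

definition dominant :: "nat \<Rightarrow> expo set" where
  "dominant n = {\<gamma> \<in> weights n. \<forall>i j. 1 \<le> i \<and> i \<le> j \<and> j \<le> n \<longrightarrow> cmp \<gamma> j \<le> cmp \<gamma> i}"

text \<open>
  Equality of the total degrees is not required, so there may be infinitely many weights
  below a given one.
\<close>

definition dominance_le :: "nat \<Rightarrow> expo \<Rightarrow> expo \<Rightarrow> bool" where
  "dominance_le n \<gamma> lam \<longleftrightarrow> (\<forall>i\<in>{1..n}. (\<Sum>j=1..i. cmp \<gamma> j) \<le> (\<Sum>j=1..i. cmp lam j))"

definition dominant_below :: "nat \<Rightarrow> expo \<Rightarrow> expo set" where
  "dominant_below n lam = {\<gamma> \<in> dominant n. dominance_le n \<gamma> lam \<and> \<gamma> \<noteq> lam}"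

definition monom_sym :: "nat \<Rightarrow> expo \<Rightarrow> laurent" where
  "monom_sym n \<gamma> = (\<Sum>\<mu>\<in>(\<lambda>w. act_expo w \<gamma>) ` {w. w permutes {1..n}}. lmonom \<mu>)"


section \<open>Nonsymmetric and symmetric Macdonald polynomials\<close>

definition v_perm :: "nat \<Rightarrow> expo \<Rightarrow> nat \<Rightarrow> nat" where
  "v_perm n \<mu> r = 1 + card {r'\<in>{1..n}. r' < r \<and> cmp \<mu> r' \<le> cmp \<mu> r}
               + card {r'\<in>{1..n}. r' > r \<and> cmp \<mu> r' < cmp \<mu> r}"

text \<open>\<open>(\<mu>\<^sub>1, \<dots>, \<mu>\<^sub>n) \<mapsto> (\<mu>\<^sub>n, \<mu>\<^sub>1, \<dots>, \<mu>\<^sub>n\<^sub>-\<^sub>1)\<close>\<close>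

definition cyc :: "nat \<Rightarrow> expo \<Rightarrow> expo" where
  "cyc n \<mu> = mk_expo n (\<lambda>i. if i = 1 then cmp \<mu> n else cmp \<mu> (i - 1))"

text \<open>
  The substitution \<open>f \<mapsto> f(x\<^sub>2, \<dots>, x\<^sub>n, q\<^sup>-\<^sup>1x\<^sub>1)\<close>, which sends \<open>x\<^sup>\<nu>\<close> to
  \<open>q\<close> to the power \<open>-\<nu>\<^sub>n\<close> times the monomial with exponent \<open>cyc n \<nu>\<close>.
\<close>

definition cyc_subst :: "nat \<Rightarrow> laurent \<Rightarrow> laurent" where
  "cyc_subst n f = (\<Sum>\<nu>\<in>Poly_Mapping.keys f.
     Poly_Mapping.single (cyc n \<nu>) (Poly_Mapping.lookup f \<nu> * qK powi (- cmp \<nu> n)))"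

definition is_nonsym_macdonald :: "nat \<Rightarrow> (expo \<Rightarrow> laurent) \<Rightarrow> bool" where
  "is_nonsym_macdonald n E \<longleftrightarrow>
     (\<forall>\<mu>\<in>weights n. E \<mu> \<in> laurent_ring n) \<and>
     E 0 = 1 \<and>
     (\<forall>\<mu>\<in>weights n.
        E (cyc n \<mu> + Poly_Mapping.single 1 1)
          = lconst (qK powi cmp \<mu> n) * Xvar 1 * cyc_subst n (E \<mu>)) \<and>
     (\<forall>\<mu>\<in>weights n. \<forall>i\<in>{1..<n}.
        (\<forall>j\<in>{1..n}. 0 \<le> cmp \<mu> j) \<and> cmp \<mu> i > cmp \<mu> (Suc i) \<longrightarrow>
        (let a = qK powi (cmp \<mu> i - cmp \<mu> (Suc i))
                 * tK powi (int (v_perm n \<mu> i) - int (v_perm n \<mu> (Suc i)))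
         in E (act_expo (simple_refl i) \<mu>)
              = ddiff i (Xvar i * E \<mu>) - lconst tK * Xvar i * ddiff i (E \<mu>)
                + lconst ((1 - tK) * a / (1 - a)) * E \<mu>)) \<and>
     (\<forall>\<mu>\<in>weights n. E (\<mu> - mk_expo n (\<lambda>_. 1)) = lmonom (- mk_expo n (\<lambda>_. 1)) * E \<mu>)"

text \<open>
  The conditions determine \<open>E \<mu>\<close> for \<open>\<mu> \<in> \<int>\<^sup>n\<close>; they say nothing about exponents not
  supported in \<open>{1..n}\<close>, hence \<open>SOME\<close> rather than \<open>THE\<close>.
\<close>

definition macdonald_E :: "nat \<Rightarrow> expo \<Rightarrow> laurent" where
  "macdonald_E n = (SOME E. is_nonsym_macdonald n E)"

text \<open>
  The Laurent polynomial whose image in the field of fractions is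
  \<open>\<Sum>\<^sub>w w(f \<Prod>\<^sub>i\<^sub><\<^sub>j (x\<^sub>i - t x\<^sub>j) / (x\<^sub>i - x\<^sub>j))\<close>.
\<close>

definition symmetrization :: "nat \<Rightarrow> laurent \<Rightarrow> laurent" where
  "symmetrization n f = (THE g. Fraction_Field.Fract g 1 =
     (\<Sum>w | w permutes {1..n}.
        Fraction_Field.Fract
          (act w (f * (\<Prod>j=1..n. \<Prod>i=1..<j. Xvar i - lconst tK * Xvar j)))
          (act w (\<Prod>j=1..n. \<Prod>i=1..<j. Xvar i - Xvar j))))"

definition W_norm :: "nat \<Rightarrow> expo \<Rightarrow> K" where
  "W_norm n lam = Poly_Mapping.lookup (symmetrization n (macdonald_E n lam)) lam"

definition macdonald_P :: "nat \<Rightarrow> expo \<Rightarrow> laurent" where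
  "macdonald_P n lam = lconst (1 / W_norm n lam) * symmetrization n (macdonald_E n lam)"


section \<open>The inner product\<close>

definition bar :: "laurent \<Rightarrow> laurent" where
  "bar f = (\<Sum>\<nu>\<in>Poly_Mapping.keys f.
              Poly_Mapping.single (- \<nu>) (bar_K (Poly_Mapping.lookup f \<nu>)))"

text \<open>
  Every factor of \<open>J\<close> is a power series in \<open>y\<^sub>i = x\<^sub>i x\<^sub>i\<^sub>+\<^sub>1\<^sup>-\<^sup>1\<close> \<open>(1 \<le> i < n)\<close> and
  \<open>y\<^sub>0 = q x\<^sub>1\<^sup>-\<^sup>1 x\<^sub>n\<close>; note \<open>q = y\<^sub>0 y\<^sub>1 \<cdots> y\<^sub>n\<^sub>-\<^sub>1\<close>.  Cutting the infinite products and the geometric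
  series \<open>1/(1 - u) = \<Sum>\<^sub>k u\<^sup>k\<close> off at \<open>N\<close> changes \<open>J\<close> only in \<open>y\<close>-degrees \<open>\<ge> N\<close>.  The \<open>y\<close>-monomials
  whose \<open>x\<close>-part is a given \<open>x\<^sup>\<mu>\<close> differ by powers of \<open>q\<close>, so the coefficient of \<open>x\<^sup>\<mu>\<close> in \<open>J\<close> is the
  \<open>q\<close>-adic limit of the coefficients of \<open>x\<^sup>\<mu>\<close> in the truncations.  The limit below is taken in the
  \<open>q\<close>-adic metric that the library puts on \<open>fls\<close>.
\<close>

definition geom :: "nat \<Rightarrow> laurent \<Rightarrow> laurent" where
  "geom N u = (\<Sum>k<N. u ^ k)"

definition J_trunc :: "nat \<Rightarrow> nat \<Rightarrow> laurent" where
  "J_trunc n N = (\<Prod>j=1..n. \<Prod>i=1..<j.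
     (\<Prod>r<N. 1 - lconst (qK ^ r) * Xratio i j) *
     (\<Prod>r<N. geom N (lconst (tK * qK ^ r) * Xratio i j)) *
     (\<Prod>r<N. 1 - lconst (qK * qK ^ r) * Xratio j i) *
     (\<Prod>r<N. geom N (lconst (tK * qK * qK ^ r) * Xratio j i)))"

definition J_coeff :: "nat \<Rightarrow> expo \<Rightarrow> coeff0 fls" where
  "J_coeff n \<mu> = lim (\<lambda>N. K_to_fls (Poly_Mapping.lookup (J_trunc n N) \<mu>))"

text \<open>The constant term of \<open>f\<^sub>1 \<cdot> bar f\<^sub>2 \<cdot> J\<close>.\<close>

definition inner_qt :: "nat \<Rightarrow> laurent \<Rightarrow> laurent \<Rightarrow> coeff0 fls" where
  "inner_qt n f1 f2 = (\<Sum>\<nu>\<in>Poly_Mapping.keys (f1 * bar f2).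
     K_to_fls (Poly_Mapping.lookup (f1 * bar f2) \<nu>) * J_coeff n (- \<nu>))"

end

theory Submission
  imports Defs
begin

text \<open>
  The weight \<open>J\<close> is invariant under the cyclic substitution, and \<open>J (1 - t u) / (1 - u)\<close> with
  \<open>u = x\<^sub>i / x\<^sub>i\<^sub>+\<^sub>1\<close> is symmetric under \<open>s\<^sub>i\<close>.  Hence the cyclic substitution and the
  Demazure--Lusztig operators \<open>T\<^sub>i\<close> of (E2) are isometries, and so are the Cherednik operators
  \<open>Y = T\<^sub>1 \<cdots> T\<^sub>n\<^sub>-\<^sub>1 \<omega>\<^sup>-\<^sup>1\<close> and its conjugates under \<open>\<Phi> = x\<^sub>1 \<omega>\<close>, where \<open>\<omega>\<close> is the cyclic
  substitution.  They are triangular for an order that \<open>\<Phi>\<close> preserves, their eigenvalues separate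
  weights by the powers of \<open>q\<close>, and the form is nondegenerate because modulo \<open>q\<close> the Gram matrix of
  the monomials is unitriangular.  So there are orthogonal joint eigenvectors with leading terms
  \<open>x\<^sup>\<mu>\<close>, without any appeal to the braid relations; they satisfy (E0)--(E3), hence are the \<open>E\<^sub>\<mu>\<close>.

  For symmetric \<open>g\<close> the form \<open>(\<cdot>, g)\<close> vanishes on the images of \<open>T\<^sub>i - 1\<close>, and modulo these images
  every monomial is a combination of the \<open>m\<^sub>\<gamma>\<close> with \<open>\<gamma>\<close> below it.  The symmetrization kills the same
  images and multiplies symmetric polynomials by a nonzero constant.  Therefore \<open>P\<^sub>\<lambda>\<close> is, up to a
  scalar, the class of \<open>E\<^sub>\<lambda>\<close> written in the \<open>m\<^sub>\<gamma>\<close>, which gives triangularity and orthogonality; and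
  a symmetric polynomial orthogonal to all \<open>m\<^sub>\<gamma>\<close> involved is orthogonal to all its monomials, which
  gives uniqueness.
\<close>

section \<open>Evaluation homomorphisms on rational functions\<close>

text \<open>Nondegeneracy of the sesquilinear form is proved in its left argument, so
  \<open>E_\<mu>\<close> is pinned down by its leading term and by
  \<open>(E_\<mu>, x^\<nu>) = 0\<close> for all \<nu> below \<mu>. This characterisation does the
  work that commuting operators usually do: a triangular isometry, divided by its eigenvalue at
  \<mu>, sends such an element to one with the same property, hence fixes it. Conversely, since
  \<open>bar\<close> inverts every eigenvalue, eigenvectors of one isometry with different
  eigenvalues are orthogonal. Two obstacles shape the rest. The weight J is an infinite product, so
  its symmetries are proved for truncations, either exactly or up to terms of high degree, and then
  passed to the limit. And dominance does not fix the total degree, so a \<gamma> below \<lambda>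
  need not be comparable with \<lambda> in the order that governs \<open>E_\<lambda>\<close>, and
  there may be infinitely many of them. Orthogonality is therefore transported through sets of
  weights closed downwards, and nondegeneracy is tested only on the monomials that occur in a given
  element.\<close>

locale field_hom =
  fixes c :: "'a::field \<Rightarrow> 'b::field"
  assumes hom_add: "c (x + y) = c x + c y"
    and hom_mult: "c (x * y) = c x * c y"
    and hom_one: "c 1 = 1"
begin

lemma hom_zero [simp]: "c 0 = 0"
proof -
  have "c 0 + c 0 = c 0 + 0" using hom_add[of 0 0] by simp
  then show ?thesis by (rule add_left_imp_eq)
qed

lemma hom_uminus: "c (- x) = - c x"
  using hom_add[of x "- x"] by (simp add: eq_neg_iff_add_eq_0 add.commute)

lemma hom_diff: "c (x - y) = c x - c y"
  using hom_add[of x "- y"] by (simp add: hom_uminus)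

lemma hom_eq_0_iff [simp]: "c x = 0 \<longleftrightarrow> x = 0"
proof
  assume "c x = 0"
  show "x = 0"
  proof (rule ccontr)
    assume "x \<noteq> 0"
    then have "c (x * inverse x) = 1" by (simp add: hom_one)
    then show False using \<open>c x = 0\<close> by (simp add: hom_mult)
  qed
qed simp

lemma hom_inverse: "c (inverse x) = inverse (c x)"
proof (cases "x = 0")
  case False
  then have "c x * c (inverse x) = 1"
    by (simp add: hom_mult[symmetric] hom_one)
  then show ?thesis by (metis inverse_unique)
qed simp

lemma hom_power: "c (x ^ k) = c x ^ k"
  by (induction k) (simp_all add: hom_one hom_mult)

lemma hom_power_int: "c (x powi k) = c x powi k"
  by (cases "k \<ge> 0") (simp_all add: power_int_def hom_power hom_inverse)

lemma hom_sum: "c (sum f A) = (\<Sum>x\<in>A. c (f x))"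
  by (induction A rule: infinite_finite_induct) (simp_all add: hom_add)

end

text \<open>Serves the two layers of \<open>bar\<close>, on \<open>coeff0\<close> and on
  \<open>K\<close>, and the expansion in powers of q. Transcendence of u over the image of c keeps
  denominators away from 0.\<close>

locale fract_eval = field_hom c for c :: "'a::field \<Rightarrow> 'b::field" +
  fixes u :: 'b
  assumes transcendental: "p \<noteq> 0 \<Longrightarrow> poly (map_poly c p) u \<noteq> 0"
begin

abbreviation "evp p \<equiv> poly (map_poly c p) u"

lemma evp_pCons: "evp (pCons a p) = c a + u * evp p"
  by (simp add: map_poly_pCons)

lemma evp_add: "evp (p + r) = evp p + evp r"
  by (induction p r rule: poly_induct2) (simp_all add: evp_pCons hom_add algebra_simps)

lemma evp_smult: "evp (smult a p) = c a * evp p"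
  by (induction p) (simp_all add: evp_pCons hom_mult algebra_simps)

lemma evp_mult: "evp (p * r) = evp p * evp r"
  by (induction p) (simp_all add: mult_pCons_left evp_add evp_smult evp_pCons algebra_simps)

lemma subst_Fract:
  assumes "b \<noteq> 0"
  shows "subst_fract c u (Fraction_Field.Fract a b) = evp a / evp b"
  unfolding subst_fract_def
proof (rule the_equality)
  show "\<exists>a' b'. b' \<noteq> 0 \<and> Fraction_Field.Fract a b = Fraction_Field.Fract a' b' \<and>
          evp a / evp b = evp a' / evp b'"
    using assms by blast
next
  fix y
  assume "\<exists>a' b'. b' \<noteq> 0 \<and> Fraction_Field.Fract a b = Fraction_Field.Fract a' b' \<and>
          y = evp a' / evp b'"
  then obtain a' b' where *: "b' \<noteq> 0" "Fraction_Field.Fract a b = Fraction_Field.Fract a' b'"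
    "y = evp a' / evp b'" by blast
  then have "a * b' = a' * b" using assms by (simp add: eq_fract)
  then have "evp a * evp b' = evp a' * evp b" by (metis evp_mult)
  then show "y = evp a / evp b"
    using * assms transcendental[of b] transcendental[of b'] by (simp add: frac_eq_eq)
qed

lemma field_hom_subst: "field_hom (subst_fract c u)"
proof
  fix x y :: "'a poly fract"
  obtain a b where x: "x = Fraction_Field.Fract a b" "b \<noteq> 0" by (cases x)
  obtain a' b' where y: "y = Fraction_Field.Fract a' b'" "b' \<noteq> 0" by (cases y)
  note nz = transcendental[OF x(2)] transcendental[OF y(2)]
  show "subst_fract c u (x + y) = subst_fract c u x + subst_fract c u y"
    using x y nz by (simp add: subst_Fract evp_add evp_mult field_simps)
  show "subst_fract c u (x * y) = subst_fract c u x * subst_fract c u y"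
    using x y nz by (simp add: subst_Fract evp_mult)
  show "subst_fract c u 1 = 1"
    by (simp add: One_fract_def subst_Fract hom_one map_poly_1')
qed

lemma subst_fract_const: "subst_fract c u (fract_const a) = c a"
  by (simp add: fract_const_def subst_Fract hom_one map_poly_pCons map_poly_1')

lemma subst_fract_var: "subst_fract c u fract_var = u"
  by (simp add: fract_var_def subst_Fract hom_one map_poly_pCons map_poly_1')

end

lemma field_hom_comp:
  assumes "field_hom f" "field_hom g"
  shows "field_hom (\<lambda>x. f (g x))"
proof -
  interpret f: field_hom f by fact
  interpret g: field_hom g by fact
  show ?thesis
    by standard (simp_all add: f.hom_add g.hom_add f.hom_mult g.hom_mult f.hom_one g.hom_one)
qed

lemma field_hom_fract_const: "field_hom fract_const"
  by standard (simp_all add: fract_const_def One_fract_def[symmetric] one_pCons[symmetric] mult_fract mult.commute)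

interpretation fract_const: field_hom fract_const
  by (rule field_hom_fract_const)

lemma poly_map_fract_const_var:
  "poly (map_poly fract_const p) fract_var = Fraction_Field.Fract p 1"
proof (induction p)
  case 0
  then show ?case by (simp add: Zero_fract_def)
next
  case (pCons a p)
  have "poly (map_poly fract_const (pCons a p)) fract_var
      = fract_const a + fract_var * Fraction_Field.Fract p 1"
    using pCons by (simp add: map_poly_pCons)
  also have "\<dots> = Fraction_Field.Fract (pCons a p) 1"
    by (simp add: fract_const_def fract_var_def)
  finally show ?case .
qed

lemma fract_var_neq_0 [simp]: "fract_var \<noteq> 0"
  by (simp add: fract_var_def Zero_fract_def eq_fract)

text \<open>Multiplying the value at 1/z by the power of z given by the degree yields the value at z
  of the reversed polynomial, and a nonzero polynomial stays nonzero in the fraction field.\<close>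

lemma poly_map_fract_const_inverse_var:
  assumes "field_hom f" "p \<noteq> 0"
  shows "poly (map_poly (\<lambda>x. fract_const (f x)) p) (inverse fract_var) \<noteq> 0"
proof
  interpret f: field_hom f by fact
  interpret g: field_hom "\<lambda>x. fract_const (f x)"
    by (rule field_hom_comp[OF field_hom_fract_const assms(1)])
  let ?p = "map_poly (\<lambda>x. fract_const (f x)) p"
  assume "poly ?p (inverse fract_var) = 0"
  then have "poly (reflect_poly ?p) fract_var = 0"
    by (simp add: poly_reflect_poly_nz)
  moreover have "reflect_poly ?p = map_poly fract_const (map_poly f (reflect_poly p))"
  proof (rule poly_eqI)
    fix k
    have "degree ?p = degree p" by (rule degree_map_poly) simp
    then show "coeff (reflect_poly ?p) k = coeff (map_poly fract_const (map_poly f (reflect_poly p))) k"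
      by (simp add: coeff_reflect_poly coeff_map_poly)
  qed
  ultimately have "Fraction_Field.Fract (map_poly f (reflect_poly p)) 1 = 0"
    by (simp add: poly_map_fract_const_var)
  then have "map_poly f (reflect_poly p) = 0"
    by (simp add: Zero_fract_def eq_fract)
  then have "reflect_poly p = 0" by (simp add: map_poly_eq_0_iff)
  then show False using \<open>p \<noteq> 0\<close> by simp
qed

interpretation bar_coeff0: fract_eval fract_const "inverse fract_var :: 'a::field poly fract"
proof
  show "p \<noteq> 0 \<Longrightarrow> poly (map_poly fract_const p) (inverse fract_var) \<noteq> 0" for p :: "'a poly"
    using poly_map_fract_const_inverse_var[of "\<lambda>x. x" p]
    by (simp add: field_hom_def)
qed

lemma field_hom_bar_coeff0: "field_hom bar_coeff0"
  unfolding bar_coeff0_def by (rule bar_coeff0.field_hom_subst)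

interpretation bar_K_eval: fract_eval "\<lambda>x. fract_const (bar_coeff0 x)" "inverse qK"
proof -
  interpret g: field_hom "\<lambda>x. fract_const (bar_coeff0 x)"
    by (rule field_hom_comp[OF field_hom_fract_const field_hom_bar_coeff0])
  show "fract_eval (\<lambda>x. fract_const (bar_coeff0 x)) (inverse qK)"
    by standard (simp add: qK_def poly_map_fract_const_inverse_var[OF field_hom_bar_coeff0])
qed

interpretation bar_K: field_hom bar_K
  unfolding bar_K_def by (rule bar_K_eval.field_hom_subst)

lemma field_hom_fls_const: "field_hom fls_const"
  by standard (simp_all add: fls_plus_const)

interpretation K_to_fls_eval: fract_eval fls_const "fls_X :: 'a::field fls"
proof -
  interpret f: field_hom "fls_const :: 'a \<Rightarrow> 'a fls" by (rule field_hom_fls_const)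
  have *: "poly (map_poly fls_const p) fls_X = fps_to_fls (fps_of_poly p)" for p :: "'a poly"
    by (induction p)
      (simp_all add: map_poly_pCons fps_of_poly_pCons fps_to_fls_plus fls_times_fps_to_fls
        fls_X_conv_shift_1 flip: fls_shifted_times_simps)
  show "fract_eval fls_const (fls_X :: 'a fls)"
    by standard (simp add: *)
qed

interpretation K_to_fls: field_hom K_to_fls
  unfolding K_to_fls_def by (rule K_to_fls_eval.field_hom_subst)

lemma qK_neq_0 [simp]: "qK \<noteq> 0"
  by (simp add: qK_def)

lemma tK_neq_0 [simp]: "tK \<noteq> 0"
  by (simp add: tK_def tK_half_def)

lemma bar_qK: "bar_K qK = inverse qK"
  using bar_K_eval.subst_fract_var by (simp add: bar_K_def qK_def)

lemma bar_tK: "bar_K tK = inverse tK"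
proof -
  have "bar_K tK_half = fract_const (bar_coeff0 fract_var)"
    unfolding bar_K_def tK_half_def by (rule bar_K_eval.subst_fract_const)
  also have "bar_coeff0 fract_var = inverse fract_var"
    unfolding bar_coeff0_def by (rule bar_coeff0.subst_fract_var)
  finally show ?thesis
    by (simp add: tK_def bar_K.hom_power tK_half_def fract_const.hom_inverse power_inverse)
qed

lemma K_to_fls_qK: "K_to_fls qK = fls_X"
  unfolding K_to_fls_def qK_def by (rule K_to_fls_eval.subst_fract_var)

lemma K_to_fls_tK: "\<exists>s. s \<noteq> 0 \<and> K_to_fls tK = fls_const s"
proof -
  have "K_to_fls tK = fls_const (fract_var ^ 2)"
    unfolding tK_def tK_half_def K_to_fls_def[symmetric]
    by (simp add: K_to_fls.hom_power)
      (simp add: K_to_fls_def K_to_fls_eval.subst_fract_const fls_const_power)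
  then show ?thesis by (intro exI[of _ "fract_var ^ 2"]) simp
qed

lemma subdegree_powi_X:
  "fls_subdegree ((fls_X :: 'a::field fls) powi a) = a"
  by (cases "a \<ge> 0") (simp_all add: power_int_def fls_subdegree_pow)

text \<open>t is a constant of the Laurent series field, so only q contributes to the order. This is
  how eigenvalues are told apart later.\<close>

lemma subdegree_q_t: "fls_subdegree (K_to_fls (qK powi a * tK powi b)) = a"
proof -
  obtain s where s: "s \<noteq> 0" "K_to_fls tK = fls_const s" using K_to_fls_tK by blast
  have "K_to_fls (qK powi a * tK powi b) = fls_X powi a * fls_const (s powi b)"
    by (simp add: K_to_fls.hom_mult K_to_fls.hom_power_int K_to_fls_qK s K_to_fls_eval.hom_power_int)
  moreover have "s powi b \<noteq> 0" using s by simp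
  ultimately show ?thesis by (simp add: subdegree_powi_X)
qed

section \<open>Laurent polynomials\<close>

lemma sum_single_lookup:
  fixes f :: "'a \<Rightarrow>\<^sub>0 'b::comm_monoid_add"
  shows "(\<Sum>\<nu>\<in>Poly_Mapping.keys f. Poly_Mapping.single \<nu> (Poly_Mapping.lookup f \<nu>)) = f"
proof (rule poly_mapping_eqI)
  fix \<kappa>
  have "Poly_Mapping.lookup (\<Sum>\<nu>\<in>Poly_Mapping.keys f. Poly_Mapping.single \<nu> (Poly_Mapping.lookup f \<nu>)) \<kappa>
      = (\<Sum>\<nu>\<in>Poly_Mapping.keys f. if \<nu> = \<kappa> then Poly_Mapping.lookup f \<nu> else 0)"
    by (auto simp: lookup_sum lookup_single when_def intro!: sum.cong)
  then show "Poly_Mapping.lookup (\<Sum>\<nu>\<in>Poly_Mapping.keys f. Poly_Mapping.single \<nu> (Poly_Mapping.lookup f \<nu>)) \<kappa>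
      = Poly_Mapping.lookup f \<kappa>"
    by (simp add: in_keys_iff)
qed

lemma pm_induct [consumes 1, case_names zero single add]:
  fixes f :: "'a \<Rightarrow>\<^sub>0 'b::comm_monoid_add"
  assumes "Poly_Mapping.keys f \<subseteq> S" and "P 0"
    and "\<And>\<nu> c. \<nu> \<in> S \<Longrightarrow> c \<noteq> 0 \<Longrightarrow> P (Poly_Mapping.single \<nu> c)"
    and "\<And>f g. P f \<Longrightarrow> P g \<Longrightarrow> P (f + g)"
  shows "P f"
proof -
  have "P (\<Sum>\<nu>\<in>A. Poly_Mapping.single \<nu> (Poly_Mapping.lookup f \<nu>))"
    if "finite A" "A \<subseteq> Poly_Mapping.keys f" for A
    using that
  proof (induction A)
    case (insert \<nu> A)
    then have "P (Poly_Mapping.single \<nu> (Poly_Mapping.lookup f \<nu>))"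
      using assms(1) by (intro assms(3)) (auto simp: in_keys_iff)
    then show ?case using insert by (simp add: assms(4))
  qed (use assms(2) in simp)
  from this[of "Poly_Mapping.keys f"] show ?thesis
    by (simp add: sum_single_lookup)
qed

lemma lookup_single_times:
  fixes f :: "'a::ab_group_add \<Rightarrow>\<^sub>0 'b::comm_semiring_1"
  shows "Poly_Mapping.lookup (Poly_Mapping.single \<mu> c * f) \<nu> = c * Poly_Mapping.lookup f (\<nu> - \<mu>)"
  using subset_UNIV[of "Poly_Mapping.keys f"]
proof (induction f rule: pm_induct)
  case (single \<kappa> d)
  have "\<mu> + \<kappa> = \<nu> \<longleftrightarrow> \<kappa> = \<nu> - \<mu>" by (auto simp: algebra_simps)
  then show ?case by (simp add: mult_single lookup_single when_def)
qed (simp_all add: lookup_add algebra_simps)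

lemma lookup_lconst_times [simp]:
  "Poly_Mapping.lookup (lconst c * f) \<nu> = c * Poly_Mapping.lookup f \<nu>"
  by (simp add: lconst_def lookup_single_times)

lemma lookup_lmonom_times:
  "Poly_Mapping.lookup (lmonom \<mu> * f) \<nu> = Poly_Mapping.lookup f (\<nu> - \<mu>)"
  by (simp add: lmonom_def lookup_single_times)

lemma lookup_lmonom: "Poly_Mapping.lookup (lmonom \<mu>) \<nu> = (if \<mu> = \<nu> then 1 else 0)"
  by (simp add: lmonom_def lookup_single)

lemma lmonom_0 [simp]: "lmonom 0 = 1"
  by (simp add: lmonom_def)

lemma lmonom_add: "lmonom (\<mu> + \<nu>) = lmonom \<mu> * lmonom \<nu>"
  by (simp add: lmonom_def mult_single)

lemma lconst_add: "lconst (c + d) = lconst c + lconst d"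
  by (simp add: lconst_def single_add)

lemma lconst_diff: "lconst (c - d) = lconst c - lconst d"
  by (simp add: lconst_def single_diff)

lemma lconst_uminus: "lconst (- c) = - lconst c"
  by (simp add: lconst_def single_uminus)

lemma lconst_mult: "lconst (c * d) = lconst c * lconst d"
  by (simp add: lconst_def mult_single)

lemma lconst_0 [simp]: "lconst 0 = 0" and lconst_1 [simp]: "lconst 1 = 1"
  by (simp_all add: lconst_def)

lemma lconst_eq_0_iff [simp]: "lconst c = 0 \<longleftrightarrow> c = 0"
  by (metis lconst_0 lookup_lconst_times lookup_one_zero lookup_zero mult.right_neutral)

lemma single_conv_lmonom: "Poly_Mapping.single \<nu> c = lconst c * lmonom \<nu>"
  by (simp add: lconst_def lmonom_def mult_single)

lemma lmonom_inverse: "lmonom \<mu> * lmonom (- \<mu>) = 1"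
  by (simp flip: lmonom_add)

section \<open>Spans of monomials and linear operators on them\<close>

definition lspan :: "expo set \<Rightarrow> laurent set" where
  "lspan S = {f. Poly_Mapping.keys f \<subseteq> S}"

lemma lspan_iff: "f \<in> lspan S \<longleftrightarrow> (\<forall>\<nu>. \<nu> \<notin> S \<longrightarrow> Poly_Mapping.lookup f \<nu> = 0)"
  by (auto simp: lspan_def in_keys_iff)

lemma lspan_0 [simp]: "0 \<in> lspan S"
  by (simp add: lspan_iff)

lemma lspan_add: "f \<in> lspan S \<Longrightarrow> g \<in> lspan S \<Longrightarrow> f + g \<in> lspan S"
  by (simp add: lspan_iff lookup_add)

lemma lspan_diff: "f \<in> lspan S \<Longrightarrow> g \<in> lspan S \<Longrightarrow> f - g \<in> lspan S"
  by (simp add: lspan_iff lookup_minus)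

lemma lspan_uminus: "f \<in> lspan S \<Longrightarrow> - f \<in> lspan S"
  by (simp add: lspan_iff)

lemma lspan_scale: "f \<in> lspan S \<Longrightarrow> lconst c * f \<in> lspan S"
  by (simp add: lspan_iff)

lemma lspan_sum: "(\<And>x. x \<in> A \<Longrightarrow> f x \<in> lspan S) \<Longrightarrow> sum f A \<in> lspan S"
  by (induction A rule: infinite_finite_induct) (simp_all add: lspan_add)

lemma lspan_mono: "S \<subseteq> S' \<Longrightarrow> f \<in> lspan S \<Longrightarrow> f \<in> lspan S'"
  by (auto simp: lspan_def)

lemma lspan_lmonom: "\<nu> \<in> S \<Longrightarrow> lmonom \<nu> \<in> lspan S"
  by (simp add: lspan_def lmonom_def)

lemma lspan_induct [consumes 1, case_names zero monom add]:
  assumes "f \<in> lspan S" and "P 0"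
    and "\<And>\<nu> c. \<nu> \<in> S \<Longrightarrow> P (lconst c * lmonom \<nu>)"
    and "\<And>f g. P f \<Longrightarrow> P g \<Longrightarrow> P (f + g)"
  shows "P f"
  by (rule pm_induct[of f S]) (use assms in \<open>auto simp: lspan_def single_conv_lmonom\<close>)

lemma laurent_induct [case_names zero monom add]:
  assumes "P 0" and "\<And>\<nu> c. P (lconst c * lmonom \<nu>)"
    and "\<And>f g. P f \<Longrightarrow> P g \<Longrightarrow> P (f + g)"
  shows "P f"
  by (rule lspan_induct[of f UNIV]) (use assms in \<open>auto simp: lspan_def\<close>)

lemma laurent_ring_eq_lspan: "laurent_ring n = lspan (weights n)"
  by (simp add: laurent_ring_def lspan_def)

lemma lspan_mult_closed:
  assumes "\<And>\<mu> \<nu>. \<mu> \<in> S \<Longrightarrow> \<nu> \<in> S \<Longrightarrow> \<mu> + \<nu> \<in> S" "f \<in> lspan S" "g \<in> lspan S"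
  shows "f * g \<in> lspan S"
  using assms keys_mult[of f g] unfolding lspan_def by blast

definition linear_op :: "(laurent \<Rightarrow> laurent) \<Rightarrow> bool" where
  "linear_op A \<longleftrightarrow> (\<forall>f g. A (f + g) = A f + A g) \<and> (\<forall>c f. A (lconst c * f) = lconst c * A f)"

lemma linear_opI:
  "(\<And>f g. A (f + g) = A f + A g) \<Longrightarrow> (\<And>c f. A (lconst c * f) = lconst c * A f) \<Longrightarrow> linear_op A"
  by (simp add: linear_op_def)

lemma linear_op_add: "linear_op A \<Longrightarrow> A (f + g) = A f + A g"
  and linear_op_scale: "linear_op A \<Longrightarrow> A (lconst c * f) = lconst c * A f"
  by (simp_all add: linear_op_def)

lemma linear_op_0: "linear_op A \<Longrightarrow> A 0 = 0"
  using linear_op_scale[of A 0 0] by simp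

lemma linear_op_diff: "linear_op A \<Longrightarrow> A (f - g) = A f - A g"
  using linear_op_add[of A "f - g" g] by (simp add: algebra_simps)

lemma linear_op_uminus: "linear_op A \<Longrightarrow> A (- f) = - A f"
  using linear_op_diff[of A 0 f] by (simp add: linear_op_0)

lemma linear_op_comp: "linear_op A \<Longrightarrow> linear_op B \<Longrightarrow> linear_op (\<lambda>f. A (B f))"
  by (simp add: linear_op_def)

lemma linear_op_mult: "linear_op ((*) g)"
  by (simp add: linear_op_def algebra_simps)

lemma linear_op_plus: "linear_op A \<Longrightarrow> linear_op B \<Longrightarrow> linear_op (\<lambda>f. A f + B f)"
  by (simp add: linear_op_def algebra_simps)

lemma linear_op_id: "linear_op (\<lambda>f. f)"
  by (simp add: linear_op_def)

lemma linear_op_eqI: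
  assumes "linear_op A" "linear_op B" "f \<in> lspan S"
    and "\<And>\<nu>. \<nu> \<in> S \<Longrightarrow> A (lmonom \<nu>) = B (lmonom \<nu>)"
  shows "A f = B f"
  using assms(3)
  by (induction f rule: lspan_induct)
    (simp_all add: assms linear_op_0 linear_op_add linear_op_scale)

lemma linear_op_lspan:
  assumes "linear_op A" "f \<in> lspan S" "\<And>\<nu>. \<nu> \<in> S \<Longrightarrow> A (lmonom \<nu>) \<in> lspan S'"
  shows "A f \<in> lspan S'"
  using assms(2)
  by (induction f rule: lspan_induct)
    (simp_all add: assms linear_op_0 linear_op_add linear_op_scale lspan_add lspan_scale)

text \<open>The common shape of \<open>act\<close>, \<open>cyc_subst\<close> and \<open>bar\<close>.\<close>

definition pmap :: "(expo \<Rightarrow> expo) \<Rightarrow> (expo \<Rightarrow> K \<Rightarrow> K) \<Rightarrow> laurent \<Rightarrow> laurent" where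
  "pmap g h f = (\<Sum>\<nu>\<in>Poly_Mapping.keys f. Poly_Mapping.single (g \<nu>) (h \<nu> (Poly_Mapping.lookup f \<nu>)))"

context
  fixes g :: "expo \<Rightarrow> expo" and h :: "expo \<Rightarrow> K \<Rightarrow> K"
  assumes h_add: "\<And>\<nu> c d. h \<nu> (c + d) = h \<nu> c + h \<nu> d"
begin

lemma pmap_h_0: "h \<nu> 0 = 0"
  using h_add[of \<nu> 0 0] by (metis add.right_neutral add_left_imp_eq)

lemma pmap_superset:
  assumes "finite A" "Poly_Mapping.keys f \<subseteq> A"
  shows "pmap g h f = (\<Sum>\<nu>\<in>A. Poly_Mapping.single (g \<nu>) (h \<nu> (Poly_Mapping.lookup f \<nu>)))"
  unfolding pmap_def
  by (rule sum.mono_neutral_left) (use assms in \<open>auto simp: in_keys_iff pmap_h_0\<close>)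

lemma pmap_add: "pmap g h (f1 + f2) = pmap g h f1 + pmap g h f2"
proof -
  let ?A = "Poly_Mapping.keys f1 \<union> Poly_Mapping.keys f2"
  have "Poly_Mapping.keys (f1 + f2) \<subseteq> ?A" by (rule keys_add)
  then show ?thesis
    by (simp add: pmap_superset[of ?A] lookup_add h_add single_add sum.distrib)
qed

lemma pmap_0 [simp]: "pmap g h 0 = 0"
  by (simp add: pmap_def)

lemma pmap_single: "pmap g h (Poly_Mapping.single \<nu> c) = Poly_Mapping.single (g \<nu>) (h \<nu> c)"
  by (simp add: pmap_superset[of "{\<nu>}"] )

lemma pmap_mult:
  assumes g: "\<And>\<mu> \<nu>. g (\<mu> + \<nu>) = g \<mu> + g \<nu>"
    and h: "\<And>\<mu> \<nu> c d. h (\<mu> + \<nu>) (c * d) = h \<mu> c * h \<nu> d"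
  shows "pmap g h (f1 * f2) = pmap g h f1 * pmap g h f2"
proof (induction f1 rule: laurent_induct)
  case (monom \<mu> c)
  show ?case
    by (induction f2 rule: laurent_induct)
      (simp_all add: pmap_add pmap_single mult_single g h algebra_simps flip: single_conv_lmonom)
qed (simp_all add: pmap_add algebra_simps)

end

lemma act_conv_pmap: "act w = pmap (act_expo w) (\<lambda>_ c. c)"
  by (simp add: act_def pmap_def fun_eq_iff)

lemma cyc_subst_conv_pmap: "cyc_subst n = pmap (cyc n) (\<lambda>\<nu> c. c * qK powi (- cmp \<nu> n))"
  by (simp add: cyc_subst_def pmap_def fun_eq_iff)

lemma bar_conv_pmap: "bar = pmap uminus (\<lambda>_. bar_K)"
  by (simp add: bar_def pmap_def fun_eq_iff)

lemma lookup_act_expo: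
  assumes "bij w"
  shows "cmp (act_expo w \<mu>) j = cmp \<mu> (inv w j)"
proof -
  have "inj (inv w)" using assms by (simp add: bij_imp_bij_inv bij_is_inj)
  then show ?thesis by (simp add: act_expo_def map_key.rep_eq)
qed

lemma act_expo_apply: "bij w \<Longrightarrow> cmp (act_expo w \<mu>) (w j) = cmp \<mu> j"
  by (simp add: lookup_act_expo bij_is_inj)

lemma act_expo_add: "bij w \<Longrightarrow> act_expo w (\<mu> + \<nu>) = act_expo w \<mu> + act_expo w \<nu>"
  by (rule poly_mapping_eqI) (simp add: lookup_act_expo lookup_add)

lemma act_expo_single: "bij w \<Longrightarrow> act_expo w (Poly_Mapping.single j c) = Poly_Mapping.single (w j) c"
  by (rule poly_mapping_eqI)
    (auto simp: lookup_act_expo lookup_single when_def bij_inv_eq_iff)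

lemma act_expo_diff: "bij w \<Longrightarrow> act_expo w (\<mu> - \<nu>) = act_expo w \<mu> - act_expo w \<nu>"
  by (rule poly_mapping_eqI) (simp add: lookup_act_expo lookup_minus)

lemma act_expo_0 [simp]: "bij w \<Longrightarrow> act_expo w 0 = 0"
  by (rule poly_mapping_eqI) (simp add: lookup_act_expo)

lemma act_expo_comp:
  "bij v \<Longrightarrow> bij w \<Longrightarrow> act_expo v (act_expo w \<mu>) = act_expo (v \<circ> w) \<mu>"
  by (rule poly_mapping_eqI) (simp add: lookup_act_expo bij_comp o_inv_distrib)

lemma act_add: "act w (f + g) = act w f + act w g"
  by (simp add: act_conv_pmap pmap_add)

lemma act_0 [simp]: "act w 0 = 0"
  by (simp add: act_conv_pmap pmap_def)

lemma act_lmonom: "act w (lmonom \<nu>) = lmonom (act_expo w \<nu>)"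
  by (simp add: act_conv_pmap lmonom_def pmap_single)

lemma act_mult: "bij w \<Longrightarrow> act w (f * g) = act w f * act w g"
  unfolding act_conv_pmap by (rule pmap_mult) (simp_all add: act_expo_add)

lemma act_lconst [simp]: "bij w \<Longrightarrow> act w (lconst c) = lconst c"
  by (simp add: act_conv_pmap lconst_def pmap_single)

lemma act_1 [simp]: "bij w \<Longrightarrow> act w 1 = 1"
  using act_lconst[of w 1] by simp

lemma linear_op_act: "bij w \<Longrightarrow> linear_op (act w)"
  by (rule linear_opI) (simp_all add: act_add act_mult)

lemma act_diff: "bij w \<Longrightarrow> act w (f - g) = act w f - act w g"
  by (rule linear_op_diff[OF linear_op_act])

lemma act_uminus: "bij w \<Longrightarrow> act w (- f) = - act w f"
  by (rule linear_op_uminus[OF linear_op_act])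

lemma act_sum: "bij w \<Longrightarrow> act w (sum f A) = (\<Sum>x\<in>A. act w (f x))"
  by (induction A rule: infinite_finite_induct) (simp_all add: act_add)

lemma act_prod: "bij w \<Longrightarrow> act w (prod f A) = (\<Prod>x\<in>A. act w (f x))"
  by (induction A rule: infinite_finite_induct) (simp_all add: act_mult)

lemma act_power: "bij w \<Longrightarrow> act w (f ^ k) = act w f ^ k"
  by (induction k) (simp_all add: act_mult)

lemma act_comp: "bij v \<Longrightarrow> bij w \<Longrightarrow> act v (act w f) = act (v \<circ> w) f"
  by (induction f rule: laurent_induct)
    (simp_all add: act_add act_mult act_lmonom act_expo_comp bij_comp)

lemma act_Xvar: "bij w \<Longrightarrow> act w (Xvar j) = Xvar (w j)"
  by (simp add: Xvar_def act_lmonom act_expo_single)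

lemma act_Xratio: "bij w \<Longrightarrow> act w (Xratio i j) = Xratio (w i) (w j)"
  by (simp add: Xratio_def act_lmonom act_expo_diff act_expo_single)

lemma lookup_act:
  assumes "bij w"
  shows "Poly_Mapping.lookup (act w f) (act_expo w \<nu>) = Poly_Mapping.lookup f \<nu>"
proof (induction f rule: laurent_induct)
  case (monom \<mu> c)
  have "act_expo w \<mu> = act_expo w \<nu> \<longleftrightarrow> \<mu> = \<nu>"
    by (metis act_expo_apply[OF assms] poly_mapping_eqI)
  then show ?case
    by (simp add: act_mult act_lmonom assms lookup_lmonom)
qed (simp_all add: act_add lookup_add)

lemma bar_add: "bar (f + g) = bar f + bar g"
  by (simp add: bar_conv_pmap pmap_add bar_K.hom_add)

lemma bar_mult: "bar (f * g) = bar f * bar g"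
  unfolding bar_conv_pmap by (rule pmap_mult) (simp_all add: bar_K.hom_add bar_K.hom_mult)

lemma bar_0 [simp]: "bar 0 = 0"
  by (simp add: bar_def)

lemma bar_lmonom: "bar (lmonom \<nu>) = lmonom (- \<nu>)"
  by (simp add: bar_conv_pmap lmonom_def pmap_single bar_K.hom_add bar_K.hom_one)

lemma bar_lconst: "bar (lconst c) = lconst (bar_K c)"
  by (simp add: bar_conv_pmap lconst_def pmap_single bar_K.hom_add)

lemma bar_diff: "bar (f - g) = bar f - bar g"
  using bar_add[of "f - g" g] by (simp add: algebra_simps)

lemma bar_Xvar: "bar (Xvar i) = lmonom (- Poly_Mapping.single i 1)"
  by (simp add: Xvar_def bar_lmonom)

lemma bar_act: "bij w \<Longrightarrow> bar (act w f) = act w (bar f)"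
proof (induction f rule: laurent_induct)
  case (monom \<nu> c)
  then have "act_expo w (- \<nu>) = - act_expo w \<nu>"
    using act_expo_diff[of w 0 \<nu>] by simp
  then show ?case using monom
    by (simp add: act_mult bar_mult act_lmonom bar_lmonom bar_lconst)
qed (simp_all add: act_add bar_add)

lemma cyc_subst_add: "cyc_subst n (f + g) = cyc_subst n f + cyc_subst n g"
  by (simp add: cyc_subst_conv_pmap pmap_add algebra_simps)

lemma lookup_mk_expo: "cmp (mk_expo n f) j = (if j \<in> {1..n} then f j else 0)"
proof -
  have "cmp (mk_expo n f) j = (\<Sum>i=1..n. if i = j then f i else 0)"
    by (auto simp: mk_expo_def lookup_sum lookup_single when_def intro!: sum.cong)
  then show ?thesis by simp
qed

lemma lookup_cyc:
  "cmp (cyc n \<mu>) j = (if j \<in> {1..n} then if j = 1 then cmp \<mu> n else cmp \<mu> (j - 1) else 0)"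
  by (simp add: cyc_def lookup_mk_expo)

lemma cyc_add: "cyc n (\<mu> + \<nu>) = cyc n \<mu> + cyc n \<nu>"
  by (rule poly_mapping_eqI) (simp add: lookup_cyc lookup_add)

lemma cyc_subst_mult: "cyc_subst n (f * g) = cyc_subst n f * cyc_subst n g"
  unfolding cyc_subst_conv_pmap
  by (rule pmap_mult)
    (simp_all add: algebra_simps cyc_add lookup_add power_int_diff power_int_minus field_simps)

lemma cyc_subst_lmonom: "cyc_subst n (lmonom \<nu>) = lconst (qK powi (- cmp \<nu> n)) * lmonom (cyc n \<nu>)"
  by (simp add: cyc_subst_conv_pmap lmonom_def pmap_single algebra_simps lconst_def mult_single)

lemma cyc_subst_0 [simp]: "cyc_subst n 0 = 0"
  by (simp add: cyc_subst_def)

lemma cyc_0 [simp]: "cyc n 0 = 0"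
  by (rule poly_mapping_eqI) (simp add: lookup_cyc)

lemma cyc_subst_lconst [simp]: "cyc_subst n (lconst c) = lconst c"
  by (simp add: cyc_subst_conv_pmap lconst_def pmap_single algebra_simps)

lemma cyc_subst_1 [simp]: "cyc_subst n 1 = 1"
  using cyc_subst_lconst[of n 1] by simp

lemma linear_op_cyc_subst: "linear_op (cyc_subst n)"
  by (rule linear_opI) (simp_all add: cyc_subst_add cyc_subst_mult)

section \<open>Demazure--Lusztig operators\<close>

lemma bij_simple_refl [simp]: "bij (simple_refl i)"
  by (simp add: simple_refl_def)

lemma simple_refl_apply: "simple_refl i j = (if j = i then Suc i else if j = Suc i then i else j)"
  by (simp add: simple_refl_def transpose_def)

lemma inv_simple_refl [simp]: "inv (simple_refl i) = simple_refl i"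
  by (simp add: simple_refl_def)

lemma simple_refl_involutory [simp]: "simple_refl i (simple_refl i j) = j"
  by (simp add: simple_refl_def)

lemma act_simple_refl_involutory [simp]: "act (simple_refl i) (act (simple_refl i) f) = f"
proof -
  have "simple_refl i \<circ> simple_refl i = id" by (simp add: fun_eq_iff)
  moreover have "act id f = f"
  proof (induction f rule: laurent_induct)
    case (monom \<nu> c)
    have "act_expo id \<nu> = \<nu>" by (rule poly_mapping_eqI) (simp add: lookup_act_expo)
    then show ?case by (simp only: act_mult act_lmonom act_lconst bij_id)
  qed (simp_all add: act_add)
  ultimately show ?thesis by (simp only: act_comp bij_simple_refl)
qed

lemma lookup_act_expo_simple_refl:
  "cmp (act_expo (simple_refl i) \<mu>) j = cmp \<mu> (simple_refl i j)"
  by (simp add: lookup_act_expo)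

lemma Xvar_diff_neq_0: "i \<noteq> j \<Longrightarrow> Xvar i - Xvar j \<noteq> 0"
proof
  assume "i \<noteq> j" "Xvar i - Xvar j = 0"
  then have "Poly_Mapping.lookup (Xvar i) (Poly_Mapping.single i 1)
           = Poly_Mapping.lookup (Xvar j) (Poly_Mapping.single i 1)" by simp
  moreover have "Poly_Mapping.single j (1::int) \<noteq> Poly_Mapping.single i 1"
    using \<open>i \<noteq> j\<close> by (metis lookup_single_eq lookup_single_not_eq zero_neq_one)
  ultimately show False by (simp add: Xvar_def lookup_lmonom)
qed

text \<open>Moves along a root direction. With j = i + 1 these are the exponents that occur in
  \<open>T_i x^\<nu>\<close>.\<close>

definition slide :: "nat \<Rightarrow> nat \<Rightarrow> int \<Rightarrow> expo \<Rightarrow> expo" where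
  "slide i j k \<nu> = \<nu> - Poly_Mapping.single i k + Poly_Mapping.single j k"

lemma slide_0 [simp]: "slide i j 0 \<nu> = \<nu>"
  by (simp add: slide_def)

lemma lookup_slide:
  "i \<noteq> j \<Longrightarrow> cmp (slide i j k \<nu>) l =
     (if l = i then cmp \<nu> i - k else if l = j then cmp \<nu> j + k else cmp \<nu> l)"
  by (simp add: slide_def lookup_add lookup_minus lookup_single when_def)

lemma Xvar_lmonom: "Xvar i * lmonom \<nu> = lmonom (\<nu> + Poly_Mapping.single i 1)"
  and lmonom_Xvar: "lmonom \<nu> * Xvar i = lmonom (\<nu> + Poly_Mapping.single i 1)"
  by (simp_all add: Xvar_def lmonom_add)

lemma act_expo_simple_refl_slide:
  "act_expo (simple_refl i) \<nu> = slide i (Suc i) (cmp \<nu> i - cmp \<nu> (Suc i)) \<nu>"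
  by (rule poly_mapping_eqI)
    (simp add: lookup_act_expo_simple_refl lookup_slide simple_refl_apply)

definition ddiff_monom :: "nat \<Rightarrow> expo \<Rightarrow> nat \<Rightarrow> laurent" where
  "ddiff_monom i \<nu> d = (\<Sum>k<d. lmonom (slide i (Suc i) (int k) \<nu> - Poly_Mapping.single i 1))"

lemma ddiff_monom_telescope:
  "ddiff_monom i \<nu> d * (Xvar i - Xvar (Suc i)) = lmonom \<nu> - lmonom (slide i (Suc i) (int d) \<nu>)"
proof (induction d)
  case (Suc d)
  have "lmonom (slide i (Suc i) (int d) \<nu> - Poly_Mapping.single i 1) * (Xvar i - Xvar (Suc i))
      = lmonom (slide i (Suc i) (int d) \<nu>) - lmonom (slide i (Suc i) (int (Suc d)) \<nu>)"
  proof -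
    have 1: "slide i (Suc i) (int d) \<nu> - Poly_Mapping.single i 1 + Poly_Mapping.single (Suc i) 1
        = slide i (Suc i) (int (Suc d)) \<nu>"
      by (rule poly_mapping_eqI)
        (simp add: lookup_slide lookup_add lookup_minus lookup_single when_def)
    show ?thesis unfolding right_diff_distrib lmonom_Xvar 1 by simp
  qed
  moreover have "ddiff_monom i \<nu> (Suc d) = ddiff_monom i \<nu> d
      + lmonom (slide i (Suc i) (int d) \<nu> - Poly_Mapping.single i 1)"
    by (simp add: ddiff_monom_def)
  ultimately show ?case using Suc by (simp add: distrib_right)
qed (simp add: ddiff_monom_def)

text \<open>The division is exact on each monomial: if \<open>\<nu>_i \<ge> \<nu>_(i+1)\<close>, the
  quotient is the geometric sum \<open>ddiff_monom\<close>, and otherwise it is minus the quotient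
  for the reflected monomial. Uniqueness is cancellation in an integral domain.\<close>

lemma ddiff_ex1: "\<exists>!g. g * (Xvar i - Xvar (Suc i)) = f - act (simple_refl i) f"
proof (rule ex_ex1I)
  show "\<exists>g. g * (Xvar i - Xvar (Suc i)) = f - act (simple_refl i) f"
  proof (induction f rule: laurent_induct)
    case (monom \<nu> c)
    have *: "\<exists>g. g * (Xvar i - Xvar (Suc i)) = lmonom \<nu> - lmonom (act_expo (simple_refl i) \<nu>)"
      if "cmp \<nu> (Suc i) \<le> cmp \<nu> i" for \<nu>
      using ddiff_monom_telescope[of i \<nu> "nat (cmp \<nu> i - cmp \<nu> (Suc i))"] that
      by (auto simp: act_expo_simple_refl_slide)
    have "\<exists>g. g * (Xvar i - Xvar (Suc i)) = lmonom \<nu> - lmonom (act_expo (simple_refl i) \<nu>)"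
    proof (cases "cmp \<nu> (Suc i) \<le> cmp \<nu> i")
      case False
      let ?\<nu> = "act_expo (simple_refl i) \<nu>"
      have "act_expo (simple_refl i) ?\<nu> = \<nu>"
        by (rule poly_mapping_eqI) (simp add: lookup_act_expo_simple_refl)
      moreover have "cmp ?\<nu> (Suc i) \<le> cmp ?\<nu> i"
        using False by (simp add: lookup_act_expo_simple_refl simple_refl_apply)
      ultimately obtain g where "g * (Xvar i - Xvar (Suc i)) = lmonom ?\<nu> - lmonom \<nu>"
        using *[of ?\<nu>] by auto
      then have "(- g) * (Xvar i - Xvar (Suc i)) = lmonom \<nu> - lmonom ?\<nu>" by simp
      then show ?thesis by blast
    qed (rule *)
    then obtain g where "g * (Xvar i - Xvar (Suc i)) = lmonom \<nu> - lmonom (act_expo (simple_refl i) \<nu>)" ..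
    then have "(lconst c * g) * (Xvar i - Xvar (Suc i))
        = lconst c * lmonom \<nu> - act (simple_refl i) (lconst c * lmonom \<nu>)"
      by (simp only: mult.assoc act_mult act_lmonom act_lconst bij_simple_refl flip: right_diff_distrib)
    then show ?case by blast
  next
    case (add f g)
    then obtain f' g' where "f' * (Xvar i - Xvar (Suc i)) = f - act (simple_refl i) f"
      "g' * (Xvar i - Xvar (Suc i)) = g - act (simple_refl i) g" by blast
    then have "(f' + g') * (Xvar i - Xvar (Suc i)) = f + g - act (simple_refl i) (f + g)"
      by (simp add: act_add distrib_right)
    then show ?case by blast
  qed (auto intro: exI[of _ 0])
next
  fix g g'
  assume "g * (Xvar i - Xvar (Suc i)) = f - act (simple_refl i) f"
    and "g' * (Xvar i - Xvar (Suc i)) = f - act (simple_refl i) f"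
  then show "g = g'" using Xvar_diff_neq_0[of i "Suc i"] by (metis mult_right_cancel n_not_Suc_n)
qed

lemma ddiff_eq: "ddiff i f * (Xvar i - Xvar (Suc i)) = f - act (simple_refl i) f"
  unfolding ddiff_def by (rule theI'[OF ddiff_ex1])

lemma ddiff_unique: "g * (Xvar i - Xvar (Suc i)) = f - act (simple_refl i) f \<Longrightarrow> ddiff i f = g"
  using ddiff_ex1[of i f] ddiff_eq[of i f] by blast

lemma act_simple_refl_eq: "act (simple_refl i) f = f - (Xvar i - Xvar (Suc i)) * ddiff i f"
  using ddiff_eq[of i f] by (simp add: algebra_simps)

lemma linear_op_ddiff: "linear_op (ddiff i)"
proof (rule linear_opI)
  show "ddiff i (f + g) = ddiff i f + ddiff i g" for f g
    by (rule ddiff_unique) (simp add: distrib_right ddiff_eq act_add)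
  show "ddiff i (lconst c * f) = lconst c * ddiff i f" for c f
    by (rule ddiff_unique)
      (simp only: mult.assoc ddiff_eq act_mult act_lconst bij_simple_refl flip: right_diff_distrib)
qed

lemma act_ddiff: "act (simple_refl i) (ddiff i f) = ddiff i f"
proof -
  have "act (simple_refl i) (ddiff i f * (Xvar i - Xvar (Suc i)))
      = act (simple_refl i) f - f"
    by (simp add: ddiff_eq act_diff)
  then have "- (act (simple_refl i) (ddiff i f)) * (Xvar i - Xvar (Suc i))
      = act (simple_refl i) f - f"
    by (simp add: act_mult act_diff act_Xvar simple_refl_apply algebra_simps)
  then have "act (simple_refl i) (ddiff i f) * (Xvar i - Xvar (Suc i))
      = f - act (simple_refl i) f"
    by (simp add: algebra_simps)
  then show ?thesis using ddiff_unique by metis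
qed

lemma ddiff_symmetric:
  assumes "act (simple_refl i) f = f"
  shows "ddiff i f = 0" "ddiff i (f * g) = f * ddiff i g"
  by (rule ddiff_unique, simp add: assms)
    (rule ddiff_unique, simp only: mult.assoc ddiff_eq act_mult assms bij_simple_refl flip: right_diff_distrib)

lemma ddiff_Xvar: "ddiff i (Xvar i * f) = f + Xvar (Suc i) * ddiff i f"
proof (rule ddiff_unique)
  have "act (simple_refl i) (Xvar i * f) = Xvar (Suc i) * act (simple_refl i) f"
    by (simp add: act_mult act_Xvar simple_refl_apply)
  moreover have "(f + Xvar (Suc i) * ddiff i f) * (Xvar i - Xvar (Suc i))
      = f * (Xvar i - Xvar (Suc i)) + Xvar (Suc i) * (f - act (simple_refl i) f)"
    by (simp only: distrib_right mult.assoc ddiff_eq)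
  ultimately show "(f + Xvar (Suc i) * ddiff i f) * (Xvar i - Xvar (Suc i))
      = Xvar i * f - act (simple_refl i) (Xvar i * f)"
    by (simp add: algebra_simps)
qed

text \<open>The Demazure--Lusztig operator of (E2), rewritten so that \<open>T_i - 1\<close> visibly
  factors through \<open>ddiff i\<close>.\<close>

definition Top :: "nat \<Rightarrow> laurent \<Rightarrow> laurent" where
  "Top i f = f + (Xvar (Suc i) - lconst tK * Xvar i) * ddiff i f"

lemma linear_op_Top: "linear_op (Top i)"
  unfolding Top_def
  by (intro linear_op_plus linear_op_id linear_op_comp[OF linear_op_mult linear_op_ddiff])

lemma Top_altdef: "Top i f = ddiff i (Xvar i * f) - lconst tK * Xvar i * ddiff i f"
  unfolding Top_def ddiff_Xvar by (simp add: algebra_simps)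

lemma Top_symmetric:
  assumes "act (simple_refl i) f = f"
  shows "Top i f = f" "Top i (f * g) = f * Top i g"
  by (simp_all add: Top_def ddiff_symmetric assms algebra_simps)

lemma ddiff_Xvar_Suc: "ddiff i (Xvar (Suc i)) = - 1"
  by (rule ddiff_unique) (simp add: act_Xvar simple_refl_apply)

lemma ddiff_Xvar_self: "ddiff i (Xvar i) = 1"
  by (rule ddiff_unique) (simp add: act_Xvar simple_refl_apply)

text \<open>The image of \<open>T_i - 1\<close> consists of multiples of
  \<open>x_(i+1) - t x_i\<close> by \<open>s_i\<close>-symmetric elements. \<open>T_i\<close> is
  linear over the latter and multiplies the former by -t.\<close>

lemma Top_quadratic: "Top i (Top i f - f) = - lconst tK * (Top i f - f)"
proof -
  let ?g = "Xvar (Suc i) - lconst tK * Xvar i"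
  have "ddiff i ?g = - 1 - lconst tK"
    by (simp add: linear_op_diff[OF linear_op_ddiff] linear_op_scale[OF linear_op_ddiff]
        ddiff_Xvar_Suc ddiff_Xvar_self)
  then have "Top i ?g = - lconst tK * ?g" unfolding Top_def by (simp only:) (simp add: algebra_simps)
  then have "Top i (ddiff i f * ?g) = - lconst tK * (ddiff i f * ?g)"
    by (simp add: Top_symmetric(2)[OF act_ddiff])
  then show ?thesis by (simp add: Top_def mult.commute)
qed

lemma Top_Top: "Top i (Top i f) = lconst (1 - tK) * Top i f + lconst tK * f"
  using Top_quadratic[of i f]
  by (simp add: linear_op_diff[OF linear_op_Top] lconst_diff algebra_simps)

text \<open>The cross relation of Bernstein type, in the form that carries \<open>x_2\<close> past
  \<open>T_1\<close> in \<open>Top_phi_op_Y1\<close>.\<close>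

lemma Xvar_Suc_Top:
  "Xvar (Suc i) * Top i f = Top i (Xvar i * f) - lconst (1 - tK) * (Xvar i * f)"
  unfolding Top_def ddiff_Xvar lconst_diff by (simp add: algebra_simps)

section \<open>The weight function\<close>

definition fls_ge :: "int \<Rightarrow> 'a::zero fls \<Rightarrow> bool" where
  "fls_ge d x \<longleftrightarrow> (\<forall>k<d. fls_nth x k = 0)"

lemma fls_ge_iff_subdegree: "fls_ge d x \<longleftrightarrow> x = 0 \<or> d \<le> fls_subdegree x"
  using nth_fls_subdegree_nonzero[of x] fls_eq0_below_subdegree[of _ x]
  by (force simp: fls_ge_def not_le intro: fls_subdegree_geI)

lemma fls_ge_0 [simp]: "fls_ge d 0"
  by (simp add: fls_ge_def)

lemma fls_ge_add: "fls_ge d x \<Longrightarrow> fls_ge d y \<Longrightarrow> fls_ge d (x + y :: 'a::comm_monoid_add fls)"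
  by (simp add: fls_ge_def)

lemma fls_ge_uminus: "fls_ge d (- x) \<longleftrightarrow> fls_ge d (x :: 'a::group_add fls)"
  by (simp add: fls_ge_def)

lemma fls_ge_mult:
  fixes x y :: "'a::field fls"
  shows "fls_ge d x \<Longrightarrow> fls_ge e y \<Longrightarrow> fls_ge (d + e) (x * y)"
  by (cases "x = 0 \<or> y = 0") (auto simp: fls_ge_iff_subdegree)

lemma fls_ge_eqI:
  fixes x y :: "'a::group_add fls"
  assumes "\<And>d. fls_ge d (x - y)"
  shows "x = y"
proof (rule fls_eqI)
  fix k
  show "fls_nth x k = fls_nth y k" using assms[of "k + 1"] by (simp add: fls_ge_def)
qed

text \<open>Convergence by orders of vanishing, which is easier to compute with than the metric;
  \<open>fls_conv_LIMSEQ\<close> links it to the \<open>lim\<close> in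
  \<open>J_coeff\<close>.\<close>

definition fls_conv :: "(nat \<Rightarrow> 'a::field fls) \<Rightarrow> 'a fls \<Rightarrow> bool" where
  "fls_conv u L \<longleftrightarrow> (\<forall>d. \<exists>N0. \<forall>N\<ge>N0. fls_ge d (u N - L))"

lemma fls_convD: "fls_conv u L \<Longrightarrow> \<exists>N0. \<forall>N\<ge>N0. fls_ge d (u N - L)"
  by (simp add: fls_conv_def)

lemma fls_conv_unique:
  assumes "fls_conv u L" "fls_conv u L'"
  shows "L = L'"
proof (rule fls_ge_eqI)
  fix d
  obtain N1 N2 where N: "\<forall>N\<ge>N1. fls_ge d (u N - L)" "\<forall>N\<ge>N2. fls_ge d (u N - L')"
    using fls_convD[OF assms(1)] fls_convD[OF assms(2)] by blast
  have "fls_ge d (u (max N1 N2) - L')" "fls_ge d (- (u (max N1 N2) - L))"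
    using N by (auto simp: fls_ge_uminus simp del: minus_diff_eq)
  from fls_ge_add[OF this] show "fls_ge d (L - L')" by simp
qed

lemma fls_conv_const: "fls_conv (\<lambda>_. L) L"
  by (simp add: fls_conv_def)

lemma fls_conv_add:
  assumes "fls_conv u L" "fls_conv v M"
  shows "fls_conv (\<lambda>N. u N + v N) (L + M)"
  unfolding fls_conv_def
proof
  fix d
  obtain N1 N2 where N: "\<forall>N\<ge>N1. fls_ge d (u N - L)" "\<forall>N\<ge>N2. fls_ge d (v N - M)"
    using fls_convD[OF assms(1)] fls_convD[OF assms(2)] by blast
  have "fls_ge d (u N + v N - (L + M))" if "N \<ge> max N1 N2" for N
    using fls_ge_add[of d "u N - L" "v N - M"] N that by (simp add: algebra_simps)
  then show "\<exists>N0. \<forall>N\<ge>N0. fls_ge d (u N + v N - (L + M))" by blast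
qed

lemma fls_conv_mult:
  assumes "fls_conv u L"
  shows "fls_conv (\<lambda>N. c * u N) (c * L)"
  unfolding fls_conv_def
proof
  fix d
  obtain N0 where N0: "\<forall>N\<ge>N0. fls_ge (d - fls_subdegree c) (u N - L)"
    using fls_convD[OF assms] by blast
  have "fls_ge d (c * u N - c * L)" if "N \<ge> N0" for N
    using fls_ge_mult[of "fls_subdegree c" c "d - fls_subdegree c" "u N - L"] N0 that
    by (simp add: fls_ge_iff_subdegree[of _ c] right_diff_distrib)
  then show "\<exists>N0. \<forall>N\<ge>N0. fls_ge d (c * u N - c * L)" by blast
qed

lemma fls_conv_sum:
  "(\<And>a. a \<in> A \<Longrightarrow> fls_conv (u a) (L a)) \<Longrightarrow> fls_conv (\<lambda>N. \<Sum>a\<in>A. u a N) (sum L A)"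
  by (induction A rule: infinite_finite_induct) (simp_all add: fls_conv_const fls_conv_add)

lemma fls_conv_LIMSEQ:
  assumes "fls_conv u L"
  shows "u \<longlonglongrightarrow> L"
proof (rule metric_LIMSEQ_I)
  fix r :: real
  assume "r > 0"
  then obtain m where m: "inverse (2 ^ m) < r"
    using real_arch_pow_inv[of r "1/2"] by (auto simp: power_one_over inverse_eq_divide)
  obtain N0 where N0: "\<forall>N\<ge>N0. fls_ge (int m) (u N - L)"
    using fls_convD[OF assms] by blast
  have "dist (u N) L < r" if "N \<ge> N0" for N
  proof (cases "u N = L")
    case False
    then have *: "int m \<le> fls_subdegree (u N - L)"
      using N0 that by (auto simp: fls_ge_iff_subdegree)
    then have "dist (u N) L = inverse (2 ^ nat (fls_subdegree (u N - L)))"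
      using False by (simp add: dist_fls_def)
    also have "\<dots> \<le> inverse (2 ^ m)"
      using * by (intro le_imp_inverse_le power_increasing) auto
    finally show ?thesis using m by simp
  qed (use \<open>r > 0\<close> in simp)
  then show "\<exists>N0. \<forall>N\<ge>N0. dist (u N) L < r" by blast
qed

lemma fls_conv_limI:
  assumes "\<And>N. fls_ge 0 (u N)" and "\<And>d. \<exists>N0. \<forall>N\<ge>N0. \<forall>M\<ge>N. fls_ge d (u M - u N)"
  shows "fls_conv u (lim u)"
proof -
  obtain B where B: "\<And>d M N. B d \<le> N \<Longrightarrow> N \<le> M \<Longrightarrow> fls_ge d (u M - u N)"
    using assms(2) by metis
  \<comment> \<open>The coefficient of q^k is read off at an index beyond which it no longer
    changes. Nonnegative order of all terms allows the limit to be assembled as a power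
    series.\<close>
  define L where "L = fps_to_fls (Abs_fps (\<lambda>k. fls_nth (u (B (int k + 1))) (int k)))"
  have "fls_conv u L"
    unfolding fls_conv_def
  proof
    fix d
    have "fls_nth (u N) k = fls_nth L k" if "B d \<le> N" "k < d" for N k
    proof (cases "k < 0")
      case True
      then show ?thesis using assms(1)[of N] by (simp add: L_def fls_ge_def)
    next
      case False
      let ?M = "max N (B (k + 1))"
      have "fls_nth (u ?M) k = fls_nth (u N) k"
        using B[of d N ?M] that by (simp add: fls_ge_def)
      moreover have "fls_nth (u ?M) k = fls_nth (u (B (k + 1))) k"
        using B[of "k + 1" "B (k + 1)" ?M] by (simp add: fls_ge_def)
      ultimately show ?thesis using False by (simp add: L_def)
    qed
    then show "\<exists>N0. \<forall>N\<ge>N0. fls_ge d (u N - L)" by (auto simp: fls_ge_def)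
  qed
  then show ?thesis using limI[OF fls_conv_LIMSEQ] by metis
qed

section \<open>The q-order and the degree filtration\<close>

definition qdeg :: "K \<Rightarrow> int" where
  "qdeg c = fls_subdegree (K_to_fls c)"

lemma qdeg_mult: "c \<noteq> 0 \<Longrightarrow> d \<noteq> 0 \<Longrightarrow> qdeg (c * d) = qdeg c + qdeg d"
  by (simp add: qdeg_def K_to_fls.hom_mult)

lemma qdeg_add: "c + d \<noteq> 0 \<Longrightarrow> min (qdeg c) (qdeg d) \<le> qdeg (c + d)"
  using fls_plus_subdegree[of "K_to_fls c" "K_to_fls d"]
  by (simp add: qdeg_def K_to_fls.hom_add flip: K_to_fls.hom_eq_0_iff)

lemma qdeg_1 [simp]: "qdeg 1 = 0"
  by (simp add: qdeg_def K_to_fls.hom_one)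

lemma qdeg_powi: "qdeg (qK powi a * tK powi b) = a"
  by (simp add: qdeg_def subdegree_q_t)

text \<open>With these weights every \<open>y_i\<close> has degree 1 in the grading n k - ht,
  including \<open>y_0 = q x_n / x_1\<close>, for which it is n - (n - 1).\<close>

definition ht :: "nat \<Rightarrow> expo \<Rightarrow> int" where
  "ht n \<nu> = (\<Sum>j=1..n. int j * cmp \<nu> j)"

lemma ht_add: "ht n (\<mu> + \<nu>) = ht n \<mu> + ht n \<nu>"
  by (simp add: ht_def lookup_add algebra_simps sum.distrib)

lemma ht_diff: "ht n (\<mu> - \<nu>) = ht n \<mu> - ht n \<nu>"
  by (simp add: ht_def lookup_minus algebra_simps sum_subtractf)

lemma ht_0 [simp]: "ht n 0 = 0"
  by (simp add: ht_def)

lemma ht_single: "j \<in> {1..n} \<Longrightarrow> ht n (Poly_Mapping.single j c) = int j * c"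
proof -
  assume j: "j \<in> {1..n}"
  have "ht n (Poly_Mapping.single j c) = (\<Sum>i=1..n. if i = j then int j * c else 0)"
    unfolding ht_def by (intro sum.cong) (auto simp: lookup_single when_def)
  then show ?thesis using j by simp
qed

text \<open>
  The \<open>y\<close>-degree of \<open>q\<^sup>k x\<^sup>\<nu>\<close> is \<open>n k - ht \<nu>\<close>; \<open>filt n d\<close> consists of the elements that are
  integral in \<open>q\<close> and have \<open>y\<close>-degree at least \<open>d\<close>.
\<close>

definition filt :: "nat \<Rightarrow> int \<Rightarrow> laurent set" where
  "filt n d = {f. \<forall>\<nu>\<in>Poly_Mapping.keys f. 0 \<le> qdeg (Poly_Mapping.lookup f \<nu>) \<and>
     d + ht n \<nu> \<le> int n * qdeg (Poly_Mapping.lookup f \<nu>)}"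

lemma filt_0 [simp]: "0 \<in> filt n d"
  by (simp add: filt_def)

lemma filt_mono: "e \<le> d \<Longrightarrow> f \<in> filt n d \<Longrightarrow> f \<in> filt n e"
  by (fastforce simp: filt_def)

lemma filt_add:
  assumes "f \<in> filt n d" "g \<in> filt n d"
  shows "f + g \<in> filt n d"
  unfolding filt_def
proof safe
  fix \<nu>
  assume \<nu>: "\<nu> \<in> Poly_Mapping.keys (f + g)"
  let ?f = "Poly_Mapping.lookup f \<nu>" and ?g = "Poly_Mapping.lookup g \<nu>"
  have nz: "?f + ?g \<noteq> 0" using \<nu> by (simp add: in_keys_iff lookup_add)
  have *: "0 \<le> qdeg (?f + ?g) \<and> d + ht n \<nu> \<le> int n * qdeg (?f + ?g)"
  proof (cases "?f = 0 \<or> ?g = 0")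
    case True
    then show ?thesis using assms nz by (auto simp: filt_def in_keys_iff)
  next
    case False
    then have f: "0 \<le> qdeg ?f" "d + ht n \<nu> \<le> int n * qdeg ?f"
      and g: "0 \<le> qdeg ?g" "d + ht n \<nu> \<le> int n * qdeg ?g"
      using assms by (auto simp: filt_def in_keys_iff)
    have m: "min (qdeg ?f) (qdeg ?g) \<le> qdeg (?f + ?g)" by (rule qdeg_add[OF nz])
    then have "int n * min (qdeg ?f) (qdeg ?g) \<le> int n * qdeg (?f + ?g)"
      by (rule mult_left_mono) simp
    then show ?thesis using f g m by (auto simp: min_def split: if_splits)
  qed
  show "0 \<le> qdeg (Poly_Mapping.lookup (f + g) \<nu>)"
    and "d + ht n \<nu> \<le> int n * qdeg (Poly_Mapping.lookup (f + g) \<nu>)"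
    using * by (simp_all add: lookup_add)
qed

lemma qdeg_uminus [simp]: "qdeg (- c) = qdeg c"
  by (simp add: qdeg_def K_to_fls.hom_uminus)

lemma filt_uminus: "f \<in> filt n d \<Longrightarrow> - f \<in> filt n d"
  by (auto simp: filt_def in_keys_iff)

lemma filt_diff: "f \<in> filt n d \<Longrightarrow> g \<in> filt n d \<Longrightarrow> f - g \<in> filt n d"
  using filt_add[of f n d "- g"] filt_uminus[of g n d] by simp

lemma filt_sum: "(\<And>a. a \<in> A \<Longrightarrow> f a \<in> filt n d) \<Longrightarrow> sum f A \<in> filt n d"
  by (induction A rule: infinite_finite_induct) (simp_all add: filt_add)

lemma filt_single:
  "c = 0 \<or> (0 \<le> qdeg c \<and> d + ht n \<nu> \<le> int n * qdeg c) \<Longrightarrow> Poly_Mapping.single \<nu> c \<in> filt n d"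
  by (auto simp: filt_def)

lemma filt_mult:
  assumes "f \<in> filt n d" "g \<in> filt n e"
  shows "f * g \<in> filt n (d + e)"
proof -
  let ?s = "\<lambda>f \<nu>. Poly_Mapping.single \<nu> (Poly_Mapping.lookup f \<nu>)"
  have "(\<Sum>\<mu>\<in>Poly_Mapping.keys f. \<Sum>\<nu>\<in>Poly_Mapping.keys g. ?s f \<mu> * ?s g \<nu>) \<in> filt n (d + e)"
  proof (intro filt_sum)
    fix \<mu> \<nu>
    assume *: "\<mu> \<in> Poly_Mapping.keys f" "\<nu> \<in> Poly_Mapping.keys g"
    then have "0 \<le> qdeg (Poly_Mapping.lookup f \<mu>)" "d + ht n \<mu> \<le> int n * qdeg (Poly_Mapping.lookup f \<mu>)"
      "0 \<le> qdeg (Poly_Mapping.lookup g \<nu>)" "e + ht n \<nu> \<le> int n * qdeg (Poly_Mapping.lookup g \<nu>)"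
      using assms by (simp_all add: filt_def)
    then show "?s f \<mu> * ?s g \<nu> \<in> filt n (d + e)"
      using * unfolding mult_single
      by (intro filt_single) (simp add: in_keys_iff qdeg_mult ht_add distrib_left)
  qed
  also have "(\<Sum>\<mu>\<in>Poly_Mapping.keys f. \<Sum>\<nu>\<in>Poly_Mapping.keys g. ?s f \<mu> * ?s g \<nu>) = f * g"
    by (simp add: sum_single_lookup flip: sum_product)
  finally show ?thesis .
qed

lemma filt_1: "1 \<in> filt n 0"
  using filt_single[of 1 0 n 0] by simp

lemma filt_mult0: "f \<in> filt n d \<Longrightarrow> g \<in> filt n 0 \<Longrightarrow> f * g \<in> filt n d"
  using filt_mult[of f n d g 0] by simp

lemma filt_prod0: "(\<And>a. a \<in> A \<Longrightarrow> f a \<in> filt n 0) \<Longrightarrow> prod f A \<in> filt n 0"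
  by (induction A rule: infinite_finite_induct) (simp_all add: filt_1 filt_mult0)

lemma filt_power: "f \<in> filt n d \<Longrightarrow> f ^ k \<in> filt n (int k * d)"
proof (induction k)
  case (Suc k)
  then have "f * f ^ k \<in> filt n (d + int k * d)" by (intro filt_mult)
  then show ?case by (simp add: algebra_simps)
qed (simp add: filt_1)

text \<open>Congruence modulo \<open>filt n d\<close> respects products only among elements of
  \<open>filt n 0\<close>, whence the two side conditions.\<close>

lemma filt_cong_mult:
  assumes "f - f' \<in> filt n d" "g - g' \<in> filt n d" "f \<in> filt n 0" "g' \<in> filt n 0"
  shows "f * g - f' * g' \<in> filt n d"
proof -
  have "(g - g') * f + (f - f') * g' \<in> filt n d"
    by (intro filt_add filt_mult0 assms)
  then show ?thesis by (simp add: algebra_simps)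
qed

lemma filt_cong_prod:
  assumes "\<And>a. a \<in> A \<Longrightarrow> f a - g a \<in> filt n d"
    and "\<And>a. a \<in> A \<Longrightarrow> f a \<in> filt n 0" "\<And>a. a \<in> A \<Longrightarrow> g a \<in> filt n 0"
  shows "prod f A - prod g A \<in> filt n d"
  using assms
proof (induction A rule: infinite_finite_induct)
  case (insert a A)
  then have "f a * prod f A - g a * prod g A \<in> filt n d"
    by (intro filt_cong_mult filt_prod0) auto
  then show ?case using insert by simp
qed simp_all

lemma filt_cong_0:
  assumes "f - g \<in> filt n d" "g \<in> filt n 0" "0 \<le> d"
  shows "f \<in> filt n 0"
  using filt_add[OF filt_mono[OF assms(3,1)] assms(2)] by simp

lemma geom_cong:
  assumes "v \<in> filt n 1" "N \<le> M"
  shows "geom M v - geom N v \<in> filt n (int N)"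
proof -
  have "{..<M} = {..<N} \<union> {N..<M}" using assms(2) by auto
  then have "geom M v - geom N v = (\<Sum>k\<in>{N..<M}. v ^ k)"
    unfolding geom_def by (simp add: sum.union_disjoint ivl_disj_int)
  also have "\<dots> \<in> filt n (int N)"
  proof (rule filt_sum)
    show "v ^ k \<in> filt n (int N)" if "k \<in> {N..<M}" for k
      using filt_mono[OF _ filt_power[OF assms(1), of k]] that by simp
  qed
  finally show ?thesis .
qed

lemma geom_cong_1:
  assumes "v \<in> filt n d" "1 \<le> d" "0 < N"
  shows "geom N v - 1 \<in> filt n d"
proof -
  have "{..<N} = insert 0 {1..<N}" using assms(3) by auto
  then have "geom N v - 1 = (\<Sum>k\<in>{1..<N}. v ^ k)"
    unfolding geom_def by simp
  also have "\<dots> \<in> filt n d"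
  proof (rule filt_sum)
    show "v ^ k \<in> filt n d" if "k \<in> {1..<N}" for k
      using filt_mono[OF _ filt_power[OF assms(1), of k]] that assms(2)
        mult_right_mono[of 1 "int k" d] by simp
  qed
  finally show ?thesis .
qed

lemma geom_filt: "v \<in> filt n 0 \<Longrightarrow> geom N v \<in> filt n 0"
  unfolding geom_def using filt_power[of v n 0] by (intro filt_sum) simp

lemma one_minus_times_geom: "(1 - v) * geom N v = 1 - v ^ N"
proof (induction N)
  case (Suc N)
  have "(1 - v) * geom (Suc N) v = (1 - v) * geom N v + (1 - v) * v ^ N"
    by (simp add: geom_def distrib_left)
  also have "\<dots> = 1 - v ^ Suc N"
    unfolding Suc by (simp add: left_diff_distrib)
  finally show ?case .
qed (simp add: geom_def)

text \<open>The truncation length enters \<open>J_trunc\<close> twice, as the number of factors and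
  inside \<open>geom\<close>. The old factors are compared one by one, the new ones with 1.\<close>

lemma prod_cong_extend:
  fixes N M :: nat
  assumes "N \<le> M"
    and "\<And>r. r < N \<Longrightarrow> f r - g r \<in> filt n d"
    and "\<And>r. N \<le> r \<Longrightarrow> r < M \<Longrightarrow> f r - 1 \<in> filt n d"
    and "\<And>r. r < M \<Longrightarrow> f r \<in> filt n 0" "\<And>r. r < N \<Longrightarrow> g r \<in> filt n 0"
  shows "(\<Prod>r<M. f r) - (\<Prod>r<N. g r) \<in> filt n d"
proof -
  let ?g = "\<lambda>r. if r < N then g r else 1"
  have "{..<M} = {..<N} \<union> {N..<M}" using assms(1) by auto
  then have "(\<Prod>r<M. ?g r) = (\<Prod>r<N. g r)"
    by (simp add: prod.union_disjoint ivl_disj_int)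
  moreover have "(\<Prod>r<M. f r) - (\<Prod>r<M. ?g r) \<in> filt n d"
    by (rule filt_cong_prod) (use assms filt_1 in auto)
  ultimately show ?thesis by simp
qed

lemma prod_one_minus_cong:
  assumes "\<And>r. v r \<in> filt n (int r + 1)" "N \<le> M"
  shows "(\<Prod>r<M. 1 - v r) - (\<Prod>r<N. 1 - v r) \<in> filt n (int N)"
proof -
  have v0: "1 - v r \<in> filt n 0" for r
    by (intro filt_diff filt_1 filt_mono[OF _ assms(1)]) simp
  show ?thesis
  proof (rule prod_cong_extend[OF assms(2)])
    show "1 - v r - 1 \<in> filt n (int N)" if "N \<le> r" "r < M" for r
      using filt_uminus[OF filt_mono[OF _ assms(1)[of r], of "int N"]] that by simp
  qed (simp_all add: v0)
qed

lemma prod_geom_cong: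
  assumes "\<And>r. v r \<in> filt n (int r + 1)" "N \<le> M"
  shows "(\<Prod>r<M. geom M (v r)) - (\<Prod>r<N. geom N (v r)) \<in> filt n (int N)"
proof -
  have v1: "v r \<in> filt n 1" "v r \<in> filt n 0" for r
    by (intro filt_mono[OF _ assms(1)]; simp)+
  show ?thesis
  proof (rule prod_cong_extend[OF assms(2)])
    show "geom M (v r) - 1 \<in> filt n (int N)" if "N \<le> r" "r < M" for r
      using filt_mono[OF _ geom_cong_1[OF assms(1)[of r], of M], of "int N"] that by simp
  qed (use v1 assms(2) in \<open>auto intro: geom_filt geom_cong\<close>)
qed

lemma prod_cong_1:
  assumes "\<And>r. r < N \<Longrightarrow> f r - 1 \<in> filt n 1"
  shows "(\<Prod>r<N. f r) - 1 \<in> filt n 1"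
  using filt_cong_prod[of "{..<N}" f "\<lambda>_. 1" n 1] assms filt_cong_0[OF assms filt_1] by (simp add: filt_1)

section \<open>Convergence of the truncated weight\<close>

definition J_pair :: "nat \<Rightarrow> nat \<Rightarrow> nat \<Rightarrow> laurent" where
  "J_pair N i j =
     (\<Prod>r<N. 1 - lconst (qK ^ r) * Xratio i j) *
     (\<Prod>r<N. geom N (lconst (tK * qK ^ r) * Xratio i j)) *
     (\<Prod>r<N. 1 - lconst (qK * qK ^ r) * Xratio j i) *
     (\<Prod>r<N. geom N (lconst (tK * qK * qK ^ r) * Xratio j i))"

definition pairs :: "nat \<Rightarrow> (nat \<times> nat) set" where
  "pairs n = {(i, j). 1 \<le> i \<and> i < j \<and> j \<le> n}"

lemma finite_pairs [simp]: "finite (pairs n)"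
  by (rule finite_subset[of _ "{1..n} \<times> {1..n}"]) (auto simp: pairs_def)

lemma prod_pairs:
  fixes f :: "nat \<Rightarrow> nat \<Rightarrow> 'a::comm_monoid_mult"
  shows "(\<Prod>j=1..n. \<Prod>i=1..<j. f i j) = (\<Prod>(i, j)\<in>pairs n. f i j)"
proof -
  have "(\<Prod>j=1..n. \<Prod>i=1..<j. f i j) = (\<Prod>(j, i)\<in>(SIGMA j:{1..n}. {1..<j}). f i j)"
    by (simp add: prod.Sigma)
  also have "\<dots> = (\<Prod>(i, j)\<in>pairs n. f i j)"
    by (rule prod.reindex_bij_witness[of _ "\<lambda>(i, j). (j, i)" "\<lambda>(j, i). (i, j)"])
      (auto simp: pairs_def)
  finally show ?thesis .
qed

lemma J_trunc_pairs: "J_trunc n N = (\<Prod>(i, j)\<in>pairs n. J_pair N i j)"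
  unfolding J_trunc_def J_pair_def[symmetric] by (rule prod_pairs)

lemma Xratio_filt:
  assumes "i \<in> {1..n}" "j \<in> {1..n}" "d \<le> int n * int r + int j - int i"
  shows "lconst (qK ^ r) * Xratio i j \<in> filt n d"
    and "lconst (tK * qK ^ r) * Xratio i j \<in> filt n d"
proof -
  have *: "lconst (tK powi b * qK ^ r) * Xratio i j \<in> filt n d" for b
    unfolding Xratio_def single_conv_lmonom[symmetric]
    using assms qdeg_powi[of "int r" b]
    by (intro filt_single) (simp add: ht_diff ht_single mult.commute)
  show "lconst (qK ^ r) * Xratio i j \<in> filt n d" using *[of 0] by simp
  show "lconst (tK * qK ^ r) * Xratio i j \<in> filt n d" using *[of 1] by simp
qed

text \<open>The degrees are n r + (j - i) and n (r + 1) - (j - i), both at least r + 1 because 1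
  \<le> j - i \<le> n - 1. So the factor with index r differs from 1 only in degrees \<ge> r +
  1.\<close>

lemma J_pair_arguments_filt:
  assumes "(i, j) \<in> pairs n"
  shows "lconst (qK ^ r) * Xratio i j \<in> filt n (int r + 1)"
    "lconst (tK * qK ^ r) * Xratio i j \<in> filt n (int r + 1)"
    "lconst (qK * qK ^ r) * Xratio j i \<in> filt n (int r + 1)"
    "lconst (tK * qK * qK ^ r) * Xratio j i \<in> filt n (int r + 1)"
proof -
  have ij: "i \<in> {1..n}" "j \<in> {1..n}" "i < j" "1 \<le> i" "j \<le> n" using assms by (auto simp: pairs_def)
  have "1 * int r \<le> int n * int r" using ij by (intro mult_right_mono) auto
  then have "int r + 1 \<le> int n * int r + int j - int i"
    "int r + 1 \<le> int n * int (Suc r) + int i - int j"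
    using ij by (auto simp: algebra_simps)
  then show "lconst (qK ^ r) * Xratio i j \<in> filt n (int r + 1)"
    "lconst (tK * qK ^ r) * Xratio i j \<in> filt n (int r + 1)"
    "lconst (qK * qK ^ r) * Xratio j i \<in> filt n (int r + 1)"
    "lconst (tK * qK * qK ^ r) * Xratio j i \<in> filt n (int r + 1)"
    using Xratio_filt[OF ij(1,2), of _ r] Xratio_filt[OF ij(2,1), of _ "Suc r"]
    by (simp_all add: mult.assoc)
qed

lemma J_pair_filt:
  assumes "(i, j) \<in> pairs n"
  shows "J_pair N i j - 1 \<in> filt n 1" "J_pair N i j \<in> filt n 0"
    "N \<le> M \<Longrightarrow> J_pair M i j - J_pair N i j \<in> filt n (int N)"
proof -
  note v = J_pair_arguments_filt[OF assms]
  have m1: "v r \<in> filt n (int r + 1) \<Longrightarrow> v r \<in> filt n 1" for v :: "nat \<Rightarrow> laurent" and r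
    by (rule filt_mono) simp_all
  have p1: "(\<Prod>r<N. 1 - v r) - 1 \<in> filt n 1" "(\<Prod>r<N. geom N (v r)) - 1 \<in> filt n 1"
    if "\<And>r. v r \<in> filt n (int r + 1)" for v :: "nat \<Rightarrow> laurent" and N
  proof -
    have "v r \<in> filt n 1" for r using m1 that by blast
    then show "(\<Prod>r<N. 1 - v r) - 1 \<in> filt n 1" "(\<Prod>r<N. geom N (v r)) - 1 \<in> filt n 1"
      by (intro prod_cong_1; use filt_uminus in \<open>force intro: geom_cong_1\<close>)+
  qed
  have p0: "(\<Prod>r<N. 1 - v r) \<in> filt n 0" "(\<Prod>r<N. geom N (v r)) \<in> filt n 0"
    if "\<And>r. v r \<in> filt n (int r + 1)" for v :: "nat \<Rightarrow> laurent" and N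
    by (rule filt_cong_0[OF p1(1)[OF that] filt_1]; simp)
      (rule filt_cong_0[OF p1(2)[OF that] filt_1]; simp)
  note pv = p0(1)[OF v(1)] p0(2)[OF v(2)] p0(1)[OF v(3)] p0(2)[OF v(4)]
  have m: "A * B - 1 \<in> filt n 1" if "A - 1 \<in> filt n 1" "B - 1 \<in> filt n 1" "A \<in> filt n 0" for A B
    using filt_cong_mult[OF that filt_1] by simp
  show "J_pair N i j - 1 \<in> filt n 1"
    unfolding J_pair_def
    by (intro m filt_mult0 pv p1(1)[OF v(1)] p1(2)[OF v(2)] p1(1)[OF v(3)] p1(2)[OF v(4)])
  then show "J_pair N i j \<in> filt n 0" by (auto intro: filt_cong_0 filt_1)
  show "J_pair M i j - J_pair N i j \<in> filt n (int N)" if "N \<le> M"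
    unfolding J_pair_def
    by (intro filt_cong_mult filt_mult0 pv that
        prod_one_minus_cong[OF v(1)] prod_geom_cong[OF v(2)] prod_one_minus_cong[OF v(3)] prod_geom_cong[OF v(4)])
qed

lemma J_trunc_filt:
  shows "J_trunc n N - 1 \<in> filt n 1" "J_trunc n N \<in> filt n 0"
    "N \<le> M \<Longrightarrow> J_trunc n M - J_trunc n N \<in> filt n (int N)"
proof -
  show "J_trunc n N - 1 \<in> filt n 1"
    using filt_cong_prod[of "pairs n" "\<lambda>(i, j). J_pair N i j" "\<lambda>_. 1" n 1] J_pair_filt filt_1
    by (auto simp: J_trunc_pairs)
  show "J_trunc n N \<in> filt n 0"
    unfolding J_trunc_pairs by (rule filt_prod0) (auto intro: J_pair_filt)
  show "J_trunc n M - J_trunc n N \<in> filt n (int N)" if "N \<le> M"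
    unfolding J_trunc_pairs by (rule filt_cong_prod) (use that in \<open>auto intro: J_pair_filt\<close>)
qed

text \<open>The q-order is an integer and at least (d + ht)/n; the hypothesis says that e is at most
  the ceiling of this quotient.\<close>

lemma filt_fls_ge:
  assumes "f \<in> filt n d" "0 < n" "int n * e \<le> d + ht n \<nu> + int n - 1"
  shows "fls_ge e (K_to_fls (Poly_Mapping.lookup f \<nu>))"
proof (cases "Poly_Mapping.lookup f \<nu> = 0")
  case False
  then have "d + ht n \<nu> \<le> int n * qdeg (Poly_Mapping.lookup f \<nu>)"
    using assms(1) by (simp add: filt_def in_keys_iff)
  then have "int n * e < int n * (qdeg (Poly_Mapping.lookup f \<nu>) + 1)"
    using assms(3) by (simp add: algebra_simps)
  then have "e \<le> qdeg (Poly_Mapping.lookup f \<nu>)"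
    using assms(2) by (simp add: mult_less_cancel_left)
  then show ?thesis by (simp add: fls_ge_iff_subdegree qdeg_def)
qed simp

lemma filt_fls_ge_0: "f \<in> filt n d \<Longrightarrow> fls_ge 0 (K_to_fls (Poly_Mapping.lookup f \<nu>))"
  by (auto simp: filt_def in_keys_iff fls_ge_iff_subdegree qdeg_def)

lemma filt_conv_0:
  assumes "0 < n" "\<And>N. e N \<in> filt n (int N)"
  shows "fls_conv (\<lambda>N. K_to_fls (Poly_Mapping.lookup (e N) \<nu>)) 0"
  unfolding fls_conv_def
proof
  fix d
  have "fls_ge d (K_to_fls (Poly_Mapping.lookup (e N) \<nu>) - 0)"
    if "nat (int n * d - ht n \<nu>) \<le> N" for N
    using filt_fls_ge[OF assms(2) assms(1), of d N \<nu>] that assms(1) by auto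
  then show "\<exists>N0. \<forall>N\<ge>N0. fls_ge d (K_to_fls (Poly_Mapping.lookup (e N) \<nu>) - 0)" by blast
qed

lemma J_coeff_conv:
  assumes "0 < n"
  shows "fls_conv (\<lambda>N. K_to_fls (Poly_Mapping.lookup (J_trunc n N) \<mu>)) (J_coeff n \<mu>)"
  unfolding J_coeff_def
proof (rule fls_conv_limI)
  show "fls_ge 0 (K_to_fls (Poly_Mapping.lookup (J_trunc n N) \<mu>))" for N
    by (rule filt_fls_ge_0[OF J_trunc_filt(2)])
  fix d
  have "fls_ge d (K_to_fls (Poly_Mapping.lookup (J_trunc n M) \<mu>)
      - K_to_fls (Poly_Mapping.lookup (J_trunc n N) \<mu>))"
    if "nat (int n * d - ht n \<mu>) \<le> N" "N \<le> M" for N M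
    using filt_fls_ge[OF J_trunc_filt(3)[OF that(2)] assms, of d \<mu>] that assms
    by (auto simp: K_to_fls.hom_diff lookup_minus)
  then show "\<exists>N0. \<forall>N\<ge>N0. \<forall>M\<ge>N. fls_ge d (K_to_fls (Poly_Mapping.lookup (J_trunc n M) \<mu>)
      - K_to_fls (Poly_Mapping.lookup (J_trunc n N) \<mu>))" by blast
qed

text \<open>J is 1 up to terms of degree \<ge> 1. Such a term at an exponent \<mu> with
  \<open>ht n \<mu> \<ge> 0\<close> has q-order at least 1/n, hence at least 1.\<close>

lemma J_coeff_order:
  assumes "0 < n"
  shows "fls_ge 0 (J_coeff n \<mu>)"
    and "0 \<le> ht n \<mu> \<Longrightarrow> fls_nth (J_coeff n \<mu>) 0 = (if \<mu> = 0 then 1 else 0)"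
proof -
  obtain N where N: "fls_ge 1 (K_to_fls (Poly_Mapping.lookup (J_trunc n N) \<mu>) - J_coeff n \<mu>)"
    using fls_convD[OF J_coeff_conv[OF assms]] by blast
  have "fls_ge 0 (K_to_fls (Poly_Mapping.lookup (J_trunc n N) \<mu>))"
    by (rule filt_fls_ge_0[OF J_trunc_filt(2)])
  then show "fls_ge 0 (J_coeff n \<mu>)" using N by (simp add: fls_ge_def)
  assume "0 \<le> ht n \<mu>"
  then have "fls_ge 1 (K_to_fls (Poly_Mapping.lookup (J_trunc n N - 1) \<mu>))"
    by (intro filt_fls_ge[OF J_trunc_filt(1) assms]) simp
  then have "fls_nth (K_to_fls (Poly_Mapping.lookup (J_trunc n N) \<mu>)) 0 = (if \<mu> = 0 then 1 else 0)"
    by (auto simp: fls_ge_def lookup_minus K_to_fls.hom_diff lookup_one K_to_fls.hom_one split: if_splits)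
  then show "fls_nth (J_coeff n \<mu>) 0 = (if \<mu> = 0 then 1 else 0)"
    using N by (simp add: fls_ge_def)
qed

section \<open>Invariance of the inner product\<close>

text \<open>The functional h -> ct(h J). Symmetries of J are first proved for it and only then
  combined with \<open>bar\<close>.\<close>

definition Lam :: "nat \<Rightarrow> laurent \<Rightarrow> coeff0 fls" where
  "Lam n h = (\<Sum>\<nu>\<in>Poly_Mapping.keys h. K_to_fls (Poly_Mapping.lookup h \<nu>) * J_coeff n (- \<nu>))"

lemma inner_qt_Lam: "inner_qt n f g = Lam n (f * bar g)"
  by (simp add: inner_qt_def Lam_def)

lemma lookup_times_0:
  "Poly_Mapping.lookup (h * e) 0
    = (\<Sum>\<nu>\<in>Poly_Mapping.keys h. Poly_Mapping.lookup h \<nu> * Poly_Mapping.lookup (e :: laurent) (- \<nu>))"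
proof -
  have "h * e = (\<Sum>\<nu>\<in>Poly_Mapping.keys h. Poly_Mapping.single \<nu> (Poly_Mapping.lookup h \<nu>) * e)"
    by (simp add: sum_single_lookup flip: sum_distrib_right)
  then show ?thesis by (simp add: lookup_sum lookup_single_times)
qed

text \<open>Only finitely many coefficients of J meet h, so ct(h J) is the limit of the constant
  terms against the truncations.\<close>

lemma Lam_conv:
  assumes "0 < n"
  shows "fls_conv (\<lambda>N. K_to_fls (Poly_Mapping.lookup (h * J_trunc n N) 0)) (Lam n h)"
  unfolding lookup_times_0 Lam_def K_to_fls.hom_sum K_to_fls.hom_mult
  by (intro fls_conv_sum fls_conv_mult J_coeff_conv assms)

lemma Lam_eqI:
  assumes "0 < n"
    and "\<And>N. Poly_Mapping.lookup (f * J_trunc n N) 0 = Poly_Mapping.lookup (g * J_trunc n N) 0"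
  shows "Lam n f = Lam n g"
  using fls_conv_unique[OF Lam_conv[OF assms(1), of f]] Lam_conv[OF assms(1), of g] assms(2) by simp

lemma Lam_0 [simp]: "Lam n 0 = 0"
  by (simp add: Lam_def)

lemma Lam_add:
  assumes "0 < n"
  shows "Lam n (f + g) = Lam n f + Lam n g"
  using fls_conv_unique[OF Lam_conv[OF assms, of "f + g"]]
    fls_conv_add[OF Lam_conv[OF assms, of f] Lam_conv[OF assms, of g]]
  by (simp add: distrib_right lookup_add K_to_fls.hom_add)

lemma Lam_scale:
  assumes "0 < n"
  shows "Lam n (lconst c * f) = K_to_fls c * Lam n f"
  using fls_conv_unique[OF Lam_conv[OF assms, of "lconst c * f"]]
    fls_conv_mult[OF Lam_conv[OF assms, of f], of "K_to_fls c"]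
  by (simp add: mult.assoc K_to_fls.hom_mult)

lemma Lam_uminus: "0 < n \<Longrightarrow> Lam n (- f) = - Lam n f"
  using Lam_scale[of n "- 1" f] by (simp add: lconst_uminus K_to_fls.hom_uminus K_to_fls.hom_one)

lemma Lam_diff: "0 < n \<Longrightarrow> Lam n (f - g) = Lam n f - Lam n g"
  using Lam_add[of n f "- g"] by (simp add: Lam_uminus)

subsection \<open>The cyclic shift\<close>

lemma cyc_subst_prod: "cyc_subst n (prod f A) = (\<Prod>a\<in>A. cyc_subst n (f a))"
  by (induction A rule: infinite_finite_induct) (simp_all add: cyc_subst_mult)

lemma cyc_subst_sum: "cyc_subst n (sum f A) = (\<Sum>a\<in>A. cyc_subst n (f a))"
  by (induction A rule: infinite_finite_induct) (simp_all add: cyc_subst_add)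

lemma cyc_subst_power: "cyc_subst n (f ^ k) = cyc_subst n f ^ k"
  by (induction k) (simp_all add: cyc_subst_mult)

lemma cyc_subst_diff: "cyc_subst n (f - g) = cyc_subst n f - cyc_subst n g"
  by (rule linear_op_diff[OF linear_op_cyc_subst])

lemma cyc_subst_geom: "cyc_subst n (geom N v) = geom N (cyc_subst n v)"
  by (simp add: geom_def cyc_subst_sum cyc_subst_power)

lemma cyc_diff: "cyc n (\<mu> - \<nu>) = cyc n \<mu> - cyc n \<nu>"
  by (rule poly_mapping_eqI) (simp add: lookup_cyc lookup_minus)

lemma cyc_single:
  "i \<in> {1..n} \<Longrightarrow> cyc n (Poly_Mapping.single i c) = Poly_Mapping.single (if i = n then 1 else Suc i) c"
  by (rule poly_mapping_eqI) (auto simp: lookup_cyc lookup_single when_def)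

lemma cyc_subst_Xratio:
  assumes "i \<in> {1..n}" "j \<in> {1..n}" "i \<noteq> j"
  shows "cyc_subst n (Xratio i j) =
    lconst (if i = n then inverse qK else if j = n then qK else 1) *
    Xratio (if i = n then 1 else Suc i) (if j = n then 1 else Suc j)"
  using assms
  by (auto simp: Xratio_def cyc_subst_lmonom cyc_diff cyc_single lookup_minus lookup_single when_def
      power_int_minus)

text \<open>A pair (i, n) wraps around to (1, i + 1): \<open>x_i / x_n\<close> becomes
  \<open>q x_(i+1) / x_1\<close>, so the two halves of \<open>J_pair\<close> trade places. The
  powers of q match exactly, hence every truncation is already invariant.\<close>

lemma cyc_subst_J_pair:
  assumes "(i, j) \<in> pairs n"
  shows "cyc_subst n (J_pair N i j) = (if j < n then J_pair N (Suc i) (Suc j) else J_pair N 1 (Suc i))"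
proof (cases "j < n")
  case True
  then have *: "cyc_subst n (Xratio i j) = Xratio (Suc i) (Suc j)"
    "cyc_subst n (Xratio j i) = Xratio (Suc j) (Suc i)"
    using assms by (auto simp: pairs_def cyc_subst_Xratio)
  show ?thesis using True
    by (simp add: J_pair_def cyc_subst_mult cyc_subst_prod cyc_subst_diff cyc_subst_geom *)
next
  case False
  then have "j = n" "i < n" using assms by (auto simp: pairs_def)
  then have *: "cyc_subst n (Xratio i j) = lconst qK * Xratio (Suc i) 1"
    "cyc_subst n (Xratio j i) = lconst (inverse qK) * Xratio 1 (Suc i)"
    using assms by (auto simp: pairs_def cyc_subst_Xratio)
  have **: "lconst c * (lconst d * f) = lconst (c * d) * f" for c d f
    by (simp add: lconst_mult mult.assoc)
  have q: "lconst (qK ^ r) * (lconst qK * f) = lconst (qK * qK ^ r) * f"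
    "lconst (tK * qK ^ r) * (lconst qK * f) = lconst (tK * qK * qK ^ r) * f"
    "lconst (qK * qK ^ r) * (lconst (inverse qK) * f) = lconst (qK ^ r) * f"
    "lconst (tK * qK * qK ^ r) * (lconst (inverse qK) * f) = lconst (tK * qK ^ r) * f" for r f
    unfolding ** by (simp_all add: field_simps)
  show ?thesis using False
    by (simp only: J_pair_def cyc_subst_mult cyc_subst_prod cyc_subst_diff cyc_subst_geom * q
        cyc_subst_1 cyc_subst_lconst if_False) (simp only: mult_ac)
qed

lemma cyc_subst_J_trunc:
  "cyc_subst n (J_trunc n N) = J_trunc n N"
proof -
  let ?h = "\<lambda>(i, j). if j < n then (Suc i, Suc j) else (1, Suc i)"
  let ?k = "\<lambda>(i, j). if 1 < i then (i - 1, j - 1) else (j - 1, n)"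
  have "cyc_subst n (J_trunc n N) = (\<Prod>p\<in>pairs n. cyc_subst n (case p of (i, j) \<Rightarrow> J_pair N i j))"
    by (simp add: J_trunc_pairs cyc_subst_prod)
  also have "\<dots> = (\<Prod>(i, j)\<in>pairs n. J_pair N i j)"
    by (rule prod.reindex_bij_witness[of _ ?k ?h])
      (auto simp: cyc_subst_J_pair, auto simp: pairs_def split: if_splits)
  finally show ?thesis by (simp add: J_trunc_pairs)
qed

lemma weights_add: "\<mu> \<in> weights n \<Longrightarrow> \<nu> \<in> weights n \<Longrightarrow> \<mu> + \<nu> \<in> weights n"
  using keys_add[of \<mu> \<nu>] by (auto simp: weights_def)

lemma weights_iff: "\<mu> \<in> weights n \<longleftrightarrow> (\<forall>j. j \<notin> {1..n} \<longrightarrow> cmp \<mu> j = 0)"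
  by (auto simp: weights_def in_keys_iff subset_iff)

lemma weights_0 [simp]: "0 \<in> weights n"
  by (simp add: weights_iff)

lemma weights_diff: "\<mu> \<in> weights n \<Longrightarrow> \<nu> \<in> weights n \<Longrightarrow> \<mu> - \<nu> \<in> weights n"
  by (simp add: weights_iff lookup_minus)

lemma weights_uminus: "\<mu> \<in> weights n \<Longrightarrow> - \<mu> \<in> weights n"
  by (simp add: weights_iff)

lemma weights_single: "i \<in> {1..n} \<Longrightarrow> Poly_Mapping.single i c \<in> weights n"
  by (auto simp: weights_iff lookup_single when_def)

lemma weights_cyc [simp]: "cyc n \<mu> \<in> weights n"
  by (simp add: weights_iff lookup_cyc)

lemma weights_eqI:
  "\<mu> \<in> weights n \<Longrightarrow> \<nu> \<in> weights n \<Longrightarrow> (\<And>j. j \<in> {1..n} \<Longrightarrow> cmp \<mu> j = cmp \<nu> j) \<Longrightarrow> \<mu> = \<nu>"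
  by (rule poly_mapping_eqI) (metis weights_iff)

lemma laurent_ring_mult: "f \<in> laurent_ring n \<Longrightarrow> g \<in> laurent_ring n \<Longrightarrow> f * g \<in> laurent_ring n"
  unfolding laurent_ring_eq_lspan by (rule lspan_mult_closed) (auto simp: weights_add)

lemma laurent_ring_add: "f \<in> laurent_ring n \<Longrightarrow> g \<in> laurent_ring n \<Longrightarrow> f + g \<in> laurent_ring n"
  by (simp add: laurent_ring_eq_lspan lspan_add)

lemma laurent_ring_diff: "f \<in> laurent_ring n \<Longrightarrow> g \<in> laurent_ring n \<Longrightarrow> f - g \<in> laurent_ring n"
  by (simp add: laurent_ring_eq_lspan lspan_diff)

lemma laurent_ring_lconst [simp]: "lconst c \<in> laurent_ring n"
  by (simp add: laurent_ring_def lconst_def)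

lemma laurent_ring_1 [simp]: "1 \<in> laurent_ring n"
  using laurent_ring_lconst[of 1 n] by simp

lemma laurent_ring_lmonom: "\<mu> \<in> weights n \<Longrightarrow> lmonom \<mu> \<in> laurent_ring n"
  by (simp add: laurent_ring_eq_lspan lspan_lmonom)

lemma laurent_ring_Xvar: "i \<in> {1..n} \<Longrightarrow> Xvar i \<in> laurent_ring n"
  unfolding Xvar_def by (intro laurent_ring_lmonom weights_single)

lemma laurent_ring_Xratio: "i \<in> {1..n} \<Longrightarrow> j \<in> {1..n} \<Longrightarrow> Xratio i j \<in> laurent_ring n"
  unfolding Xratio_def by (intro laurent_ring_lmonom weights_diff weights_single)

lemma laurent_ring_prod: "(\<And>a. a \<in> A \<Longrightarrow> f a \<in> laurent_ring n) \<Longrightarrow> prod f A \<in> laurent_ring n"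
  by (induction A rule: infinite_finite_induct) (simp_all add: laurent_ring_mult)

lemma laurent_ring_sum: "(\<And>a. a \<in> A \<Longrightarrow> f a \<in> laurent_ring n) \<Longrightarrow> sum f A \<in> laurent_ring n"
  by (simp add: laurent_ring_eq_lspan lspan_sum)

lemma laurent_ring_power: "f \<in> laurent_ring n \<Longrightarrow> f ^ k \<in> laurent_ring n"
  by (induction k) (simp_all add: laurent_ring_mult)

lemma laurent_ring_geom: "f \<in> laurent_ring n \<Longrightarrow> geom N f \<in> laurent_ring n"
  unfolding geom_def by (intro laurent_ring_sum laurent_ring_power)

lemma laurent_ring_J_trunc: "J_trunc n N \<in> laurent_ring n"
  unfolding J_trunc_pairs J_pair_def
  by (rule laurent_ring_prod)
    (auto simp: pairs_def intro!: laurent_ring_mult laurent_ring_prod laurent_ring_diff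
      laurent_ring_geom laurent_ring_Xratio)

lemma laurent_ring_bar:
  assumes "f \<in> laurent_ring n"
  shows "bar f \<in> laurent_ring n"
  using assms unfolding laurent_ring_eq_lspan
  by (induction f rule: lspan_induct)
    (simp_all add: bar_add bar_mult bar_lconst bar_lmonom lspan_add lspan_scale lspan_lmonom weights_uminus)

lemma laurent_ring_cyc_subst:
  "f \<in> laurent_ring n \<Longrightarrow> cyc_subst n f \<in> laurent_ring n"
  unfolding laurent_ring_eq_lspan
  by (erule linear_op_lspan[OF linear_op_cyc_subst])
    (simp add: cyc_subst_lmonom lspan_scale lspan_lmonom)

text \<open>Within \<open>weights n\<close> only the exponent 0 is sent to 0, and there the power of
  q is 1; so constant terms survive the substitution.\<close>

lemma Lam_cyc_subst:
  assumes "0 < n" "h \<in> laurent_ring n"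
  shows "Lam n (cyc_subst n h) = Lam n h"
proof (rule Lam_eqI[OF assms(1)])
  fix N
  have *: "Poly_Mapping.lookup (cyc_subst n f) 0 = Poly_Mapping.lookup f 0" if "f \<in> lspan (weights n)" for f
    using that
  proof (induction f rule: lspan_induct)
    case (monom \<nu> c)
    have "cyc n \<nu> = 0 \<longleftrightarrow> \<nu> = 0"
    proof
      assume c0: "cyc n \<nu> = 0"
      show "\<nu> = 0"
      proof (rule weights_eqI[OF monom weights_0])
        fix j
        assume j: "j \<in> {1..n}"
        have "cmp (cyc n \<nu>) (if j = n then 1 else Suc j) = 0" using c0 by simp
        then show "cmp \<nu> j = cmp 0 j" using j by (auto simp: lookup_cyc split: if_splits)
      qed
    qed simp
    then show ?case by (simp add: cyc_subst_mult cyc_subst_lmonom lookup_lmonom)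
  qed (simp_all add: cyc_subst_add lookup_add)
  have "cyc_subst n h * J_trunc n N = cyc_subst n (h * J_trunc n N)"
    by (simp add: cyc_subst_mult cyc_subst_J_trunc)
  then show "Poly_Mapping.lookup (cyc_subst n h * J_trunc n N) 0 = Poly_Mapping.lookup (h * J_trunc n N) 0"
    using *[of "h * J_trunc n N"] assms(2) laurent_ring_J_trunc[of n N]
    by (simp add: laurent_ring_mult flip: laurent_ring_eq_lspan)
qed

lemma bar_cyc_subst: "bar (cyc_subst n f) = cyc_subst n (bar f)"
proof (induction f rule: laurent_induct)
  case (monom \<nu> c)
  have "cyc n (- \<nu>) = - cyc n \<nu>" using cyc_diff[of n 0 \<nu>] by simp
  then show ?case
    by (simp add: cyc_subst_mult bar_mult cyc_subst_lmonom bar_lmonom bar_lconst bar_K.hom_inverse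
        bar_K.hom_power_int bar_qK power_int_inverse power_int_minus)
qed (simp_all add: cyc_subst_add bar_add)

lemma inner_cyc_subst:
  assumes "0 < n" "f \<in> laurent_ring n" "g \<in> laurent_ring n"
  shows "inner_qt n (cyc_subst n f) (cyc_subst n g) = inner_qt n f g"
  using Lam_cyc_subst[OF assms(1) laurent_ring_mult[OF assms(2) laurent_ring_bar[OF assms(3)]]]
  by (simp add: inner_qt_Lam bar_cyc_subst cyc_subst_mult)

lemma inner_lmonom: "inner_qt n (lmonom \<mu> * f) (lmonom \<mu> * g) = inner_qt n f g"
proof -
  have "lmonom \<mu> * f * (lmonom (- \<mu>) * bar g) = (lmonom \<mu> * lmonom (- \<mu>)) * (f * bar g)"
    by (simp only: mult_ac)
  then show ?thesis by (simp only: inner_qt_Lam bar_mult bar_lmonom lmonom_inverse mult_1_left)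
qed

lemma inner_add_left: "0 < n \<Longrightarrow> inner_qt n (f + f') g = inner_qt n f g + inner_qt n f' g"
  by (simp add: inner_qt_Lam distrib_right Lam_add)

lemma inner_add_right: "0 < n \<Longrightarrow> inner_qt n f (g + g') = inner_qt n f g + inner_qt n f g'"
  by (simp add: inner_qt_Lam distrib_left Lam_add bar_add)

lemma inner_diff_left: "0 < n \<Longrightarrow> inner_qt n (f - f') g = inner_qt n f g - inner_qt n f' g"
  by (simp add: inner_qt_Lam left_diff_distrib Lam_diff)

lemma inner_diff_right: "0 < n \<Longrightarrow> inner_qt n f (g - g') = inner_qt n f g - inner_qt n f g'"
  by (simp add: inner_qt_Lam right_diff_distrib Lam_diff bar_diff)

lemma inner_scale_left: "0 < n \<Longrightarrow> inner_qt n (lconst c * f) g = K_to_fls c * inner_qt n f g"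
  by (simp add: inner_qt_Lam mult.assoc Lam_scale)

lemma inner_scale_right: "0 < n \<Longrightarrow> inner_qt n f (lconst c * g) = K_to_fls (bar_K c) * inner_qt n f g"
  by (simp add: inner_qt_Lam mult.left_commute[of f] bar_mult bar_lconst Lam_scale)

lemma inner_0_left [simp]: "inner_qt n 0 g = 0" and inner_0_right [simp]: "inner_qt n f 0 = 0"
  by (simp_all add: inner_qt_Lam)

lemma inner_sum_right: "0 < n \<Longrightarrow> inner_qt n f (sum g A) = (\<Sum>a\<in>A. inner_qt n f (g a))"
  by (induction A rule: infinite_finite_induct) (simp_all add: inner_add_right)

subsection \<open>Demazure--Lusztig operators are isometries\<close>

lemma act_geom: "bij w \<Longrightarrow> act w (geom N v) = geom N (act w v)"
  by (simp add: geom_def act_sum act_power)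

lemma act_J_pair: "bij w \<Longrightarrow> act w (J_pair N i j) = J_pair N (w i) (w j)"
  by (simp add: J_pair_def act_mult act_prod act_diff act_geom act_Xratio)

lemma two_neq_0_fract:
  assumes "(2 :: 'a::field) \<noteq> 0"
  shows "(2 :: 'a poly fract) \<noteq> 0"
proof -
  have "(2 :: 'a poly fract) = of_nat 2" by simp
  also have "\<dots> = Fraction_Field.Fract (of_nat 2) 1" by (rule of_nat_fract)
  also have "\<dots> \<noteq> 0"
    using assms by (simp add: Zero_fract_def eq_fract numeral_poly)
  finally show ?thesis .
qed

lemma two_neq_0_K: "(2 :: K) \<noteq> 0"
  by (intro two_neq_0_fract) simp

text \<open>Up to high \<open>y\<close>-degree, \<open>J\<close> is symmetric under \<open>s\<^sub>i\<close> except for one factor.\<close>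

lemma J_trunc_simple_refl:
  assumes "1 \<le> i" "i < n"
  shows "\<exists>S. act (simple_refl i) S = S \<and>
    (1 - lconst tK * Xratio i (Suc i)) * J_trunc n (Suc m) - (1 - Xratio i (Suc i)) * S \<in> filt n (int (Suc m))"
proof -
  let ?N = "Suc m" and ?s = "simple_refl i"
  let ?u = "Xratio i (Suc i)" and ?v = "Xratio (Suc i) i"
  have p: "(i, Suc i) \<in> pairs n" using assms by (auto simp: pairs_def)
  \<comment> \<open>Under \<open>s_i\<close>, the factors in \<open>q^(r+1) u\<close> and
    \<open>q^(r+1) v\<close> are exchanged. Without a partner remain r = 0 in the products over u
    and r = m in those over v; the rest is \<open>B\<close>.\<close>
  define B where "B =
    (\<Prod>r<m. 1 - lconst (qK * qK ^ r) * ?u) * (\<Prod>r<m. geom ?N (lconst (tK * qK * qK ^ r) * ?u)) *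
    (\<Prod>r<m. 1 - lconst (qK * qK ^ r) * ?v) * (\<Prod>r<m. geom ?N (lconst (tK * qK * qK ^ r) * ?v))"
  define R where "R = (\<Prod>(a, b)\<in>pairs n - {(i, Suc i)}. J_pair ?N a b)"
  define w1 where "w1 = lconst (qK * qK ^ m) * ?v"
  define w2 where "w2 = lconst (tK * qK * qK ^ m) * ?v"
  have "(\<Prod>r<?N. 1 - lconst (qK ^ r) * ?u) = (1 - ?u) * (\<Prod>r<m. 1 - lconst (qK * qK ^ r) * ?u)"
    "(\<Prod>r<?N. geom ?N (lconst (tK * qK ^ r) * ?u))
      = geom ?N (lconst tK * ?u) * (\<Prod>r<m. geom ?N (lconst (tK * qK * qK ^ r) * ?u))"
    unfolding prod.lessThan_Suc_shift by (simp_all add: mult.assoc)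
  then have Jp: "J_pair ?N i (Suc i) = (1 - ?u) * geom ?N (lconst tK * ?u) * B * ((1 - w1) * geom ?N w2)"
    unfolding J_pair_def B_def w1_def w2_def prod.lessThan_Suc[of _ m]
    by (simp only: mult_ac)
  have J: "J_trunc n ?N = J_pair ?N i (Suc i) * R"
    unfolding J_trunc_pairs R_def using p by (subst prod.remove[OF finite_pairs p]) simp
  have sB: "act ?s B = B"
    by (simp add: B_def act_mult act_prod act_diff act_geom act_Xratio simple_refl_apply mult_ac)
  have sR: "act ?s R = R"
  proof -
    have "act ?s R = (\<Prod>p\<in>pairs n - {(i, Suc i)}. act ?s (case p of (a, b) \<Rightarrow> J_pair ?N a b))"
      by (simp add: R_def act_prod)
    also have "\<dots> = R"
      unfolding R_def
      by (rule prod.reindex_bij_witness[of _ "\<lambda>(a, b). (?s a, ?s b)" "\<lambda>(a, b). (?s a, ?s b)"])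
        (use assms in \<open>auto simp: act_J_pair pairs_def simple_refl_apply split: if_splits\<close>)
    finally show ?thesis .
  qed
  \<comment> \<open>\<open>E\<close> gathers the defects of truncation: the remainder of the
    geometric series of t u and the unpaired factors in v. All of them are 1 up to high
    degree.\<close>
  define E where "E = (1 - (lconst tK * ?u) ^ ?N) * ((1 - w1) * geom ?N w2)"
  have eq: "(1 - lconst tK * ?u) * J_trunc n ?N = (1 - ?u) * (B * R) * E"
  proof -
    have "(1 - lconst tK * ?u) * J_trunc n ?N
        = (1 - ?u) * (B * R) * (((1 - lconst tK * ?u) * geom ?N (lconst tK * ?u)) * ((1 - w1) * geom ?N w2))"
      unfolding J Jp by (simp only: mult_ac)
    then show ?thesis unfolding one_minus_times_geom E_def .
  qed
  note args = J_pair_arguments_filt[OF p]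
  have u: "?u \<in> filt n 1" "lconst tK * ?u \<in> filt n 1"
    using args(1,2)[of 0] by simp_all
  have "w1 \<in> filt n (int ?N)" "w2 \<in> filt n (int ?N)"
    using args(3,4)[of m] by (simp_all add: w1_def w2_def add.commute)
  then have w: "(1 - w1) - 1 \<in> filt n (int ?N)" "geom ?N w2 - 1 \<in> filt n (int ?N)"
    using filt_uminus[of w1] by (auto intro: geom_cong_1)
  have "(1 - (lconst tK * ?u) ^ ?N) - 1 \<in> filt n (int ?N)"
    using filt_uminus[OF filt_power[OF u(2), of ?N]] by simp
  then have E: "E - 1 \<in> filt n (int ?N)"
    using w unfolding E_def
    by (metis (no_types, opaque_lifting) filt_cong_mult filt_cong_0 filt_1 mult_1_left of_nat_0_le_iff)
  have f0: "filt n (int k + 1) \<subseteq> filt n 0" for k using filt_mono[of 0 "int k + 1" _ n] by auto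
  have B0: "B \<in> filt n 0"
  proof -
    have "lconst (qK * qK ^ r) * ?u \<in> filt n 0" "lconst (tK * qK * qK ^ r) * ?u \<in> filt n 0"
      "lconst (qK * qK ^ r) * ?v \<in> filt n 0" "lconst (tK * qK * qK ^ r) * ?v \<in> filt n 0" for r
      using args(1,2)[of "Suc r"] args(3,4)[of r] f0[of r] f0[of "Suc r"]
      by (auto simp: mult.assoc)
    note v = this
    have P: "(\<Prod>r<m. 1 - v r) \<in> filt n 0" "(\<Prod>r<m. geom ?N (v r)) \<in> filt n 0"
      if "\<And>r. v r \<in> filt n 0" for v :: "nat \<Rightarrow> laurent"
      by (intro filt_prod0 filt_diff filt_1 geom_filt that)+
    show ?thesis
      unfolding B_def by (rule filt_mult0[OF filt_mult0[OF filt_mult0[OF P(1) P(2)] P(1)] P(2)]; rule v)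
  qed
  have R0: "R \<in> filt n 0"
    unfolding R_def by (rule filt_prod0) (auto intro: J_pair_filt)
  have "(E - 1) * ((1 - ?u) * (B * R)) \<in> filt n (int ?N)"
    by (intro filt_mult0 E filt_diff filt_1 B0 R0 filt_mono[OF _ u(1)]) simp
  then have "(1 - lconst tK * ?u) * J_trunc n ?N - (1 - ?u) * (B * R) \<in> filt n (int ?N)"
    unfolding eq by (simp add: algebra_simps)
  moreover have "act ?s (B * R) = B * R" by (simp add: act_mult sB sR)
  ultimately show ?thesis by blast
qed

text \<open>With u = \<open>x_i / x_(i+1)\<close> the integrand is
  \<open>x_(i+1) (1 - t u) J H\<close>. By \<open>J_trunc_simple_refl\<close> it equals
  \<open>(x_(i+1) - x_i) S H\<close> up to high degree, which is antisymmetric under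
  \<open>s_i\<close> and so has no constant term.\<close>

lemma Lam_symmetric:
  assumes "1 \<le> i" "i < n" "act (simple_refl i) H = H"
  shows "Lam n ((Xvar (Suc i) - lconst tK * Xvar i) * H) = 0"
proof -
  let ?u = "Xratio i (Suc i)"
  have n: "0 < n" using assms by simp
  obtain S where S: "act (simple_refl i) (S m) = S m"
    "(1 - lconst tK * ?u) * J_trunc n (Suc m) - (1 - ?u) * S m \<in> filt n (int (Suc m))" for m
    using J_trunc_simple_refl[OF assms(1,2)] by metis
  define e where "e m = (1 - lconst tK * ?u) * J_trunc n (Suc m) - (1 - ?u) * S m" for m
  have Xu: "Xvar (Suc i) * ?u = Xvar i"
    by (simp add: Xvar_def Xratio_def algebra_simps flip: lmonom_add)
  have lookup: "Poly_Mapping.lookup ((Xvar (Suc i) - lconst tK * Xvar i) * H * J_trunc n (Suc m)) 0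
      = Poly_Mapping.lookup (Xvar (Suc i) * H * e m) 0" for m
  proof -
    let ?F = "(Xvar (Suc i) - Xvar i) * (H * S m)"
    have "act (simple_refl i) ?F = (Xvar i - Xvar (Suc i)) * (H * S m)"
      by (simp add: act_mult act_diff act_Xvar simple_refl_apply S(1) assms(3))
    also have "\<dots> = - ?F" by (simp add: left_diff_distrib)
    finally have sF: "act (simple_refl i) ?F = - ?F" .
    have "Poly_Mapping.lookup ?F 0 = Poly_Mapping.lookup (act (simple_refl i) ?F) (act_expo (simple_refl i) 0)"
      by (rule lookup_act[symmetric]) simp
    also have "\<dots> = - Poly_Mapping.lookup ?F 0"
      unfolding sF by (simp only: act_expo_0 bij_simple_refl lookup_uminus)
    finally have "Poly_Mapping.lookup ?F 0 = - Poly_Mapping.lookup ?F 0" .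
    then have "Poly_Mapping.lookup ?F 0 + Poly_Mapping.lookup ?F 0 = 0"
      by (simp only: eq_neg_iff_add_eq_0)
    then have "2 * Poly_Mapping.lookup ?F 0 = 0" by (simp only: mult_2)
    then have F0: "Poly_Mapping.lookup ?F 0 = 0"
      using two_neq_0_K unfolding mult_eq_0_iff by blast
    have "(Xvar (Suc i) - lconst tK * Xvar i) * H * J_trunc n (Suc m)
        = (Xvar (Suc i) - lconst tK * (Xvar (Suc i) * ?u)) * H * J_trunc n (Suc m)"
      by (simp only: Xu)
    also have "\<dots> = Xvar (Suc i) * H * ((1 - lconst tK * ?u) * J_trunc n (Suc m))"
      by (simp add: algebra_simps)
    also have "(1 - lconst tK * ?u) * J_trunc n (Suc m) = e m + (1 - ?u) * S m"
      by (simp add: e_def)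
    also have "Xvar (Suc i) * H * (e m + (1 - ?u) * S m)
        = Xvar (Suc i) * H * e m + (Xvar (Suc i) - Xvar (Suc i) * ?u) * (H * S m)"
      by (simp add: algebra_simps)
    finally show ?thesis unfolding Xu by (simp add: lookup_add F0)
  qed
  have e: "e m \<in> filt n (int m)" for m
    unfolding e_def by (rule filt_mono[OF _ S(2)]) simp
  let ?g = "Xvar (Suc i) * H"
  have "fls_conv (\<lambda>m. K_to_fls (Poly_Mapping.lookup (?g * e m) 0)) (\<Sum>\<nu>\<in>Poly_Mapping.keys ?g. K_to_fls (Poly_Mapping.lookup ?g \<nu>) * 0)"
    unfolding lookup_times_0[of ?g] K_to_fls.hom_sum K_to_fls.hom_mult
    by (intro fls_conv_sum fls_conv_mult filt_conv_0[OF n] e)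
  moreover have "fls_conv (\<lambda>m. K_to_fls (Poly_Mapping.lookup
      ((Xvar (Suc i) - lconst tK * Xvar i) * H * J_trunc n (Suc m)) 0))
      (Lam n ((Xvar (Suc i) - lconst tK * Xvar i) * H))"
    unfolding fls_conv_def
  proof
    fix d
    obtain N0 where "\<forall>N\<ge>N0. fls_ge d (K_to_fls (Poly_Mapping.lookup
      ((Xvar (Suc i) - lconst tK * Xvar i) * H * J_trunc n N) 0)
      - Lam n ((Xvar (Suc i) - lconst tK * Xvar i) * H))"
      using fls_convD[OF Lam_conv[OF n]] by blast
    then show "\<exists>N0. \<forall>N\<ge>N0. fls_ge d (K_to_fls (Poly_Mapping.lookup
      ((Xvar (Suc i) - lconst tK * Xvar i) * H * J_trunc n (Suc N)) 0)
      - Lam n ((Xvar (Suc i) - lconst tK * Xvar i) * H))"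
      by (intro exI[of _ N0]) auto
  qed
  ultimately show ?thesis
    unfolding lookup using fls_conv_unique[of _ "Lam n ((Xvar (Suc i) - lconst tK * Xvar i) * H)"]
    by (simp only: mult_zero_right sum.neutral_const)
qed

text \<open>\<open>T_i\<close> is self-adjoint for the bilinear form ct(f h J): the two integrands
  differ by \<open>x_(i+1) - t x_i\<close> times a symmetric element.\<close>

lemma Lam_Top:
  assumes "1 \<le> i" "i < n"
  shows "Lam n (Top i f * h) = Lam n (f * Top i h)"
proof -
  let ?H = "ddiff i f * h - f * ddiff i h"
  have "act (simple_refl i) ?H = ?H"
    by (simp only: act_diff act_mult act_ddiff bij_simple_refl)
      (simp add: act_simple_refl_eq algebra_simps)
  then have "Lam n ((Xvar (Suc i) - lconst tK * Xvar i) * ?H) = 0"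
    by (rule Lam_symmetric[OF assms])
  also have "(Xvar (Suc i) - lconst tK * Xvar i) * ?H = Top i f * h - f * Top i h"
    by (simp add: Top_def algebra_simps)
  finally show ?thesis using assms by (simp add: Lam_diff)
qed

text \<open>Under \<open>bar\<close> the denominator \<open>x_i - x_(i+1)\<close> becomes
  \<open>-(x_i - x_(i+1)) / (x_i x_(i+1))\<close>.\<close>

lemma bar_ddiff: "bar (ddiff i f) = - (Xvar i * Xvar (Suc i) * ddiff i (bar f))"
proof -
  let ?a = "lmonom (- Poly_Mapping.single i 1)" and ?b = "lmonom (- Poly_Mapping.single (Suc i) 1)"
  have inv: "Xvar i * ?a = 1" "Xvar (Suc i) * ?b = 1"
    by (simp_all add: Xvar_def lmonom_inverse)
  have "bar (ddiff i f) * (?a - ?b) = bar f - act (simple_refl i) (bar f)"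
    using arg_cong[OF ddiff_eq[of i f], of bar]
    by (simp add: bar_mult bar_diff bar_Xvar bar_act)
  also have "\<dots> = ddiff i (bar f) * (Xvar i - Xvar (Suc i))" by (simp add: ddiff_eq)
  finally have eq: "bar (ddiff i f) * (?a - ?b) = ddiff i (bar f) * (Xvar i - Xvar (Suc i))" .
  have "bar (ddiff i f) * (Xvar (Suc i) - Xvar i)
      = bar (ddiff i f) * ((Xvar i * ?a) * Xvar (Suc i) - (Xvar (Suc i) * ?b) * Xvar i)"
    by (simp add: inv)
  also have "\<dots> = (bar (ddiff i f) * (?a - ?b)) * (Xvar i * Xvar (Suc i))"
    by (simp add: algebra_simps)
  also have "\<dots> = - (Xvar i * Xvar (Suc i) * ddiff i (bar f)) * (Xvar (Suc i) - Xvar i)"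
    unfolding eq by (simp add: algebra_simps)
  finally show ?thesis using Xvar_diff_neq_0[of "Suc i" i] by (metis mult_right_cancel n_not_Suc_n)
qed

text \<open>Conjugation by \<open>bar\<close> inverts \<open>T_i\<close>. This turns
  self-adjointness for the bilinear form into isometry for the sesquilinear one.\<close>

lemma Top_bar_Top: "Top i (bar (Top i g)) = bar g"
proof -
  let ?a = "lmonom (- Poly_Mapping.single i 1)" and ?b = "lmonom (- Poly_Mapping.single (Suc i) 1)"
  have inv: "Xvar i * ?a = 1" "Xvar (Suc i) * ?b = 1"
    by (simp_all add: Xvar_def lmonom_inverse)
  have t: "lconst (inverse tK) * lconst tK = 1" by (simp flip: lconst_mult)
  have "bar (Top i g) = bar g - (?b - lconst (inverse tK) * ?a) * (Xvar i * Xvar (Suc i) * ddiff i (bar g))"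
    by (simp add: Top_def bar_add bar_mult bar_diff bar_lconst bar_tK bar_Xvar bar_ddiff)
  also have "\<dots> = bar g - ((Xvar (Suc i) * ?b) * Xvar i - lconst (inverse tK) * (Xvar i * ?a) * Xvar (Suc i)) * ddiff i (bar g)"
    by (simp add: algebra_simps)
  also have "\<dots> = bar g - ((lconst (inverse tK) * lconst tK) * Xvar i - lconst (inverse tK) * Xvar (Suc i)) * ddiff i (bar g)"
    unfolding inv t by simp
  also have "\<dots> = bar g + lconst (inverse tK) * (Top i (bar g) - bar g)"
    by (simp add: Top_def algebra_simps)
  finally have "Top i (bar (Top i g))
      = Top i (bar g) + lconst (inverse tK) * (- lconst tK * (Top i (bar g) - bar g))"
    by (simp add: linear_op_add[OF linear_op_Top] linear_op_scale[OF linear_op_Top] Top_quadratic)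
  also have "\<dots> = Top i (bar g) - (lconst (inverse tK) * lconst tK) * (Top i (bar g) - bar g)"
    by (simp add: algebra_simps)
  finally show ?thesis unfolding t by simp
qed

lemma inner_Top:
  assumes "1 \<le> i" "i < n"
  shows "inner_qt n (Top i f) (Top i g) = inner_qt n f g"
  by (simp add: inner_qt_Lam Lam_Top[OF assms] Top_bar_Top)

subsection \<open>Nondegeneracy\<close>

text \<open>
  Modulo \<open>q\<close> the Gram matrix of the monomials is unitriangular with respect to \<open>ht\<close>.
\<close>

lemma inner_nondegenerate:
  assumes n: "0 < n" and f: "f \<in> laurent_ring n"
    and orth: "\<And>\<nu>. \<nu> \<in> Poly_Mapping.keys f \<Longrightarrow> inner_qt n f (lmonom \<nu>) = 0"
  shows "f = 0"
proof (rule ccontr)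
  assume "f \<noteq> 0"
  let ?S = "Poly_Mapping.keys f"
  let ?c = "\<lambda>\<kappa>. Poly_Mapping.lookup f \<kappa>"
  have ne: "?S \<noteq> {}" using \<open>f \<noteq> 0\<close> by simp
  \<comment> \<open>Among the terms of least q-order m, the one of greatest \<open>ht\<close> is
    isolated: in the pairing of f with its monomial, only its own coefficient contributes to
    q^m.\<close>
  define m where "m = Min ((\<lambda>\<kappa>. qdeg (?c \<kappa>)) ` ?S)"
  have m_le: "m \<le> qdeg (?c \<kappa>)" if "\<kappa> \<in> ?S" for \<kappa>
    unfolding m_def using that by (intro Min_le) auto
  define A where "A = {\<kappa>\<in>?S. qdeg (?c \<kappa>) = m}"
  have "m \<in> (\<lambda>\<kappa>. qdeg (?c \<kappa>)) ` ?S"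
    unfolding m_def using ne by (intro Min_in) auto
  then have A: "finite A" "A \<noteq> {}" by (auto simp: A_def)
  have "Max (ht n ` A) \<in> ht n ` A" using A by (intro Max_in) auto
  then obtain \<nu> where "\<nu> \<in> A" "ht n \<nu> = Max (ht n ` A)" by auto
  then have \<nu>: "\<nu> \<in> A" "\<And>\<kappa>. \<kappa> \<in> A \<Longrightarrow> ht n \<kappa> \<le> ht n \<nu>"
    using A(1) by auto
  have "inner_qt n f (lmonom \<nu>) = (\<Sum>\<kappa>\<in>?S. K_to_fls (?c \<kappa>) * J_coeff n (\<nu> - \<kappa>))"
  proof -
    have "inner_qt n f (lmonom \<nu>)
        = (\<Sum>\<kappa>\<in>Poly_Mapping.keys (f * lmonom (- \<nu>)).
            K_to_fls (Poly_Mapping.lookup (f * lmonom (- \<nu>)) \<kappa>) * J_coeff n (- \<kappa>))"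
      by (simp add: inner_qt_Lam Lam_def bar_lmonom)
    also have "\<dots> = (\<Sum>\<kappa>\<in>?S. K_to_fls (?c \<kappa>) * J_coeff n (\<nu> - \<kappa>))"
      by (rule sum.reindex_bij_witness[of _ "\<lambda>\<kappa>. \<kappa> - \<nu>" "\<lambda>\<kappa>. \<kappa> + \<nu>"])
        (auto simp: mult.commute[of f] in_keys_iff lookup_lmonom_times)
    finally show ?thesis .
  qed
  then have "fls_nth (\<Sum>\<kappa>\<in>?S. K_to_fls (?c \<kappa>) * J_coeff n (\<nu> - \<kappa>)) m = 0"
    using orth \<nu>(1) by (simp add: A_def)
  moreover have "fls_nth (K_to_fls (?c \<kappa>) * J_coeff n (\<nu> - \<kappa>)) m
      = (if \<kappa> = \<nu> then fls_nth (K_to_fls (?c \<nu>)) m else 0)" if "\<kappa> \<in> ?S" for \<kappa>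
  proof -
    have c: "fls_ge m (K_to_fls (?c \<kappa>))"
      using m_le[OF that] by (simp add: fls_ge_iff_subdegree qdeg_def)
    have *: "fls_nth (K_to_fls (?c \<kappa>) * J) m = 0" if "fls_ge (m + 1) (K_to_fls (?c \<kappa>)) \<and> fls_ge 0 J \<or> fls_ge 1 J" for J
      using that fls_ge_mult[of "m + 1" "K_to_fls (?c \<kappa>)" 0 J] fls_ge_mult[OF c, of 1 J]
      by (auto simp: fls_ge_def)
    have J: "fls_ge 1 (J_coeff n \<mu> - (if \<mu> = 0 then 1 else 0))" if "0 \<le> ht n \<mu>" for \<mu>
    proof -
      have "k < 1 \<longleftrightarrow> k < 0 \<or> k = 0" for k :: int by auto
      then show ?thesis using J_coeff_order[OF n, of \<mu>] that by (auto simp: fls_ge_def)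
    qed
    show ?thesis
    proof (cases "\<kappa> \<in> A")
      case True
      then have "0 \<le> ht n (\<nu> - \<kappa>)" using \<nu>(2) by (simp add: ht_diff)
      from J[OF this] have J1: "fls_ge 1 (J_coeff n (\<nu> - \<kappa>) - (if \<kappa> = \<nu> then 1 else 0))"
        by (cases "\<kappa> = \<nu>") simp_all
      show ?thesis
      proof (cases "\<kappa> = \<nu>")
        case True
        then have "fls_nth (K_to_fls (?c \<kappa>) * (J_coeff n 0 - 1)) m = 0"
          using J1 * by simp
        then show ?thesis using True by (simp add: right_diff_distrib)
      qed (use J1 * in simp)
    next
      case False
      then have "m + 1 \<le> qdeg (?c \<kappa>)" using m_le[OF that] that by (simp add: A_def)
      then show ?thesis using False \<nu>(1) J_coeff_order(1)[OF n] *
        by (auto simp: fls_ge_iff_subdegree qdeg_def)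
    qed
  qed
  ultimately have "(\<Sum>\<kappa>\<in>?S. if \<kappa> = \<nu> then fls_nth (K_to_fls (?c \<nu>)) m else 0) = 0"
    by (simp add: fls_nth_sum)
  then have "fls_nth (K_to_fls (?c \<nu>)) m = 0"
    using \<nu>(1) by (simp add: A_def)
  moreover have "fls_subdegree (K_to_fls (?c \<nu>)) = m" "K_to_fls (?c \<nu>) \<noteq> 0"
    using \<nu>(1) by (simp_all add: A_def qdeg_def in_keys_iff)
  ultimately show False using nth_fls_subdegree_nonzero by blast
qed

section \<open>A Bruhat-type order on the weights\<close>

lemma slide_slide: "slide i j k (slide i j l \<nu>) = slide i j (k + l) \<nu>"
  by (simp add: slide_def single_add algebra_simps)

lemma weights_slide:
  "i \<in> {1..n} \<Longrightarrow> j \<in> {1..n} \<Longrightarrow> \<nu> \<in> weights n \<Longrightarrow> slide i j k \<nu> \<in> weights n"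
  unfolding slide_def by (intro weights_add weights_diff weights_single)

text \<open>
  A step replaces \<open>(\<mu>\<^sub>i, \<mu>\<^sub>j)\<close>, \<open>i < j\<close>, by a pair with the same sum whose difference is closer
  to \<open>1/2\<close>.  This is a reflection order of the affine symmetric group; since passing the last entry
  to the front as \<open>\<mu>\<^sub>n + 1\<close> turns a difference \<open>d\<close> into \<open>1 - d\<close>, it is invariant under \<open>phi\<close> below.
\<close>

definition low_step :: "nat \<Rightarrow> expo \<Rightarrow> expo \<Rightarrow> bool" where
  "low_step n \<nu> \<mu> \<longleftrightarrow> \<mu> \<in> weights n \<and> (\<exists>i j k. (i, j) \<in> pairs n \<and> \<nu> = slide i j k \<mu> \<and>
     (0 < k \<and> k < cmp \<mu> i - cmp \<mu> j \<or> cmp \<mu> i - cmp \<mu> j \<le> k \<and> k < 0))"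

definition low :: "nat \<Rightarrow> expo \<Rightarrow> expo \<Rightarrow> bool" where
  "low n = (low_step n)\<^sup>+\<^sup>+"

lemma low_stepE:
  assumes "low_step n \<nu> \<mu>"
  obtains i j k where "\<mu> \<in> weights n" "(i, j) \<in> pairs n" "\<nu> = slide i j k \<mu>"
    "0 < k \<and> k < cmp \<mu> i - cmp \<mu> j \<or> cmp \<mu> i - cmp \<mu> j \<le> k \<and> k < 0"
    "i \<in> {1..n}" "j \<in> {1..n}" "i \<noteq> j" "i < j"
  using assms unfolding low_step_def pairs_def by fastforce

lemma low_stepI:
  "\<mu> \<in> weights n \<Longrightarrow> (i, j) \<in> pairs n \<Longrightarrow>
   0 < k \<and> k < cmp \<mu> i - cmp \<mu> j \<or> cmp \<mu> i - cmp \<mu> j \<le> k \<and> k < 0 \<Longrightarrow> low_step n (slide i j k \<mu>) \<mu>"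
  unfolding low_step_def by blast

lemma low_step_weights: "low_step n \<nu> \<mu> \<Longrightarrow> \<nu> \<in> weights n"
  by (elim low_stepE) (simp add: weights_slide)

lemma low_weights:
  assumes "low n \<nu> \<mu>"
  shows "\<nu> \<in> weights n" "\<mu> \<in> weights n"
proof -
  have "\<nu> \<in> weights n \<and> \<mu> \<in> weights n"
    using assms unfolding low_def
    by (induction rule: tranclp_induct) (auto simp: low_step_weights, auto simp: low_step_def)
  then show "\<nu> \<in> weights n" "\<mu> \<in> weights n" by auto
qed

lemma low_trans: "low n \<kappa> \<nu> \<Longrightarrow> low n \<nu> \<mu> \<Longrightarrow> low n \<kappa> \<mu>"
  unfolding low_def by (rule tranclp_trans)

lemma low_map:
  assumes "\<And>\<nu> \<mu>. low_step n \<nu> \<mu> \<Longrightarrow> low_step n (f \<nu>) (f \<mu>)" "low n \<nu> \<mu>"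
  shows "low n (f \<nu>) (f \<mu>)"
  using assms(2) unfolding low_def
proof (induction rule: tranclp_induct)
  case (base y)
  then show ?case by (intro tranclp.r_into_trancl assms(1))
next
  case (step y z)
  then show ?case by (meson assms(1) tranclp.trancl_into_trancl)
qed

section \<open>The affine rotation of weights\<close>

definition phi :: "nat \<Rightarrow> expo \<Rightarrow> expo" where
  "phi n \<mu> = cyc n \<mu> + Poly_Mapping.single 1 1"

definition cyc_inv :: "nat \<Rightarrow> expo \<Rightarrow> expo" where
  "cyc_inv n \<mu> = mk_expo n (\<lambda>j. if j = n then cmp \<mu> 1 else cmp \<mu> (Suc j))"

definition psi :: "nat \<Rightarrow> expo \<Rightarrow> expo" where
  "psi n \<mu> = cyc_inv n (\<mu> - Poly_Mapping.single 1 1)"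

lemma lookup_phi:
  "j \<in> {1..n} \<Longrightarrow> cmp (phi n \<mu>) j = (if j = 1 then cmp \<mu> n + 1 else cmp \<mu> (j - 1))"
  by (simp add: phi_def lookup_add lookup_cyc lookup_single when_def)

lemma lookup_psi:
  "j \<in> {1..n} \<Longrightarrow> cmp (psi n \<mu>) j = (if j = n then cmp \<mu> 1 - 1 else cmp \<mu> (Suc j))"
  by (simp add: psi_def cyc_inv_def lookup_mk_expo lookup_minus lookup_single when_def)

lemma lookup_psi_pred: "1 < j \<Longrightarrow> j \<le> n \<Longrightarrow> cmp (psi n \<mu>) (j - Suc 0) = cmp \<mu> j"
  by (cases j) (auto simp: lookup_psi)

lemma weights_mk_expo [simp]: "mk_expo n f \<in> weights n"
  by (simp add: weights_iff lookup_mk_expo)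

lemma weights_phi: "0 < n \<Longrightarrow> phi n \<mu> \<in> weights n"
  unfolding phi_def by (intro weights_add weights_cyc weights_single) simp

lemma weights_psi [simp]: "psi n \<mu> \<in> weights n"
  by (simp add: psi_def cyc_inv_def)

lemma phi_psi: "0 < n \<Longrightarrow> \<mu> \<in> weights n \<Longrightarrow> phi n (psi n \<mu>) = \<mu>"
  by (rule weights_eqI[OF weights_phi]) (auto simp: lookup_phi lookup_psi lookup_psi_pred)

lemma psi_phi: "0 < n \<Longrightarrow> \<mu> \<in> weights n \<Longrightarrow> psi n (phi n \<mu>) = \<mu>"
  by (rule weights_eqI[OF weights_psi]) (auto simp: lookup_phi lookup_psi)

lemma low_step_phi:
  assumes n: "0 < n" and "low_step n \<nu> \<mu>"
  shows "low_step n (phi n \<nu>) (phi n \<mu>)"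
  using assms(2)
proof (elim low_stepE)
  fix i j k
  assume ij: "(i, j) \<in> pairs n" "i \<in> {1..n}" "j \<in> {1..n}" "i \<noteq> j" "i < j" and \<mu>: "\<mu> \<in> weights n"
    and \<nu>: "\<nu> = slide i j k \<mu>"
    and k: "0 < k \<and> k < cmp \<mu> i - cmp \<mu> j \<or> cmp \<mu> i - cmp \<mu> j \<le> k \<and> k < 0"
  show ?thesis
  proof (cases "j < n")
    case True
    have "phi n \<nu> = slide (Suc i) (Suc j) k (phi n \<mu>)"
      unfolding \<nu> by (rule weights_eqI[OF weights_phi[OF n] weights_slide[OF _ _ weights_phi[OF n]]])
        (use ij True in \<open>auto simp: lookup_phi lookup_slide\<close>)
    moreover have "low_step n (slide (Suc i) (Suc j) k (phi n \<mu>)) (phi n \<mu>)"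
      by (rule low_stepI[OF weights_phi[OF n]])
        (use ij True k in \<open>auto simp: pairs_def lookup_phi\<close>)
    ultimately show ?thesis by simp
  next
    case False
    then have j: "j = n" "i < n" using ij by auto
    \<comment> \<open>The pair (i, n) wraps around to (1, i + 1) with difference 1 - d and step -k.
      The range 0 < k < d becomes 1 - d \<le> -k < 0, which explains the asymmetric bounds in
      \<open>low_step\<close>.\<close>
    have "phi n \<nu> = slide 1 (Suc i) (- k) (phi n \<mu>)"
      unfolding \<nu> by (rule weights_eqI[OF weights_phi[OF n] weights_slide[OF _ _ weights_phi[OF n]]])
        (use ij j in \<open>auto simp: lookup_phi lookup_slide\<close>)
    moreover have "low_step n (slide 1 (Suc i) (- k) (phi n \<mu>)) (phi n \<mu>)"
      by (rule low_stepI[OF weights_phi[OF n]])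
        (use ij j k in \<open>auto simp: pairs_def lookup_phi\<close>)
    ultimately show ?thesis by simp
  qed
qed

lemma low_step_psi:
  assumes n: "0 < n" and "low_step n \<nu> \<mu>"
  shows "low_step n (psi n \<nu>) (psi n \<mu>)"
  using assms(2)
proof (elim low_stepE)
  fix i j k
  assume ij: "(i, j) \<in> pairs n" "i \<in> {1..n}" "j \<in> {1..n}" "i \<noteq> j" "i < j" and \<mu>: "\<mu> \<in> weights n"
    and \<nu>: "\<nu> = slide i j k \<mu>"
    and k: "0 < k \<and> k < cmp \<mu> i - cmp \<mu> j \<or> cmp \<mu> i - cmp \<mu> j \<le> k \<and> k < 0"
  show ?thesis
  proof (cases "1 < i")
    case True
    have "psi n \<nu> = slide (i - 1) (j - 1) k (psi n \<mu>)"
      unfolding \<nu> by (rule weights_eqI[OF weights_psi weights_slide[OF _ _ weights_psi]])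
        (use ij True in \<open>auto simp: lookup_psi lookup_slide\<close>)
    moreover have "low_step n (slide (i - 1) (j - 1) k (psi n \<mu>)) (psi n \<mu>)"
      by (rule low_stepI[OF weights_psi])
        (use ij True k in \<open>auto simp: pairs_def lookup_psi_pred\<close>)
    ultimately show ?thesis by simp
  next
    case False
    then have i: "i = 1" "1 < j" using ij by auto
    have "psi n \<nu> = slide (j - 1) n (- k) (psi n \<mu>)"
      unfolding \<nu> by (rule weights_eqI[OF weights_psi weights_slide[OF _ _ weights_psi]])
        (use ij i in \<open>auto simp: lookup_psi lookup_slide\<close>)
    moreover have "low_step n (slide (j - 1) n (- k) (psi n \<mu>)) (psi n \<mu>)"
      by (rule low_stepI[OF weights_psi])
        (use ij i k in \<open>auto simp: pairs_def lookup_psi lookup_psi_pred\<close>)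
    ultimately show ?thesis by simp
  qed
qed

lemma low_phi: "0 < n \<Longrightarrow> low n \<nu> \<mu> \<Longrightarrow> low n (phi n \<nu>) (phi n \<mu>)"
  by (rule low_map[OF low_step_phi])

lemma low_psi: "0 < n \<Longrightarrow> low n \<nu> \<mu> \<Longrightarrow> low n (psi n \<nu>) (psi n \<mu>)"
  by (rule low_map[OF low_step_psi])

lemma low_shift:
  assumes "low n \<nu> \<mu>"
  shows "low n (\<nu> + mk_expo n (\<lambda>_. c)) (\<mu> + mk_expo n (\<lambda>_. c))"
proof (rule low_map[OF _ assms, where f = "\<lambda>\<nu>. \<nu> + mk_expo n (\<lambda>_. c)"])
  fix \<nu> \<mu>
  assume "low_step n \<nu> \<mu>"
  then show "low_step n (\<nu> + mk_expo n (\<lambda>_. c)) (\<mu> + mk_expo n (\<lambda>_. c))"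
  proof (elim low_stepE)
    fix i j k
    assume ij: "(i, j) \<in> pairs n" "i \<in> {1..n}" "j \<in> {1..n}" and \<mu>: "\<mu> \<in> weights n"
      and \<nu>: "\<nu> = slide i j k \<mu>"
      and k: "0 < k \<and> k < cmp \<mu> i - cmp \<mu> j \<or> cmp \<mu> i - cmp \<mu> j \<le> k \<and> k < 0"
    have "\<nu> + mk_expo n (\<lambda>_. c) = slide i j k (\<mu> + mk_expo n (\<lambda>_. c))"
      by (simp add: \<nu> slide_def)
    moreover have "low_step n (slide i j k (\<mu> + mk_expo n (\<lambda>_. c))) (\<mu> + mk_expo n (\<lambda>_. c))"
      by (rule low_stepI[OF weights_add[OF \<mu> weights_mk_expo] ij(1)])
        (use ij k in \<open>simp add: lookup_add lookup_mk_expo\<close>)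
    ultimately show ?thesis by simp
  qed
qed

section \<open>Quantities monotone along the order\<close>

definition sqn :: "nat \<Rightarrow> expo \<Rightarrow> int" where
  "sqn n \<mu> = (\<Sum>j=1..n. (cmp \<mu> j)\<^sup>2)"

definition tail :: "nat \<Rightarrow> nat \<Rightarrow> expo \<Rightarrow> int" where
  "tail n p \<mu> = (\<Sum>j\<in>{p<..n}. cmp \<mu> j)"

text \<open>\<open>\<nu>\<^sub>+ \<le> \<mu>\<^sub>+\<close> in dominance order, without reference to the rearrangements.\<close>

definition dle :: "nat \<Rightarrow> expo \<Rightarrow> expo \<Rightarrow> bool" where
  "dle n \<nu> \<mu> \<longleftrightarrow> (\<forall>A. A \<subseteq> {1..n} \<longrightarrow> (\<exists>B. B \<subseteq> {1..n} \<and> card B = card A \<and>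
     (\<Sum>j\<in>A. cmp \<nu> j) \<le> (\<Sum>j\<in>B. cmp \<mu> j)))"

lemma sum_slide:
  fixes h :: "nat \<Rightarrow> int \<Rightarrow> int"
  assumes "i \<noteq> j" "finite A"
  shows "(\<Sum>l\<in>A. h l (cmp (slide i j k \<mu>) l)) = (\<Sum>l\<in>A. h l (cmp \<mu> l))
    + (if i \<in> A then h i (cmp \<mu> i - k) - h i (cmp \<mu> i) else 0)
    + (if j \<in> A then h j (cmp \<mu> j + k) - h j (cmp \<mu> j) else 0)"
proof -
  have "(\<Sum>l\<in>A. h l (cmp (slide i j k \<mu>) l)) = (\<Sum>l\<in>A. h l (cmp \<mu> l)
    + (if l = i then h i (cmp \<mu> i - k) - h i (cmp \<mu> i) else 0)
    + (if l = j then h j (cmp \<mu> j + k) - h j (cmp \<mu> j) else 0))"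
    using assms(1) by (intro sum.cong) (auto simp: lookup_slide)
  then show ?thesis using assms(2) by (simp add: sum.distrib)
qed

lemma sqn_slide:
  assumes "i \<noteq> j" "i \<in> {1..n}" "j \<in> {1..n}"
  shows "sqn n (slide i j k \<mu>) = sqn n \<mu> + 2 * (k * (k - (cmp \<mu> i - cmp \<mu> j)))"
  using assms sum_slide[of i j "{1..n}" "\<lambda>_ x. x\<^sup>2" k \<mu>]
  by (simp add: sqn_def power2_eq_square algebra_simps)

lemma tail_slide:
  assumes "i < j" "i \<in> {1..n}" "j \<in> {1..n}"
  shows "tail n p (slide i j k \<mu>) = tail n p \<mu> + (if i \<le> p \<and> p < j then k else 0)"
  using assms sum_slide[of i j "{p<..n}" "\<lambda>_ x. x" k \<mu>]
  by (auto simp: tail_def)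

lemma ht_slide:
  assumes "i \<noteq> j" "i \<in> {1..n}" "j \<in> {1..n}"
  shows "ht n (slide i j k \<mu>) = ht n \<mu> + k * (int j - int i)"
  using assms by (simp add: slide_def ht_add ht_diff ht_single algebra_simps)

text \<open>
  Up to a constant, \<open>n \<cdot> sqn \<mu> + 2 \<cdot> ht \<mu>\<close> is \<open>n\<close> times the squared distance of \<open>\<mu>\<close> from
  \<open>-(1, \<dots>, n)/n\<close>.
\<close>

lemma low_step_energy:
  assumes "low_step n \<nu> \<mu>"
  shows "int n * sqn n \<nu> + 2 * ht n \<nu> < int n * sqn n \<mu> + 2 * ht n \<mu>"
  using assms
proof (elim low_stepE)
  fix i j k
  assume ij: "i \<in> {1..n}" "j \<in> {1..n}" "i \<noteq> j" "i < j" and \<nu>: "\<nu> = slide i j k \<mu>"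
    and k: "0 < k \<and> k < cmp \<mu> i - cmp \<mu> j \<or> cmp \<mu> i - cmp \<mu> j \<le> k \<and> k < 0"
  let ?d = "cmp \<mu> i - cmp \<mu> j"
  have "k * (int n * (k - ?d) + (int j - int i)) < 0"
    using k
  proof
    assume k: "0 < k \<and> k < ?d"
    have "int n * (k - ?d) \<le> int n * (- 1)" using k by (intro mult_left_mono) auto
    then have "int n * (k - ?d) + (int j - int i) < 0" using ij by auto
    then show ?thesis using k by (intro mult_pos_neg) auto
  next
    assume k: "?d \<le> k \<and> k < 0"
    then have "0 \<le> int n * (k - ?d)" by simp
    then have "0 < int n * (k - ?d) + (int j - int i)" using ij by auto
    then show ?thesis using k by (intro mult_neg_pos) auto
  qed
  moreover have "int n * sqn n \<nu> + 2 * ht n \<nu>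
      = int n * sqn n \<mu> + 2 * ht n \<mu> + 2 * (k * (int n * (k - ?d) + (int j - int i)))"
    using ij by (simp add: \<nu> sqn_slide ht_slide algebra_simps)
  ultimately show ?thesis by linarith
qed

lemma low_energy:
  "low n \<nu> \<mu> \<Longrightarrow> int n * sqn n \<nu> + 2 * ht n \<nu> < int n * sqn n \<mu> + 2 * ht n \<mu>"
  unfolding low_def
  by (induction rule: tranclp_induct) (use low_step_energy in fastforce)+

lemma low_irrefl: "\<not> low n \<mu> \<mu>"
  using low_energy by blast

lemma low_preorder:
  assumes "low n \<nu> \<mu>" "\<And>\<nu> \<mu>. low_step n \<nu> \<mu> \<Longrightarrow> R \<nu> \<mu>"
    and "\<And>\<kappa> \<nu> \<mu>. R \<kappa> \<nu> \<Longrightarrow> R \<nu> \<mu> \<Longrightarrow> R \<kappa> \<mu>"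
  shows "R \<nu> \<mu>"
  using assms(1) unfolding low_def
  by (induction rule: tranclp_induct) (use assms(2,3) in blast)+

lemma sqn_slide_le:
  assumes "i \<noteq> j" "i \<in> {1..n}" "j \<in> {1..n}"
    and "0 \<le> k \<and> k \<le> cmp \<mu> i - cmp \<mu> j \<or> cmp \<mu> i - cmp \<mu> j \<le> k \<and> k \<le> 0"
  shows "sqn n (slide i j k \<mu>) \<le> sqn n \<mu>"
proof -
  have "k * (k - (cmp \<mu> i - cmp \<mu> j)) \<le> 0"
    using assms(4) by (auto intro: mult_nonneg_nonpos mult_nonpos_nonneg)
  then show ?thesis using assms(1-3) by (simp add: sqn_slide)
qed

lemma dle_trans: "dle n \<kappa> \<nu> \<Longrightarrow> dle n \<nu> \<mu> \<Longrightarrow> dle n \<kappa> \<mu>"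
  unfolding dle_def by (metis order_trans)

text \<open>If the sum over A grows, A contains exactly one of i and j; exchanging it for the other
  one covers the gain.\<close>

lemma dle_slide:
  assumes "i \<noteq> j" "i \<in> {1..n}" "j \<in> {1..n}"
    and "0 \<le> k \<and> k \<le> cmp \<mu> i - cmp \<mu> j \<or> cmp \<mu> i - cmp \<mu> j \<le> k \<and> k \<le> 0"
  shows "dle n (slide i j k \<mu>) \<mu>"
  unfolding dle_def
proof (intro allI impI)
  fix A :: "nat set"
  assume A: "A \<subseteq> {1..n}"
  then have fin: "finite A" using finite_subset by blast
  have S: "(\<Sum>l\<in>A. cmp (slide i j k \<mu>) l) = (\<Sum>l\<in>A. cmp \<mu> l)
      + (if i \<in> A then - k else 0) + (if j \<in> A then k else 0)"
    using sum_slide[OF assms(1) fin, of "\<lambda>_ x. x" k \<mu>] by simp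
  have swap: "(\<Sum>l\<in>insert b (A - {a}). cmp \<mu> l) = (\<Sum>l\<in>A. cmp \<mu> l) - cmp \<mu> a + cmp \<mu> b
      \<and> card (insert b (A - {a})) = card A" if "a \<in> A" "b \<notin> A" for a b
  proof -
    have "card (insert b (A - {a})) = Suc (card (A - {a}))" using that fin by simp
    also have "\<dots> = card A" using card_Suc_Diff1[OF fin that(1)] .
    finally show ?thesis using that fin by (simp add: sum_diff1)
  qed
  show "\<exists>B\<subseteq>{1..n}. card B = card A \<and> (\<Sum>l\<in>A. cmp (slide i j k \<mu>) l) \<le> (\<Sum>l\<in>B. cmp \<mu> l)"
  proof (cases "(\<Sum>l\<in>A. cmp (slide i j k \<mu>) l) \<le> (\<Sum>l\<in>A. cmp \<mu> l)")
    case True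
    then show ?thesis using A by blast
  next
    case False
    then consider "i \<in> A" "j \<notin> A" "k < 0" | "i \<notin> A" "j \<in> A" "0 < k"
      using S by (auto split: if_splits)
    then show ?thesis
    proof cases
      case 1
      then show ?thesis
        using swap[of i j] A assms S by (intro exI[of _ "insert j (A - {i})"]) auto
    next
      case 2
      then show ?thesis
        using swap[of j i] A assms S by (intro exI[of _ "insert i (A - {j})"]) auto
    qed
  qed
qed

lemma low_dle:
  assumes "low n \<nu> \<mu>"
  shows "dle n \<nu> \<mu>"
proof (rule low_preorder[OF assms _ dle_trans])
  fix \<nu> \<mu>
  assume "low_step n \<nu> \<mu>"
  then show "dle n \<nu> \<mu>"
    by (elim low_stepE) (auto intro: dle_slide)
qed

lemma low_tail0:
  assumes "low n \<nu> \<mu>"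
  shows "tail n 0 \<nu> = tail n 0 \<mu>"
proof (rule low_preorder[OF assms])
  fix \<nu> \<mu>
  assume "low_step n \<nu> \<mu>"
  then show "tail n 0 \<nu> = tail n 0 \<mu>"
    by (elim low_stepE) (auto simp: tail_slide)
qed simp

lemma low_sqn:
  assumes "low n \<nu> \<mu>"
  shows "sqn n \<nu> \<le> sqn n \<mu>"
proof (rule low_preorder[OF assms])
  fix \<nu> \<mu>
  assume "low_step n \<nu> \<mu>"
  then show "sqn n \<nu> \<le> sqn n \<mu>"
    by (elim low_stepE) (auto intro!: sqn_slide_le)
qed simp

text \<open>A step changes the quantity by 2 k (k - d) or 2 k (k - d + 1), and integrality of k
  leaves room for the extra 1. This sharper bound feeds \<open>wle\<close> and
  \<open>low_dominant_sqn\<close>.\<close>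

lemma low_sqn_tail:
  assumes "low n \<nu> \<mu>"
  shows "sqn n \<nu> + 2 * tail n p \<nu> \<le> sqn n \<mu> + 2 * tail n p \<mu>"
proof (rule low_preorder[OF assms])
  fix \<nu> \<mu>
  assume "low_step n \<nu> \<mu>"
  then show "sqn n \<nu> + 2 * tail n p \<nu> \<le> sqn n \<mu> + 2 * tail n p \<mu>"
  proof (elim low_stepE)
    fix i j k
    assume ij: "i \<in> {1..n}" "j \<in> {1..n}" "i \<noteq> j" "i < j" and \<nu>: "\<nu> = slide i j k \<mu>"
      and k: "0 < k \<and> k < cmp \<mu> i - cmp \<mu> j \<or> cmp \<mu> i - cmp \<mu> j \<le> k \<and> k < 0"
    let ?d = "cmp \<mu> i - cmp \<mu> j"
    have "k * (k - ?d) \<le> 0" "k * (k - ?d + 1) \<le> 0"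
      using k mult_nonneg_nonpos[of k "k - ?d"] mult_nonneg_nonpos[of k "k - ?d + 1"]
        mult_nonpos_nonneg[of k "k - ?d"] mult_nonpos_nonneg[of k "k - ?d + 1"] by linarith+
    then show ?thesis using ij by (simp add: \<nu> sqn_slide tail_slide algebra_simps)
  qed
qed simp

lemma finite_bounded_weights: "finite {\<nu> \<in> weights n. sqn n \<nu> \<le> c}"
proof -
  let ?F = "PiE {1..n} (\<lambda>_. {- c..c})"
  have "{\<nu> \<in> weights n. sqn n \<nu> \<le> c} \<subseteq> mk_expo n ` ?F"
  proof
    fix \<nu>
    assume \<nu>: "\<nu> \<in> {\<nu> \<in> weights n. sqn n \<nu> \<le> c}"
    have "\<bar>cmp \<nu> j\<bar> \<le> c" if "j \<in> {1..n}" for j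
    proof -
      have "\<bar>x\<bar> \<le> x\<^sup>2" for x :: int
        using mult_left_mono[of 1 "\<bar>x\<bar>" "\<bar>x\<bar>"] by (cases "x = 0") (auto simp: power2_eq_square)
      then have "\<bar>cmp \<nu> j\<bar> \<le> (cmp \<nu> j)\<^sup>2" .
      also have "\<dots> \<le> sqn n \<nu>"
        unfolding sqn_def using that by (intro member_le_sum) auto
      finally show ?thesis using \<nu> by simp
    qed
    then have "restrict (cmp \<nu>) {1..n} \<in> ?F" by (auto simp: abs_le_iff minus_le_iff)
    moreover have "\<nu> = mk_expo n (restrict (cmp \<nu>) {1..n})"
      by (rule weights_eqI[of _ n]) (use \<nu> in \<open>auto simp: lookup_mk_expo\<close>)
    ultimately show "\<nu> \<in> mk_expo n ` ?F" by blast
  qed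
  then show ?thesis by (rule finite_subset) (intro finite_imageI finite_PiE; simp)
qed

lemma finite_low: "finite {\<nu>. low n \<nu> \<mu>}"
  by (rule finite_subset[OF _ finite_bounded_weights[of n "sqn n \<mu>"]])
    (auto dest: low_weights low_sqn)

text \<open>Since \<open>sqn\<close> cannot grow downwards, lower sets are finite, and their
  cardinality serves as a rank.\<close>

lemma low_induct [case_names less]:
  assumes "\<And>\<mu>. (\<And>\<nu>. low n \<nu> \<mu> \<Longrightarrow> P \<nu>) \<Longrightarrow> P \<mu>"
  shows "P \<mu>"
proof -
  have "wfp (low n)"
  proof (rule wfp_if_convertible_to_nat)
    fix \<nu> \<mu>
    assume \<nu>: "low n \<nu> \<mu>"
    have sub: "{\<kappa>. low n \<kappa> \<nu>} \<subset> {\<nu>. low n \<nu> \<mu>}"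
    proof (rule psubsetI)
      show "{\<kappa>. low n \<kappa> \<nu>} \<subseteq> {\<nu>. low n \<nu> \<mu>}"
        by (rule Collect_mono) (rule impI, erule low_trans[OF _ \<nu>])
      have "\<nu> \<in> {\<nu>. low n \<nu> \<mu>}" using \<nu> by (rule CollectI)
      moreover have "\<nu> \<notin> {\<kappa>. low n \<kappa> \<nu>}" by (simp add: low_irrefl)
      ultimately show "{\<kappa>. low n \<kappa> \<nu>} \<noteq> {\<nu>. low n \<nu> \<mu>}" by metis
    qed
    show "card {\<kappa>. low n \<kappa> \<nu>} < card {\<nu>. low n \<nu> \<mu>}"
      by (rule psubset_card_mono[OF finite_low sub])
  qed
  then show ?thesis
    by (rule wfp_induct_rule) (rule assms)
qed

section \<open>Cherednik operators\<close>

lemma ddiff_lmonom: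
  assumes "cmp \<nu> (Suc i) \<le> cmp \<nu> i"
  shows "ddiff i (lmonom \<nu>) = ddiff_monom i \<nu> (nat (cmp \<nu> i - cmp \<nu> (Suc i)))"
  by (rule ddiff_unique)
    (use assms in \<open>simp add: ddiff_monom_telescope act_lmonom act_expo_simple_refl_slide\<close>)

lemma Xvar_ddiff_monom:
  "Xvar i * ddiff_monom i \<nu> D = (\<Sum>k<D. lmonom (slide i (Suc i) (int k) \<nu>))"
  "Xvar (Suc i) * ddiff_monom i \<nu> D = (\<Sum>k<D. lmonom (slide i (Suc i) (int k + 1) \<nu>))"
proof -
  have *: "slide i (Suc i) (int k) \<nu> - Poly_Mapping.single i 1 + Poly_Mapping.single (Suc i) 1
      = slide i (Suc i) (int k + 1) \<nu>" for k
    by (simp add: slide_def single_add)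
  show "Xvar i * ddiff_monom i \<nu> D = (\<Sum>k<D. lmonom (slide i (Suc i) (int k) \<nu>))"
    by (simp add: ddiff_monom_def sum_distrib_left Xvar_lmonom)
  show "Xvar (Suc i) * ddiff_monom i \<nu> D = (\<Sum>k<D. lmonom (slide i (Suc i) (int k + 1) \<nu>))"
    by (simp add: ddiff_monom_def sum_distrib_left Xvar_lmonom *)
qed

text \<open>The string through \<open>\<nu>\<close> is parametrised from its reflected end point \<open>\<sigma> = s\<^sub>i \<nu>\<close>.\<close>

lemma Top_lmonom:
  fixes i \<nu>
  defines "\<sigma> \<equiv> act_expo (simple_refl i) \<nu>"
  defines "d \<equiv> cmp \<nu> (Suc i) - cmp \<nu> i"
  shows "Top i (lmonom \<nu>) - lconst (if 0 < d then tK else 1) * lmonom \<sigma>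
    \<in> lspan {slide i (Suc i) k \<sigma> | k. 0 < k \<and> k < d \<or> d \<le> k \<and> k < 0}" (is "_ \<in> lspan ?S")
proof (cases "d \<le> 0")
  case True
  have \<nu>: "\<nu> = slide i (Suc i) d \<sigma>"
    by (simp add: \<sigma>_def d_def act_expo_simple_refl_slide slide_slide)
  define D where "D = nat (- d)"
  have T: "Top i (lmonom \<nu>) = lmonom \<nu> + (\<Sum>k<D. lmonom (slide i (Suc i) (int k + 1) \<nu>))
      - lconst tK * (\<Sum>k<D. lmonom (slide i (Suc i) (int k) \<nu>))"
    using True unfolding Top_def left_diff_distrib mult.assoc
    by (simp add: ddiff_lmonom Xvar_ddiff_monom D_def d_def)
  have low: "lmonom (slide i (Suc i) (int k) \<nu>) \<in> lspan ?S" if "k < D" for k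
  proof (rule lspan_lmonom)
    have "slide i (Suc i) (int k) \<nu> = slide i (Suc i) (int k + d) \<sigma>"
      by (simp add: \<nu> slide_slide)
    then show "slide i (Suc i) (int k) \<nu> \<in> ?S"
      using that D_def by (intro CollectI exI[of _ "int k + d"]) auto
  qed
  show ?thesis
  proof (cases D)
    case 0
    then have "d = 0" using True by (simp add: D_def)
    then show ?thesis using T 0 \<nu> by simp
  next
    case (Suc D')
    \<comment> \<open>The last term of the sum without t is the reflected end point; it provides the
      leading term, with coefficient 1.\<close>
    have "slide i (Suc i) (int D' + 1) \<nu> = \<sigma>"
    proof -
      have "int D' + 1 + d = 0" using Suc D_def by simp
      then show ?thesis unfolding \<nu> slide_slide by simp
    qed
    then have "Top i (lmonom \<nu>) - lconst (if 0 < d then tK else 1) * lmonom \<sigma> =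
        lmonom \<nu> + (\<Sum>k<D'. lmonom (slide i (Suc i) (int (Suc k)) \<nu>))
        - lconst tK * (\<Sum>k<D. lmonom (slide i (Suc i) (int k) \<nu>))"
      using True unfolding T Suc sum.lessThan_Suc[of _ D'] by (simp add: add.commute)
    also have "\<dots> \<in> lspan ?S"
      using low[of 0] Suc by (intro lspan_add lspan_diff lspan_scale lspan_sum low) auto
    finally show ?thesis .
  qed
next
  case False
  have \<nu>: "\<nu> = slide i (Suc i) d \<sigma>"
    by (simp add: \<sigma>_def d_def act_expo_simple_refl_slide slide_slide)
  have \<sigma>\<nu>: "act_expo (simple_refl i) \<sigma> = \<nu>"
    by (rule poly_mapping_eqI) (simp add: \<sigma>_def lookup_act_expo_simple_refl)
  have s: "cmp \<sigma> i = cmp \<nu> (Suc i)" "cmp \<sigma> (Suc i) = cmp \<nu> i"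
    by (simp_all add: \<sigma>_def lookup_act_expo_simple_refl simple_refl_apply)
  obtain D where D: "d = int (Suc D)" using False by (metis not_le zero_less_imp_eq_int gr0_implies_Suc)
  have "ddiff i (lmonom \<sigma>) = ddiff_monom i \<sigma> (Suc D)"
  proof -
    have "nat (cmp \<sigma> i - cmp \<sigma> (Suc i)) = Suc D"
      using D unfolding s d_def by (simp only: nat_int)
    moreover have "cmp \<sigma> (Suc i) \<le> cmp \<sigma> i" using False unfolding s d_def by simp
    ultimately show ?thesis by (simp only: ddiff_lmonom)
  qed
  moreover have "ddiff i (lmonom \<nu>) = - ddiff i (lmonom \<sigma>)"
    by (rule ddiff_unique) (simp add: ddiff_eq act_lmonom \<sigma>\<nu> flip: \<sigma>_def)
  ultimately have dd: "ddiff i (lmonom \<nu>) = - ddiff_monom i \<sigma> (Suc D)" by simp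
  have low: "lmonom (slide i (Suc i) (int k + 1) \<sigma>) \<in> lspan ?S" if "k < D" for k
    using that D by (intro lspan_lmonom CollectI exI[of _ "int k + 1"]) auto
  have "Top i (lmonom \<nu>) = lmonom \<nu> - (\<Sum>k<Suc D. lmonom (slide i (Suc i) (int k + 1) \<sigma>))
      + lconst tK * (\<Sum>k<Suc D. lmonom (slide i (Suc i) (int k) \<sigma>))"
    unfolding Top_def dd left_diff_distrib mult.assoc mult_minus_right Xvar_ddiff_monom by simp
  \<comment> \<open>The far end of the string is \<nu> itself and cancels the summand x^\<nu> of
    \<open>T_i x^\<nu>\<close>; this is why k = d is excluded when d > 0.\<close>
  also have "(\<Sum>k<Suc D. lmonom (slide i (Suc i) (int k + 1) \<sigma>))
      = (\<Sum>k<D. lmonom (slide i (Suc i) (int k + 1) \<sigma>)) + lmonom \<nu>"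
    by (simp add: \<nu> D add.commute)
  also have "(\<Sum>k<Suc D. lmonom (slide i (Suc i) (int k) \<sigma>))
      = lmonom \<sigma> + (\<Sum>k<D. lmonom (slide i (Suc i) (int k + 1) \<sigma>))"
    unfolding sum.lessThan_Suc_shift by (simp add: add.commute)
  finally have "Top i (lmonom \<nu>) - lconst (if 0 < d then tK else 1) * lmonom \<sigma>
      = lconst tK * (\<Sum>k<D. lmonom (slide i (Suc i) (int k + 1) \<sigma>))
        - (\<Sum>k<D. lmonom (slide i (Suc i) (int k + 1) \<sigma>))"
    using False by (simp add: distrib_left)
  also have "\<dots> \<in> lspan ?S" by (intro lspan_diff lspan_scale lspan_sum low) auto
  finally show ?thesis .
qed

lemma laurent_ring_scale: "f \<in> laurent_ring n \<Longrightarrow> lconst c * f \<in> laurent_ring n"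
  by (simp add: laurent_ring_eq_lspan lspan_scale)

lemma weights_act_simple_refl:
  assumes "1 \<le> i" "i < n" "\<nu> \<in> weights n"
  shows "act_expo (simple_refl i) \<nu> \<in> weights n"
  unfolding act_expo_simple_refl_slide using assms by (intro weights_slide) auto

lemma laurent_ring_Top:
  assumes "1 \<le> i" "i < n" "f \<in> laurent_ring n"
  shows "Top i f \<in> laurent_ring n"
  using assms(3) unfolding laurent_ring_eq_lspan
proof (rule linear_op_lspan[OF linear_op_Top])
  fix \<nu>
  assume \<nu>: "\<nu> \<in> weights n"
  let ?\<sigma> = "act_expo (simple_refl i) \<nu>"
  have \<sigma>: "?\<sigma> \<in> weights n" by (rule weights_act_simple_refl[OF assms(1,2) \<nu>])
  obtain S c where S: "Top i (lmonom \<nu>) - lconst c * lmonom ?\<sigma> \<in> lspan S" "S \<subseteq> weights n"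
    using Top_lmonom[of i \<nu>] assms weights_slide[OF _ _ \<sigma>] by force
  have "(Top i (lmonom \<nu>) - lconst c * lmonom ?\<sigma>) + lconst c * lmonom ?\<sigma> \<in> lspan (weights n)"
    by (intro lspan_add lspan_scale lspan_lmonom \<sigma> lspan_mono[OF S(2,1)])
  then show "Top i (lmonom \<nu>) \<in> lspan (weights n)" by simp
qed

section \<open>The inverse rotation and the operators Phi and Psi\<close>

definition omi :: "nat \<Rightarrow> laurent \<Rightarrow> laurent" where
  "omi n = pmap (cyc_inv n) (\<lambda>\<nu> c. c * qK powi cmp \<nu> 1)"

lemma lookup_cyc_inv:
  "j \<in> {1..n} \<Longrightarrow> cmp (cyc_inv n \<mu>) j = (if j = n then cmp \<mu> 1 else cmp \<mu> (Suc j))"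
  by (simp add: cyc_inv_def lookup_mk_expo)

lemma weights_cyc_inv [simp]: "cyc_inv n \<mu> \<in> weights n"
  by (simp add: cyc_inv_def)

lemma cyc_cyc_inv: "0 < n \<Longrightarrow> \<mu> \<in> weights n \<Longrightarrow> cyc n (cyc_inv n \<mu>) = \<mu>"
  by (rule weights_eqI[OF weights_cyc]) (auto simp: lookup_cyc cyc_inv_def lookup_mk_expo)

lemma cyc_inv_cyc: "0 < n \<Longrightarrow> \<mu> \<in> weights n \<Longrightarrow> cyc_inv n (cyc n \<mu>) = \<mu>"
  by (rule weights_eqI[OF weights_cyc_inv]) (auto simp: lookup_cyc cyc_inv_def lookup_mk_expo)

lemma omi_lmonom: "omi n (lmonom \<nu>) = lconst (qK powi cmp \<nu> 1) * lmonom (cyc_inv n \<nu>)"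
  by (simp add: omi_def lmonom_def pmap_single algebra_simps lconst_def mult_single)

lemma cyc_inv_add: "cyc_inv n (\<mu> + \<nu>) = cyc_inv n \<mu> + cyc_inv n \<nu>"
  by (rule poly_mapping_eqI) (simp add: cyc_inv_def lookup_mk_expo lookup_add)

lemma omi_mult: "omi n (f * g) = omi n f * omi n g"
  unfolding omi_def
  by (rule pmap_mult) (simp_all add: algebra_simps cyc_inv_add lookup_add power_int_add)

lemma omi_lconst: "omi n (lconst c) = lconst c"
proof -
  have "cyc_inv n 0 = 0" by (rule poly_mapping_eqI) (simp add: cyc_inv_def lookup_mk_expo)
  then show ?thesis by (simp add: omi_def lconst_def pmap_single algebra_simps)
qed

lemma linear_op_omi: "linear_op (omi n)"
proof (rule linear_opI)
  show "omi n (f + g) = omi n f + omi n g" for f g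
    unfolding omi_def by (rule pmap_add) (simp add: algebra_simps)
qed (simp add: omi_mult omi_lconst)

lemma cyc_subst_omi:
  assumes "0 < n" "f \<in> laurent_ring n"
  shows "cyc_subst n (omi n f) = f"
proof (rule linear_op_eqI[OF linear_op_comp[OF linear_op_cyc_subst linear_op_omi] linear_op_id])
  show "f \<in> lspan (weights n)" using assms by (simp add: laurent_ring_eq_lspan)
  fix \<nu>
  assume "\<nu> \<in> weights n"
  moreover have "cmp (cyc_inv n \<nu>) n = cmp \<nu> 1" using assms(1) by (simp add: cyc_inv_def lookup_mk_expo)
  moreover have "lconst (qK powi k) * (lconst (qK powi (- k)) * g) = g" for k g
    by (simp add: mult.assoc[symmetric] flip: lconst_mult power_int_add)
  ultimately show "cyc_subst n (omi n (lmonom \<nu>)) = lmonom \<nu>"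
    using assms(1) by (simp only: omi_lmonom cyc_subst_mult cyc_subst_lconst cyc_subst_lmonom cyc_cyc_inv)
qed

lemma omi_cyc_subst:
  assumes "0 < n" "f \<in> laurent_ring n"
  shows "omi n (cyc_subst n f) = f"
proof (rule linear_op_eqI[OF linear_op_comp[OF linear_op_omi linear_op_cyc_subst] linear_op_id])
  show "f \<in> lspan (weights n)" using assms by (simp add: laurent_ring_eq_lspan)
  fix \<nu>
  assume "\<nu> \<in> weights n"
  moreover have "cmp (cyc n \<nu>) 1 = cmp \<nu> n" using assms(1) by (simp add: lookup_cyc)
  moreover have "lconst (qK powi (- k)) * (lconst (qK powi k) * g) = g" for k g
    by (simp add: mult.assoc[symmetric] flip: lconst_mult power_int_add)
  ultimately show "omi n (cyc_subst n (lmonom \<nu>)) = lmonom \<nu>"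
    using assms(1) by (simp only: omi_lmonom omi_mult omi_lconst cyc_subst_lmonom cyc_inv_cyc)
qed

lemma laurent_ring_omi: "f \<in> laurent_ring n \<Longrightarrow> omi n f \<in> laurent_ring n"
  unfolding laurent_ring_eq_lspan
  by (erule linear_op_lspan[OF linear_op_omi]) (simp add: omi_lmonom lspan_scale lspan_lmonom)

lemma inner_omi:
  assumes "0 < n" "f \<in> laurent_ring n" "g \<in> laurent_ring n"
  shows "inner_qt n (omi n f) (omi n g) = inner_qt n f g"
  using inner_cyc_subst[of n "omi n f" "omi n g"] assms by (simp add: laurent_ring_omi cyc_subst_omi)

text \<open>The operator of (E1) without its scalar, which depends on the weight and would spoil
  linearity.\<close>

definition phi_op :: "nat \<Rightarrow> laurent \<Rightarrow> laurent" where
  "phi_op n f = Xvar 1 * cyc_subst n f"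

definition psi_op :: "nat \<Rightarrow> laurent \<Rightarrow> laurent" where
  "psi_op n f = omi n (lmonom (- Poly_Mapping.single 1 1) * f)"

lemma linear_op_phi_op: "linear_op (phi_op n)"
  unfolding phi_op_def by (rule linear_op_comp[OF linear_op_mult linear_op_cyc_subst])

lemma linear_op_psi_op: "linear_op (psi_op n)"
  unfolding psi_op_def by (rule linear_op_comp[OF linear_op_omi linear_op_mult])

lemma phi_op_lmonom: "phi_op n (lmonom \<mu>) = lconst (qK powi (- cmp \<mu> n)) * lmonom (phi n \<mu>)"
  by (simp add: phi_op_def cyc_subst_lmonom phi_def mult.left_commute[of "Xvar 1"] Xvar_lmonom)

lemma psi_op_lmonom: "psi_op n (lmonom \<mu>) = lconst (qK powi (cmp \<mu> 1 - 1)) * lmonom (psi n \<mu>)"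
proof -
  have "lmonom (- Poly_Mapping.single 1 1) * lmonom \<mu> = lmonom (\<mu> - Poly_Mapping.single 1 1)"
    by (simp flip: lmonom_add)
  then show ?thesis unfolding psi_op_def by (simp add: omi_lmonom psi_def lookup_minus)
qed

lemma laurent_ring_phi_op: "0 < n \<Longrightarrow> f \<in> laurent_ring n \<Longrightarrow> phi_op n f \<in> laurent_ring n"
  unfolding phi_op_def by (intro laurent_ring_mult laurent_ring_Xvar laurent_ring_cyc_subst) auto

lemma laurent_ring_X1_inverse:
  "0 < n \<Longrightarrow> f \<in> laurent_ring n \<Longrightarrow> lmonom (- Poly_Mapping.single 1 1) * f \<in> laurent_ring n"
  by (intro laurent_ring_mult laurent_ring_lmonom weights_uminus weights_single) auto

lemma laurent_ring_psi_op: "0 < n \<Longrightarrow> f \<in> laurent_ring n \<Longrightarrow> psi_op n f \<in> laurent_ring n"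
  unfolding psi_op_def by (intro laurent_ring_omi laurent_ring_X1_inverse)

lemma phi_op_psi_op: "0 < n \<Longrightarrow> f \<in> laurent_ring n \<Longrightarrow> phi_op n (psi_op n f) = f"
  unfolding phi_op_def psi_op_def
  by (simp only: cyc_subst_omi laurent_ring_X1_inverse Xvar_def mult.assoc[symmetric] lmonom_inverse mult_1_left)

lemma inner_phi_op:
  assumes "0 < n" "f \<in> laurent_ring n" "g \<in> laurent_ring n"
  shows "inner_qt n (phi_op n f) (phi_op n g) = inner_qt n f g"
  unfolding phi_op_def Xvar_def inner_lmonom by (rule inner_cyc_subst[OF assms])

lemma inner_psi_op:
  assumes "0 < n" "f \<in> laurent_ring n" "g \<in> laurent_ring n"
  shows "inner_qt n (psi_op n f) (psi_op n g) = inner_qt n f g"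
  unfolding psi_op_def
  by (simp only: inner_omi laurent_ring_X1_inverse assms inner_lmonom)

section \<open>The first Cherednik operator and its conjugates\<close>

definition Y1 :: "nat \<Rightarrow> laurent \<Rightarrow> laurent" where
  "Y1 n f = foldr Top [1..<n] (omi n f)"

definition y1 :: "nat \<Rightarrow> expo \<Rightarrow> K" where
  "y1 n \<mu> = qK powi cmp \<mu> 1 * tK powi int (card {j \<in> {2..n}. cmp \<mu> j < cmp \<mu> 1})"

text \<open>The state of a weight halfway through \<open>Y1\<close>: \<open>omi\<close> sends the
  first entry to the end, and \<open>T_(n-1)\<close>, ..., \<open>T_k\<close> bring it forward to
  place k.\<close>

definition ins :: "nat \<Rightarrow> nat \<Rightarrow> expo \<Rightarrow> expo" where
  "ins n k \<nu> = mk_expo n (\<lambda>j. if j < k then cmp \<nu> (Suc j) else if j = k then cmp \<nu> 1 else cmp \<nu> j)"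

lemma lookup_ins:
  "j \<in> {1..n} \<Longrightarrow> cmp (ins n k \<nu>) j = (if j < k then cmp \<nu> (Suc j) else if j = k then cmp \<nu> 1 else cmp \<nu> j)"
  by (simp add: ins_def lookup_mk_expo)

lemma weights_ins [simp]: "ins n k \<nu> \<in> weights n"
  by (simp add: ins_def)

lemma ins_1: "0 < n \<Longrightarrow> \<nu> \<in> weights n \<Longrightarrow> ins n 1 \<nu> = \<nu>"
  by (rule weights_eqI[OF weights_ins]) (auto simp: lookup_ins)

lemma ins_n: "0 < n \<Longrightarrow> ins n n \<nu> = cyc_inv n \<nu>"
  by (rule weights_eqI[OF weights_ins weights_cyc_inv]) (auto simp: lookup_ins lookup_cyc_inv)

text \<open>The travelling entry \<open>\<kappa>_1\<close> moves past \<open>\<kappa>_(k+1)\<close>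
  and picks up t when it passes a smaller entry. The other terms of the string come from slides
  between places 1 and k + 1 of \<kappa> itself, which are steps of \<open>low\<close>.\<close>

lemma Top_ins:
  assumes k: "1 \<le> k" "k < n" and \<kappa>: "\<kappa> \<in> weights n"
  shows "Top k (lmonom (ins n (Suc k) \<kappa>))
    - lconst (if cmp \<kappa> (Suc k) < cmp \<kappa> 1 then tK else 1) * lmonom (ins n k \<kappa>)
    \<in> lspan (ins n k ` {\<nu>. low n \<nu> \<kappa>})"
proof -
  let ?\<nu> = "ins n (Suc k) \<kappa>"
  have \<sigma>: "act_expo (simple_refl k) ?\<nu> = ins n k \<kappa>"
    by (rule weights_eqI[OF weights_act_simple_refl[OF k weights_ins] weights_ins])
      (use k in \<open>auto simp: lookup_act_expo_simple_refl lookup_ins simple_refl_apply\<close>)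
  have d: "cmp ?\<nu> (Suc k) - cmp ?\<nu> k = cmp \<kappa> 1 - cmp \<kappa> (Suc k)"
    using k by (simp add: lookup_ins)
  have "slide k (Suc k) m (ins n k \<kappa>) \<in> ins n k ` {\<nu>. low n \<nu> \<kappa>}"
    if "0 < m \<and> m < cmp \<kappa> 1 - cmp \<kappa> (Suc k) \<or> cmp \<kappa> 1 - cmp \<kappa> (Suc k) \<le> m \<and> m < 0" for m
  proof -
    have "slide k (Suc k) m (ins n k \<kappa>) = ins n k (slide 1 (Suc k) m \<kappa>)"
      by (rule weights_eqI[OF weights_slide[OF _ _ weights_ins] weights_ins])
        (use k in \<open>auto simp: lookup_slide lookup_ins\<close>)
    moreover have "low_step n (slide 1 (Suc k) m \<kappa>) \<kappa>"
      by (rule low_stepI[OF \<kappa> _ that]) (use k in \<open>auto simp: pairs_def\<close>)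
    then have "low n (slide 1 (Suc k) m \<kappa>) \<kappa>" unfolding low_def by (rule tranclp.r_into_trancl)
    ultimately show ?thesis by (metis imageI mem_Collect_eq)
  qed
  then have "{slide k (Suc k) m (ins n k \<kappa>) | m. 0 < m \<and> m < cmp \<kappa> 1 - cmp \<kappa> (Suc k) \<or>
      cmp \<kappa> 1 - cmp \<kappa> (Suc k) \<le> m \<and> m < 0} \<subseteq> ins n k ` {\<nu>. low n \<nu> \<kappa>}" by blast
  from lspan_mono[OF this] Top_lmonom[of k ?\<nu>] show ?thesis
    unfolding \<sigma> d by simp
qed

lemma Top_chain_omi:
  assumes "k \<le> n" "1 \<le> k" "\<mu> \<in> weights n"
  shows "foldr Top [k..<n] (omi n (lmonom \<mu>))
    - lconst (qK powi cmp \<mu> 1 * tK ^ card {j \<in> {Suc k..n}. cmp \<mu> j < cmp \<mu> 1}) * lmonom (ins n k \<mu>)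
    \<in> lspan (ins n k ` {\<nu>. low n \<nu> \<mu>})"
  using assms(1,2)
proof (induction k rule: inc_induct)
  case base
  then show ?case by (simp add: omi_lmonom ins_n)
next
  case (step k)
  let ?c = "\<lambda>k. lconst (qK powi cmp \<mu> 1 * tK ^ card {j \<in> {Suc k..n}. cmp \<mu> j < cmp \<mu> 1})"
  let ?t = "if cmp \<mu> (Suc k) < cmp \<mu> 1 then tK else 1"
  let ?S = "ins n k ` {\<nu>. low n \<nu> \<mu>}"
  let ?F = "foldr Top [Suc k..<n] (omi n (lmonom \<mu>))"
  have k: "1 \<le> k" "k < n" using step by auto
  have IH: "?F - ?c (Suc k) * lmonom (ins n (Suc k) \<mu>) \<in> lspan (ins n (Suc k) ` {\<nu>. low n \<nu> \<mu>})"
    using step by simp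
  have c: "?c k = ?c (Suc k) * lconst ?t"
  proof -
    have "{j \<in> {Suc k..n}. cmp \<mu> j < cmp \<mu> 1} = (if cmp \<mu> (Suc k) < cmp \<mu> 1
        then insert (Suc k) {j \<in> {Suc (Suc k)..n}. cmp \<mu> j < cmp \<mu> 1}
        else {j \<in> {Suc (Suc k)..n}. cmp \<mu> j < cmp \<mu> 1})"
    proof -
      have "j \<in> {Suc k..n} \<longleftrightarrow> j = Suc k \<or> j \<in> {Suc (Suc k)..n}" for j using k by auto
      then show ?thesis by auto
    qed
    moreover have "Suc k \<notin> {j \<in> {Suc (Suc k)..n}. cmp \<mu> j < cmp \<mu> 1}" by simp
    ultimately show ?thesis by (simp flip: lconst_mult add: mult_ac)
  qed
  have lowS: "Top k (lmonom (ins n (Suc k) \<kappa>)) \<in> lspan ?S" if "low n \<kappa> \<mu>" for \<kappa>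
  proof -
    let ?u = "if cmp \<kappa> (Suc k) < cmp \<kappa> 1 then tK else 1"
    have "Top k (lmonom (ins n (Suc k) \<kappa>)) - lconst ?u * lmonom (ins n k \<kappa>) \<in> lspan ?S"
      by (rule lspan_mono[OF _ Top_ins[OF k low_weights(1)[OF that]]])
        (use low_trans[OF _ that] in auto)
    moreover have "lconst ?u * lmonom (ins n k \<kappa>) \<in> lspan ?S"
      using that by (intro lspan_scale lspan_lmonom) auto
    ultimately show ?thesis using lspan_add by fastforce
  qed
  have "Top k (?F - ?c (Suc k) * lmonom (ins n (Suc k) \<mu>)) \<in> lspan ?S"
    by (rule linear_op_lspan[OF linear_op_Top IH]) (use lowS in auto)
  moreover have "?c (Suc k) * (Top k (lmonom (ins n (Suc k) \<mu>)) - lconst ?t * lmonom (ins n k \<mu>)) \<in> lspan ?S"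
    by (intro lspan_scale Top_ins k assms(3))
  ultimately have "Top k (?F - ?c (Suc k) * lmonom (ins n (Suc k) \<mu>))
      + ?c (Suc k) * (Top k (lmonom (ins n (Suc k) \<mu>)) - lconst ?t * lmonom (ins n k \<mu>)) \<in> lspan ?S"
    by (rule lspan_add)
  also have "Top k (?F - ?c (Suc k) * lmonom (ins n (Suc k) \<mu>))
      + ?c (Suc k) * (Top k (lmonom (ins n (Suc k) \<mu>)) - lconst ?t * lmonom (ins n k \<mu>))
      = Top k ?F - ?c k * lmonom (ins n k \<mu>)"
    unfolding linear_op_diff[OF linear_op_Top] linear_op_scale[OF linear_op_Top] c
    by (simp only: right_diff_distrib mult.assoc diff_add_eq diff_diff_eq2) simp
  also have "Top k ?F = foldr Top [k..<n] (omi n (lmonom \<mu>))"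
    using k by (simp add: upt_conv_Cons)
  finally show ?case .
qed

text \<open>The properties that survive conjugation by \<open>phi_op\<close>. The final clause
  allows an eigenvalue to be taken out of the second argument of the form, where \<open>bar\<close>
  inverts it.\<close>

definition tri_iso :: "nat \<Rightarrow> (laurent \<Rightarrow> laurent) \<Rightarrow> (expo \<Rightarrow> K) \<Rightarrow> bool" where
  "tri_iso n A e \<longleftrightarrow> linear_op A \<and> (\<forall>f\<in>laurent_ring n. A f \<in> laurent_ring n) \<and>
     (\<forall>f\<in>laurent_ring n. \<forall>g\<in>laurent_ring n. inner_qt n (A f) (A g) = inner_qt n f g) \<and>
     (\<forall>\<mu>\<in>weights n. A (lmonom \<mu>) - lconst (e \<mu>) * lmonom \<mu> \<in> lspan {\<nu>. low n \<nu> \<mu>}) \<and>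
     (\<forall>\<mu>. e \<mu> \<noteq> 0 \<and> bar_K (e \<mu>) = inverse (e \<mu>))"

lemma linear_op_foldr_Top: "linear_op (foldr Top is)"
proof (induction "is")
  case Nil
  show ?case by (rule linear_opI) simp_all
next
  case (Cons i "is")
  have "linear_op (\<lambda>f. Top i (foldr Top is f))"
    by (rule linear_op_comp[OF linear_op_Top Cons])
  then show ?case by (simp only: foldr.simps comp_def)
qed

lemma laurent_ring_foldr_Top:
  assumes "\<forall>i\<in>set is. 1 \<le> i \<and> i < n" "f \<in> laurent_ring n"
  shows "foldr Top is f \<in> laurent_ring n"
  using assms(1)
proof (induction "is")
  case (Cons i "is")
  then show ?case
    unfolding foldr.simps comp_apply by (intro laurent_ring_Top) auto
qed (use assms(2) in simp)

lemma inner_foldr_Top: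
  assumes "\<forall>i\<in>set is. 1 \<le> i \<and> i < n"
  shows "inner_qt n (foldr Top is f) (foldr Top is g) = inner_qt n f g"
  using assms
proof (induction "is")
  case (Cons i "is")
  then show ?case
    unfolding foldr.simps comp_apply by (subst inner_Top) auto
qed simp

lemma linear_op_Y1: "linear_op (Y1 n)"
  unfolding Y1_def by (rule linear_op_comp[OF linear_op_foldr_Top linear_op_omi])

lemma tri_iso_Y1:
  assumes "0 < n"
  shows "tri_iso n (Y1 n) (y1 n)"
  unfolding tri_iso_def
proof (intro conjI ballI allI)
  show "linear_op (Y1 n)" by (rule linear_op_Y1)
  show "Y1 n f \<in> laurent_ring n" if "f \<in> laurent_ring n" for f
    unfolding Y1_def by (rule laurent_ring_foldr_Top) (use that in \<open>auto simp: laurent_ring_omi\<close>)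
  show "inner_qt n (Y1 n f) (Y1 n g) = inner_qt n f g"
    if "f \<in> laurent_ring n" "g \<in> laurent_ring n" for f g
    unfolding Y1_def using inner_omi[OF assms that] by (subst inner_foldr_Top) auto
  show "Y1 n (lmonom \<mu>) - lconst (y1 n \<mu>) * lmonom \<mu> \<in> lspan {\<nu>. low n \<nu> \<mu>}" if "\<mu> \<in> weights n" for \<mu>
  proof -
    have "ins n 1 ` {\<nu>. low n \<nu> \<mu>} = (\<lambda>\<nu>. \<nu>) ` {\<nu>. low n \<nu> \<mu>}"
    proof (rule image_cong[OF refl])
      fix \<nu>
      assume "\<nu> \<in> {\<nu>. low n \<nu> \<mu>}"
      then have "\<nu> \<in> weights n" by (simp add: low_weights(1))
      then show "ins n 1 \<nu> = \<nu>" by (rule ins_1[OF assms])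
    qed
    then show ?thesis
      using Top_chain_omi[of 1 n \<mu>] assms that
      by (simp add: Y1_def y1_def ins_1[OF assms, unfolded One_nat_def] numeral_2_eq_2)
  qed
  show "y1 n \<mu> \<noteq> 0" for \<mu> by (simp add: y1_def)
  show "bar_K (y1 n \<mu>) = inverse (y1 n \<mu>)" for \<mu>
    by (simp add: y1_def bar_K.hom_mult bar_K.hom_power bar_K.hom_power_int bar_qK bar_tK
        power_int_inverse power_inverse)
qed

text \<open>\<open>psi_op\<close> and \<open>phi_op\<close> are isometries moving exponents by
  \<open>psi\<close> and \<open>phi\<close>, and \<open>phi\<close> preserves \<open>low\<close>.
  Their scalars on x^\<mu> cancel, so only the eigenvalue at \<open>psi n \<mu>\<close> is
  left.\<close>

lemma tri_iso_conj:
  assumes n: "0 < n" and A: "tri_iso n A e"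
  shows "tri_iso n (\<lambda>f. phi_op n (A (psi_op n f))) (\<lambda>\<mu>. e (psi n \<mu>))"
  unfolding tri_iso_def
proof (intro conjI ballI allI)
  note A = A[unfolded tri_iso_def]
  show "linear_op (\<lambda>f. phi_op n (A (psi_op n f)))"
    using A by (intro linear_op_comp[OF linear_op_phi_op] linear_op_comp[OF _ linear_op_psi_op]) auto
  show "phi_op n (A (psi_op n f)) \<in> laurent_ring n" if "f \<in> laurent_ring n" for f
    using A that n by (simp add: laurent_ring_phi_op laurent_ring_psi_op)
  show "inner_qt n (phi_op n (A (psi_op n f))) (phi_op n (A (psi_op n g))) = inner_qt n f g"
    if "f \<in> laurent_ring n" "g \<in> laurent_ring n" for f g
    using A that n by (simp add: inner_phi_op inner_psi_op laurent_ring_psi_op)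
  show "e (psi n \<mu>) \<noteq> 0" "bar_K (e (psi n \<mu>)) = inverse (e (psi n \<mu>))" for \<mu> using A by auto
  fix \<mu>
  assume \<mu>: "\<mu> \<in> weights n"
  let ?q = "lconst (qK powi (cmp \<mu> 1 - 1))"
  let ?r = "A (lmonom (psi n \<mu>)) - lconst (e (psi n \<mu>)) * lmonom (psi n \<mu>)"
  have "?r \<in> lspan {\<nu>. low n \<nu> (psi n \<mu>)}" using A by simp
  then have r: "phi_op n ?r \<in> lspan {\<nu>. low n \<nu> \<mu>}"
  proof (rule linear_op_lspan[OF linear_op_phi_op])
    fix \<nu>
    assume "\<nu> \<in> {\<nu>. low n \<nu> (psi n \<mu>)}"
    then have "low n (phi n \<nu>) \<mu>" using low_phi[OF n, of \<nu> "psi n \<mu>"] by (simp add: phi_psi n \<mu>)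
    then show "phi_op n (lmonom \<nu>) \<in> lspan {\<nu>. low n \<nu> \<mu>}"
      unfolding phi_op_lmonom by (intro lspan_scale lspan_lmonom) simp
  qed
  have lin: "linear_op A" using A by simp
  have q: "?q * phi_op n (lmonom (psi n \<mu>)) = lmonom \<mu>"
    using phi_op_psi_op[OF n laurent_ring_lmonom[OF \<mu>]]
    by (simp add: psi_op_lmonom linear_op_scale[OF linear_op_phi_op])
  have "phi_op n (A (psi_op n (lmonom \<mu>))) = ?q * phi_op n (lconst (e (psi n \<mu>)) * lmonom (psi n \<mu>) + ?r)"
    by (simp add: psi_op_lmonom linear_op_scale[OF lin] linear_op_scale[OF linear_op_phi_op])
  also have "\<dots> = lconst (e (psi n \<mu>)) * (?q * phi_op n (lmonom (psi n \<mu>))) + ?q * phi_op n ?r"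
    by (simp only: linear_op_add[OF linear_op_phi_op] linear_op_scale[OF linear_op_phi_op] distrib_left
        mult.left_commute)
  finally show "phi_op n (A (psi_op n (lmonom \<mu>))) - lconst (e (psi n \<mu>)) * lmonom \<mu> \<in> lspan {\<nu>. low n \<nu> \<mu>}"
    unfolding q using lspan_scale[OF r] by simp
qed

text \<open>Taking conjugates of a single operator means that triangularity and isometry have to be
  computed only for \<open>Y1\<close>.\<close>

definition Yop :: "nat \<Rightarrow> nat \<Rightarrow> laurent \<Rightarrow> laurent" where
  "Yop n k = ((\<lambda>A f. phi_op n (A (psi_op n f))) ^^ k) (Y1 n)"

definition yval :: "nat \<Rightarrow> nat \<Rightarrow> expo \<Rightarrow> K" where
  "yval n k \<mu> = y1 n ((psi n ^^ k) \<mu>)"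

lemma tri_iso_Yop:
  assumes "0 < n"
  shows "tri_iso n (Yop n k) (yval n k)"
proof (induction k)
  case 0
  then show ?case using tri_iso_Y1[OF assms] by (simp add: Yop_def yval_def[abs_def])
next
  case (Suc k)
  then show ?case using tri_iso_conj[OF assms Suc]
    by (simp add: Yop_def yval_def[abs_def] funpow_swap1)
qed

lemma lookup_funpow_psi:
  "1 \<le> j \<Longrightarrow> j + k \<le> n \<Longrightarrow> cmp ((psi n ^^ k) \<mu>) j = cmp \<mu> (j + k)"
  by (induction k arbitrary: j) (simp_all add: lookup_psi)

text \<open>The q-exponent of the eigenvalue number k is the entry k + 1, so the eigenvalues for k <
  n recover the weight.\<close>

lemma yval_separates:
  assumes "\<mu> \<in> weights n" "\<nu> \<in> weights n" "\<mu> \<noteq> \<nu>"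
  shows "\<exists>k<n. yval n k \<mu> \<noteq> yval n k \<nu>"
proof (rule ccontr)
  assume *: "\<not> (\<exists>k<n. yval n k \<mu> \<noteq> yval n k \<nu>)"
  have "\<mu> = \<nu>"
  proof (rule weights_eqI[OF assms(1,2)])
    fix j
    assume j: "j \<in> {1..n}"
    have deg: "qdeg (yval n (j - 1) \<kappa>) = cmp \<kappa> j" for \<kappa>
      using j lookup_funpow_psi[of 1 "j - 1" n \<kappa>] unfolding yval_def y1_def qdeg_powi by simp
    show "cmp \<mu> j = cmp \<nu> j" using * j deg[of \<mu>] deg[of \<nu>] by (cases j) auto
  qed
  then show False using assms(3) by simp
qed

section \<open>Nonsymmetric Macdonald polynomials\<close>

text \<open>No operator appears here: uniqueness rests on nondegeneracy alone, and the eigenvector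
  property is a consequence.\<close>

definition is_E :: "nat \<Rightarrow> expo \<Rightarrow> laurent \<Rightarrow> bool" where
  "is_E n \<mu> f \<longleftrightarrow> f - lmonom \<mu> \<in> lspan {\<nu>. low n \<nu> \<mu>} \<and>
     (\<forall>\<nu>. low n \<nu> \<mu> \<longrightarrow> inner_qt n f (lmonom \<nu>) = 0)"

lemma inner_lspan_right:
  assumes "0 < n" "g \<in> lspan S" "\<And>\<nu>. \<nu> \<in> S \<Longrightarrow> inner_qt n h (lmonom \<nu>) = 0"
  shows "inner_qt n h g = 0"
  using assms(2)
  by (induction g rule: lspan_induct) (simp_all add: assms inner_add_right inner_scale_right)

lemma nondegenerate_lspan:
  assumes "0 < n" "S \<subseteq> weights n" "f \<in> lspan S" "\<And>\<nu>. \<nu> \<in> S \<Longrightarrow> inner_qt n f (lmonom \<nu>) = 0"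
  shows "f = 0"
proof (rule inner_nondegenerate[OF assms(1)])
  show "f \<in> laurent_ring n" unfolding laurent_ring_eq_lspan by (rule lspan_mono[OF assms(2,3)])
  show "inner_qt n f (lmonom \<nu>) = 0" if "\<nu> \<in> Poly_Mapping.keys f" for \<nu>
    using that assms(3,4) by (auto simp: lspan_def)
qed

lemma is_E_span:
  assumes "is_E n \<mu> f"
  shows "f \<in> lspan (insert \<mu> {\<nu>. low n \<nu> \<mu>})"
proof -
  have "(f - lmonom \<mu>) + lmonom \<mu> \<in> lspan (insert \<mu> {\<nu>. low n \<nu> \<mu>})"
    using assms unfolding is_E_def
    by (intro lspan_add lspan_lmonom) (auto intro: lspan_mono[OF subset_insertI])
  then show ?thesis by simp
qed

lemma is_E_laurent_ring:
  assumes "is_E n \<mu> f" "\<mu> \<in> weights n"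
  shows "f \<in> laurent_ring n"
  unfolding laurent_ring_eq_lspan
  by (rule lspan_mono[OF _ is_E_span[OF assms(1)]]) (use assms(2) low_weights in auto)

text \<open>In the difference the leading terms cancel, so it is orthogonal to every monomial in its
  own support.\<close>

lemma is_E_unique:
  assumes "0 < n" "is_E n \<mu> f" "is_E n \<mu> g"
  shows "f = g"
proof -
  have "f - g = 0"
  proof (rule nondegenerate_lspan[OF assms(1)])
    have "(f - lmonom \<mu>) - (g - lmonom \<mu>) \<in> lspan {\<nu>. low n \<nu> \<mu>}"
      by (rule lspan_diff) (use assms(2,3) in \<open>auto simp: is_E_def\<close>)
    then show "f - g \<in> lspan {\<nu>. low n \<nu> \<mu>}" by simp
    show "{\<nu>. low n \<nu> \<mu>} \<subseteq> weights n" using low_weights by auto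
    show "inner_qt n (f - g) (lmonom \<nu>) = 0" if "\<nu> \<in> {\<nu>. low n \<nu> \<mu>}" for \<nu>
      using assms that by (simp add: inner_diff_left is_E_def)
  qed
  then show ?thesis by simp
qed

text \<open>Over a set closed downwards the \<open>F \<kappa>\<close> are unitriangular in the
  monomials, so orthogonality to the former passes to the latter.\<close>

lemma inner_down_closed:
  assumes "0 < n" and S: "\<And>\<nu> \<kappa>. \<nu> \<in> S \<Longrightarrow> low n \<kappa> \<nu> \<Longrightarrow> \<kappa> \<in> S"
    and F: "\<And>\<kappa>. \<kappa> \<in> S \<Longrightarrow> is_E n \<kappa> (F \<kappa>)" "\<And>\<kappa>. \<kappa> \<in> S \<Longrightarrow> inner_qt n h (F \<kappa>) = 0"
    and "\<nu> \<in> S"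
  shows "inner_qt n h (lmonom \<nu>) = 0"
  using assms(5)
proof (induction \<nu> rule: low_induct[of n])
  case (less \<nu>)
  have "inner_qt n h (F \<nu> - lmonom \<nu>) = 0"
  proof (rule inner_lspan_right[OF assms(1)])
    show "F \<nu> - lmonom \<nu> \<in> lspan {\<kappa>. low n \<kappa> \<nu>}" using F(1)[OF less.prems] by (simp add: is_E_def)
    show "inner_qt n h (lmonom \<kappa>) = 0" if "\<kappa> \<in> {\<kappa>. low n \<kappa> \<nu>}" for \<kappa>
      using less.IH[of \<kappa>] S[OF less.prems] that by simp
  qed
  then show ?case using F(2)[OF less.prems] by (simp add: inner_diff_right[OF assms(1)])
qed

lemma Yop_facts:
  assumes "0 < n"
  shows "linear_op (Yop n k)"
    "f \<in> laurent_ring n \<Longrightarrow> Yop n k f \<in> laurent_ring n"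
    "f \<in> laurent_ring n \<Longrightarrow> g \<in> laurent_ring n \<Longrightarrow> inner_qt n (Yop n k f) (Yop n k g) = inner_qt n f g"
    "\<mu> \<in> weights n \<Longrightarrow> Yop n k (lmonom \<mu>) - lconst (yval n k \<mu>) * lmonom \<mu> \<in> lspan {\<nu>. low n \<nu> \<mu>}"
    "yval n k \<mu> \<noteq> 0" "bar_K (yval n k \<mu>) = inverse (yval n k \<mu>)"
  using tri_iso_Yop[OF assms, of k] unfolding tri_iso_def by auto

text \<open>Write g as \<open>y^-1 Y g\<close>. The scalar leaves the second argument as y, because
  \<open>bar\<close> inverts it, and isometry removes Y on both sides.\<close>

lemma inner_Yop_eigenvector:
  assumes "0 < n" "f \<in> laurent_ring n" "g \<in> laurent_ring n"
    and "Yop n k g = lconst (yval n k \<nu>) * g"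
  shows "inner_qt n (Yop n k f) g = K_to_fls (yval n k \<nu>) * inner_qt n f g"
proof -
  let ?y = "yval n k \<nu>"
  have y: "?y \<noteq> 0" by (rule Yop_facts(5)[OF assms(1)])
  have "g = lconst (inverse ?y) * Yop n k g"
    unfolding assms(4) mult.assoc[symmetric] lconst_mult[symmetric] using y by simp
  then have "inner_qt n (Yop n k f) g = inner_qt n (Yop n k f) (lconst (inverse ?y) * Yop n k g)"
    by (rule arg_cong)
  also have "\<dots> = K_to_fls ?y * inner_qt n (Yop n k f) (Yop n k g)"
    using y by (simp only: inner_scale_right[OF assms(1)] bar_K.hom_inverse Yop_facts(6)[OF assms(1)] inverse_inverse_eq)
  finally show ?thesis by (simp only: Yop_facts(3)[OF assms(1-3)])
qed

lemma Yop_lspan_low: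
  assumes "0 < n" "f \<in> lspan {\<nu>. low n \<nu> \<mu>}"
  shows "Yop n k f \<in> lspan {\<nu>. low n \<nu> \<mu>}"
proof (rule linear_op_lspan[OF Yop_facts(1)[OF assms(1)] assms(2)])
  fix \<nu>
  assume "\<nu> \<in> {\<nu>. low n \<nu> \<mu>}"
  then have \<nu>: "low n \<nu> \<mu>" by simp
  have "Yop n k (lmonom \<nu>) - lconst (yval n k \<nu>) * lmonom \<nu> \<in> lspan {\<nu>. low n \<nu> \<mu>}"
    by (rule lspan_mono[OF _ Yop_facts(4)[OF assms(1) low_weights(1)[OF \<nu>]]])
      (use low_trans[OF _ \<nu>] in auto)
  moreover have "lconst (yval n k \<nu>) * lmonom \<nu> \<in> lspan {\<nu>. low n \<nu> \<mu>}"
    using \<nu> by (intro lspan_scale lspan_lmonom) simp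
  ultimately show "Yop n k (lmonom \<nu>) \<in> lspan {\<nu>. low n \<nu> \<mu>}"
    using lspan_add by fastforce
qed

lemma Yop_leading:
  assumes "0 < n" "\<mu> \<in> weights n" "f - lmonom \<mu> \<in> lspan {\<nu>. low n \<nu> \<mu>}"
  shows "Yop n k f - lconst (yval n k \<mu>) * lmonom \<mu> \<in> lspan {\<nu>. low n \<nu> \<mu>}"
proof -
  have "Yop n k (f - lmonom \<mu>) + (Yop n k (lmonom \<mu>) - lconst (yval n k \<mu>) * lmonom \<mu>) \<in> lspan {\<nu>. low n \<nu> \<mu>}"
    by (intro lspan_add Yop_lspan_low Yop_facts(4) assms)
  then show ?thesis by (simp add: linear_op_diff[OF Yop_facts(1)[OF assms(1)]])
qed

text \<open>
  Starting from \<open>x\<^sup>\<mu>\<close>, the components along the finitely many smaller \<open>E\<^sub>\<nu>\<close> are killed one by one,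
  by an operator that separates the eigenvalues at \<open>\<mu>\<close> and \<open>\<nu>\<close>.
\<close>

lemma eigenvector_exists:
  assumes n: "0 < n"
  shows "\<mu> \<in> weights n \<Longrightarrow> \<exists>f. is_E n \<mu> f \<and> (\<forall>k<n. Yop n k f = lconst (yval n k \<mu>) * f)"
proof (induction \<mu> rule: low_induct[of n])
  case (less \<mu>)
  let ?L = "{\<nu>. low n \<nu> \<mu>}"
  have \<mu>: "\<mu> \<in> weights n" by fact
  have "\<forall>\<nu>\<in>?L. \<exists>f. is_E n \<nu> f \<and> (\<forall>k<n. Yop n k f = lconst (yval n k \<nu>) * f)"
    using less.IH low_weights(1) by blast
  from bchoice[OF this] obtain F where
    F': "\<forall>\<nu>\<in>?L. is_E n \<nu> (F \<nu>) \<and> (\<forall>k<n. Yop n k (F \<nu>) = lconst (yval n k \<nu>) * F \<nu>)" ..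
  have F: "is_E n \<nu> (F \<nu>)" "k < n \<Longrightarrow> Yop n k (F \<nu>) = lconst (yval n k \<nu>) * F \<nu>"
    if "low n \<nu> \<mu>" for \<nu> k
    using F' that by auto
  have FR: "F \<nu> \<in> laurent_ring n" if "low n \<nu> \<mu>" for \<nu>
    by (rule is_E_laurent_ring[OF F(1)[OF that] low_weights(1)[OF that]])
  have lead_ring: "f \<in> laurent_ring n" if "f - lmonom \<mu> \<in> lspan ?L" for f
  proof -
    have "(f - lmonom \<mu>) + lmonom \<mu> \<in> laurent_ring n"
      unfolding laurent_ring_eq_lspan
      by (intro lspan_add lspan_lmonom \<mu> lspan_mono[OF _ that]) (use low_weights(1) in auto)
    then show ?thesis by simp
  qed
  have orth: "inner_qt n f (lmonom \<nu>) = 0"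
    if "\<And>\<kappa>. low n \<kappa> \<mu> \<Longrightarrow> inner_qt n f (F \<kappa>) = 0" "low n \<nu> \<mu>" for f \<nu>
  proof (rule inner_down_closed[OF n, of ?L F])
    show "\<kappa> \<in> ?L" if "\<nu> \<in> ?L" "low n \<kappa> \<nu>" for \<nu> \<kappa>
      using that low_trans[of n \<kappa> \<nu> \<mu>] by simp
  qed (use that F(1) in auto)
  have "\<exists>f. f - lmonom \<mu> \<in> lspan ?L \<and> (\<forall>\<nu>\<in>B. inner_qt n f (F \<nu>) = 0)" if "finite B" "B \<subseteq> ?L" for B
    using that
  proof (induction B)
    case empty
    show ?case by (intro exI[of _ "lmonom \<mu>"]) simp
  next
    case (insert \<nu> B)
    then obtain f where f: "f - lmonom \<mu> \<in> lspan ?L" "\<forall>\<kappa>\<in>B. inner_qt n f (F \<kappa>) = 0" by auto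
    have \<nu>: "low n \<nu> \<mu>" using insert.prems by simp
    then have "\<nu> \<noteq> \<mu>" using low_irrefl by blast
    then obtain k where k: "k < n" "yval n k \<mu> \<noteq> yval n k \<nu>"
      using yval_separates[OF \<mu> low_weights(1)[OF \<nu>]] by metis
    let ?e = "yval n k"
    let ?c = "inverse (?e \<mu> - ?e \<nu>)"
    \<comment> \<open>The operator \<open>(Y - e(\<nu>)) / (e(\<mu>) - e(\<nu>))\<close> keeps the
      leading coefficient 1 and multiplies the pairing with each \<open>F \<kappa>\<close> by a
      scalar that is 0 for \<kappa> = \<nu>. Orthogonality already achieved is therefore not
      lost.\<close>
    define f' where "f' = lconst ?c * (Yop n k f - lconst (?e \<nu>) * f)"
    have cc: "lconst ?c * lconst (?e \<mu> - ?e \<nu>) = 1"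
      using k by (simp flip: lconst_mult)
    have "lconst ?c * ((Yop n k f - lconst (?e \<mu>) * lmonom \<mu>) - lconst (?e \<nu>) * (f - lmonom \<mu>)) \<in> lspan ?L"
      by (intro lspan_scale lspan_diff Yop_leading n \<mu> f(1))
    also have "lconst ?c * ((Yop n k f - lconst (?e \<mu>) * lmonom \<mu>) - lconst (?e \<nu>) * (f - lmonom \<mu>))
        = f' - (lconst ?c * lconst (?e \<mu> - ?e \<nu>)) * lmonom \<mu>"
      unfolding f'_def lconst_diff by (simp add: algebra_simps)
    finally have "f' - lmonom \<mu> \<in> lspan ?L" unfolding cc by simp
    moreover have "inner_qt n f' (F \<kappa>) = 0" if "\<kappa> \<in> insert \<nu> B" for \<kappa>
    proof -
      have \<kappa>: "low n \<kappa> \<mu>" using that insert.prems by auto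
      have "inner_qt n (Yop n k f) (F \<kappa>) = K_to_fls (?e \<kappa>) * inner_qt n f (F \<kappa>)"
        by (rule inner_Yop_eigenvector[OF n lead_ring[OF f(1)] FR[OF \<kappa>] F(2)[OF \<kappa> k(1)]])
      then have "inner_qt n f' (F \<kappa>) = K_to_fls ?c * ((K_to_fls (?e \<kappa>) - K_to_fls (?e \<nu>)) * inner_qt n f (F \<kappa>))"
        unfolding f'_def by (simp only: inner_scale_left[OF n] inner_diff_left[OF n] left_diff_distrib)
      also have "\<dots> = 0" using f(2) that by auto
      finally show ?thesis .
    qed
    ultimately show ?case by blast
  qed
  from this[OF finite_low subset_refl] obtain f where f: "f - lmonom \<mu> \<in> lspan ?L"
    "\<And>\<nu>. low n \<nu> \<mu> \<Longrightarrow> inner_qt n f (F \<nu>) = 0" by auto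
  have E: "is_E n \<mu> f" unfolding is_E_def using f orth[of f] by blast
  \<comment> \<open>\<open>y^-1 Y f\<close> meets the same characterisation as f, so f is an
    eigenvector of every \<open>Yop n k\<close>; no commutation relation enters.\<close>
  have "Yop n k f = lconst (yval n k \<mu>) * f" if "k < n" for k
  proof -
    let ?c = "inverse (yval n k \<mu>)"
    have cc: "lconst ?c * lconst (yval n k \<mu>) = 1" "lconst (yval n k \<mu>) * lconst ?c = 1"
      using Yop_facts(5)[OF n] by (simp_all flip: lconst_mult)
    have "is_E n \<mu> (lconst ?c * Yop n k f)"
      unfolding is_E_def
    proof (intro conjI allI impI)
      have "lconst ?c * (Yop n k f - lconst (yval n k \<mu>) * lmonom \<mu>) \<in> lspan ?L"
        by (intro lspan_scale Yop_leading n \<mu> f(1))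
      then show "lconst ?c * Yop n k f - lmonom \<mu> \<in> lspan ?L"
        unfolding right_diff_distrib mult.assoc[symmetric] cc by simp
      fix \<nu>
      assume \<nu>: "low n \<nu> \<mu>"
      show "inner_qt n (lconst ?c * Yop n k f) (lmonom \<nu>) = 0"
      proof (rule orth[OF _ \<nu>])
        fix \<kappa>
        assume \<kappa>: "low n \<kappa> \<mu>"
        show "inner_qt n (lconst ?c * Yop n k f) (F \<kappa>) = 0"
          unfolding inner_scale_left[OF n]
            inner_Yop_eigenvector[OF n lead_ring[OF f(1)] FR[OF \<kappa>] F(2)[OF \<kappa> that]] f(2)[OF \<kappa>]
          by simp
      qed
    qed
    then have "lconst ?c * Yop n k f = f" by (rule is_E_unique[OF n _ E])
    then have "lconst (yval n k \<mu>) * f = (lconst (yval n k \<mu>) * lconst ?c) * Yop n k f"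
      by (simp only: mult.assoc)
    then show ?thesis unfolding cc by simp
  qed
  then show ?case using E by blast
qed

definition Emac :: "nat \<Rightarrow> expo \<Rightarrow> laurent" where
  "Emac n \<mu> = (SOME f. is_E n \<mu> f)"

lemma is_E_Emac:
  assumes "0 < n" "\<mu> \<in> weights n"
  shows "is_E n \<mu> (Emac n \<mu>)"
proof -
  obtain f where "is_E n \<mu> f" using eigenvector_exists[OF assms] by auto
  then show ?thesis unfolding Emac_def by (rule someI)
qed

lemma Emac_eqI: "0 < n \<Longrightarrow> \<mu> \<in> weights n \<Longrightarrow> is_E n \<mu> f \<Longrightarrow> Emac n \<mu> = f"
  by (rule is_E_unique[OF _ is_E_Emac])

lemma Yop_Emac:
  assumes "0 < n" "\<mu> \<in> weights n" "k < n"
  shows "Yop n k (Emac n \<mu>) = lconst (yval n k \<mu>) * Emac n \<mu>"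
proof -
  obtain f where f: "is_E n \<mu> f" "\<forall>k<n. Yop n k f = lconst (yval n k \<mu>) * f"
    using eigenvector_exists[OF assms(1,2)] by auto
  show ?thesis unfolding Emac_eqI[OF assms(1,2) f(1)] using f(2) assms(3) by simp
qed

lemma laurent_ring_Emac: "0 < n \<Longrightarrow> \<mu> \<in> weights n \<Longrightarrow> Emac n \<mu> \<in> laurent_ring n"
  by (rule is_E_laurent_ring[OF is_E_Emac])

lemma inner_Emac:
  assumes "0 < n" "\<mu> \<in> weights n" "\<nu> \<in> weights n" "\<mu> \<noteq> \<nu>"
  shows "inner_qt n (Emac n \<mu>) (Emac n \<nu>) = 0"
proof -
  obtain k where k: "k < n" "yval n k \<mu> \<noteq> yval n k \<nu>"
    using yval_separates[OF assms(2-4)] by blast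
  let ?I = "inner_qt n (Emac n \<mu>) (Emac n \<nu>)"
  have "inner_qt n (Yop n k (Emac n \<mu>)) (Emac n \<nu>) = K_to_fls (yval n k \<nu>) * ?I"
    by (intro inner_Yop_eigenvector laurent_ring_Emac Yop_Emac assms k)
  then have "K_to_fls (yval n k \<mu>) * ?I = K_to_fls (yval n k \<nu>) * ?I"
    by (simp only: Yop_Emac[OF assms(1,2) k(1)] inner_scale_left[OF assms(1)])
  then have "K_to_fls (yval n k \<mu> - yval n k \<nu>) * ?I = 0"
    by (simp add: K_to_fls.hom_diff left_diff_distrib)
  then show ?thesis using k(2) by simp
qed

text \<open>The weight \<mu> need not lie above S. Being outside is enough, since the
  \<open>Emac\<close> of distinct weights are orthogonal.\<close>

lemma inner_Emac_lmonom:
  assumes "0 < n" "S \<subseteq> weights n" "\<And>\<nu> \<kappa>. \<nu> \<in> S \<Longrightarrow> low n \<kappa> \<nu> \<Longrightarrow> \<kappa> \<in> S"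
    and "\<mu> \<in> weights n" "\<mu> \<notin> S" "\<nu> \<in> S"
  shows "inner_qt n (Emac n \<mu>) (lmonom \<nu>) = 0"
  by (rule inner_down_closed[of n S "Emac n"])
    (use assms in \<open>auto intro!: is_E_Emac inner_Emac\<close>)

lemma Emac_0:
  assumes "0 < n"
  shows "Emac n 0 = 1"
proof (rule Emac_eqI[OF assms weights_0])
  have "\<not> low n \<nu> 0" for \<nu>
  proof
    assume low: "low n \<nu> 0"
    then have "sqn n \<nu> \<le> 0" using low_sqn[OF low] by (simp add: sqn_def)
    moreover have "0 \<le> (cmp \<nu> j)\<^sup>2" for j by simp
    ultimately have "\<forall>j\<in>{1..n}. (cmp \<nu> j)\<^sup>2 = 0"
      unfolding sqn_def by (metis (no_types, lifting) finite_atLeastAtMost sum_nonneg sum_nonneg_eq_0_iff order_antisym)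
    then have "\<nu> = 0"
      using low_weights(1)[OF low] by (intro weights_eqI[of _ n]) auto
    then show False using low low_irrefl by blast
  qed
  then show "is_E n 0 1" by (simp add: is_E_def)
qed

text \<open>\<open>phi_op\<close> is an isometry and \<open>phi\<close> is an automorphism of the
  order, so the right side meets the characterisation of the left.\<close>

lemma Emac_phi:
  assumes n: "0 < n" and \<mu>: "\<mu> \<in> weights n"
  shows "Emac n (phi n \<mu>) = lconst (qK powi cmp \<mu> n) * phi_op n (Emac n \<mu>)"
proof (rule Emac_eqI[OF n weights_phi[OF n]])
  let ?q = "lconst (qK powi cmp \<mu> n)"
  have E: "is_E n \<mu> (Emac n \<mu>)" by (rule is_E_Emac[OF n \<mu>])
  show "is_E n (phi n \<mu>) (?q * phi_op n (Emac n \<mu>))"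
    unfolding is_E_def
  proof (intro conjI allI impI)
    have r: "phi_op n (Emac n \<mu> - lmonom \<mu>) \<in> lspan {\<nu>. low n \<nu> (phi n \<mu>)}"
    proof (rule linear_op_lspan[OF linear_op_phi_op])
      show "Emac n \<mu> - lmonom \<mu> \<in> lspan {\<nu>. low n \<nu> \<mu>}" using E by (simp add: is_E_def)
      show "phi_op n (lmonom \<nu>) \<in> lspan {\<nu>. low n \<nu> (phi n \<mu>)}" if "\<nu> \<in> {\<nu>. low n \<nu> \<mu>}" for \<nu>
        unfolding phi_op_lmonom using that by (intro lspan_scale lspan_lmonom) (simp add: low_phi[OF n])
    qed
    have "?q * phi_op n (lmonom \<mu>) = lmonom (phi n \<mu>)"
      unfolding phi_op_lmonom mult.assoc[symmetric] lconst_mult[symmetric] power_int_add[symmetric, OF disjI1[OF qK_neq_0]]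
      by simp
    then have "?q * phi_op n (Emac n \<mu>) - lmonom (phi n \<mu>) = ?q * phi_op n (Emac n \<mu> - lmonom \<mu>)"
      by (simp add: linear_op_diff[OF linear_op_phi_op] right_diff_distrib)
    then show "?q * phi_op n (Emac n \<mu>) - lmonom (phi n \<mu>) \<in> lspan {\<nu>. low n \<nu> (phi n \<mu>)}"
      using lspan_scale[OF r] by simp
    fix \<kappa>
    assume low: "low n \<kappa> (phi n \<mu>)"
    have \<kappa>: "\<kappa> \<in> weights n" by (rule low_weights(1)[OF low])
    have "low n (psi n \<kappa>) \<mu>" using low_psi[OF n low] by (simp add: psi_phi[OF n \<mu>])
    then have 0: "inner_qt n (Emac n \<mu>) (lmonom (psi n \<kappa>)) = 0" using E by (simp add: is_E_def)
    have "lmonom \<kappa> = phi_op n (psi_op n (lmonom \<kappa>))"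
      by (rule phi_op_psi_op[OF n laurent_ring_lmonom[OF \<kappa>], symmetric])
    also have "\<dots> = lconst (qK powi (cmp \<kappa> 1 - 1)) * phi_op n (lmonom (psi n \<kappa>))"
      unfolding psi_op_lmonom by (rule linear_op_scale[OF linear_op_phi_op])
    finally have \<kappa>_eq: "lmonom \<kappa> = lconst (qK powi (cmp \<kappa> 1 - 1)) * phi_op n (lmonom (psi n \<kappa>))" .
    show "inner_qt n (?q * phi_op n (Emac n \<mu>)) (lmonom \<kappa>) = 0"
      unfolding \<kappa>_eq inner_scale_left[OF n] inner_scale_right[OF n]
        inner_phi_op[OF n laurent_ring_Emac[OF n \<mu>] laurent_ring_lmonom[OF weights_psi]] 0
      by simp
  qed
qed

lemma mk_expo_minus: "- mk_expo n (\<lambda>_. c) = mk_expo n (\<lambda>_. - c)"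
  by (rule poly_mapping_eqI) (simp add: lookup_mk_expo)

lemma Emac_shift:
  assumes n: "0 < n" and \<mu>: "\<mu> \<in> weights n"
  shows "Emac n (\<mu> - mk_expo n (\<lambda>_. 1)) = lmonom (- mk_expo n (\<lambda>_. 1)) * Emac n \<mu>"
proof (rule Emac_eqI[OF n weights_diff[OF \<mu> weights_mk_expo]])
  let ?c = "mk_expo n (\<lambda>_. 1)"
  have E: "is_E n \<mu> (Emac n \<mu>)" by (rule is_E_Emac[OF n \<mu>])
  show "is_E n (\<mu> - ?c) (lmonom (- ?c) * Emac n \<mu>)"
    unfolding is_E_def
  proof (intro conjI allI impI)
    have "lmonom (- ?c) * (Emac n \<mu> - lmonom \<mu>) \<in> lspan {\<nu>. low n \<nu> (\<mu> - ?c)}"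
    proof (rule linear_op_lspan[OF linear_op_mult])
      show "Emac n \<mu> - lmonom \<mu> \<in> lspan {\<nu>. low n \<nu> \<mu>}" using E by (simp add: is_E_def)
      fix \<nu>
      assume "\<nu> \<in> {\<nu>. low n \<nu> \<mu>}"
      then have "low n (\<nu> + - ?c) (\<mu> + - ?c)" unfolding mk_expo_minus by (intro low_shift) simp
      then show "lmonom (- ?c) * lmonom \<nu> \<in> lspan {\<nu>. low n \<nu> (\<mu> - ?c)}"
        unfolding lmonom_add[symmetric] by (intro lspan_lmonom) (simp add: add.commute)
    qed
    then show "lmonom (- ?c) * Emac n \<mu> - lmonom (\<mu> - ?c) \<in> lspan {\<nu>. low n \<nu> (\<mu> - ?c)}"
      by (simp add: right_diff_distrib flip: lmonom_add)
    fix \<nu>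
    assume "low n \<nu> (\<mu> - ?c)"
    from low_shift[OF this, of 1] have "low n (\<nu> + ?c) \<mu>" by simp
    then have "inner_qt n (Emac n \<mu>) (lmonom (\<nu> + ?c)) = 0" using E by (simp add: is_E_def)
    moreover have "lmonom \<nu> = lmonom (- ?c) * lmonom (\<nu> + ?c)" by (simp flip: lmonom_add)
    ultimately show "inner_qt n (lmonom (- ?c) * Emac n \<mu>) (lmonom \<nu>) = 0"
      by (simp only: inner_lmonom)
  qed
qed

subsection \<open>The intertwining relation for the simple reflections\<close>

lemma cyc_act_expo_simple_refl:
  assumes "1 \<le> i" "Suc i < n"
  shows "cyc n (act_expo (simple_refl i) \<nu>) = act_expo (simple_refl (Suc i)) (cyc n \<nu>)"
proof (rule poly_mapping_eqI)
  fix j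
  show "cmp (cyc n (act_expo (simple_refl i) \<nu>)) j = cmp (act_expo (simple_refl (Suc i)) (cyc n \<nu>)) j"
    using assms by (cases j) (auto simp: lookup_cyc lookup_act_expo_simple_refl simple_refl_apply)
qed

lemma cyc_subst_act_simple_refl:
  assumes "1 \<le> i" "Suc i < n"
  shows "cyc_subst n (act (simple_refl i) f) = act (simple_refl (Suc i)) (cyc_subst n f)"
proof (induction f rule: laurent_induct)
  case (monom \<nu> c)
  have "cmp (act_expo (simple_refl i) \<nu>) n = cmp \<nu> n"
    using assms by (simp add: lookup_act_expo_simple_refl simple_refl_apply)
  then show ?case
    by (simp only: act_mult act_lmonom act_lconst bij_simple_refl cyc_subst_mult cyc_subst_lmonom
        cyc_subst_lconst cyc_act_expo_simple_refl[OF assms])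
qed (simp_all only: act_add act_0 cyc_subst_add cyc_subst_0)

lemma cyc_subst_Xvar:
  assumes "i \<in> {1..n}"
  shows "cyc_subst n (Xvar i) = (if i = n then lconst (inverse qK) * Xvar 1 else Xvar (Suc i))"
  using assms by (simp add: Xvar_def cyc_subst_lmonom cyc_single lookup_single power_int_minus)

lemma cyc_subst_Top:
  assumes "1 \<le> i" "Suc i < n"
  shows "cyc_subst n (Top i f) = Top (Suc i) (cyc_subst n f)"
proof -
  have X: "cyc_subst n (Xvar i) = Xvar (Suc i)" "cyc_subst n (Xvar (Suc i)) = Xvar (Suc (Suc i))"
    using assms by (simp_all add: cyc_subst_Xvar)
  have "cyc_subst n (ddiff i f) * (Xvar (Suc i) - Xvar (Suc (Suc i)))
      = cyc_subst n (ddiff i f * (Xvar i - Xvar (Suc i)))"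
    by (simp only: cyc_subst_mult cyc_subst_diff X)
  also have "\<dots> = cyc_subst n f - act (simple_refl (Suc i)) (cyc_subst n f)"
    by (simp only: ddiff_eq cyc_subst_diff cyc_subst_act_simple_refl[OF assms])
  finally have "ddiff (Suc i) (cyc_subst n f) = cyc_subst n (ddiff i f)" by (rule ddiff_unique)
  then show ?thesis
    by (simp only: Top_def cyc_subst_add cyc_subst_mult cyc_subst_diff cyc_subst_lconst X)
qed

text \<open>Conjugating \<open>T_(n-1)\<close> once by the cyclic substitution gives the affine
  generator, which is none of the \<open>Top i\<close>; a second conjugation gives
  \<open>T_1\<close>. Both variables pick up the same inverse of q, which cancels against the one in
  \<open>ddiff\<close>.\<close>

lemma cyc_subst_cyc_subst_Top:
  assumes "2 \<le> n"
  shows "cyc_subst n (cyc_subst n (Top (n - 1) g)) = Top 1 (cyc_subst n (cyc_subst n g))"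
proof -
  let ?c2 = "\<lambda>f. cyc_subst n (cyc_subst n f)" and ?s = "simple_refl (n - 1)"
  have n: "Suc (n - 1) = n" using assms by simp
  have s: "?c2 (act ?s f) = act (simple_refl 1) (?c2 f)" for f
  proof (induction f rule: laurent_induct)
    case (monom \<nu> c)
    let ?sv = "act_expo ?s \<nu>"
    have e: "cyc n (cyc n ?sv) = act_expo (simple_refl 1) (cyc n (cyc n \<nu>))"
    proof (rule poly_mapping_eqI)
      fix j
      show "cmp (cyc n (cyc n ?sv)) j = cmp (act_expo (simple_refl 1) (cyc n (cyc n \<nu>))) j"
        using assms by (auto simp: lookup_cyc lookup_act_expo_simple_refl simple_refl_apply n numeral_2_eq_2)
    qed
    have q: "lconst (qK powi - cmp ?sv n) * lconst (qK powi - cmp (cyc n ?sv) n)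
        = lconst (qK powi - cmp \<nu> n) * lconst (qK powi - cmp (cyc n \<nu>) n)"
    proof -
      have "n \<noteq> n - Suc 0" using assms by simp
      then show ?thesis
        unfolding lconst_mult[symmetric] power_int_add[OF disjI1[OF qK_neq_0], symmetric]
        using assms by (simp add: lookup_cyc lookup_act_expo_simple_refl simple_refl_apply n algebra_simps)
    qed
    have "?c2 (lmonom \<kappa>) = (lconst (qK powi - cmp \<kappa> n) * lconst (qK powi - cmp (cyc n \<kappa>) n)) * lmonom (cyc n (cyc n \<kappa>))" for \<kappa>
      by (simp only: cyc_subst_lmonom cyc_subst_mult cyc_subst_lconst mult.assoc)
    then show ?case
      by (simp only: act_mult act_lmonom act_lconst bij_simple_refl cyc_subst_mult cyc_subst_lconst q e)
  qed (simp_all only: act_add act_0 cyc_subst_add cyc_subst_0)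
  have X: "?c2 (Xvar (n - 1)) = lconst (inverse qK) * Xvar 1" "?c2 (Xvar n) = lconst (inverse qK) * Xvar 2"
    using assms by (auto simp: cyc_subst_Xvar cyc_subst_mult n numeral_2_eq_2)
  let ?D = "ddiff (n - 1) g"
  have "(lconst (inverse qK) * ?c2 ?D) * (Xvar 1 - Xvar (Suc 1))
      = ?c2 ?D * (?c2 (Xvar (n - 1)) - ?c2 (Xvar n))"
    unfolding X by (simp add: algebra_simps numeral_2_eq_2)
  also have "\<dots> = ?c2 (?D * (Xvar (n - 1) - Xvar (Suc (n - 1))))"
    by (simp only: n cyc_subst_mult cyc_subst_diff)
  also have "\<dots> = ?c2 g - act (simple_refl 1) (?c2 g)"
    by (simp only: ddiff_eq cyc_subst_diff s)
  finally have "ddiff 1 (?c2 g) = lconst (inverse qK) * ?c2 ?D" by (rule ddiff_unique)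
  moreover have "?c2 (Top (n - 1) g) = ?c2 g + (?c2 (Xvar n) - lconst tK * ?c2 (Xvar (n - 1))) * ?c2 ?D"
    by (simp only: Top_def n cyc_subst_add cyc_subst_mult cyc_subst_diff cyc_subst_lconst)
  ultimately show ?thesis
    unfolding X Top_def by (simp add: algebra_simps numeral_2_eq_2)
qed

lemma foldr_Top_cyc:
  assumes "k < n" "1 \<le> j"
  shows "Xvar 1 * cyc_subst n (foldr Top [j..<k] h) = foldr Top [Suc j..<Suc k] (Xvar 1 * cyc_subst n h)"
proof (cases "j \<le> k")
  case True
  then show ?thesis using assms(2)
  proof (induction j rule: inc_induct)
    case (step j)
    have X: "act (simple_refl (Suc j)) (Xvar 1) = Xvar 1"
      using step by (simp add: act_Xvar simple_refl_apply)
    have IH: "Xvar 1 * cyc_subst n (foldr Top [Suc j..<k] h) = foldr Top [Suc (Suc j)..<Suc k] (Xvar 1 * cyc_subst n h)"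
      using step by simp
    have "foldr Top [j..<k] h = Top j (foldr Top [Suc j..<k] h)"
      using step by (simp add: upt_conv_Cons)
    moreover have "1 \<le> j" "Suc j < n" using step assms by auto
    note cT = cyc_subst_Top[OF this]
    ultimately have "Xvar 1 * cyc_subst n (foldr Top [j..<k] h)
        = Top (Suc j) (Xvar 1 * cyc_subst n (foldr Top [Suc j..<k] h))"
      by (simp only: cT Top_symmetric(2)[OF X])
    also have "\<dots> = foldr Top [Suc j..<Suc k] (Xvar 1 * cyc_subst n h)"
      unfolding IH using step by (simp add: upt_conv_Cons del: upt_Suc)
    finally show ?case .
  qed simp
qed simp

text \<open>As \<open>T_1 - (1 - t) = t T_1^-1\<close> by \<open>Top_Top\<close>, this says
  \<open>Phi Y_1 Phi^-1 = t T_1^-1 Y_1 T_1^-1\<close>. Moving Phi to the right shifts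
  \<open>T_1\<close>, ..., \<open>T_(n-2)\<close> to \<open>T_2\<close>, ...,
  \<open>T_(n-1)\<close>; the remaining \<open>T_(n-1)\<close> returns as \<open>T_1\<close> after
  two rotations, and the cross relation absorbs the variable.\<close>

lemma Top_phi_op_Y1:
  assumes "2 \<le> n" "f \<in> laurent_ring n"
  shows "Top 1 (phi_op n (Y1 n f)) = Y1 n (Top 1 (phi_op n f) - lconst (1 - tK) * phi_op n f)"
proof -
  have n: "0 < n" "1 < n" "Suc (n - 1) = n" using assms by auto
  let ?g = "omi n f"
  have g: "?g \<in> laurent_ring n" by (rule laurent_ring_omi[OF assms(2)])
  have f: "f = cyc_subst n ?g" using cyc_subst_omi[OF n(1) assms(2)] by simp
  have split: "foldr Top [1..<n] h = foldr Top [1..<n - 1] (Top (n - 1) h)" for h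
  proof -
    have "[1..<n] = [1..<n - 1] @ [n - 1]" using n upt_Suc_append[of 1 "n - 1"] by simp
    then show ?thesis by simp
  qed
  have "phi_op n (Y1 n f) = foldr Top [Suc 1..<Suc (n - 1)] (Xvar 1 * cyc_subst n (Top (n - 1) ?g))"
    unfolding phi_op_def Y1_def split by (rule foldr_Top_cyc) (use n in auto)
  then have "Top 1 (phi_op n (Y1 n f)) = foldr Top [1..<n] (Xvar 1 * cyc_subst n (Top (n - 1) ?g))"
    unfolding n(3) by (simp only: upt_conv_Cons[OF n(2)] foldr.simps comp_apply)
  also have "cyc_subst n (Top (n - 1) ?g) = omi n (Top 1 (cyc_subst n f))"
  proof -
    have T: "Top (n - 1) ?g \<in> laurent_ring n"
      using n by (intro laurent_ring_Top g) auto
    have "cyc_subst n (Top (n - 1) ?g) = omi n (cyc_subst n (cyc_subst n (Top (n - 1) ?g)))"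
      by (rule omi_cyc_subst[OF n(1) laurent_ring_cyc_subst[OF T], symmetric])
    also have "\<dots> = omi n (Top 1 (cyc_subst n (cyc_subst n ?g)))"
      by (simp only: cyc_subst_cyc_subst_Top[OF assms(1)])
    finally show ?thesis unfolding f[symmetric] .
  qed
  also have "Xvar 1 * omi n (Top 1 (cyc_subst n f)) = omi n (Xvar (Suc 1) * Top 1 (cyc_subst n f))"
  proof -
    have "cyc_inv n (Poly_Mapping.single (Suc 1) 1) = Poly_Mapping.single 1 1"
      by (rule poly_mapping_eqI)
        (use n in \<open>auto simp: cyc_inv_def lookup_mk_expo lookup_single when_def\<close>)
    then have "omi n (Xvar (Suc 1)) = Xvar 1" by (simp add: Xvar_def omi_lmonom lookup_single)
    then show ?thesis by (simp only: omi_mult)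
  qed
  also have "foldr Top [1..<n] (omi n (Xvar (Suc 1) * Top 1 (cyc_subst n f)))
      = Y1 n (Top 1 (phi_op n f) - lconst (1 - tK) * phi_op n f)"
    unfolding Y1_def phi_op_def Xvar_Suc_Top ..
  finally show ?thesis .
qed

text \<open>
  \<open>wle\<close> is invariant under \<open>s\<^sub>1\<close>, coarser than \<open>low\<close>, and separates orbits of \<open>s\<^sub>1\<close>.
\<close>

definition wle :: "nat \<Rightarrow> expo \<Rightarrow> expo \<Rightarrow> bool" where
  "wle n \<kappa> \<nu> \<longleftrightarrow> \<kappa> \<in> weights n \<and> tail n 0 \<kappa> = tail n 0 \<nu> \<and> sqn n \<kappa> \<le> sqn n \<nu> \<and>
     (\<forall>p\<ge>2. sqn n \<kappa> + 2 * tail n p \<kappa> \<le> sqn n \<nu> + 2 * tail n p \<nu>)"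

lemma wle_trans: "wle n \<kappa> \<nu> \<Longrightarrow> wle n \<nu> \<mu> \<Longrightarrow> wle n \<kappa> \<mu>"
  unfolding wle_def by (auto intro: order_trans)

lemma wle_refl: "\<mu> \<in> weights n \<Longrightarrow> wle n \<mu> \<mu>"
  by (simp add: wle_def)

lemma low_wle: "low n \<nu> \<mu> \<Longrightarrow> wle n \<nu> \<mu>"
  unfolding wle_def by (simp add: low_weights low_tail0 low_sqn low_sqn_tail)

lemma wle_slide:
  assumes "2 \<le> n" "\<nu> \<in> weights n"
    and "0 \<le> k \<and> k \<le> cmp \<nu> 1 - cmp \<nu> 2 \<or> cmp \<nu> 1 - cmp \<nu> 2 \<le> k \<and> k \<le> 0"
  shows "wle n (slide 1 2 k \<nu>) \<nu>"
proof -
  have "sqn n (slide 1 2 k \<nu>) \<le> sqn n \<nu>"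
    by (rule sqn_slide_le) (use assms in auto)
  moreover have "tail n p (slide 1 2 k \<nu>) = tail n p \<nu>" if "p = 0 \<or> 2 \<le> p" for p
    using that assms(1) by (subst tail_slide) auto
  moreover have "slide 1 2 k \<nu> \<in> weights n"
    by (rule weights_slide) (use assms in auto)
  ultimately show ?thesis by (simp add: wle_def)
qed

lemma wle_simple_refl:
  assumes "2 \<le> n" "\<nu> \<in> weights n"
  shows "wle n (act_expo (simple_refl 1) \<nu>) \<nu>"
proof -
  have "act_expo (simple_refl 1) \<nu> = slide 1 2 (cmp \<nu> 1 - cmp \<nu> 2) \<nu>"
    by (simp add: act_expo_simple_refl_slide numeral_2_eq_2)
  moreover have "wle n (slide 1 2 (cmp \<nu> 1 - cmp \<nu> 2) \<nu>) \<nu>"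
    by (rule wle_slide[OF assms]) linarith
  ultimately show ?thesis by simp
qed

lemma tail_Suc: "p < n \<Longrightarrow> tail n p \<mu> = cmp \<mu> (Suc p) + tail n (Suc p) \<mu>"
proof -
  assume "p < n"
  then have "{p<..n} = insert (Suc p) {Suc p<..n}" by auto
  then show ?thesis by (simp add: tail_def)
qed

text \<open>The total and the tails from p = 2 on fix the entries from the third one and the sum of
  the first two; \<open>sqn\<close> fixes the sum of their squares, hence the first two entries up
  to exchange.\<close>

lemma wle_antisym:
  assumes n: "2 \<le> n" and w: "\<mu> \<in> weights n" "\<nu> \<in> weights n"
    and "wle n \<mu> \<nu>" "wle n \<nu> \<mu>"
  shows "\<nu> = \<mu> \<or> \<nu> = act_expo (simple_refl 1) \<mu>"
proof -
  have sq: "sqn n \<mu> = sqn n \<nu>" and t0: "tail n 0 \<mu> = tail n 0 \<nu>"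
    using assms(4,5) by (auto simp: wle_def)
  have t: "tail n p \<mu> = tail n p \<nu>" if "2 \<le> p" for p
  proof -
    have "sqn n \<mu> + 2 * tail n p \<mu> \<le> sqn n \<nu> + 2 * tail n p \<nu>"
      "sqn n \<nu> + 2 * tail n p \<nu> \<le> sqn n \<mu> + 2 * tail n p \<mu>"
      using assms(4,5) that unfolding wle_def by blast+
    then show ?thesis using sq by linarith
  qed
  have hi: "cmp \<mu> j = cmp \<nu> j" if "3 \<le> j" "j \<le> n" for j
  proof -
    obtain p where p: "j = Suc p" "2 \<le> p" using \<open>3 \<le> j\<close> by (cases j) auto
    show ?thesis using tail_Suc[of p n \<mu>] tail_Suc[of p n \<nu>] t[of p] t[of "Suc p"] p that by simp
  qed
  have lo: "tail n 0 \<kappa> = cmp \<kappa> 1 + (cmp \<kappa> 2 + tail n 2 \<kappa>)" for \<kappa>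
    using tail_Suc[of 0 n \<kappa>] tail_Suc[of 1 n \<kappa>] n by (simp add: numeral_2_eq_2)
  have s: "cmp \<nu> 2 = cmp \<mu> 1 + cmp \<mu> 2 - cmp \<nu> 1"
    using lo[of \<mu>] lo[of \<nu>] t0 t[of 2] by simp
  have "{1..n} = insert 1 (insert 2 {3..n})" using n by auto
  then have sqn: "sqn n \<kappa> = (cmp \<kappa> 1)\<^sup>2 + ((cmp \<kappa> 2)\<^sup>2 + (\<Sum>j=3..n. (cmp \<kappa> j)\<^sup>2))" for \<kappa>
    by (simp add: sqn_def)
  have "(\<Sum>j=3..n. (cmp \<mu> j)\<^sup>2) = (\<Sum>j=3..n. (cmp \<nu> j)\<^sup>2)"
    by (rule sum.cong) (use hi in auto)
  then have "(cmp \<mu> 1)\<^sup>2 + (cmp \<mu> 2)\<^sup>2 = (cmp \<nu> 1)\<^sup>2 + (cmp \<nu> 2)\<^sup>2"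
    using sq by (simp add: sqn)
  then have "(cmp \<nu> 1 - cmp \<mu> 1) * (cmp \<nu> 1 - cmp \<mu> 2) = 0"
    unfolding s by (simp add: power2_eq_square algebra_simps)
  then consider "cmp \<nu> 1 = cmp \<mu> 1" | "cmp \<nu> 1 = cmp \<mu> 2" by auto
  then show ?thesis
  proof cases
    case 1
    have "\<nu> = \<mu>"
    proof (rule weights_eqI[OF w(2,1)])
      fix j
      assume "j \<in> {1..n}"
      then consider "j = 1" | "j = 2" | "3 \<le> j" "j \<le> n" by fastforce
      then show "cmp \<nu> j = cmp \<mu> j" using 1 s hi[of j] by cases auto
    qed
    then show ?thesis ..
  next
    case 2
    have "\<nu> = act_expo (simple_refl 1) \<mu>"
    proof (rule weights_eqI[OF w(2) weights_act_simple_refl[OF _ _ w(1)]])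
      fix j
      assume "j \<in> {1..n}"
      then consider "j = 1" | "j = 2" | "3 \<le> j" "j \<le> n" by fastforce
      then show "cmp \<nu> j = cmp (act_expo (simple_refl 1) \<mu>) j"
        using 2 s hi[of j] by cases (auto simp: lookup_act_expo_simple_refl simple_refl_apply numeral_2_eq_2)
    qed (use n in auto)
    then show ?thesis ..
  qed
qed

lemma Top1_wle:
  assumes n: "2 \<le> n" and \<nu>: "\<nu> \<in> weights n"
  shows "Top 1 (lmonom \<nu>) \<in> lspan {\<kappa>. wle n \<kappa> \<nu>}"
proof -
  let ?\<sigma> = "act_expo (simple_refl 1) \<nu>"
  let ?d = "cmp \<nu> (Suc 1) - cmp \<nu> 1"
  let ?c = "lconst (if 0 < ?d then tK else 1)"
  have \<sigma>: "?\<sigma> \<in> weights n" "wle n ?\<sigma> \<nu>"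
    by (rule weights_act_simple_refl[OF _ _ \<nu>]; use n in simp) (rule wle_simple_refl[OF n \<nu>])
  have d: "cmp ?\<sigma> 1 - cmp ?\<sigma> 2 = ?d"
    by (simp add: lookup_act_expo_simple_refl simple_refl_apply numeral_2_eq_2)
  have "{slide 1 (Suc 1) k ?\<sigma> | k. 0 < k \<and> k < ?d \<or> ?d \<le> k \<and> k < 0} \<subseteq> {\<kappa>. wle n \<kappa> \<nu>}"
  proof safe
    fix k
    assume "0 < k" "k < ?d"
    then have "0 \<le> k \<and> k \<le> cmp ?\<sigma> 1 - cmp ?\<sigma> 2 \<or> cmp ?\<sigma> 1 - cmp ?\<sigma> 2 \<le> k \<and> k \<le> 0"
      unfolding d by linarith
    then have "wle n (slide 1 2 k ?\<sigma>) ?\<sigma>" by (rule wle_slide[OF n \<sigma>(1)])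
    then show "wle n (slide 1 (Suc 1) k ?\<sigma>) \<nu>" using wle_trans \<sigma>(2) by (metis Suc_1)
  next
    fix k
    assume "?d \<le> k" "k < 0"
    then have "0 \<le> k \<and> k \<le> cmp ?\<sigma> 1 - cmp ?\<sigma> 2 \<or> cmp ?\<sigma> 1 - cmp ?\<sigma> 2 \<le> k \<and> k \<le> 0"
      unfolding d by linarith
    then have "wle n (slide 1 2 k ?\<sigma>) ?\<sigma>" by (rule wle_slide[OF n \<sigma>(1)])
    then show "wle n (slide 1 (Suc 1) k ?\<sigma>) \<nu>" using wle_trans \<sigma>(2) by (metis Suc_1)
  qed
  from lspan_mono[OF this Top_lmonom[of 1 \<nu>]]
  have "(Top 1 (lmonom \<nu>) - ?c * lmonom ?\<sigma>) + ?c * lmonom ?\<sigma> \<in> lspan {\<kappa>. wle n \<kappa> \<nu>}"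
    using \<sigma>(2) by (intro lspan_add lspan_scale lspan_lmonom) simp_all
  then show ?thesis by simp
qed

lemma lspan_insertD: "f \<in> lspan (insert \<mu> S) \<Longrightarrow> Poly_Mapping.lookup f \<mu> = 0 \<Longrightarrow> f \<in> lspan S"
  by (auto simp: lspan_iff)

text \<open>In \<open>T_1 E_\<mu> - E_(s_1 \<mu>)\<close> the leading terms cancel. After a multiple
  of \<open>E_\<mu>\<close> has removed the term at \<mu>, the rest is supported on
  \<open>?D\<close> and orthogonal to \<open>?D\<close>, hence 0.\<close>

lemma Top1_Emac_ex:
  assumes n: "2 \<le> n" and \<mu>: "\<mu> \<in> weights n" and gt: "cmp \<mu> 2 < cmp \<mu> 1"
  shows "\<exists>a. Top 1 (Emac n \<mu>) = Emac n (act_expo (simple_refl 1) \<mu>) + lconst a * Emac n \<mu>"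
proof -
  have n0: "0 < n" and n1: "1 < n" using n by auto
  let ?\<sigma> = "act_expo (simple_refl 1) \<mu>"
  \<comment> \<open>The weights strictly below both \<mu> and \<open>s_1 \<mu>\<close> for
    \<open>wle\<close>. They are closed downwards under \<open>low\<close>, and their span is stable
    under \<open>T_1\<close>.\<close>
  let ?D = "{\<nu>. wle n \<nu> \<mu> \<and> \<not> wle n \<mu> \<nu>}"
  have \<sigma>: "?\<sigma> \<in> weights n" by (rule weights_act_simple_refl[OF _ n1 \<mu>]) simp
  have \<sigma>\<sigma>: "act_expo (simple_refl 1) ?\<sigma> = \<mu>"
    by (rule poly_mapping_eqI) (simp add: lookup_act_expo_simple_refl)
  have \<sigma>\<mu>: "wle n ?\<sigma> \<mu>" "wle n \<mu> ?\<sigma>"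
    by (rule wle_simple_refl[OF n \<mu>], rule wle_simple_refl[OF n \<sigma>, unfolded \<sigma>\<sigma>])
  have D_down: "\<kappa> \<in> ?D" if "\<nu> \<in> ?D" "wle n \<kappa> \<nu>" for \<nu> \<kappa>
    using that wle_trans[of n \<kappa> \<nu> \<mu>] wle_trans[of n \<mu> \<kappa> \<nu>] by blast
  have D_low: "\<kappa> \<in> ?D" if "\<nu> \<in> ?D" "low n \<kappa> \<nu>" for \<nu> \<kappa>
    using D_down[OF that(1) low_wle[OF that(2)]] .
  have D_w: "?D \<subseteq> weights n" by (auto simp: wle_def)
  have \<mu>D: "\<mu> \<notin> ?D" "?\<sigma> \<notin> ?D" using wle_refl[OF \<mu>] \<sigma>\<mu> by auto
  have wle_cases: "\<nu> \<in> ?D \<or> \<nu> = \<mu> \<or> \<nu> = ?\<sigma>" if "wle n \<nu> \<mu>" for \<nu>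
    using wle_antisym[OF n \<mu> _ _ that] that by (auto simp: wle_def[of n \<nu>])
  have TD: "Top 1 f \<in> lspan ?D" if "f \<in> lspan ?D" for f
  proof (rule linear_op_lspan[OF linear_op_Top that])
    fix \<nu>
    assume \<nu>: "\<nu> \<in> ?D"
    then have "\<nu> \<in> weights n" using D_w by blast
    from Top1_wle[OF n this] show "Top 1 (lmonom \<nu>) \<in> lspan ?D"
      by (rule lspan_mono[rotated]) (use D_down[OF \<nu>] in blast)
  qed
  have d: "cmp ?\<sigma> 1 = cmp \<mu> 2" "cmp ?\<sigma> 2 = cmp \<mu> 1"
    by (simp_all add: lookup_act_expo_simple_refl simple_refl_apply numeral_2_eq_2)
  \<comment> \<open>The reflection of a descent has greater energy, so \<open>s_1 \<mu>\<close> is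
    not below \<mu> in \<open>low\<close> and does not occur in \<open>E_\<mu>\<close>.\<close>
  have energy: "int n * sqn n \<mu> + 2 * ht n \<mu> < int n * sqn n ?\<sigma> + 2 * ht n ?\<sigma>"
  proof -
    have "?\<sigma> = slide 1 2 (cmp \<mu> 1 - cmp \<mu> 2) \<mu>"
      by (simp add: act_expo_simple_refl_slide numeral_2_eq_2)
    then have "ht n ?\<sigma> = ht n \<mu> + (cmp \<mu> 1 - cmp \<mu> 2)"
      using n by (simp add: ht_slide)
    moreover have "sqn n ?\<sigma> = sqn n \<mu>" using \<sigma>\<mu> by (simp add: wle_def)
    ultimately show ?thesis using gt by simp
  qed
  have E\<mu>: "Emac n \<mu> - lmonom \<mu> \<in> lspan ?D"
  proof -
    have "{\<nu>. low n \<nu> \<mu>} \<subseteq> ?D"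
    proof
      fix \<nu>
      assume "\<nu> \<in> {\<nu>. low n \<nu> \<mu>}"
      then have low: "low n \<nu> \<mu>" by simp
      then have "\<nu> \<noteq> \<mu>" "\<nu> \<noteq> ?\<sigma>" using low_energy[OF low] energy by auto
      then show "\<nu> \<in> ?D" using wle_cases[OF low_wle[OF low]] by blast
    qed
    then show ?thesis using is_E_Emac[OF n0 \<mu>] unfolding is_E_def by (blast intro: lspan_mono)
  qed
  have E\<sigma>: "Emac n ?\<sigma> - lmonom ?\<sigma> \<in> lspan (insert \<mu> ?D)"
  proof -
    have "{\<nu>. low n \<nu> ?\<sigma>} \<subseteq> insert \<mu> ?D"
    proof
      fix \<nu>
      assume "\<nu> \<in> {\<nu>. low n \<nu> ?\<sigma>}"
      then have low: "low n \<nu> ?\<sigma>" by simp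
      then have "\<nu> \<noteq> ?\<sigma>" using low_irrefl by blast
      then show "\<nu> \<in> insert \<mu> ?D"
        using wle_cases[OF wle_trans[OF low_wle[OF low] \<sigma>\<mu>(1)]] by blast
    qed
    then show ?thesis using is_E_Emac[OF n0 \<sigma>] unfolding is_E_def by (blast intro: lspan_mono)
  qed
  have T\<mu>: "Top 1 (lmonom \<mu>) - lmonom ?\<sigma> \<in> lspan (insert \<mu> ?D)"
  proof -
    let ?d = "cmp \<mu> (Suc 1) - cmp \<mu> 1"
    have neg: "?d < 0" using gt by (simp add: numeral_2_eq_2)
    have "{slide 1 (Suc 1) k ?\<sigma> | k. 0 < k \<and> k < ?d \<or> ?d \<le> k \<and> k < 0} \<subseteq> insert \<mu> ?D"
    proof
      fix \<kappa>
      assume "\<kappa> \<in> {slide 1 (Suc 1) k ?\<sigma> | k. 0 < k \<and> k < ?d \<or> ?d \<le> k \<and> k < 0}"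
      then obtain k where k: "\<kappa> = slide 1 2 k ?\<sigma>" "?d \<le> k" "k < 0"
        using neg by (auto simp: numeral_2_eq_2)
      have "wle n \<kappa> ?\<sigma>" unfolding k(1)
      proof (rule wle_slide[OF n \<sigma>])
        show "0 \<le> k \<and> k \<le> cmp ?\<sigma> 1 - cmp ?\<sigma> 2 \<or> cmp ?\<sigma> 1 - cmp ?\<sigma> 2 \<le> k \<and> k \<le> 0"
          unfolding d using k(2,3) unfolding Suc_1 by linarith
      qed
      from wle_cases[OF wle_trans[OF this \<sigma>\<mu>(1)]] have "\<kappa> \<in> ?D \<or> \<kappa> = \<mu> \<or> \<kappa> = ?\<sigma>" .
      moreover have "\<kappa> \<noteq> ?\<sigma>"
      proof
        assume "\<kappa> = ?\<sigma>"
        then have "cmp (slide 1 2 k ?\<sigma>) 1 = cmp ?\<sigma> 1" using k(1) by simp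
        then show False using k(3) by (simp add: lookup_slide)
      qed
      ultimately show "\<kappa> \<in> insert \<mu> ?D" by blast
    qed
    from lspan_mono[OF this Top_lmonom[of 1 \<mu>]] neg show ?thesis by simp
  qed
  let ?g = "Top 1 (Emac n \<mu>) - Emac n ?\<sigma>"
  have gD: "?g \<in> lspan (insert \<mu> ?D)"
  proof -
    have "Top 1 (Emac n \<mu> - lmonom \<mu>) + (Top 1 (lmonom \<mu>) - lmonom ?\<sigma>) - (Emac n ?\<sigma> - lmonom ?\<sigma>)
        \<in> lspan (insert \<mu> ?D)"
      by (intro lspan_add lspan_diff T\<mu> E\<sigma> lspan_mono[OF subset_insertI TD[OF E\<mu>]])
    then show ?thesis by (simp add: linear_op_diff[OF linear_op_Top])
  qed
  define a where "a = Poly_Mapping.lookup ?g \<mu>"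
  let ?h = "?g - lconst a * Emac n \<mu>"
  have "?h = 0"
  proof (rule nondegenerate_lspan[OF n0 D_w])
    have E\<mu>': "Emac n \<mu> \<in> lspan (insert \<mu> ?D)"
    proof -
      have "(Emac n \<mu> - lmonom \<mu>) + lmonom \<mu> \<in> lspan (insert \<mu> ?D)"
        by (intro lspan_add lspan_lmonom lspan_mono[OF subset_insertI E\<mu>]) simp
      then show ?thesis by simp
    qed
    have "Poly_Mapping.lookup (Emac n \<mu> - lmonom \<mu>) \<mu> = 0"
      using E\<mu> \<mu>D unfolding lspan_iff by blast
    then have l1: "Poly_Mapping.lookup (Emac n \<mu>) \<mu> = 1" by (simp add: lookup_minus lookup_lmonom)
    have "?h \<in> lspan (insert \<mu> ?D)" by (intro lspan_diff lspan_scale gD E\<mu>')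
    moreover have "Poly_Mapping.lookup ?h \<mu> = 0"
      unfolding lookup_minus[of ?g] lookup_lconst_times l1 a_def by simp
    ultimately show "?h \<in> lspan ?D" by (rule lspan_insertD)
    fix \<nu>
    assume \<nu>: "\<nu> \<in> ?D"
    have o: "inner_qt n (Emac n \<kappa>) (lmonom \<nu>) = 0" if "\<kappa> \<in> weights n" "\<kappa> \<notin> ?D" "\<nu> \<in> ?D" for \<kappa> \<nu>
      by (rule inner_Emac_lmonom[OF n0 D_w D_low that])
    have "inner_qt n (Top 1 (Emac n \<mu>)) (lmonom \<nu>) = 0"
    proof -
      \<comment> \<open>By the quadratic relation this is \<open>T_1^-1 x^\<nu>\<close>. It stays in
        the span of \<open>?D\<close>, so isometry moves \<open>T_1\<close> off
        \<open>E_\<mu>\<close>.\<close>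
      let ?k = "lconst (inverse tK) * (Top 1 (lmonom \<nu>) - lconst (1 - tK) * lmonom \<nu>)"
      have kD: "?k \<in> lspan ?D"
        by (intro lspan_scale lspan_diff TD lspan_lmonom \<nu>)
      have "Top 1 ?k = lconst (inverse tK) * (Top 1 (Top 1 (lmonom \<nu>)) - lconst (1 - tK) * Top 1 (lmonom \<nu>))"
        by (simp only: linear_op_scale[OF linear_op_Top] linear_op_diff[OF linear_op_Top])
      also have "\<dots> = (lconst (inverse tK) * lconst tK) * lmonom \<nu>"
        unfolding Top_Top by (simp add: algebra_simps)
      also have "\<dots> = lmonom \<nu>" by (simp flip: lconst_mult)
      finally have "inner_qt n (Top 1 (Emac n \<mu>)) (lmonom \<nu>) = inner_qt n (Top 1 (Emac n \<mu>)) (Top 1 ?k)"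
        by simp
      also have "\<dots> = inner_qt n (Emac n \<mu>) ?k" by (rule inner_Top[OF _ n1]) simp
      also have "\<dots> = 0" by (rule inner_lspan_right[OF n0 kD o[OF \<mu> \<mu>D(1)]])
      finally show ?thesis .
    qed
    then show "inner_qt n ?h (lmonom \<nu>) = 0"
      using o[OF \<mu> \<mu>D(1) \<nu>] o[OF \<sigma> \<mu>D(2) \<nu>]
      by (simp add: inner_diff_left[OF n0] inner_scale_left[OF n0])
  qed
  then have "Top 1 (Emac n \<mu>) = Emac n ?\<sigma> + lconst a * Emac n \<mu>" by (simp add: algebra_simps)
  then show ?thesis by blast
qed

lemma lookup_Emac_self:
  assumes "0 < n" "\<mu> \<in> weights n"
  shows "Poly_Mapping.lookup (Emac n \<mu>) \<mu> = 1"
proof -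
  have "Poly_Mapping.lookup (Emac n \<mu> - lmonom \<mu>) \<mu> = 0"
    using is_E_Emac[OF assms] low_irrefl unfolding is_E_def lspan_iff by blast
  then show ?thesis by (simp add: lookup_minus lookup_lmonom)
qed

text \<open>Let b be the unknown in \<open>T_1 E_\<mu> = E_(s_1 \<mu>) + b E_\<mu>\<close>. Applied
  to \<open>psi_op n (Emac n \<mu>)\<close>, the relation \<open>Top_phi_op_Y1\<close> ties b to the
  eigenvalues, and comparing the coefficients at \<mu> gives b. Here a is the ratio of the first two
  eigenvalues.\<close>

lemma Top1_Emac:
  assumes n: "2 \<le> n" and \<mu>: "\<mu> \<in> weights n" and gt: "cmp \<mu> 2 < cmp \<mu> 1"
  defines "a \<equiv> y1 n \<mu> / y1 n (psi n \<mu>)"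
  shows "Emac n (act_expo (simple_refl 1) \<mu>) = Top 1 (Emac n \<mu>) + lconst ((1 - tK) * a / (1 - a)) * Emac n \<mu>"
proof -
  have n0: "0 < n" and n1: "1 < n" using n by auto
  let ?\<sigma> = "act_expo (simple_refl 1) \<mu>"
  have \<sigma>: "?\<sigma> \<in> weights n" by (rule weights_act_simple_refl[OF _ n1 \<mu>]) simp
  let ?E = "Emac n \<mu>" and ?E' = "Emac n ?\<sigma>"
  let ?y1 = "y1 n \<mu>" and ?y2 = "y1 n (psi n \<mu>)"
  obtain b where b: "Top 1 ?E = ?E' + lconst b * ?E" using Top1_Emac_ex[OF n \<mu> gt] by blast
  have Y: "Y1 n (Emac n \<kappa>) = lconst (y1 n \<kappa>) * Emac n \<kappa>" if "\<kappa> \<in> weights n" for \<kappa>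
    using Yop_Emac[OF n0 that n0] by (simp add: Yop_def yval_def)
  have "phi_op n (Y1 n (psi_op n ?E)) = lconst ?y2 * ?E"
    using Yop_Emac[OF n0 \<mu> n1] by (simp add: Yop_def yval_def)
  then have "lconst ?y2 * Top 1 ?E = Top 1 (phi_op n (Y1 n (psi_op n ?E)))"
    by (simp only: linear_op_scale[OF linear_op_Top])
  also have "\<dots> = Y1 n (Top 1 ?E - lconst (1 - tK) * ?E)"
    by (simp only: Top_phi_op_Y1[OF n laurent_ring_psi_op[OF n0 laurent_ring_Emac[OF n0 \<mu>]]]
        phi_op_psi_op[OF n0 laurent_ring_Emac[OF n0 \<mu>]])
  also have "Top 1 ?E - lconst (1 - tK) * ?E = ?E' + lconst (b - (1 - tK)) * ?E"
    unfolding b lconst_diff by (simp add: algebra_simps)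
  also have "Y1 n (?E' + lconst (b - (1 - tK)) * ?E)
      = lconst (y1 n ?\<sigma>) * ?E' + lconst (b - (1 - tK)) * (lconst ?y1 * ?E)"
    by (simp only: linear_op_add[OF linear_op_Y1] linear_op_scale[OF linear_op_Y1] Y[OF \<mu>] Y[OF \<sigma>])
  finally have eq: "lconst ?y2 * (?E' + lconst b * ?E)
      = lconst (y1 n ?\<sigma>) * ?E' + lconst (b - (1 - tK)) * (lconst ?y1 * ?E)" unfolding b .
  have sn: "\<not> low n ?\<sigma> \<mu>" "?\<sigma> \<noteq> \<mu>"
  proof -
    have "?\<sigma> = slide 1 2 (cmp \<mu> 1 - cmp \<mu> 2) \<mu>"
      by (simp add: act_expo_simple_refl_slide numeral_2_eq_2)
    then have "int n * sqn n \<mu> + 2 * ht n \<mu> < int n * sqn n ?\<sigma> + 2 * ht n ?\<sigma>"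
      using n gt by (simp add: ht_slide sqn_slide)
    then show "\<not> low n ?\<sigma> \<mu>" "?\<sigma> \<noteq> \<mu>" using low_energy[of n ?\<sigma> \<mu>] by auto
  qed
  have l0: "Poly_Mapping.lookup ?E ?\<sigma> = 0"
  proof -
    have "Poly_Mapping.lookup (?E - lmonom \<mu>) ?\<sigma> = 0"
      using is_E_Emac[OF n0 \<mu>] sn(1) unfolding is_E_def lspan_iff by blast
    then show ?thesis using sn(2) by (simp add: lookup_minus lookup_lmonom)
  qed
  note l1 = lookup_Emac_self[OF n0 \<mu>] lookup_Emac_self[OF n0 \<sigma>]
  have "?y2 = y1 n ?\<sigma>"
    using arg_cong[OF eq, of "\<lambda>f. Poly_Mapping.lookup f ?\<sigma>"]
    by (simp only: lookup_add lookup_lconst_times l0 l1 mult_zero_right add_0_right mult_1_right)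
  then have "?y2 * b = (b - (1 - tK)) * ?y1"
    using arg_cong[OF eq, of "\<lambda>f. Poly_Mapping.lookup f \<mu>"]
    by (simp only: lookup_add lookup_lconst_times l1 mult_1_right distrib_left add_left_cancel)
  moreover have nz: "?y2 \<noteq> 0" by (simp add: y1_def)
  \<comment> \<open>The two eigenvalues have q-exponents \<open>\<mu>_1\<close> and
    \<open>\<mu>_2\<close>, which differ.\<close>
  moreover have "a \<noteq> 1"
  proof
    assume "a = 1"
    then have "?y1 = ?y2" using nz by (simp add: a_def)
    then have "qdeg ?y1 = qdeg ?y2" by simp
    then show False unfolding y1_def qdeg_powi using gt n by (simp add: lookup_psi numeral_2_eq_2)
  qed
  moreover have "b = - ((1 - tK) * a / (1 - a))"
    if h: "?y2 * b = (b - (1 - tK)) * ?y1" and "a \<noteq> 1"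
  proof -
    have ya: "?y2 * a = ?y1" using nz by (simp add: a_def)
    have "?y2 * (b * (1 - a)) = ?y2 * b - b * (?y2 * a)" by (simp add: algebra_simps)
    also have "\<dots> = - ((1 - tK) * (?y2 * a))" unfolding ya h by (simp add: algebra_simps)
    also have "\<dots> = ?y2 * (- ((1 - tK) * a))" by simp
    finally have "b * (1 - a) = - ((1 - tK) * a)" by (rule iffD1[OF mult_left_cancel[OF nz]])
    note eq = this
    have "1 - a \<noteq> 0" using \<open>a \<noteq> 1\<close> by simp
    from iffD2[OF nonzero_eq_divide_eq[OF this] eq] show ?thesis by simp
  qed
  ultimately have "b = - ((1 - tK) * a / (1 - a))" by blast
  then show ?thesis unfolding b by (simp add: lconst_uminus)
qed

lemma phi_op_Top:
  assumes "1 \<le> i" "Suc i < n"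
  shows "phi_op n (Top i f) = Top (Suc i) (phi_op n f)"
proof -
  have X: "act (simple_refl (Suc i)) (Xvar 1) = Xvar 1"
    using assms by (simp add: act_Xvar simple_refl_apply)
  show ?thesis unfolding phi_op_def cyc_subst_Top[OF assms] Top_symmetric(2)[OF X] ..
qed

lemma phi_act_simple_refl:
  assumes "1 \<le> i" "Suc i < n"
  shows "phi n (act_expo (simple_refl i) \<nu>) = act_expo (simple_refl (Suc i)) (phi n \<nu>)"
  using assms
  by (simp add: phi_def act_expo_add act_expo_single cyc_act_expo_simple_refl simple_refl_apply)

text \<open>\<open>phi_op\<close> carries \<open>T_i\<close> to \<open>T_(i+1)\<close> and
  \<open>E_\<nu>\<close> to a multiple of \<open>E_(phi \<nu>)\<close>, and it leaves the ratio of
  eigenvalues unchanged; so everything reduces to i = 1.\<close>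

lemma Emac_simple_refl:
  assumes "1 \<le> i" "i < n" "\<mu> \<in> weights n" "cmp \<mu> (Suc i) < cmp \<mu> i"
  defines "a \<equiv> y1 n ((psi n ^^ (i - 1)) \<mu>) / y1 n ((psi n ^^ i) \<mu>)"
  shows "Emac n (act_expo (simple_refl i) \<mu>) = Top i (Emac n \<mu>) + lconst ((1 - tK) * a / (1 - a)) * Emac n \<mu>"
  using assms(1-4) unfolding a_def
proof (induction i arbitrary: \<mu> rule: dec_induct)
  case base
  then show ?case using Top1_Emac[of n \<mu>] by (simp add: numeral_2_eq_2)
next
  case (step i)
  have n: "0 < n" and i: "1 \<le> i" "Suc i < n" using step by auto
  define \<nu> where "\<nu> = psi n \<mu>"
  have \<nu>: "\<nu> \<in> weights n" "phi n \<nu> = \<mu>" using phi_psi[OF n] step.prems by (simp_all add: \<nu>_def)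
  define b where "b = y1 n ((psi n ^^ i) \<mu>) / y1 n ((psi n ^^ Suc i) \<mu>)"
  define c where "c = lconst ((1 - tK) * b / (1 - b))"
  obtain k where k: "i = Suc k" using i by (cases i) auto
  have b: "y1 n ((psi n ^^ (i - 1)) \<nu>) / y1 n ((psi n ^^ i) \<nu>) = b"
    unfolding b_def \<nu>_def k by (simp add: funpow_swap1)
  have "cmp \<nu> (Suc i) < cmp \<nu> i"
    using step.prems i by (simp add: \<nu>_def lookup_psi)
  from step.IH[OF _ \<nu>(1) this] i
  have IH: "Emac n (act_expo (simple_refl i) \<nu>) = Top i (Emac n \<nu>) + c * Emac n \<nu>"
    unfolding b c_def by simp
  let ?q = "lconst (qK powi cmp \<nu> n)"
  have "cmp (act_expo (simple_refl i) \<nu>) n = cmp \<nu> n"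
    using i by (simp add: lookup_act_expo_simple_refl simple_refl_apply)
  then have "Emac n (phi n (act_expo (simple_refl i) \<nu>)) = ?q * phi_op n (Emac n (act_expo (simple_refl i) \<nu>))"
    using Emac_phi[OF n weights_act_simple_refl[OF i(1) _ \<nu>(1)]] i(2) by simp
  also have "\<dots> = ?q * (phi_op n (Top i (Emac n \<nu>)) + c * phi_op n (Emac n \<nu>))"
    unfolding IH c_def linear_op_add[OF linear_op_phi_op] linear_op_scale[OF linear_op_phi_op] ..
  also have "\<dots> = Top (Suc i) (?q * phi_op n (Emac n \<nu>)) + c * (?q * phi_op n (Emac n \<nu>))"
    unfolding phi_op_Top[OF i] linear_op_scale[OF linear_op_Top] by (simp add: distrib_left mult.left_commute)
  also have "?q * phi_op n (Emac n \<nu>) = Emac n \<mu>"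
    using Emac_phi[OF n \<nu>(1)] by (simp only: \<nu>(2))
  finally show ?case
    unfolding phi_act_simple_refl[OF i] \<nu>(2) c_def b_def by simp
qed

text \<open>The entry \<open>\<mu>_1\<close> moves from the front to the end and drops by 1: the
  condition \<open>\<mu>_1 \<le> \<mu>_(r+1)\<close>, counted to the left of the place, equals
  \<open>\<mu>_1 - 1 < \<mu>_(r+1)\<close>, counted to its right.\<close>

lemma v_perm_psi:
  assumes "1 \<le> r" "r < n"
  shows "v_perm n (psi n \<mu>) r = v_perm n \<mu> (Suc r)"
proof -
  let ?m = "cmp \<mu>" and ?p = "cmp (psi n \<mu>)"
  let ?A = "{r'\<in>{1..n}. r' < r \<and> ?p r' \<le> ?p r}" and ?B = "{r'\<in>{1..n}. r < r' \<and> ?p r' < ?p r}"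
  let ?A' = "{r'\<in>{1..n}. r' < Suc r \<and> ?m r' \<le> ?m (Suc r)}"
    and ?B' = "{r'\<in>{1..n}. Suc r < r' \<and> ?m r' < ?m (Suc r)}"
  let ?c = "?m 1 \<le> ?m (Suc r)"
  have pr: "?p r' = ?m (Suc r')" if "1 \<le> r'" "r' < n" for r' using that by (simp add: lookup_psi)
  have "?A' = Suc ` ?A \<union> (if ?c then {1} else {})"
  proof (rule set_eqI)
    fix x
    show "x \<in> ?A' \<longleftrightarrow> x \<in> Suc ` ?A \<union> (if ?c then {1} else {})"
      using assms pr by (cases x; cases "x = 1") (auto simp: image_iff)
  qed
  moreover have "Suc ` ?A \<inter> (if ?c then {1} else {}) = {}" by auto
  ultimately have A: "card ?A' = card ?A + (if ?c then 1 else 0)"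
    by (simp add: card_Un_disjoint card_image)
  have "?B = (\<lambda>x. x - 1) ` ?B' \<union> (if ?c then {n} else {})"
  proof (rule set_eqI)
    fix x
    have "x \<in> (\<lambda>x. x - 1) ` ?B' \<longleftrightarrow> Suc x \<in> ?B'"
    proof
      assume "Suc x \<in> ?B'"
      then show "x \<in> (\<lambda>x. x - 1) ` ?B'" by (intro image_eqI[of _ _ "Suc x"]) auto
    qed auto
    moreover have "?p n = ?m 1 - 1" using assms by (simp add: lookup_psi)
    ultimately show "x \<in> ?B \<longleftrightarrow> x \<in> (\<lambda>x. x - 1) ` ?B' \<union> (if ?c then {n} else {})"
      using assms pr[of x] pr[of r] by (cases "x = n") auto
  qed
  moreover have "(\<lambda>x. x - 1) ` ?B' \<inter> (if ?c then {n} else {}) = {}" by auto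
  moreover have "card ((\<lambda>x. x - 1) ` ?B') = card ?B'"
    by (rule card_image) (auto intro!: inj_onI)
  ultimately have "card ?B = card ?B' + (if ?c then 1 else 0)"
    by (simp add: card_Un_disjoint)
  then show ?thesis using A by (simp add: v_perm_def)
qed

lemma y1_funpow_psi:
  assumes "k < n"
  shows "y1 n ((psi n ^^ k) \<mu>) = qK powi cmp \<mu> (Suc k) * tK powi (int (v_perm n \<mu> (Suc k)) - 1)"
proof -
  have "v_perm n ((psi n ^^ k) \<mu>) r = v_perm n \<mu> (r + k)" if "1 \<le> r" "r + k \<le> n" for r
    using that
  proof (induction k arbitrary: r)
    case (Suc k)
    then show ?case by (simp add: v_perm_psi)
  qed simp
  then have "v_perm n ((psi n ^^ k) \<mu>) 1 = v_perm n \<mu> (Suc k)" using assms by simp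
  moreover have v: "int (card {j \<in> {2..n}. cmp \<nu> j < cmp \<nu> 1}) = int (v_perm n \<nu> 1) - 1" for \<nu>
  proof -
    have "{j \<in> {1..n}. j < 1 \<and> cmp \<nu> j \<le> cmp \<nu> 1} = {}"
      "{j \<in> {1..n}. 1 < j \<and> cmp \<nu> j < cmp \<nu> 1} = {j \<in> {2..n}. cmp \<nu> j < cmp \<nu> 1}" by auto
    then show ?thesis unfolding v_perm_def by simp
  qed
  moreover have "cmp ((psi n ^^ k) \<mu>) 1 = cmp \<mu> (Suc k)"
    using lookup_funpow_psi[of 1 k n \<mu>] assms by simp
  ultimately show ?thesis unfolding y1_def v by (simp only:)
qed

section \<open>The defining recursion holds and has only one solution\<close>

lemma is_nonsym_macdonald_Emac:
  assumes n: "0 < n"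
  shows "is_nonsym_macdonald n (Emac n)"
  unfolding is_nonsym_macdonald_def
proof (intro conjI ballI impI)
  show "Emac n \<mu> \<in> laurent_ring n" if "\<mu> \<in> weights n" for \<mu> by (rule laurent_ring_Emac[OF n that])
  show "Emac n 0 = 1" by (rule Emac_0[OF n])
  show "Emac n (cyc n \<mu> + Poly_Mapping.single 1 1) = lconst (qK powi cmp \<mu> n) * Xvar 1 * cyc_subst n (Emac n \<mu>)"
    if "\<mu> \<in> weights n" for \<mu>
    using Emac_phi[OF n that] by (simp only: phi_def phi_op_def mult.assoc)
  show "Emac n (\<mu> - mk_expo n (\<lambda>_. 1)) = lmonom (- mk_expo n (\<lambda>_. 1)) * Emac n \<mu>"
    if "\<mu> \<in> weights n" for \<mu> by (rule Emac_shift[OF n that])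
  fix \<mu> i
  assume \<mu>: "\<mu> \<in> weights n" and i: "i \<in> {1..<n}"
    and "(\<forall>j\<in>{1..n}. 0 \<le> cmp \<mu> j) \<and> cmp \<mu> (Suc i) < cmp \<mu> i"
  then have gt: "cmp \<mu> (Suc i) < cmp \<mu> i" by simp
  have i': "1 \<le> i" "i < n" "Suc (i - 1) = i" "i - 1 < n" using i by auto
  have "y1 n ((psi n ^^ (i - 1)) \<mu>) / y1 n ((psi n ^^ i) \<mu>)
      = (qK powi cmp \<mu> i / qK powi cmp \<mu> (Suc i)) *
        (tK powi (int (v_perm n \<mu> i) - 1) / tK powi (int (v_perm n \<mu> (Suc i)) - 1))"
    unfolding y1_funpow_psi[OF i'(2)] y1_funpow_psi[OF i'(4)] i'(3) by simp
  also have "\<dots> = qK powi (cmp \<mu> i - cmp \<mu> (Suc i)) * tK powi (int (v_perm n \<mu> i) - int (v_perm n \<mu> (Suc i)))"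
    by (simp flip: power_int_diff)
  finally show "let a = qK powi (cmp \<mu> i - cmp \<mu> (Suc i)) * tK powi (int (v_perm n \<mu> i) - int (v_perm n \<mu> (Suc i)))
      in Emac n (act_expo (simple_refl i) \<mu>) = ddiff i (Xvar i * Emac n \<mu>) - lconst tK * Xvar i * ddiff i (Emac n \<mu>)
        + lconst ((1 - tK) * a / (1 - a)) * Emac n \<mu>"
    using Emac_simple_refl[OF i'(1,2) \<mu> gt] by (simp only: Let_def Top_altdef)
qed

context
  fixes n :: nat and E E' :: "expo \<Rightarrow> laurent"
  assumes n: "0 < n" and E: "is_nonsym_macdonald n E" and E': "is_nonsym_macdonald n E'"
begin

lemma nonsym_macdonald_unique_phi:
  assumes "\<mu> \<in> weights n" "E \<mu> = E' \<mu>"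
  shows "E (phi n \<mu>) = E' (phi n \<mu>)"
proof -
  have "F (phi n \<mu>) = lconst (qK powi cmp \<mu> n) * Xvar 1 * cyc_subst n (F \<mu>)"
    if "is_nonsym_macdonald n F" for F
    using that assms(1) unfolding is_nonsym_macdonald_def phi_def by blast
  from this[OF E] this[OF E'] assms(2) show ?thesis by simp
qed

lemma nonsym_macdonald_unique_simple_refl:
  assumes "\<mu> \<in> weights n" "i \<in> {1..<n}" "\<forall>j\<in>{1..n}. 0 \<le> cmp \<mu> j" "cmp \<mu> (Suc i) < cmp \<mu> i" "E \<mu> = E' \<mu>"
  shows "E (act_expo (simple_refl i) \<mu>) = E' (act_expo (simple_refl i) \<mu>)"
proof -
  let ?a = "qK powi (cmp \<mu> i - cmp \<mu> (Suc i)) * tK powi (int (v_perm n \<mu> i) - int (v_perm n \<mu> (Suc i)))"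
  have "F (act_expo (simple_refl i) \<mu>) = ddiff i (Xvar i * F \<mu>) - lconst tK * Xvar i * ddiff i (F \<mu>)
        + lconst ((1 - tK) * ?a / (1 - ?a)) * F \<mu>"
    if "is_nonsym_macdonald n F" for F
  proof -
    have "\<forall>\<mu>\<in>weights n. \<forall>i\<in>{1..<n}. (\<forall>j\<in>{1..n}. 0 \<le> cmp \<mu> j) \<and> cmp \<mu> i > cmp \<mu> (Suc i) \<longrightarrow>
        (let a = qK powi (cmp \<mu> i - cmp \<mu> (Suc i))
                 * tK powi (int (v_perm n \<mu> i) - int (v_perm n \<mu> (Suc i)))
         in F (act_expo (simple_refl i) \<mu>)
              = ddiff i (Xvar i * F \<mu>) - lconst tK * Xvar i * ddiff i (F \<mu>)
                + lconst ((1 - tK) * a / (1 - a)) * F \<mu>)"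
      using that unfolding is_nonsym_macdonald_def by (elim conjE)
    from bspec[OF bspec[OF this assms(1)] assms(2)] assms(3,4) show ?thesis
      by (simp only: Let_def simp_thms)
  qed
  from this[OF E] this[OF E'] assms(5) show ?thesis by simp
qed

lemma nonsym_macdonald_unique_shift:
  assumes "\<mu> \<in> weights n" "E \<mu> = E' \<mu>"
  shows "E (\<mu> - mk_expo n (\<lambda>_. 1)) = E' (\<mu> - mk_expo n (\<lambda>_. 1))"
proof -
  have "F (\<mu> - mk_expo n (\<lambda>_. 1)) = lmonom (- mk_expo n (\<lambda>_. 1)) * F \<mu>"
    if "is_nonsym_macdonald n F" for F
    using that assms(1) unfolding is_nonsym_macdonald_def by blast
  from this[OF E] this[OF E'] assms(2) show ?thesis by simp
qed

lemma tail0_phi: "tail n 0 (phi n \<mu>) = tail n 0 \<mu> + 1"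
proof -
  have i: "{0<..n} = insert 1 {2..n}" "{0<..n} = insert n {1..<n}" using n by auto
  have "tail n 0 (phi n \<mu>) = cmp \<mu> n + 1 + (\<Sum>j=2..n. cmp \<mu> (j - 1))"
    unfolding tail_def i(1) using n by (simp add: lookup_phi)
  also have "(\<Sum>j=2..n. cmp \<mu> (j - 1)) = (\<Sum>j=1..<n. cmp \<mu> j)"
    by (rule sum.reindex_bij_witness[of _ Suc "\<lambda>j. j - 1"]) auto
  also have "cmp \<mu> n + 1 + (\<Sum>j=1..<n. cmp \<mu> j) = tail n 0 \<mu> + 1"
    unfolding tail_def i(2) by simp
  finally show ?thesis .
qed

text \<open>Outer induction on the total degree, inner induction on the place of a positive entry:
  (E2) brings it to the front, where (E1) takes one unit from it.\<close>

lemma nonsym_macdonald_unique_nonneg: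
  "\<mu> \<in> weights n \<Longrightarrow> \<forall>j\<in>{1..n}. 0 \<le> cmp \<mu> j \<Longrightarrow> tail n 0 \<mu> = int m \<Longrightarrow> E \<mu> = E' \<mu>"
proof (induction m arbitrary: \<mu>)
  case 0
  have "(\<Sum>j\<in>{0<..n}. cmp \<mu> j) = 0" using 0 by (simp add: tail_def)
  then have "\<forall>j\<in>{0<..n}. cmp \<mu> j = 0"
    by (subst (asm) sum_nonneg_eq_0_iff) (use 0 in auto)
  then have "\<mu> = 0" by (intro weights_eqI[OF 0(1) weights_0]) auto
  then show ?case using E E' by (simp add: is_nonsym_macdonald_def)
next
  case (Suc m)
  note IHm = Suc.IH
  have step: "E \<mu> = E' \<mu>"
    if "j \<in> {1..n}" "0 < cmp \<mu> j" "\<mu> \<in> weights n" "\<forall>j\<in>{1..n}. 0 \<le> cmp \<mu> j" "tail n 0 \<mu> = int (Suc m)"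
    for j \<mu>
    using that
  proof (induction j arbitrary: \<mu>)
    case (Suc j)
    note hyp = Suc.prems and IHj = Suc.IH
    show ?case
    proof (cases "j = 0")
      case True
      have "0 \<le> cmp (psi n \<mu>) l" if "l \<in> {1..n}" for l
        using hyp that True by (auto simp: lookup_psi)
      moreover have "tail n 0 (psi n \<mu>) = int m"
        using tail0_phi[of "psi n \<mu>"] hyp(5) by (simp add: phi_psi[OF n hyp(3)])
      ultimately have "E (psi n \<mu>) = E' (psi n \<mu>)" by (intro IHm) auto
      from nonsym_macdonald_unique_phi[OF weights_psi this] show ?thesis
        by (simp add: phi_psi[OF n hyp(3)])
    next
      case False
      then have j: "j \<in> {1..<n}" "1 \<le> j" "j < n" using hyp(1) by auto
      show ?thesis
      proof (cases "0 < cmp \<mu> j")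
        case True
        then show ?thesis using IHj[of \<mu>] hyp j by simp
      next
        case F: False
        \<comment> \<open>(E2) is used from the reflected weight back to \<mu>. There the positive
          entry stands directly before a 0, which is the required descent.\<close>
        then have 0: "cmp \<mu> j = 0" using hyp(4) j by force
        let ?\<nu> = "act_expo (simple_refl j) \<mu>"
        have l: "cmp ?\<nu> j = cmp \<mu> (Suc j)" "cmp ?\<nu> (Suc j) = cmp \<mu> j"
          by (simp_all add: lookup_act_expo_simple_refl simple_refl_apply)
        have \<nu>: "?\<nu> \<in> weights n" by (rule weights_act_simple_refl[OF j(2,3) hyp(3)])
        have nonneg: "\<forall>l\<in>{1..n}. 0 \<le> cmp ?\<nu> l"
          using hyp(4) j by (auto simp: lookup_act_expo_simple_refl simple_refl_apply)
        have "tail n 0 ?\<nu> = tail n 0 \<mu>"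
          unfolding act_expo_simple_refl_slide using j by (subst tail_slide) auto
        then have "E ?\<nu> = E' ?\<nu>" using IHj[of ?\<nu>] \<nu> nonneg hyp j by (simp add: l)
        from nonsym_macdonald_unique_simple_refl[OF \<nu> j(1) nonneg _ this]
        have "E (act_expo (simple_refl j) ?\<nu>) = E' (act_expo (simple_refl j) ?\<nu>)"
          using hyp(2) by (simp add: l 0)
        moreover have "act_expo (simple_refl j) ?\<nu> = \<mu>"
          by (rule poly_mapping_eqI) (simp add: lookup_act_expo_simple_refl)
        ultimately show ?thesis by simp
      qed
    qed
  qed simp
  have "\<exists>j\<in>{1..n}. 0 < cmp \<mu> j"
  proof (rule ccontr)
    assume "\<not> (\<exists>j\<in>{1..n}. 0 < cmp \<mu> j)"
    then have "tail n 0 \<mu> \<le> 0" unfolding tail_def by (intro sum_nonpos) (auto simp: not_less)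
    then show False using Suc.prems(3) by simp
  qed
  then show ?case using step Suc.prems by blast
qed

text \<open>Adding (1, ..., 1) often enough makes all entries nonnegative, and (E3) undoes
  this.\<close>

lemma nonsym_macdonald_unique:
  assumes "\<mu> \<in> weights n"
  shows "E \<mu> = E' \<mu>"
proof -
  have *: "E \<mu> = E' \<mu>" if "\<mu> \<in> weights n" "\<forall>j\<in>{1..n}. - int N \<le> cmp \<mu> j" for N \<mu>
    using that
  proof (induction N arbitrary: \<mu>)
    case 0
    then have "0 \<le> tail n 0 \<mu>" unfolding tail_def by (intro sum_nonneg) auto
    then obtain m where "tail n 0 \<mu> = int m" by (metis zero_le_imp_eq_int)
    then show ?case using nonsym_macdonald_unique_nonneg[of \<mu> m] 0 by auto
  next
    case (Suc N)
    let ?c = "mk_expo n (\<lambda>_. 1)"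
    have w: "\<mu> + ?c \<in> weights n" using Suc.prems by (intro weights_add) auto
    have "E (\<mu> + ?c) = E' (\<mu> + ?c)"
      using Suc.prems by (intro Suc.IH[OF w]) (auto simp: lookup_add lookup_mk_expo)
    from nonsym_macdonald_unique_shift[OF w this] show ?case by simp
  qed
  let ?N = "nat (\<Sum>j=1..n. \<bar>cmp \<mu> j\<bar>)"
  have "- int ?N \<le> cmp \<mu> j" if "j \<in> {1..n}" for j
  proof -
    have "\<bar>cmp \<mu> j\<bar> \<le> (\<Sum>j=1..n. \<bar>cmp \<mu> j\<bar>)" using that by (intro member_le_sum) auto
    then show ?thesis by simp
  qed
  then show ?thesis by (intro *[OF assms, of ?N]) blast
qed

end

text \<open>The choice made by \<open>SOME\<close> does not matter, as any two solutions agree on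
  \<open>weights n\<close>.\<close>

lemma macdonald_E_eq:
  assumes "0 < n" "\<mu> \<in> weights n"
  shows "macdonald_E n \<mu> = Emac n \<mu>"
proof -
  have "is_nonsym_macdonald n (macdonald_E n)"
    unfolding macdonald_E_def by (rule someI[where P = "is_nonsym_macdonald n", OF is_nonsym_macdonald_Emac[OF assms(1)]])
  then show ?thesis
    by (rule nonsym_macdonald_unique[OF assms(1) _ is_nonsym_macdonald_Emac[OF assms(1)] assms(2)])
qed

section \<open>Dominant weights and coinvariants\<close>

lemma weights_act_expo:
  assumes "w permutes {1..n}" "\<mu> \<in> weights n"
  shows "act_expo w \<mu> \<in> weights n"
  unfolding weights_iff
proof (intro allI impI)
  fix j
  assume "j \<notin> {1..n}"
  then have "inv w j = j" using assms(1) by (metis permutes_inv permutes_not_in)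
  then show "cmp (act_expo w \<mu>) j = 0"
    using assms \<open>j \<notin> {1..n}\<close> by (simp add: lookup_act_expo permutes_bij weights_iff)
qed

lemma act_expo_inv: "bij w \<Longrightarrow> act_expo (inv w) (act_expo w \<mu>) = \<mu>"
  by (rule poly_mapping_eqI) (simp add: lookup_act_expo bij_imp_bij_inv inv_inv_eq bij_is_inj)

lemma sqn_act_expo:
  assumes "w permutes {1..n}"
  shows "sqn n (act_expo w \<mu>) = sqn n \<mu>"
  unfolding sqn_def
  by (subst sum.permute[OF assms]) (simp add: comp_def act_expo_apply permutes_bij[OF assms])

lemma dle_act_expo:
  assumes "w permutes {1..n}"
  shows "dle n (act_expo w \<mu>) \<mu>" "dle n \<mu> (act_expo w \<mu>)"
proof -
  have *: "dle n (act_expo w \<mu>) \<mu>" if w: "w permutes {1..n}" for w \<mu>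
    unfolding dle_def
  proof (intro allI impI)
    fix A
    assume A: "A \<subseteq> {1..n}"
    let ?B = "inv w ` A"
    have inj: "inj_on (inv w) A"
      using permutes_inj[OF permutes_inv[OF w]] by (rule inj_on_subset) simp
    have "?B \<subseteq> {1..n}" using A permutes_image[OF permutes_inv[OF w]] by blast
    moreover have "card ?B = card A" by (rule card_image[OF inj])
    moreover have "(\<Sum>j\<in>?B. cmp \<mu> j) = (\<Sum>j\<in>A. cmp (act_expo w \<mu>) j)"
      by (simp add: sum.reindex[OF inj] lookup_act_expo permutes_bij[OF w])
    ultimately show "\<exists>B\<subseteq>{1..n}. card B = card A \<and> (\<Sum>j\<in>A. cmp (act_expo w \<mu>) j) \<le> (\<Sum>j\<in>B. cmp \<mu> j)"
      by (metis order_refl)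
  qed
  show "dle n (act_expo w \<mu>) \<mu>" by (rule *[OF assms])
  show "dle n \<mu> (act_expo w \<mu>)"
    using *[OF permutes_inv[OF assms], of "act_expo w \<mu>"] by (simp add: act_expo_inv permutes_bij[OF assms])
qed

lemma dominant_weights: "\<gamma> \<in> dominant n \<Longrightarrow> \<gamma> \<in> weights n"
  by (simp add: dominant_def)

text \<open>The largest element of a set of i + 1 places is at least i + 1, so its entry is bounded
  by the entry at i + 1.\<close>

lemma dominant_sum_max:
  assumes "\<gamma> \<in> dominant n"
  shows "B \<subseteq> {1..n} \<Longrightarrow> card B = i \<Longrightarrow> (\<Sum>j\<in>B. cmp \<gamma> j) \<le> (\<Sum>j=1..i. cmp \<gamma> j)"
proof (induction i arbitrary: B)
  case 0
  then have "B = {}" using finite_subset[of B] by simp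
  then show ?case by simp
next
  case (Suc i)
  have fin: "finite B" and ne: "B \<noteq> {}" using Suc.prems finite_subset[of B] by auto
  let ?m = "Max B"
  have m: "?m \<in> B" by (rule Max_in[OF fin ne])
  have "B \<subseteq> {1..?m}" using Suc.prems(1) Max_ge[OF fin] by auto
  then have "Suc i \<le> ?m" using card_mono[of "{1..?m}" B] Suc.prems(2) by simp
  then have "cmp \<gamma> ?m \<le> cmp \<gamma> (Suc i)"
    using assms m Suc.prems(1) by (auto simp: dominant_def)
  moreover have "(\<Sum>j\<in>B - {?m}. cmp \<gamma> j) \<le> (\<Sum>j=1..i. cmp \<gamma> j)"
    using Suc.prems m fin by (intro Suc.IH) (auto simp: card_Diff_singleton)
  moreover have "(\<Sum>j\<in>B. cmp \<gamma> j) = cmp \<gamma> ?m + (\<Sum>j\<in>B - {?m}. cmp \<gamma> j)"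
    by (rule sum.remove[OF fin m])
  ultimately show ?case by simp
qed

lemma dle_dominant:
  assumes "dle n \<nu> \<gamma>" "\<gamma> \<in> dominant n"
  shows "dominance_le n \<nu> \<gamma>"
  unfolding dominance_le_def
proof
  fix i
  assume "i \<in> {1..n}"
  then have "{1..i} \<subseteq> {1..n}" by auto
  then obtain B where B: "B \<subseteq> {1..n}" "card B = card {1..i}" "(\<Sum>j=1..i. cmp \<nu> j) \<le> (\<Sum>j\<in>B. cmp \<gamma> j)"
    using assms(1) unfolding dle_def by blast
  then show "(\<Sum>j=1..i. cmp \<nu> j) \<le> (\<Sum>j=1..i. cmp \<gamma> j)"
    using dominant_sum_max[OF assms(2) B(1), of i] by simp
qed

lemma dominance_le_trans: "dominance_le n \<kappa> \<nu> \<Longrightarrow> dominance_le n \<nu> \<mu> \<Longrightarrow> dominance_le n \<kappa> \<mu>"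
  unfolding dominance_le_def by (meson order_trans)

lemma dominance_le_antisym:
  assumes "dominance_le n \<mu> \<nu>" "dominance_le n \<nu> \<mu>" "\<mu> \<in> weights n" "\<nu> \<in> weights n"
  shows "\<mu> = \<nu>"
proof (rule weights_eqI[OF assms(3,4)])
  have eq: "(\<Sum>j=1..i. cmp \<mu> j) = (\<Sum>j=1..i. cmp \<nu> j)" if "i \<le> n" for i
  proof (cases "i = 0")
    case False
    then have "i \<in> {1..n}" using that by simp
    then show ?thesis using assms(1,2) unfolding dominance_le_def by (meson order_antisym)
  qed simp
  fix j
  assume "j \<in> {1..n}"
  then obtain i where i: "j = Suc i" "Suc i \<le> n" by (cases j) auto
  show "cmp \<mu> j = cmp \<nu> j" using eq[of i] eq[of "Suc i"] i by simp
qed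

lemma dominant_below_if_dle:
  assumes "\<gamma> \<in> dominant n" "dle n \<gamma> \<nu>" "dle n \<nu> \<gamma>'" "\<gamma>' \<in> dominant_below n lam" "lam \<in> dominant n"
  shows "\<gamma> \<in> dominant_below n lam"
proof -
  have \<gamma>': "\<gamma>' \<in> dominant n" "dominance_le n \<gamma>' lam" "\<gamma>' \<noteq> lam"
    using assms(4) by (auto simp: dominant_below_def)
  have le: "dominance_le n \<gamma> \<gamma>'" by (rule dle_dominant[OF dle_trans[OF assms(2,3)] \<gamma>'(1)])
  moreover have "\<gamma> \<noteq> lam"
  proof
    assume "\<gamma> = lam"
    then have "\<gamma>' = lam"
      using le \<gamma>' assms(5) by (intro dominance_le_antisym[of n]) (auto intro: dominant_weights)
    then show False using \<gamma>'(3) by simp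
  qed
  ultimately show ?thesis using assms(1) dominance_le_trans \<gamma>'(2) by (simp add: dominant_below_def)
qed

text \<open>Were \<open>sqn\<close> equal, \<open>low_sqn_tail\<close> would bound all tails and put
  lam below \<nu>, against \<open>low_dle\<close>. The strict drop keeps x^lam out of the
  corrections when \<open>E_lam\<close> is rewritten in orbit sums.\<close>

lemma low_dominant_sqn:
  assumes "low n \<nu> lam" "lam \<in> dominant n"
  shows "sqn n \<nu> < sqn n lam"
proof (rule ccontr)
  assume "\<not> sqn n \<nu> < sqn n lam"
  then have sq: "sqn n \<nu> = sqn n lam" using low_sqn[OF assms(1)] by simp
  have split: "tail n 0 \<mu> = (\<Sum>j=1..p. cmp \<mu> j) + tail n p \<mu>" if "p \<le> n" for p \<mu>
  proof -
    have "{0<..n} = {1..p} \<union> {p<..n}" using that by auto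
    then show ?thesis by (simp add: tail_def sum.union_disjoint ivl_disj_int)
  qed
  have "dominance_le n lam \<nu>"
    unfolding dominance_le_def
  proof
    fix i
    assume "i \<in> {1..n}"
    then have "i \<le> n" by simp
    moreover have "tail n i \<nu> \<le> tail n i lam" using low_sqn_tail[OF assms(1), of i] sq by simp
    ultimately show "(\<Sum>j=1..i. cmp lam j) \<le> (\<Sum>j=1..i. cmp \<nu> j)"
      using split[of i \<nu>] split[of i lam] low_tail0[OF assms(1)] by simp
  qed
  moreover have "dominance_le n \<nu> lam" by (rule dle_dominant[OF low_dle[OF assms(1)] assms(2)])
  ultimately have "\<nu> = lam"
    using low_weights[OF assms(1)] by (intro dominance_le_antisym[of n])
  then show False using assms(1) low_irrefl by blast
qed

subsection \<open>Symmetric monomials\<close>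

definition orbit :: "nat \<Rightarrow> expo \<Rightarrow> expo set" where
  "orbit n \<gamma> = (\<lambda>w. act_expo w \<gamma>) ` {w. w permutes {1..n}}"

lemma finite_orbit [simp]: "finite (orbit n \<gamma>)"
  by (simp add: orbit_def finite_permutations)

lemma monom_sym_orbit: "monom_sym n \<gamma> = (\<Sum>\<mu>\<in>orbit n \<gamma>. lmonom \<mu>)"
  by (simp add: monom_sym_def orbit_def)

lemma orbit_self: "\<gamma> \<in> orbit n \<gamma>"
proof -
  have "act_expo id \<gamma> = \<gamma>" by (rule poly_mapping_eqI) (simp add: lookup_act_expo)
  then show ?thesis unfolding orbit_def using permutes_id[of "{1..n}"] by (metis image_eqI mem_Collect_eq)
qed

lemma lookup_monom_sym: "Poly_Mapping.lookup (monom_sym n \<gamma>) \<nu> = (if \<nu> \<in> orbit n \<gamma> then 1 else 0)"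
  by (simp add: monom_sym_orbit lookup_sum lookup_lmonom)

lemma orbit_act_expo:
  assumes w: "w permutes {1..n}"
  shows "act_expo w ` orbit n \<gamma> = orbit n \<gamma>"
proof -
  have sub: "act_expo w ` orbit n \<gamma> \<subseteq> orbit n \<gamma>" if w: "w permutes {1..n}" for w
  proof
    fix \<nu>
    assume "\<nu> \<in> act_expo w ` orbit n \<gamma>"
    then obtain v where v: "v permutes {1..n}" "\<nu> = act_expo w (act_expo v \<gamma>)"
      by (auto simp: orbit_def)
    then have "\<nu> = act_expo (w \<circ> v) \<gamma>" by (simp add: act_expo_comp permutes_bij[OF w] permutes_bij[OF v(1)])
    then show "\<nu> \<in> orbit n \<gamma>" unfolding orbit_def using permutes_compose[OF v(1) w] by blast
  qed
  have "orbit n \<gamma> \<subseteq> act_expo w ` orbit n \<gamma>"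
  proof
    fix \<nu>
    assume "\<nu> \<in> orbit n \<gamma>"
    then have "act_expo (inv w) \<nu> \<in> orbit n \<gamma>" using sub[OF permutes_inv[OF w]] by blast
    moreover have "act_expo w (act_expo (inv w) \<nu>) = \<nu>"
      using act_expo_inv[of "inv w" \<nu>] permutes_bij[OF w] by (simp add: bij_imp_bij_inv inv_inv_eq)
    ultimately show "\<nu> \<in> act_expo w ` orbit n \<gamma>" by (metis image_eqI)
  qed
  then show ?thesis using sub[OF w] by blast
qed

lemma act_monom_sym:
  assumes "w permutes {1..n}"
  shows "act w (monom_sym n \<gamma>) = monom_sym n \<gamma>"
proof -
  have b: "bij w" by (rule permutes_bij[OF assms])
  have "inj_on (act_expo w) (orbit n \<gamma>)" by (metis act_expo_inv[OF b] inj_onI)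
  then have "(\<Sum>\<mu>\<in>orbit n \<gamma>. lmonom (act_expo w \<mu>)) = (\<Sum>\<mu>\<in>act_expo w ` orbit n \<gamma>. lmonom \<mu>)"
    by (simp add: sum.reindex)
  then show ?thesis by (simp add: monom_sym_orbit act_sum[OF b] act_lmonom orbit_act_expo[OF assms])
qed

lemma orbit_weights: "\<gamma> \<in> weights n \<Longrightarrow> orbit n \<gamma> \<subseteq> weights n"
  by (auto simp: orbit_def weights_act_expo)

lemma laurent_ring_monom_sym: "\<gamma> \<in> weights n \<Longrightarrow> monom_sym n \<gamma> \<in> laurent_ring n"
  unfolding monom_sym_orbit using orbit_weights by (intro laurent_ring_sum laurent_ring_lmonom) blast

lemma orbit_dle:
  assumes "\<nu> \<in> orbit n \<gamma>"
  shows "dle n \<nu> \<gamma>" "dle n \<gamma> \<nu>" "sqn n \<nu> = sqn n \<gamma>"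
  using assms dle_act_expo sqn_act_expo by (auto simp: orbit_def)

lemma orbit_dominant_unique:
  assumes "\<nu> \<in> orbit n \<gamma>" "\<nu> \<in> orbit n \<gamma>'" "\<gamma> \<in> dominant n" "\<gamma>' \<in> dominant n"
  shows "\<gamma> = \<gamma>'"
proof (rule dominance_le_antisym[of n])
  show "dominance_le n \<gamma> \<gamma>'" "dominance_le n \<gamma>' \<gamma>"
    by (rule dle_dominant[OF dle_trans[OF orbit_dle(2) orbit_dle(1)]]; fact)+
qed (use assms dominant_weights in auto)

section \<open>Spans of orbit sums\<close>

definition mspan :: "nat \<Rightarrow> expo set \<Rightarrow> laurent set" where
  "mspan n S = {f. \<exists>A c. finite A \<and> A \<subseteq> S \<and> f = (\<Sum>\<gamma>\<in>A. lconst (c \<gamma>) * monom_sym n \<gamma>)}"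

lemma mspan_0 [simp]: "0 \<in> mspan n S"
  unfolding mspan_def by (intro CollectI exI[of _ "{}"]) simp

lemma mspan_monom_sym: "\<gamma> \<in> S \<Longrightarrow> lconst c * monom_sym n \<gamma> \<in> mspan n S"
  unfolding mspan_def by (intro CollectI exI[of _ "{\<gamma>}"] exI[of _ "\<lambda>_. c"]) simp

lemma mspan_add:
  assumes "f \<in> mspan n S" "g \<in> mspan n S"
  shows "f + g \<in> mspan n S"
proof -
  obtain A c where A: "finite A" "A \<subseteq> S" "f = (\<Sum>\<gamma>\<in>A. lconst (c \<gamma>) * monom_sym n \<gamma>)"
    using assms(1) by (auto simp: mspan_def)
  obtain B d where B: "finite B" "B \<subseteq> S" "g = (\<Sum>\<gamma>\<in>B. lconst (d \<gamma>) * monom_sym n \<gamma>)"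
    using assms(2) by (auto simp: mspan_def)
  have ext: "(\<Sum>\<gamma>\<in>A. lconst (c \<gamma>) * monom_sym n \<gamma>)
      = (\<Sum>\<gamma>\<in>A \<union> B. lconst (if \<gamma> \<in> A then c \<gamma> else 0) * monom_sym n \<gamma>)" if "finite A" "finite B"
    for A B and c :: "expo \<Rightarrow> K"
    using that by (intro sum.mono_neutral_cong_left) auto
  let ?e = "\<lambda>\<gamma>. (if \<gamma> \<in> A then c \<gamma> else 0) + (if \<gamma> \<in> B then d \<gamma> else 0)"
  have "f + g = (\<Sum>\<gamma>\<in>A \<union> B. lconst (?e \<gamma>) * monom_sym n \<gamma>)"
    unfolding A(3) B(3) ext[OF A(1) B(1), of c] ext[OF B(1) A(1), of d] Un_commute[of B A]
    by (simp add: lconst_add distrib_right sum.distrib)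
  then show ?thesis unfolding mspan_def using A(1,2) B(1,2)
    by (intro CollectI exI[of _ "A \<union> B"] exI[of _ ?e]) simp
qed

lemma mspan_scale:
  assumes "f \<in> mspan n S"
  shows "lconst a * f \<in> mspan n S"
proof -
  obtain A c where A: "finite A" "A \<subseteq> S" "f = (\<Sum>\<gamma>\<in>A. lconst (c \<gamma>) * monom_sym n \<gamma>)"
    using assms by (auto simp: mspan_def)
  have "lconst a * f = (\<Sum>\<gamma>\<in>A. lconst (a * c \<gamma>) * monom_sym n \<gamma>)"
    by (simp add: A(3) sum_distrib_left lconst_mult mult.assoc)
  then show ?thesis unfolding mspan_def using A(1,2)
    by (intro CollectI exI[of _ A] exI[of _ "\<lambda>\<gamma>. a * c \<gamma>"]) simp
qed

lemma mspan_diff: "f \<in> mspan n S \<Longrightarrow> g \<in> mspan n S \<Longrightarrow> f - g \<in> mspan n S"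
  using mspan_add[of f n S "lconst (- 1) * g"] mspan_scale[of g n S "- 1"] by (simp add: lconst_uminus)

lemma mspan_mono: "S \<subseteq> S' \<Longrightarrow> f \<in> mspan n S \<Longrightarrow> f \<in> mspan n S'"
  unfolding mspan_def by blast

lemma mspan_induct [consumes 1, case_names zero monom add]:
  assumes "f \<in> mspan n S" "P 0" "\<And>c \<gamma>. \<gamma> \<in> S \<Longrightarrow> P (lconst c * monom_sym n \<gamma>)"
    "\<And>f g. P f \<Longrightarrow> P g \<Longrightarrow> P (f + g)"
  shows "P f"
proof -
  obtain A c where A: "finite A" "A \<subseteq> S" "f = (\<Sum>\<gamma>\<in>A. lconst (c \<gamma>) * monom_sym n \<gamma>)"
    using assms(1) by (auto simp: mspan_def)
  show ?thesis unfolding A(3) using A(1,2)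
    by (induction A) (use assms in auto)
qed

lemma mspan_symmetric:
  assumes "f \<in> mspan n S" "w permutes {1..n}"
  shows "act w f = f"
  using assms(1)
  by (induction f rule: mspan_induct)
    (simp_all add: act_add act_mult permutes_bij[OF assms(2)] act_monom_sym[OF assms(2)])

lemma mspan_laurent_ring:
  assumes "f \<in> mspan n S" "S \<subseteq> weights n"
  shows "f \<in> laurent_ring n"
  using assms(1)
proof (induction f rule: mspan_induct)
  case (monom c \<gamma>)
  then show ?case using assms(2) by (intro laurent_ring_scale laurent_ring_monom_sym) auto
next
  case (add f g)
  then show ?case by (rule laurent_ring_add)
qed (simp add: laurent_ring_def)

lemma simple_refl_permutes: "1 \<le> i \<Longrightarrow> i < n \<Longrightarrow> simple_refl i permutes {1..n}"
  unfolding simple_refl_def by (rule permutes_swap_id) auto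

subsection \<open>Coinvariants of the Demazure--Lusztig operators\<close>

text \<open>Congruence modulo the sum of the images of \<open>T_i - 1\<close>. One
  \<open>h i\<close> for each i suffices because these maps are linear.\<close>

definition coinv :: "nat \<Rightarrow> laurent \<Rightarrow> laurent \<Rightarrow> bool" where
  "coinv n f p \<longleftrightarrow> (\<exists>h. f = p + (\<Sum>i\<in>{1..<n}. Top i (h i) - h i))"

lemma coinv_refl: "coinv n f f"
  unfolding coinv_def by (intro exI[of _ "\<lambda>_. 0"]) (simp add: linear_op_0[OF linear_op_Top])

lemma coinv_add:
  assumes "coinv n f p" "coinv n g r"
  shows "coinv n (f + g) (p + r)"
proof -
  obtain h k where "f = p + (\<Sum>i\<in>{1..<n}. Top i (h i) - h i)" "g = r + (\<Sum>i\<in>{1..<n}. Top i (k i) - k i)"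
    using assms by (auto simp: coinv_def)
  moreover have "(\<Sum>i\<in>{1..<n}. Top i (h i + k i) - (h i + k i))
      = (\<Sum>i\<in>{1..<n}. Top i (h i) - h i) + (\<Sum>i\<in>{1..<n}. Top i (k i) - k i)"
    unfolding sum.distrib[symmetric] by (intro sum.cong refl) (simp add: linear_op_add[OF linear_op_Top])
  ultimately have "f + g = p + r + (\<Sum>i\<in>{1..<n}. Top i (h i + k i) - (h i + k i))"
    by (simp add: add_ac)
  then show ?thesis unfolding coinv_def by (intro exI[of _ "\<lambda>i. h i + k i"])
qed

lemma coinv_scale:
  assumes "coinv n f p"
  shows "coinv n (lconst c * f) (lconst c * p)"
proof -
  obtain h where h: "f = p + (\<Sum>i\<in>{1..<n}. Top i (h i) - h i)" using assms by (auto simp: coinv_def)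
  have "lconst c * f = lconst c * p + (\<Sum>i\<in>{1..<n}. Top i (lconst c * h i) - lconst c * h i)"
    unfolding h distrib_left sum_distrib_left
    by (simp only: linear_op_scale[OF linear_op_Top] right_diff_distrib)
  then show ?thesis unfolding coinv_def by (intro exI[of _ "\<lambda>i. lconst c * h i"])
qed

lemma coinv_trans:
  assumes "coinv n f g" "coinv n g p"
  shows "coinv n f p"
proof -
  obtain h where h: "f = g + (\<Sum>i\<in>{1..<n}. Top i (h i) - h i)" using assms by (auto simp: coinv_def)
  then have "coinv n (f - g) 0" unfolding coinv_def by (intro exI[of _ h]) simp
  from coinv_add[OF this assms(2)] show ?thesis by simp
qed

lemma coinv_diff: "coinv n f p \<Longrightarrow> coinv n g r \<Longrightarrow> coinv n (f - g) (p - r)"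
  using coinv_add[of n f p "lconst (- 1) * g" "lconst (- 1) * r"] coinv_scale[of n g r "- 1"]
  by (simp add: lconst_uminus)

lemma coinv_sum:
  "(\<And>a. a \<in> A \<Longrightarrow> coinv n (f a) (p a)) \<Longrightarrow> coinv n (sum f A) (sum p A)"
  by (induction A rule: infinite_finite_induct) (simp_all add: coinv_refl coinv_add)

lemma coinv_Top: "1 \<le> i \<Longrightarrow> i < n \<Longrightarrow> coinv n f (Top i f)"
proof -
  assume i: "1 \<le> i" "i < n"
  have "(\<Sum>j\<in>{1..<n}. Top j (if j = i then - f else 0) - (if j = i then - f else 0))
      = (\<Sum>j\<in>{1..<n}. if j = i then f - Top i f else 0)"
    by (intro sum.cong refl)
      (simp add: linear_op_0[OF linear_op_Top] linear_op_uminus[OF linear_op_Top])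
  also have "\<dots> = f - Top i f" using i by simp
  finally have "f = Top i f + (\<Sum>j\<in>{1..<n}. Top j (if j = i then - f else 0) - (if j = i then - f else 0))"
    by simp
  then show ?thesis unfolding coinv_def by (intro exI[of _ "\<lambda>j. if j = i then - f else 0"])
qed

text \<open>A symmetric g is fixed by every \<open>T_i\<close>, so isometry gives
  \<open>(T_i h - h, g) = 0\<close>, and likewise in the other argument.\<close>

lemma coinv_inner:
  assumes "0 < n" "coinv n f p" "\<And>i. 1 \<le> i \<Longrightarrow> i < n \<Longrightarrow> act (simple_refl i) g = g"
  shows "inner_qt n f g = inner_qt n p g" "inner_qt n g f = inner_qt n g p"
proof -
  obtain h where h: "f = p + (\<Sum>i\<in>{1..<n}. Top i (h i) - h i)" using assms by (auto simp: coinv_def)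
  have T: "inner_qt n (Top i k) g = inner_qt n k g" "inner_qt n g (Top i k) = inner_qt n g k"
    if "i \<in> {1..<n}" for i k
    using inner_Top[of i n k g] inner_Top[of i n g k] Top_symmetric(1)[OF assms(3)[of i]] that by auto
  have "inner_qt n (\<Sum>i\<in>A. Top i (h i) - h i) g = 0" if "A \<subseteq> {1..<n}" "finite A" for A
    using that(2,1) by (induction A)
      (use T in \<open>auto simp: inner_add_left[OF assms(1)] inner_diff_left[OF assms(1)]\<close>)
  then show "inner_qt n f g = inner_qt n p g"
    unfolding h by (simp add: inner_add_left[OF assms(1)])
  have "inner_qt n g (\<Sum>i\<in>{1..<n}. Top i (h i) - h i) = 0"
    unfolding inner_sum_right[OF assms(1)]
    by (intro sum.neutral) (simp add: T inner_diff_right[OF assms(1)])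
  then show "inner_qt n g f = inner_qt n g p"
    unfolding h by (simp add: inner_add_right[OF assms(1)])
qed

definition below :: "nat \<Rightarrow> expo \<Rightarrow> expo set" where
  "below n \<nu> = {\<kappa> \<in> weights n. dle n \<kappa> \<nu> \<and> sqn n \<kappa> < sqn n \<nu>}"

lemma below_orbit: "\<nu> \<in> orbit n \<gamma> \<Longrightarrow> below n \<nu> = below n \<gamma>"
  unfolding below_def using orbit_dle[of \<nu> n \<gamma>] dle_trans by auto

lemma not_dominantE:
  assumes "\<nu> \<in> weights n" "\<nu> \<notin> dominant n"
  obtains i where "1 \<le> i" "i < n" "cmp \<nu> i < cmp \<nu> (Suc i)"
proof -
  have "\<exists>i. 1 \<le> i \<and> i < n \<and> cmp \<nu> i < cmp \<nu> (Suc i)"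
  proof (rule ccontr)
    assume *: "\<not> ?thesis"
    have "cmp \<nu> j \<le> cmp \<nu> i" if "1 \<le> i" "i \<le> j" "j \<le> n" for i j
      using that(2,3)
    proof (induction j rule: dec_induct)
      case (step j)
      then have "cmp \<nu> (Suc j) \<le> cmp \<nu> j" using * that(1) by (meson Suc_le_lessD le_trans not_less)
      then show ?case using step by simp
    qed simp
    then show False using assms by (simp add: dominant_def)
  qed
  then show thesis using that by blast
qed

text \<open>
  Modulo the images of \<open>T\<^sub>i - 1\<close>, a monomial is sorted at the cost of powers of \<open>t\<close> and of
  smaller monomials.
\<close>

lemma coinv_sort:
  shows "\<nu> \<in> weights n \<Longrightarrow> \<exists>\<gamma>\<in>dominant n. \<exists>l r. \<nu> \<in> orbit n \<gamma> \<and> r \<in> lspan (below n \<gamma>) \<and>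
    coinv n (lmonom \<nu>) (lconst (tK ^ l) * lmonom \<gamma> + r)"
proof (induction \<nu> rule: low_induct[of n])
  case (less \<nu>)
  show ?case
  proof (cases "\<nu> \<in> dominant n")
    case True
    show ?thesis
      by (intro bexI[OF _ True] exI[of _ 0] conjI orbit_self lspan_0) (simp add: coinv_refl)
  next
    case False
    then obtain i where i: "1 \<le> i" "i < n" "cmp \<nu> i < cmp \<nu> (Suc i)"
      using not_dominantE[OF less.prems] by blast
    let ?\<sigma> = "act_expo (simple_refl i) \<nu>" and ?d = "cmp \<nu> (Suc i) - cmp \<nu> i"
    have \<sigma>: "?\<sigma> \<in> weights n" by (rule weights_act_simple_refl[OF i(1,2) less.prems])
    \<comment> \<open>Reflecting an ascent is the boundary case k = d of \<open>low_step\<close>, so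
      sorting towards the dominant weight descends in \<open>low\<close>.\<close>
    have "low_step n (slide i (Suc i) (cmp \<nu> i - cmp \<nu> (Suc i)) \<nu>) \<nu>"
      by (rule low_stepI[OF less.prems]) (use i in \<open>auto simp: pairs_def\<close>)
    then have "low n ?\<sigma> \<nu>" unfolding low_def act_expo_simple_refl_slide by (rule tranclp.r_into_trancl)
    from less.IH[OF this \<sigma>] obtain \<gamma> l r where IH: "\<gamma> \<in> dominant n" "?\<sigma> \<in> orbit n \<gamma>"
      "r \<in> lspan (below n \<gamma>)" "coinv n (lmonom ?\<sigma>) (lconst (tK ^ l) * lmonom \<gamma> + r)" by blast
    have \<nu>\<sigma>: "\<nu> = act_expo (simple_refl i) ?\<sigma>"
      by (rule poly_mapping_eqI) (simp add: lookup_act_expo_simple_refl)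
    have "\<nu> \<in> orbit n \<gamma>"
      using IH(2) orbit_act_expo[OF simple_refl_permutes[OF i(1,2)], of \<gamma>] \<nu>\<sigma> by blast
    define r' where "r' = Top i (lmonom \<nu>) - lconst tK * lmonom ?\<sigma>"
    have d: "cmp ?\<sigma> i - cmp ?\<sigma> (Suc i) = ?d"
      by (simp add: lookup_act_expo_simple_refl simple_refl_apply)
    have "{slide i (Suc i) k ?\<sigma> | k. 0 < k \<and> k < ?d \<or> ?d \<le> k \<and> k < 0} \<subseteq> below n \<gamma>"
    proof
      fix \<kappa>
      assume "\<kappa> \<in> {slide i (Suc i) k ?\<sigma> | k. 0 < k \<and> k < ?d \<or> ?d \<le> k \<and> k < 0}"
      then obtain k where k: "\<kappa> = slide i (Suc i) k ?\<sigma>" "0 < k" "k < ?d" using i(3) by auto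
      have "k * (k - ?d) < 0" using k by (intro mult_pos_neg) auto
      then have "sqn n \<kappa> < sqn n ?\<sigma>" unfolding k(1) using i by (subst sqn_slide) (auto simp: d)
      moreover have "dle n \<kappa> ?\<sigma>" unfolding k(1)
      proof (rule dle_slide)
        show "0 \<le> k \<and> k \<le> cmp ?\<sigma> i - cmp ?\<sigma> (Suc i) \<or> cmp ?\<sigma> i - cmp ?\<sigma> (Suc i) \<le> k \<and> k \<le> 0"
          unfolding d using k by linarith
      qed (use i in auto)
      moreover have "\<kappa> \<in> weights n" unfolding k(1) using i by (intro weights_slide \<sigma>) auto
      ultimately have "\<kappa> \<in> below n ?\<sigma>" by (simp add: below_def)
      then show "\<kappa> \<in> below n \<gamma>" by (simp add: below_orbit[OF IH(2)])
    qed
    from lspan_mono[OF this Top_lmonom[of i \<nu>]] have r': "r' \<in> lspan (below n \<gamma>)"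
      using i(3) by (simp add: r'_def)
    have "coinv n (lmonom \<nu>) (lconst tK * lmonom ?\<sigma> + r')"
      using coinv_Top[OF i(1,2), of "lmonom \<nu>"] by (simp add: r'_def)
    moreover have "coinv n (lconst tK * lmonom ?\<sigma> + r') (lconst tK * (lconst (tK ^ l) * lmonom \<gamma> + r) + r')"
      by (intro coinv_add coinv_scale IH(4) coinv_refl)
    ultimately have "coinv n (lmonom \<nu>) (lconst tK * (lconst (tK ^ l) * lmonom \<gamma> + r) + r')"
      by (rule coinv_trans)
    also have "lconst tK * (lconst (tK ^ l) * lmonom \<gamma> + r) + r'
        = lconst (tK ^ Suc l) * lmonom \<gamma> + (lconst tK * r + r')"
      by (simp add: distrib_left lconst_mult mult.assoc add.assoc)
    finally have "coinv n (lmonom \<nu>) (lconst (tK ^ Suc l) * lmonom \<gamma> + (lconst tK * r + r'))" .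
    moreover have "lconst tK * r + r' \<in> lspan (below n \<gamma>)" by (intro lspan_add lspan_scale IH(3) r')
    ultimately show ?thesis using IH(1) \<open>\<nu> \<in> orbit n \<gamma>\<close> by blast
  qed
qed

text \<open>Seen as a polynomial in the square root of t, the sum takes at 1 the value card
  A.\<close>

lemma sum_tK_powers_neq_0:
  assumes "finite A" "A \<noteq> {}"
  shows "(\<Sum>a\<in>A. tK ^ l a) \<noteq> 0"
proof
  let ?p = "\<Sum>a\<in>A. monom 1 (2 * l a) :: complex poly"
  have F_add: "Fraction_Field.Fract (\<Sum>a\<in>B. f a) 1 = (\<Sum>a\<in>B. Fraction_Field.Fract (f a) (1::complex poly))"
    if "finite B" for B :: "'a set" and f
    using that
  proof (induction B)
    case (insert b B)
    have "Fraction_Field.Fract (sum f (insert b B)) 1 = Fraction_Field.Fract (f b) 1 + Fraction_Field.Fract (sum f B) 1"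
      using insert.hyps by simp
    then show ?case using insert by simp
  qed (simp add: Zero_fract_def)
  have F_pow: "fract_var ^ k = Fraction_Field.Fract (monom (1::complex) k) 1" for k
  proof (induction k)
    case (Suc k)
    have "monom (1::complex) (Suc k) = [:0, 1:] * monom 1 k" by (simp add: monom_Suc)
    then show ?case using Suc by (simp add: fract_var_def)
  qed (simp add: One_fract_def)
  assume "(\<Sum>a\<in>A. tK ^ l a) = 0"
  also have "(\<Sum>a\<in>A. tK ^ l a) = fract_const (\<Sum>a\<in>A. fract_var ^ (2 * l a))"
    by (simp add: tK_def tK_half_def fract_const.hom_sum fract_const.hom_power power_mult)
  finally have "(\<Sum>a\<in>A. fract_var ^ (2 * l a)) = (0 :: coeff0)" by simp
  then have "Fraction_Field.Fract ?p 1 = 0" by (simp add: F_add[OF assms(1)] F_pow)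
  then have "?p = 0" by (simp add: Zero_fract_def eq_fract)
  then have "poly ?p 1 = 0" by simp
  then show False using assms by (simp add: poly_sum poly_monom)
qed

text \<open>Summing \<open>coinv_sort\<close> over the orbit writes \<open>m_\<gamma>\<close> as a
  sum of powers of t times x^\<gamma>, plus smaller terms. That sum is invertible, so the congruence
  can be solved for x^\<gamma>.\<close>

lemma coinv_dominant:
  assumes "\<gamma> \<in> dominant n"
  shows "\<exists>c r. c \<noteq> 0 \<and> r \<in> lspan (below n \<gamma>) \<and> coinv n (lmonom \<gamma>) (lconst c * monom_sym n \<gamma> + r)"
proof -
  have "\<exists>l r. r \<in> lspan (below n \<gamma>) \<and> coinv n (lmonom \<nu>) (lconst (tK ^ l) * lmonom \<gamma> + r)"
    if \<nu>: "\<nu> \<in> orbit n \<gamma>" for \<nu>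
  proof -
    have "\<nu> \<in> weights n" using \<nu> orbit_weights[OF dominant_weights[OF assms]] by blast
    from coinv_sort[OF this] obtain \<gamma>' l r where s: "\<gamma>' \<in> dominant n" "\<nu> \<in> orbit n \<gamma>'"
      "r \<in> lspan (below n \<gamma>')" "coinv n (lmonom \<nu>) (lconst (tK ^ l) * lmonom \<gamma>' + r)" by blast
    have "\<gamma>' = \<gamma>" by (rule orbit_dominant_unique[OF s(2) \<nu> s(1) assms])
    then show ?thesis using s by blast
  qed
  then obtain l r where lr: "\<And>\<nu>. \<nu> \<in> orbit n \<gamma> \<Longrightarrow> r \<nu> \<in> lspan (below n \<gamma>)"
    "\<And>\<nu>. \<nu> \<in> orbit n \<gamma> \<Longrightarrow> coinv n (lmonom \<nu>) (lconst (tK ^ l \<nu>) * lmonom \<gamma> + r \<nu>)"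
    by metis
  let ?O = "orbit n \<gamma>"
  let ?T = "\<Sum>\<nu>\<in>?O. tK ^ l \<nu>" and ?R = "\<Sum>\<nu>\<in>?O. r \<nu>"
  have T: "?T \<noteq> 0" using orbit_self[of \<gamma> n] by (intro sum_tK_powers_neq_0) auto
  have R: "?R \<in> lspan (below n \<gamma>)" by (intro lspan_sum lr(1))
  have sumT: "(\<Sum>\<nu>\<in>A. lconst (tK ^ l \<nu>) * g) = lconst (\<Sum>\<nu>\<in>A. tK ^ l \<nu>) * g" for A g
    by (induction A rule: infinite_finite_induct) (simp_all add: lconst_add distrib_right)
  have "coinv n (monom_sym n \<gamma>) (\<Sum>\<nu>\<in>?O. lconst (tK ^ l \<nu>) * lmonom \<gamma> + r \<nu>)"
    unfolding monom_sym_orbit by (rule coinv_sum) (rule lr(2))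
  then have m: "coinv n (monom_sym n \<gamma>) (lconst ?T * lmonom \<gamma> + ?R)"
    by (simp only: sum.distrib sumT)
  then obtain h where h: "monom_sym n \<gamma> = (lconst ?T * lmonom \<gamma> + ?R) + (\<Sum>i\<in>{1..<n}. Top i (h i) - h i)"
    unfolding coinv_def by blast
  have "coinv n (monom_sym n \<gamma> - (lconst ?T * lmonom \<gamma> + ?R)) 0"
    unfolding coinv_def by (intro exI[of _ h]) (subst h, simp)
  from coinv_diff[OF coinv_refl[of n "monom_sym n \<gamma>"] this]
  have "coinv n (lconst ?T * lmonom \<gamma> + ?R) (monom_sym n \<gamma>)" by simp
  from coinv_diff[OF this coinv_refl[of n ?R]]
  have "coinv n (lconst ?T * lmonom \<gamma>) (monom_sym n \<gamma> - ?R)" by simp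
  from coinv_scale[OF this, of "inverse ?T"]
  have "coinv n ((lconst (inverse ?T) * lconst ?T) * lmonom \<gamma>)
      (lconst (inverse ?T) * monom_sym n \<gamma> + (- (lconst (inverse ?T) * ?R)))"
    by (simp add: right_diff_distrib mult.assoc)
  moreover have "lconst (inverse ?T) * lconst ?T = 1" using T by (simp flip: lconst_mult)
  ultimately show ?thesis using T R
    by (intro exI[of _ "inverse ?T"] exI[of _ "- (lconst (inverse ?T) * ?R)"])
      (simp add: lspan_uminus lspan_scale)
qed

text \<open>Sort \<nu>, replace the dominant monomial by its orbit sum, and repeat on the
  remainders, whose \<open>sqn\<close> is strictly smaller.\<close>

lemma coinv_lmonom:
  "\<nu> \<in> weights n \<Longrightarrow> \<exists>p \<in> mspan n {\<gamma> \<in> dominant n. dle n \<gamma> \<nu> \<and> sqn n \<gamma> \<le> sqn n \<nu>}. coinv n (lmonom \<nu>) p"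
proof (induction "nat (sqn n \<nu>)" arbitrary: \<nu> rule: less_induct)
  case less
  let ?S = "\<lambda>\<nu>. {\<gamma> \<in> dominant n. dle n \<gamma> \<nu> \<and> sqn n \<gamma> \<le> sqn n \<nu>}"
  have pos: "0 \<le> sqn n \<kappa>" for \<kappa> by (simp add: sqn_def sum_nonneg)
  have ext: "\<exists>p\<in>mspan n (?S \<nu>). coinv n r p" if "r \<in> lspan (below n \<nu>)" for r
    using that
  proof (induction r rule: lspan_induct)
    case zero
    show ?case using coinv_refl mspan_0 by blast
  next
    case (monom \<kappa> c)
    then have \<kappa>: "\<kappa> \<in> weights n" "dle n \<kappa> \<nu>" "sqn n \<kappa> < sqn n \<nu>" by (auto simp: below_def)
    then have "nat (sqn n \<kappa>) < nat (sqn n \<nu>)" using pos[of \<kappa>] by simp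
    from less.hyps[OF this \<kappa>(1)] obtain p where p: "p \<in> mspan n (?S \<kappa>)" "coinv n (lmonom \<kappa>) p" by blast
    have "?S \<kappa> \<subseteq> ?S \<nu>" using \<kappa> dle_trans[OF _ \<kappa>(2)] by auto
    from mspan_mono[OF this p(1)] show ?case using p(2) by (intro bexI[of _ "lconst c * p"] coinv_scale mspan_scale)
  next
    case (add f g)
    then show ?case using coinv_add mspan_add by blast
  qed
  obtain \<gamma> l r where s: "\<gamma> \<in> dominant n" "\<nu> \<in> orbit n \<gamma>"
    "r \<in> lspan (below n \<gamma>)" "coinv n (lmonom \<nu>) (lconst (tK ^ l) * lmonom \<gamma> + r)"
    using coinv_sort[OF less.prems] by blast
  obtain c r' where d: "r' \<in> lspan (below n \<gamma>)" "coinv n (lmonom \<gamma>) (lconst c * monom_sym n \<gamma> + r')"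
    using coinv_dominant[OF s(1)] by blast
  note b = below_orbit[OF s(2)]
  obtain p where p: "p \<in> mspan n (?S \<nu>)" "coinv n r p"
    using ext[unfolded b, OF s(3)] by (elim bexE)
  obtain p' where p': "p' \<in> mspan n (?S \<nu>)" "coinv n r' p'"
    using ext[unfolded b, OF d(1)] by (elim bexE)
  have "coinv n (lmonom \<nu>) (lconst (tK ^ l) * (lconst c * monom_sym n \<gamma> + p') + p)"
    by (rule coinv_trans[OF s(4) coinv_add[OF coinv_scale[OF coinv_trans[OF d(2) coinv_add[OF coinv_refl p'(2)]]] p(2)]])
  moreover have "lconst (tK ^ l) * (lconst c * monom_sym n \<gamma> + p') + p \<in> mspan n (?S \<nu>)"
    using s(1) orbit_dle[OF s(2)] by (intro mspan_add mspan_scale mspan_monom_sym p(1) p'(1)) auto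
  ultimately show ?case by (rule bexI)
qed

lemma coinv_lspan:
  assumes "f \<in> lspan S" "\<And>\<nu>. \<nu> \<in> S \<Longrightarrow> \<exists>p\<in>mspan n D. coinv n (lmonom \<nu>) p"
  shows "\<exists>p\<in>mspan n D. coinv n f p"
  using assms(1)
proof (induction f rule: lspan_induct)
  case zero
  show ?case using coinv_refl mspan_0 by blast
next
  case (monom \<nu> c)
  then show ?case using assms(2) coinv_scale mspan_scale by blast
next
  case (add f g)
  then show ?case using coinv_add mspan_add by blast
qed

section \<open>The symmetrizer\<close>

definition vand :: "nat \<Rightarrow> laurent" where
  "vand n = (\<Prod>(i, j)\<in>pairs n. Xvar i - Xvar j)"

definition vandt :: "nat \<Rightarrow> laurent" where
  "vandt n = (\<Prod>(i, j)\<in>pairs n. Xvar i - lconst tK * Xvar j)"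

text \<open>A permutation acts on unordered pairs, each represented with its smaller element
  first.\<close>

definition sort_pair :: "(nat \<Rightarrow> nat) \<Rightarrow> nat \<times> nat \<Rightarrow> nat \<times> nat" where
  "sort_pair w p = (if w (fst p) < w (snd p) then (w (fst p), w (snd p)) else (w (snd p), w (fst p)))"

lemma bij_betw_sort_pair:
  assumes w: "w permutes {1..n}"
  shows "bij_betw (sort_pair w) (pairs n) (pairs n)"
proof -
  have inj: "w i = w j \<longleftrightarrow> i = j" for i j using permutes_inj[OF w] by (simp add: inj_eq)
  have mem: "w i \<in> {1..n}" if "i \<in> {1..n}" for i using permutes_in_image[OF w] that by simp
  have sub: "sort_pair w ` pairs n \<subseteq> pairs n"
  proof
    fix p
    assume "p \<in> sort_pair w ` pairs n"
    then obtain i j where ij: "(i, j) \<in> pairs n" "p = sort_pair w (i, j)" by auto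
    then have "w i \<noteq> w j" "w i \<in> {1..n}" "w j \<in> {1..n}"
      using inj[of i j] mem[of i] mem[of j] by (auto simp: pairs_def)
    then show "p \<in> pairs n" unfolding ij(2) by (auto simp: sort_pair_def pairs_def)
  qed
  have "inj_on (sort_pair w) (pairs n)"
  proof (rule inj_onI)
    fix p p'
    assume p: "p \<in> pairs n" "p' \<in> pairs n" "sort_pair w p = sort_pair w p'"
    obtain i j i' j' where [simp]: "p = (i, j)" "p' = (i', j')" by (cases p; cases p')
    have "i < j" "i' < j'" using p by (auto simp: pairs_def)
    then show "p = p'" using p(3) inj by (auto simp: sort_pair_def split: if_splits)
  qed
  moreover from this have "sort_pair w ` pairs n = pairs n"
    by (rule endo_inj_surj[OF finite_pairs sub])
  ultimately show ?thesis by (simp add: bij_betw_def)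
qed

lemma prod_sort_pair:
  fixes F :: "nat \<times> nat \<Rightarrow> 'a::comm_monoid_mult"
  assumes "w permutes {1..n}"
  shows "(\<Prod>p\<in>pairs n. F (sort_pair w p)) = (\<Prod>p\<in>pairs n. F p)"
  by (rule prod.reindex_bij_betw[OF bij_betw_sort_pair[OF assms]])

lemma act_vand_sign:
  assumes "w permutes {1..n}"
  shows "\<exists>e\<in>{1, - 1}. act w (vand n) = e * vand n"
proof -
  have b: "bij w" by (rule permutes_bij[OF assms])
  let ?F = "\<lambda>p. Xvar (fst p) - Xvar (snd p)"
  let ?s = "\<lambda>p. if w (fst p) < w (snd p) then 1 else - 1 :: laurent"
  have V: "vand n = (\<Prod>p\<in>pairs n. ?F p)" by (simp add: vand_def split_def)
  have "act w (vand n) = (\<Prod>p\<in>pairs n. act w (?F p))"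
    unfolding V by (rule act_prod[OF b])
  also have "\<dots> = (\<Prod>p\<in>pairs n. ?s p * ?F (sort_pair w p))"
    by (intro prod.cong refl) (simp add: act_diff[OF b] act_Xvar[OF b] sort_pair_def)
  also have "\<dots> = (\<Prod>p\<in>pairs n. ?s p) * vand n"
    unfolding V prod.distrib prod_sort_pair[OF assms, of ?F] ..
  finally have eq: "act w (vand n) = (\<Prod>p\<in>pairs n. ?s p) * vand n" .
  have "(\<Prod>p\<in>A. ?s p) \<in> {1, - 1}" for A :: "(nat \<times> nat) set"
    by (induction A rule: infinite_finite_induct) auto
  then show ?thesis using eq by blast
qed

lemma vand_neq_0: "vand n \<noteq> 0"
proof -
  have "(case p of (i, j) \<Rightarrow> Xvar i - Xvar j) \<noteq> 0" if "p \<in> pairs n" for p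
    using that Xvar_diff_neq_0 by (fastforce simp: pairs_def)
  then show ?thesis unfolding vand_def by (simp add: prod_zero_iff)
qed

lemma prod_pairs_simple_refl:
  fixes F :: "nat \<Rightarrow> nat \<Rightarrow> laurent"
  assumes i: "1 \<le> i" "i < n" and F: "\<And>a b. act (simple_refl i) (F a b) = F (simple_refl i a) (simple_refl i b)"
  shows "\<exists>R. (\<Prod>(a, b)\<in>pairs n. F a b) = F i (Suc i) * R \<and> act (simple_refl i) R = R"
proof -
  let ?s = "simple_refl i"
  have p: "(i, Suc i) \<in> pairs n" using i by (auto simp: pairs_def)
  define R where "R = (\<Prod>(a, b)\<in>pairs n - {(i, Suc i)}. F a b)"
  have "(\<Prod>(a, b)\<in>pairs n. F a b) = F i (Suc i) * R"
    unfolding R_def by (subst prod.remove[OF finite_pairs p]) simp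
  moreover have "act ?s R = R"
  proof -
    have "act ?s R = (\<Prod>p\<in>pairs n - {(i, Suc i)}. act ?s (case p of (a, b) \<Rightarrow> F a b))"
      by (simp add: R_def act_prod)
    also have "\<dots> = R"
      unfolding R_def
      by (rule prod.reindex_bij_witness[of _ "\<lambda>(a, b). (?s a, ?s b)" "\<lambda>(a, b). (?s a, ?s b)"])
        (use i in \<open>auto simp: F pairs_def simple_refl_apply split: if_splits\<close>)
    finally show ?thesis .
  qed
  ultimately show ?thesis by blast
qed

lemma act_simple_refl_vand:
  assumes "1 \<le> i" "i < n"
  shows "act (simple_refl i) (vand n) = - vand n"
proof -
  obtain R where R: "vand n = (Xvar i - Xvar (Suc i)) * R" "act (simple_refl i) R = R"
    using prod_pairs_simple_refl[OF assms, of "\<lambda>a b. Xvar a - Xvar b"]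
    by (auto simp: vand_def act_diff act_Xvar)
  have "act (simple_refl i) (vand n) = (Xvar (Suc i) - Xvar i) * R"
    unfolding R(1) by (simp add: act_mult act_diff act_Xvar simple_refl_apply R(2))
  then show ?thesis unfolding R(1) by (simp add: left_diff_distrib)
qed

text \<open>The sign of w, read off from its action on the Vandermonde product and kept as a Laurent
  polynomial.\<close>

definition vsgn :: "nat \<Rightarrow> (nat \<Rightarrow> nat) \<Rightarrow> laurent" where
  "vsgn n w = (if act w (vand n) = vand n then 1 else - 1)"

lemma act_vand: "w permutes {1..n} \<Longrightarrow> act w (vand n) = vsgn n w * vand n"
  using act_vand_sign[of w n] by (auto simp: vsgn_def)

lemma vsgn_square: "vsgn n w * vsgn n w = 1"
  by (simp add: vsgn_def)

lemma act_vsgn: "bij v \<Longrightarrow> act v (vsgn n w) = vsgn n w"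
  by (simp add: vsgn_def act_uminus)

definition alt :: "nat \<Rightarrow> laurent \<Rightarrow> laurent" where
  "alt n F = (\<Sum>w | w permutes {1..n}. vsgn n w * act w F)"

definition symsum :: "nat \<Rightarrow> laurent \<Rightarrow> laurent fract" where
  "symsum n F = (\<Sum>w | w permutes {1..n}. Fraction_Field.Fract (act w F) (act w (vand n)))"

lemma symmetrization_symsum:
  "symmetrization n f = (THE g. Fraction_Field.Fract g 1 = symsum n (f * vandt n))"
  unfolding symmetrization_def symsum_def prod_pairs vand_def vandt_def ..

lemma Fract_sum_same_denominator:
  assumes "V \<noteq> (0 :: laurent)"
  shows "(\<Sum>a\<in>A. Fraction_Field.Fract (f a) V) = Fraction_Field.Fract (\<Sum>a\<in>A. f a) V"
proof (induction A rule: infinite_finite_induct)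
  case (insert a A)
  have "Fraction_Field.Fract (f a) V + Fraction_Field.Fract (sum f A) V = Fraction_Field.Fract (f a + sum f A) V"
    using assms by (simp add: eq_fract algebra_simps)
  then show ?case using insert by simp
qed (use assms in \<open>simp_all add: Zero_fract_def eq_fract\<close>)

text \<open>The denominators differ only by signs, so the Vandermonde product is a common
  one.\<close>

lemma symsum_alt: "symsum n F = Fraction_Field.Fract (alt n F) (vand n)"
proof -
  have "symsum n F = (\<Sum>w | w permutes {1..n}. Fraction_Field.Fract (vsgn n w * act w F) (vand n))"
    unfolding symsum_def
  proof (rule sum.cong[OF refl])
    fix w
    assume "w \<in> {w. w permutes {1..n}}"
    then have V: "act w (vand n) = vsgn n w * vand n" by (simp add: act_vand)
    have "vsgn n w \<noteq> 0" by (simp add: vsgn_def)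
    moreover have "act w F * vand n = (vsgn n w * vsgn n w) * (act w F * vand n)"
      unfolding vsgn_square by simp
    ultimately show "Fraction_Field.Fract (act w F) (act w (vand n)) = Fraction_Field.Fract (vsgn n w * act w F) (vand n)"
      unfolding V using vand_neq_0 by (simp add: eq_fract mult_ac)
  qed
  then show ?thesis by (simp add: alt_def Fract_sum_same_denominator[OF vand_neq_0])
qed

lemma alt_add: "alt n (F + G) = alt n F + alt n G"
  by (simp add: alt_def act_add distrib_left sum.distrib)

lemma alt_0 [simp]: "alt n 0 = 0"
  by (simp add: alt_def)

lemma alt_sum: "alt n (sum f A) = (\<Sum>a\<in>A. alt n (f a))"
  by (induction A rule: infinite_finite_induct) (simp_all add: alt_add)

lemma alt_mult_symmetric:
  assumes "\<And>w. w permutes {1..n} \<Longrightarrow> act w p = p"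
  shows "alt n (p * F) = p * alt n F"
  unfolding alt_def sum_distrib_left
  by (intro sum.cong refl) (simp add: act_mult permutes_bij assms mult_ac)

lemma vsgn_simple_refl:
  assumes "1 \<le> i" "i < n" "w permutes {1..n}"
  shows "vsgn n (simple_refl i \<circ> w) = - vsgn n w" "vsgn n (w \<circ> simple_refl i) = - vsgn n w"
proof -
  have s: "simple_refl i permutes {1..n}" by (rule simple_refl_permutes[OF assms(1,2)])
  have b: "bij w" by (rule permutes_bij[OF assms(3)])
  have cancel: "e = e'" if "e * vand n = e' * vand n" for e e'
    using that vand_neq_0[of n] by simp
  have "vsgn n (simple_refl i \<circ> w) * vand n = act (simple_refl i) (act w (vand n))"
    by (simp only: act_vand[OF permutes_compose[OF assms(3) s], symmetric] act_comp[OF bij_simple_refl b])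
  also have "\<dots> = (- vsgn n w) * vand n"
    by (simp add: act_vand[OF assms(3)] act_mult act_vsgn act_simple_refl_vand[OF assms(1,2)])
  finally show "vsgn n (simple_refl i \<circ> w) = - vsgn n w" by (rule cancel)
  have "vsgn n (w \<circ> simple_refl i) * vand n = act w (act (simple_refl i) (vand n))"
    by (simp only: act_vand[OF permutes_compose[OF s assms(3)], symmetric] act_comp[OF b bij_simple_refl])
  also have "\<dots> = (- vsgn n w) * vand n"
    by (simp add: act_simple_refl_vand[OF assms(1,2)] act_uminus[OF b] act_vand[OF assms(3)])
  finally show "vsgn n (w \<circ> simple_refl i) = - vsgn n w" by (rule cancel)
qed

lemma act_alt:
  assumes "1 \<le> i" "i < n"
  shows "act (simple_refl i) (alt n F) = - alt n F"
proof -
  let ?s = "simple_refl i"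
  have s: "?s permutes {1..n}" by (rule simple_refl_permutes[OF assms])
  have ss: "?s \<circ> (?s \<circ> w) = w" for w by (simp add: fun_eq_iff)
  have "act ?s (alt n F) = (\<Sum>w | w permutes {1..n}. vsgn n w * act (?s \<circ> w) F)"
    unfolding alt_def act_sum[OF bij_simple_refl]
    by (intro sum.cong refl) (simp add: act_mult act_vsgn act_comp permutes_bij)
  also have "\<dots> = (\<Sum>w | w permutes {1..n}. - (vsgn n w * act w F))"
    by (rule sum.reindex_bij_witness[of _ "\<lambda>w. ?s \<circ> w" "\<lambda>w. ?s \<circ> w"])
      (use s in \<open>auto simp: ss vsgn_simple_refl(1)[OF assms] intro: permutes_compose\<close>)
  finally show ?thesis by (simp add: alt_def sum_negf)
qed

lemma two_neq_0_laurent: "(2 :: laurent) \<noteq> 0"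
proof
  assume "(2 :: laurent) = 0"
  then have "(1 :: laurent) + 1 = 0" by simp
  then have "Poly_Mapping.lookup ((1 :: laurent) + 1) 0 = 0" by (simp only: lookup_zero)
  then have "(1 :: K) + 1 = 0" by (simp only: lookup_add lookup_one_zero)
  then have "(2 :: K) = 0" by simp
  then show False using two_neq_0_K by contradiction
qed

text \<open>Replacing w by \<open>w \<circ> s_i\<close> reverses the sign of every term.\<close>

lemma alt_simple_refl_invariant:
  assumes "1 \<le> i" "i < n" "act (simple_refl i) F = F"
  shows "alt n F = 0"
proof -
  let ?s = "simple_refl i"
  have s: "?s permutes {1..n}" by (rule simple_refl_permutes[OF assms(1,2)])
  have ss: "(w \<circ> ?s) \<circ> ?s = w" for w by (simp add: fun_eq_iff)
  have "act (w \<circ> ?s) F = act w F" if "w permutes {1..n}" for w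
    using act_comp[OF permutes_bij[OF that] bij_simple_refl[of i], of F] assms(3) by simp
  then have "alt n F = (\<Sum>w | w permutes {1..n}. - (vsgn n w * act w F))"
    unfolding alt_def
    by (intro sum.reindex_bij_witness[of _ "\<lambda>w. w \<circ> ?s" "\<lambda>w. w \<circ> ?s"])
      (use s in \<open>auto simp: ss vsgn_simple_refl(2)[OF assms(1,2)] intro: permutes_compose\<close>)
  then have "alt n F = - alt n F" by (simp add: alt_def sum_negf)
  then have "alt n F + alt n F = 0" by (simp only: eq_neg_iff_add_eq_0)
  then have "2 * alt n F = 0" by (simp only: mult_2)
  then show ?thesis using two_neq_0_laurent unfolding mult_eq_0_iff by blast
qed

text \<open>\<open>T_i h - h\<close> contributes \<open>x_(i+1) - t x_i\<close> and
  \<open>vandt n\<close> contributes \<open>x_i - t x_(i+1)\<close>; their product is symmetric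
  under \<open>s_i\<close>, and so is everything else.\<close>

lemma alt_Top:
  assumes "1 \<le> i" "i < n"
  shows "alt n ((Top i h - h) * vandt n) = 0"
proof (rule alt_simple_refl_invariant[OF assms])
  obtain R where R: "vandt n = (Xvar i - lconst tK * Xvar (Suc i)) * R" "act (simple_refl i) R = R"
    using prod_pairs_simple_refl[OF assms, of "\<lambda>a b. Xvar a - lconst tK * Xvar b"]
    by (auto simp: vandt_def act_diff act_mult act_Xvar)
  have "(Top i h - h) * vandt n
      = ((Xvar (Suc i) - lconst tK * Xvar i) * (Xvar i - lconst tK * Xvar (Suc i))) * (ddiff i h * R)"
    unfolding R(1) Top_def by (simp add: mult_ac)
  then show "act (simple_refl i) ((Top i h - h) * vandt n) = (Top i h - h) * vandt n"
    by (simp add: act_mult act_diff act_Xvar simple_refl_apply act_ddiff R(2) mult_ac)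
qed

lemma alt_coinv:
  assumes "coinv n f p" "\<And>w. w permutes {1..n} \<Longrightarrow> act w p = p"
  shows "alt n (f * vandt n) = p * alt n (vandt n)"
proof -
  obtain h where h: "f = p + (\<Sum>i\<in>{1..<n}. Top i (h i) - h i)" using assms(1) by (auto simp: coinv_def)
  have "alt n ((\<Sum>i\<in>{1..<n}. Top i (h i) - h i) * vandt n) = 0"
    unfolding sum_distrib_right alt_sum by (intro sum.neutral) (simp add: alt_Top)
  moreover have "alt n (p * vandt n) = p * alt n (vandt n)"
    by (rule alt_mult_symmetric) (rule assms(2))
  ultimately show ?thesis unfolding h distrib_right alt_add by simp
qed

subsection \<open>The symmetrization of 1 is constant\<close>

text \<open>Each variable occurs in n - 1 of the factors \<open>x_i - c x_j\<close>, hence the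
  bound. Within it (n - 1, ..., 1, 0) is the only strictly decreasing exponent.\<close>

definition box :: "nat \<Rightarrow> expo set" where
  "box n = {\<nu> \<in> weights n. \<forall>j\<in>{1..n}. 0 \<le> cmp \<nu> j \<and> cmp \<nu> j \<le> int n - 1}"

lemma box_prod_pairs:
  "(\<Prod>(i, j)\<in>pairs n. Xvar i - lconst c * Xvar j) \<in> lspan (box n)"
proof -
  let ?f = "\<lambda>(i, j). Xvar i - lconst c * Xvar j"
  let ?k = "\<lambda>P j. card {p \<in> P. fst p = j \<or> snd p = j}"
  have "prod ?f P \<in> lspan {\<nu> \<in> weights n. \<forall>j\<in>{1..n}. 0 \<le> cmp \<nu> j \<and> cmp \<nu> j \<le> int (?k P j)}"
    if "finite P" "P \<subseteq> pairs n" for P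
    using that
  proof (induction P)
    case empty
    have "lmonom 0 \<in> lspan {\<nu> \<in> weights n. \<forall>j\<in>{1..n}. 0 \<le> cmp \<nu> j \<and> cmp \<nu> j \<le> int (?k {} j)}"
      by (intro lspan_lmonom) simp
    then show ?case by simp
  next
    case (insert p P)
    let ?S = "\<lambda>P. {\<nu> \<in> weights n. \<forall>j\<in>{1..n}. 0 \<le> cmp \<nu> j \<and> cmp \<nu> j \<le> int (?k P j)}"
    obtain a b where p: "p = (a, b)" by (cases p)
    have ab: "a \<in> {1..n}" "b \<in> {1..n}" "a \<noteq> b" using insert.prems p by (auto simp: pairs_def)
    have k: "?k (insert p P) j = (if a = j \<or> b = j then Suc (?k P j) else ?k P j)" for j
    proof -
      have "{q \<in> insert p P. fst q = j \<or> snd q = j}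
          = (if a = j \<or> b = j then insert p {q \<in> P. fst q = j \<or> snd q = j} else {q \<in> P. fst q = j \<or> snd q = j})"
        using p by auto
      then show ?thesis using insert.hyps by simp
    qed
    have X: "Xvar x * g \<in> lspan (?S (insert p P))" if x: "x = a \<or> x = b" and g: "g \<in> lspan (?S P)" for x g
    proof (rule linear_op_lspan[OF linear_op_mult g])
      fix \<nu>
      assume \<nu>: "\<nu> \<in> ?S P"
      have "0 \<le> cmp (\<nu> + Poly_Mapping.single x 1) j \<and> cmp (\<nu> + Poly_Mapping.single x 1) j \<le> int (?k (insert p P) j)"
        if "j \<in> {1..n}" for j
      proof -
        have "0 \<le> cmp \<nu> j" "cmp \<nu> j \<le> int (?k P j)" using \<nu> that by auto
        then show ?thesis
          using x unfolding k lookup_add lookup_single when_def by auto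
      qed
      moreover have "\<nu> + Poly_Mapping.single x 1 \<in> weights n"
        using \<nu> x ab by (intro weights_add weights_single) auto
      ultimately have "\<nu> + Poly_Mapping.single x 1 \<in> ?S (insert p P)" by blast
      then show "Xvar x * lmonom \<nu> \<in> lspan (?S (insert p P))" unfolding Xvar_lmonom by (rule lspan_lmonom)
    qed
    have IH: "prod ?f P \<in> lspan (?S P)" using insert by simp
    have "Xvar a * prod ?f P - lconst c * (Xvar b * prod ?f P) \<in> lspan (?S (insert p P))"
      by (intro lspan_diff lspan_scale X IH) simp_all
    then show ?case using insert.hyps by (simp add: p left_diff_distrib mult.assoc)
  qed
  from this[OF finite_pairs subset_refl]
  have prod: "prod ?f (pairs n) \<in> lspan {\<nu> \<in> weights n. \<forall>j\<in>{1..n}. 0 \<le> cmp \<nu> j \<and> cmp \<nu> j \<le> int (?k (pairs n) j)}" .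
  have le: "int (?k (pairs n) j) \<le> int n - 1" if "j \<in> {1..n}" for j
  proof -
    have "{p \<in> pairs n. fst p = j \<or> snd p = j} \<subseteq> (\<lambda>i. if i < j then (i, j) else (j, i)) ` ({1..n} - {j})"
    proof
      fix p
      assume p: "p \<in> {p \<in> pairs n. fst p = j \<or> snd p = j}"
      then consider i where "p = (j, i)" "j < i" "i \<le> n" | i where "p = (i, j)" "1 \<le> i" "i < j" "j \<le> n"
        by (auto simp: pairs_def)
      then show "p \<in> (\<lambda>i. if i < j then (i, j) else (j, i)) ` ({1..n} - {j})"
      proof cases
        case (1 i)
        then show ?thesis by (intro image_eqI[of _ _ i]) auto
      next
        case (2 i)
        then show ?thesis by (intro image_eqI[of _ _ i]) auto
      qed
    qed
    then have "?k (pairs n) j \<le> card ({1..n} - {j})"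
      by (rule surj_card_le[rotated]) simp
    also have "\<dots> = n - 1" using that by simp
    finally show ?thesis using that by auto
  qed
  have "{\<nu> \<in> weights n. \<forall>j\<in>{1..n}. 0 \<le> cmp \<nu> j \<and> cmp \<nu> j \<le> int (?k (pairs n) j)} \<subseteq> box n"
    unfolding box_def using order_trans[OF _ le] by blast
  from lspan_mono[OF this prod] show ?thesis .
qed

lemma alt_box:
  assumes "F \<in> lspan (box n)"
  shows "alt n F \<in> lspan (box n)"
  unfolding alt_def
proof (rule lspan_sum)
  fix w
  assume "w \<in> {w. w permutes {1..n}}"
  then have w: "w permutes {1..n}" by simp
  have b: "bij w" by (rule permutes_bij[OF w])
  have "act w F \<in> lspan (box n)"
  proof (rule linear_op_lspan[OF linear_op_act[OF b] assms])
    fix \<nu>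
    assume \<nu>: "\<nu> \<in> box n"
    have "inv w j \<in> {1..n}" if "j \<in> {1..n}" for j
      using permutes_in_image[OF permutes_inv[OF w]] that by blast
    then have "act_expo w \<nu> \<in> box n"
      using \<nu> by (auto simp: box_def lookup_act_expo[OF b] weights_act_expo[OF w])
    then show "act w (lmonom \<nu>) \<in> lspan (box n)" unfolding act_lmonom by (rule lspan_lmonom)
  qed
  then show "vsgn n w * act w F \<in> lspan (box n)" by (simp add: vsgn_def lspan_uminus)
qed

lemma strictly_decreasing_box:
  assumes "\<nu> \<in> box n" "\<And>i. 1 \<le> i \<Longrightarrow> i < n \<Longrightarrow> cmp \<nu> (Suc i) < cmp \<nu> i"
  shows "\<nu> = mk_expo n (\<lambda>j. int n - int j)"
proof (rule weights_eqI[OF _ weights_mk_expo])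
  show "\<nu> \<in> weights n" using assms(1) by (simp add: box_def)
  fix j
  assume j: "j \<in> {1..n}"
  have "cmp \<nu> j \<le> int n - int j"
  proof -
    have "1 \<le> j" using j by simp
    then show ?thesis using j
    proof (induction j rule: dec_induct)
      case base
      then show ?case using assms(1) by (auto simp: box_def)
    next
      case (step k)
      then show ?case using assms(2)[of k] by auto
    qed
  qed
  moreover have "int n - int j \<le> cmp \<nu> j"
  proof -
    have "j \<le> n" using j by simp
    then show ?thesis using j
    proof (induction j rule: inc_induct)
      case base
      then show ?case using assms(1) by (auto simp: box_def)
    next
      case (step k)
      then show ?case using assms(2)[of k] by auto
    qed
  qed
  ultimately show "cmp \<nu> j = cmp (mk_expo n (\<lambda>j. int n - int j)) j" using j by (simp add: lookup_mk_expo)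
qed

text \<open>Antisymmetry makes coefficients vanish at exponents with equal neighbours, and at an
  ascent it passes to the reflected exponent, which is lower for \<open>low\<close>. Only the
  strictly decreasing exponent is left.\<close>

lemma antisymmetric_box_eq_0:
  assumes "f \<in> lspan (box n)" "\<And>i. 1 \<le> i \<Longrightarrow> i < n \<Longrightarrow> act (simple_refl i) f = - f"
    and "Poly_Mapping.lookup f (mk_expo n (\<lambda>j. int n - int j)) = 0"
  shows "f = 0"
proof -
  have swap: "Poly_Mapping.lookup f \<nu> = - Poly_Mapping.lookup f (act_expo (simple_refl i) \<nu>)"
    if "1 \<le> i" "i < n" for i \<nu>
  proof -
    have "Poly_Mapping.lookup f \<nu> = Poly_Mapping.lookup (act (simple_refl i) f) (act_expo (simple_refl i) \<nu>)"
      by (rule lookup_act[symmetric]) simp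
    then show ?thesis by (simp only: assms(2)[OF that] lookup_uminus)
  qed
  have "\<nu> \<in> box n \<Longrightarrow> Poly_Mapping.lookup f \<nu> = 0" for \<nu>
  proof (induction \<nu> rule: low_induct[of n])
    case (less \<nu>)
    have w: "\<nu> \<in> weights n" using less.prems by (simp add: box_def)
    consider i where "1 \<le> i" "i < n" "cmp \<nu> i < cmp \<nu> (Suc i)"
      | i where "1 \<le> i" "i < n" "cmp \<nu> i = cmp \<nu> (Suc i)"
      | "\<And>i. 1 \<le> i \<Longrightarrow> i < n \<Longrightarrow> cmp \<nu> (Suc i) < cmp \<nu> i"
      by (meson linorder_neqE)
    then show ?case
    proof cases
      case (1 i)
      let ?\<sigma> = "act_expo (simple_refl i) \<nu>"
      have "low_step n (slide i (Suc i) (cmp \<nu> i - cmp \<nu> (Suc i)) \<nu>) \<nu>"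
        by (rule low_stepI[OF w]) (use 1 in \<open>auto simp: pairs_def\<close>)
      then have "low n ?\<sigma> \<nu>" unfolding low_def act_expo_simple_refl_slide by (rule tranclp.r_into_trancl)
      moreover have "?\<sigma> \<in> box n"
        using less.prems 1 weights_act_simple_refl[OF 1(1,2) w]
        by (auto simp: box_def lookup_act_expo_simple_refl simple_refl_apply)
      ultimately have "Poly_Mapping.lookup f ?\<sigma> = 0" by (rule less.IH)
      then show ?thesis using swap[OF 1(1,2), of \<nu>] by simp
    next
      case (2 i)
      have "act_expo (simple_refl i) \<nu> = \<nu>"
        unfolding act_expo_simple_refl_slide using 2 by simp
      then have "Poly_Mapping.lookup f \<nu> = - Poly_Mapping.lookup f \<nu>" using swap[OF 2(1,2), of \<nu>] by simp
      then have "Poly_Mapping.lookup f \<nu> + Poly_Mapping.lookup f \<nu> = 0" by (simp only: eq_neg_iff_add_eq_0)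
      then have "2 * Poly_Mapping.lookup f \<nu> = 0" by (simp only: mult_2)
      then show ?thesis using two_neq_0_K unfolding mult_eq_0_iff by blast
    next
      case 3
      then have "\<nu> = mk_expo n (\<lambda>j. int n - int j)" by (rule strictly_decreasing_box[OF less.prems])
      then show ?thesis using assms(3) by simp
    qed
  qed
  then show ?thesis using assms(1) by (intro poly_mapping_eqI) (auto simp: lspan_iff)
qed

lemma alt_vandt_const: "\<exists>W. alt n (vandt n) = lconst W * vand n"
proof -
  let ?A = "alt n (vandt n)" and ?V = "vand n" and ?\<delta> = "mk_expo n (\<lambda>j. int n - int j)"
  let ?a = "Poly_Mapping.lookup ?A ?\<delta>" and ?v = "Poly_Mapping.lookup ?V ?\<delta>"
  have A: "?A \<in> lspan (box n)" unfolding vandt_def by (intro alt_box box_prod_pairs)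
  have V: "?V \<in> lspan (box n)" using box_prod_pairs[of 1 n] by (simp add: vand_def)
  have "?v \<noteq> 0"
    using antisymmetric_box_eq_0[OF V act_simple_refl_vand] vand_neq_0[of n] by blast
  \<comment> \<open>An antisymmetric element of the box is determined by its coefficient at
    \<delta>, which is cancelled in this combination.\<close>
  have "lconst ?v * ?A - lconst ?a * ?V = 0"
  proof (rule antisymmetric_box_eq_0)
    show "lconst ?v * ?A - lconst ?a * ?V \<in> lspan (box n)" by (intro lspan_diff lspan_scale A V)
    show "act (simple_refl i) (lconst ?v * ?A - lconst ?a * ?V) = - (lconst ?v * ?A - lconst ?a * ?V)"
      if "1 \<le> i" "i < n" for i
      by (simp add: act_diff act_mult act_alt[OF that] act_simple_refl_vand[OF that])
    show "Poly_Mapping.lookup (lconst ?v * ?A - lconst ?a * ?V) ?\<delta> = 0"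
      unfolding lookup_minus lookup_lconst_times by simp
  qed
  then have "lconst (inverse ?v) * (lconst ?v * ?A) = lconst (inverse ?v) * (lconst ?a * ?V)" by simp
  then have "?A = lconst (inverse ?v * ?a) * ?V"
    using \<open>?v \<noteq> 0\<close> unfolding mult.assoc[symmetric] lconst_mult[symmetric] by simp
  then show ?thesis by blast
qed

text \<open>
  The factor does not vanish, because the symmetrization of \<open>x\<^sup>\<kappa> \<Prod>\<^sub>i\<^sub><\<^sub>j (x\<^sub>j - t x\<^sub>i)\<close> with
  \<open>\<kappa>\<close> regular does not.
\<close>

lemma alt_vandt_neq_0:
  assumes "0 < n"
  shows "alt n (vandt n) \<noteq> 0"
proof
  assume 0: "alt n (vandt n) = 0"
  define G where "G p = (Xvar (fst p) - lconst tK * Xvar (snd p)) * (Xvar (snd p) - lconst tK * Xvar (fst p))"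
    for p :: "nat \<times> nat"
  define R where "R = (\<Prod>p\<in>pairs n. Xvar (snd p) - lconst tK * Xvar (fst p))"
  define D where "D = (\<Prod>p\<in>pairs n. G p)"
  let ?\<kappa> = "mk_expo n int"
  \<comment> \<open>\<open>R\<close> completes the product over i < j to one over all ordered pairs,
    which is symmetric. So the alternation of \<open>R x^\<kappa>\<close> times
    \<open>vandt n\<close> reduces to that of x^\<kappa>.\<close>
  have D: "D = vandt n * R" by (simp add: D_def G_def R_def vandt_def split_def prod.distrib)
  have symD: "act w D = D" if w: "w permutes {1..n}" for w
  proof -
    have b: "bij w" by (rule permutes_bij[OF w])
    have "act w D = (\<Prod>p\<in>pairs n. act w (G p))" unfolding D_def by (rule act_prod[OF b])
    also have "\<dots> = (\<Prod>p\<in>pairs n. G (sort_pair w p))"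
      by (intro prod.cong refl)
        (simp add: G_def sort_pair_def act_mult[OF b] act_diff[OF b] act_Xvar[OF b] b mult.commute)
    finally show ?thesis unfolding D_def prod_sort_pair[OF w] .
  qed
  have X: "Xvar i - lconst tK * Xvar j \<noteq> 0" if "i \<noteq> j" for i j
  proof
    assume "Xvar i - lconst tK * Xvar j = 0"
    then have "Poly_Mapping.lookup (Xvar i - lconst tK * Xvar j) (Poly_Mapping.single i 1) = 0" by simp
    moreover have "Poly_Mapping.single j (1::int) \<noteq> Poly_Mapping.single i 1"
      using that by (metis lookup_single_eq lookup_single_not_eq zero_neq_one)
    ultimately show False by (simp add: lookup_minus Xvar_def lookup_lmonom)
  qed
  have "G p \<noteq> 0" if "p \<in> pairs n" for p 
    using that X[of "fst p" "snd p"] X[of "snd p" "fst p"] by (auto simp: G_def pairs_def)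
  then have "D \<noteq> 0" unfolding D_def by (simp add: prod_zero_iff)
  have R_ring: "R \<in> laurent_ring n"
    unfolding R_def
    by (rule laurent_ring_prod)
      (auto simp: pairs_def intro!: laurent_ring_diff laurent_ring_scale laurent_ring_Xvar)
  have "R * lmonom ?\<kappa> \<in> lspan (weights n)"
    unfolding laurent_ring_eq_lspan[symmetric] by (intro laurent_ring_mult R_ring laurent_ring_lmonom weights_mk_expo)
  then have "\<exists>p\<in>mspan n (dominant n). coinv n (R * lmonom ?\<kappa>) p"
  proof (rule coinv_lspan)
    fix \<nu>
    assume "\<nu> \<in> weights n"
    from coinv_lmonom[OF this] obtain p where
      p: "p \<in> mspan n {\<gamma> \<in> dominant n. dle n \<gamma> \<nu> \<and> sqn n \<gamma> \<le> sqn n \<nu>}" "coinv n (lmonom \<nu>) p" by (elim bexE)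
    have "{\<gamma> \<in> dominant n. dle n \<gamma> \<nu> \<and> sqn n \<gamma> \<le> sqn n \<nu>} \<subseteq> dominant n" by auto
    from mspan_mono[OF this p(1)] p(2) show "\<exists>p\<in>mspan n (dominant n). coinv n (lmonom \<nu>) p"
      by (rule bexI[rotated])
  qed
  then obtain p where p: "p \<in> mspan n (dominant n)" "coinv n (R * lmonom ?\<kappa>) p" by (elim bexE)
  \<comment> \<open>Every Laurent polynomial in the ring is congruent to a symmetric one, so a
    vanishing \<open>alt n (vandt n)\<close> makes all such alternations vanish.\<close>
  have "alt n (R * lmonom ?\<kappa> * vandt n) = p * alt n (vandt n)"
    by (rule alt_coinv[OF p(2) mspan_symmetric[OF p(1)]])
  then have "alt n (D * lmonom ?\<kappa>) = 0" unfolding 0 D by (simp add: mult_ac)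
  then have "D * alt n (lmonom ?\<kappa>) = 0" by (simp only: alt_mult_symmetric[OF symD])
  then have alt0: "alt n (lmonom ?\<kappa>) = 0" using \<open>D \<noteq> 0\<close> by simp
  have id1: "vsgn n id * act id (lmonom ?\<kappa>) = lmonom ?\<kappa>"
  proof -
    have e: "act_expo id \<mu> = \<mu>" for \<mu> by (rule poly_mapping_eqI) (simp add: lookup_act_expo)
    have "act id f = f" for f
      by (induction f rule: laurent_induct) (simp_all only: act_add act_mult act_lmonom act_lconst bij_id e act_0)
    then show ?thesis by (simp only: vsgn_def simp_thms if_True mult_1_left)
  qed
  \<comment> \<open>The exponent \<kappa> = (1, ..., n) has trivial stabiliser, so only the identity
    contributes to its coefficient.\<close>
  have reg: "w = id" if "w permutes {1..n}" "act_expo w ?\<kappa> = ?\<kappa>" for w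
  proof
    fix j
    show "w j = id j"
    proof (cases "j \<in> {1..n}")
      case True
      then have "w j \<in> {1..n}" using permutes_in_image[OF that(1)] by simp
      moreover have "cmp ?\<kappa> (w j) = cmp ?\<kappa> j"
        using act_expo_apply[OF permutes_bij[OF that(1)], of ?\<kappa> j] unfolding that(2) .
      ultimately show ?thesis using True by (simp add: lookup_mk_expo)
    next
      case False
      then show ?thesis using permutes_not_in[OF that(1)] by simp
    qed
  qed
  have "Poly_Mapping.lookup (alt n (lmonom ?\<kappa>)) ?\<kappa>
      = (\<Sum>w | w permutes {1..n}. if w = id then 1 else 0)"
    unfolding alt_def lookup_sum
  proof (rule sum.cong[OF refl])
    fix w
    assume "w \<in> {w. w permutes {1..n}}"
    then have w: "w permutes {1..n}" by simp
    show "Poly_Mapping.lookup (vsgn n w * act w (lmonom ?\<kappa>)) ?\<kappa> = (if w = id then 1 else 0)"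
    proof (cases "w = id")
      case True
      then show ?thesis using id1 by (simp add: lookup_lmonom)
    next
      case False
      then have "act_expo w ?\<kappa> \<noteq> ?\<kappa>" using reg[OF w] by blast
      then show ?thesis using False by (simp add: vsgn_def act_lmonom lookup_lmonom)
    qed
  qed
  also have "\<dots> = 1" by (simp add: finite_permutations permutes_id)
  finally show False unfolding alt0 by simp
qed

text \<open>The alternation of f times \<open>vandt n\<close> is p times a constant times the
  Vandermonde product, which cancels the denominator; this also settles the definite description in
  \<open>symmetrization\<close>.\<close>

lemma symmetrization_coinv:
  assumes "0 < n"
  shows "\<exists>W. W \<noteq> 0 \<and> (\<forall>f p. coinv n f p \<longrightarrow> (\<forall>w. w permutes {1..n} \<longrightarrow> act w p = p) \<longrightarrow>
    symmetrization n f = lconst W * p)"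
proof -
  obtain W where W: "alt n (vandt n) = lconst W * vand n" using alt_vandt_const by blast
  have "W \<noteq> 0" using W alt_vandt_neq_0[OF assms] by auto
  moreover have "symmetrization n f = lconst W * p"
    if "coinv n f p" "\<And>w. w permutes {1..n} \<Longrightarrow> act w p = p" for f p
  proof -
    have a: "alt n (f * vandt n) = p * alt n (vandt n)"
      by (rule alt_coinv[OF that(1)]) (rule that(2))
    have "symsum n (f * vandt n) = Fraction_Field.Fract (p * (lconst W * vand n)) (vand n)"
      unfolding symsum_alt a W ..
    also have "\<dots> = Fraction_Field.Fract (lconst W * p) 1"
      using vand_neq_0 by (simp add: eq_fract mult_ac)
    finally have eq: "symsum n (f * vandt n) = Fraction_Field.Fract (lconst W * p) 1" .
    show ?thesis
      unfolding symmetrization_symsum eq by (rule the_equality) (simp_all add: eq_fract)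
  qed
  ultimately show ?thesis by blast
qed

section \<open>The symmetric Macdonald polynomials\<close>

lemma mspan_keys:
  assumes "f \<in> mspan n S" "\<nu> \<in> Poly_Mapping.keys f"
  shows "\<exists>\<gamma>\<in>S. \<nu> \<in> orbit n \<gamma>"
proof -
  have "f \<in> lspan (\<Union>\<gamma>\<in>S. orbit n \<gamma>)"
    using assms(1)
  proof (induction f rule: mspan_induct)
    case (monom c \<gamma>)
    then show ?case unfolding monom_sym_orbit by (intro lspan_scale lspan_sum lspan_lmonom) auto
  qed (auto intro: lspan_add)
  then show ?thesis using assms(2) by (auto simp: lspan_def)
qed

text \<open>\<open>E_lam\<close> is congruent to c \<open>m_lam\<close> plus smaller orbit sums.
  Symmetrization multiplies this by a constant W, and the normalisation divides by W c. The
  congruence stays in the conclusion because orthogonality is transferred along it.\<close>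

lemma macdonald_P_mspan:
  assumes n: "0 < n" and lam: "lam \<in> dominant n"
  shows "\<exists>c. macdonald_P n lam - monom_sym n lam \<in> mspan n (dominant_below n lam) \<and>
    coinv n (Emac n lam) (lconst c * macdonald_P n lam) \<and> c \<noteq> 0"
proof -
  let ?E = "Emac n lam"
  let ?D = "{\<gamma> \<in> dominant n. dle n \<gamma> lam \<and> sqn n \<gamma> < sqn n lam}"
  have lw: "lam \<in> weights n" by (rule dominant_weights[OF lam])
  obtain c r where cr: "c \<noteq> 0" "r \<in> lspan (below n lam)" "coinv n (lmonom lam) (lconst c * monom_sym n lam + r)"
    using coinv_dominant[OF lam] by blast
  have "{\<nu>. low n \<nu> lam} \<subseteq> below n lam"
    using low_weights(1) low_dle low_dominant_sqn[OF _ lam] by (auto simp: below_def)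
  then have E: "?E - lmonom lam \<in> lspan (below n lam)"
    using is_E_Emac[OF n lw] unfolding is_E_def by (elim conjE) (rule lspan_mono)
  have "\<exists>p\<in>mspan n ?D. coinv n (r + (?E - lmonom lam)) p"
  proof (rule coinv_lspan[OF lspan_add[OF cr(2) E]])
    fix \<nu>
    assume "\<nu> \<in> below n lam"
    then have \<nu>: "\<nu> \<in> weights n" "dle n \<nu> lam" "sqn n \<nu> < sqn n lam" by (auto simp: below_def)
    from coinv_lmonom[OF \<nu>(1)] obtain p where
      p: "p \<in> mspan n {\<gamma> \<in> dominant n. dle n \<gamma> \<nu> \<and> sqn n \<gamma> \<le> sqn n \<nu>}" "coinv n (lmonom \<nu>) p" by (elim bexE)
    have "{\<gamma> \<in> dominant n. dle n \<gamma> \<nu> \<and> sqn n \<gamma> \<le> sqn n \<nu>} \<subseteq> ?D"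
      using \<nu>(3) dle_trans[OF _ \<nu>(2)] by auto
    from mspan_mono[OF this p(1)] p(2) show "\<exists>p\<in>mspan n ?D. coinv n (lmonom \<nu>) p" by (rule bexI[rotated])
  qed
  then obtain p' where p': "p' \<in> mspan n ?D" "coinv n (r + (?E - lmonom lam)) p'" by (elim bexE)
  let ?p = "lconst c * monom_sym n lam + p'"
  have "coinv n (lmonom lam + (?E - lmonom lam)) ((lconst c * monom_sym n lam + r) + (?E - lmonom lam))"
    by (intro coinv_add cr(3) coinv_refl)
  then have 1: "coinv n ?E (lconst c * monom_sym n lam + (r + (?E - lmonom lam)))"
    by (simp add: add.assoc)
  have coE: "coinv n ?E ?p"
    by (rule coinv_trans[OF 1 coinv_add[OF coinv_refl p'(2)]])
  have pm: "?p \<in> mspan n (insert lam ?D)"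
    by (intro mspan_add mspan_monom_sym mspan_mono[OF subset_insertI p'(1)]) simp
  obtain W where W: "W \<noteq> 0" "\<And>f p. coinv n f p \<Longrightarrow> (\<And>w. w permutes {1..n} \<Longrightarrow> act w p = p) \<Longrightarrow>
      symmetrization n f = lconst W * p"
    using symmetrization_coinv[OF n] by blast
  have sym: "symmetrization n ?E = lconst W * ?p"
    by (rule W(2)[OF coE mspan_symmetric[OF pm]])
  \<comment> \<open>The orbits occurring in p' have smaller \<open>sqn\<close> than lam, so the
    coefficient of x^lam in \<open>?p\<close> is exactly c.\<close>
  have "Poly_Mapping.lookup p' lam = 0"
  proof (rule ccontr)
    assume "Poly_Mapping.lookup p' lam \<noteq> 0"
    then have "lam \<in> Poly_Mapping.keys p'" by (simp add: in_keys_iff)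
    from mspan_keys[OF p'(1) this] obtain \<gamma> where "\<gamma> \<in> ?D" "lam \<in> orbit n \<gamma>" by (elim bexE)
    then show False using orbit_dle(3)[of lam n \<gamma>] by simp
  qed
  then have "Poly_Mapping.lookup ?p lam = c"
    by (simp add: lookup_add lookup_monom_sym orbit_self)
  then have norm: "W_norm n lam = W * c"
    unfolding W_norm_def macdonald_E_eq[OF n lw] sym lookup_lconst_times by simp
  have "macdonald_P n lam = (lconst (1 / (W * c)) * lconst W) * ?p"
    unfolding macdonald_P_def norm macdonald_E_eq[OF n lw] sym by (simp only: mult.assoc)
  also have "lconst (1 / (W * c)) * lconst W = lconst (inverse c)"
    using W(1) cr(1) by (simp add: field_simps flip: lconst_mult)
  finally have P: "macdonald_P n lam = lconst (inverse c) * ?p" .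
  have inv: "lconst (inverse c) * lconst c = 1" "lconst c * lconst (inverse c) = 1"
    using cr(1) by (simp_all flip: lconst_mult)
  have "macdonald_P n lam - monom_sym n lam = lconst (inverse c) * p'"
    unfolding P distrib_left mult.assoc[symmetric] inv by simp
  moreover have "?D \<subseteq> dominant_below n lam"
    using dle_dominant[OF _ lam] by (auto simp: dominant_below_def)
  then have "lconst (inverse c) * p' \<in> mspan n (dominant_below n lam)"
    by (intro mspan_scale mspan_mono[OF _ p'(1)])
  moreover have "lconst c * macdonald_P n lam = ?p"
    unfolding P mult.assoc[symmetric] inv by simp
  ultimately show ?thesis using coE cr(1) by (intro exI[of _ c]) simp
qed

lemma dominant_below_not_dle:
  assumes "\<gamma> \<in> dominant_below n lam" "lam \<in> dominant n"
  shows "\<not> dle n lam \<gamma>"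
proof
  assume "dle n lam \<gamma>"
  then have "dominance_le n lam \<gamma>" using assms(1) by (intro dle_dominant) (auto simp: dominant_below_def)
  then have "\<gamma> = lam"
    using assms by (intro dominance_le_antisym[of n]) (auto simp: dominant_below_def intro: dominant_weights)
  then show False using assms(1) by (simp add: dominant_below_def)
qed

text \<open>A \<gamma> below lam in dominance may have another degree and so need not be comparable
  in \<open>low\<close>. Hence the detour through the down-closed set of \<kappa> with
  \<open>dle n \<kappa> \<gamma>\<close>, which misses lam.\<close>

lemma inner_Emac_monom_sym:
  assumes n: "0 < n" and lam: "lam \<in> dominant n" and \<gamma>: "\<gamma> \<in> dominant_below n lam"
  shows "inner_qt n (Emac n lam) (monom_sym n \<gamma>) = 0"
proof (rule inner_lspan_right[OF n])
  show "monom_sym n \<gamma> \<in> lspan (orbit n \<gamma>)"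
    unfolding monom_sym_orbit by (intro lspan_sum lspan_lmonom)
  fix \<nu>
  assume \<nu>: "\<nu> \<in> orbit n \<gamma>"
  have \<gamma>w: "\<gamma> \<in> weights n" using \<gamma> by (auto simp: dominant_below_def intro: dominant_weights)
  show "inner_qt n (Emac n lam) (lmonom \<nu>) = 0"
  proof (rule inner_Emac_lmonom[OF n, of "{\<kappa> \<in> weights n. dle n \<kappa> \<gamma>}"])
    show "\<kappa> \<in> {\<kappa> \<in> weights n. dle n \<kappa> \<gamma>}" if "\<nu> \<in> {\<kappa> \<in> weights n. dle n \<kappa> \<gamma>}" "low n \<kappa> \<nu>" for \<nu> \<kappa>
      using that low_weights(1)[OF that(2)] dle_trans[OF low_dle[OF that(2)]] by auto
    show "lam \<notin> {\<kappa> \<in> weights n. dle n \<kappa> \<gamma>}" using dominant_below_not_dle[OF \<gamma> lam] by simp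
    show "\<nu> \<in> {\<kappa> \<in> weights n. dle n \<kappa> \<gamma>}"
      using orbit_dle(1)[OF \<nu>] orbit_weights[OF \<gamma>w] \<nu> by auto
  qed (auto intro: dominant_weights[OF lam])
qed

text \<open>Nondegeneracy asks for orthogonality to the monomials of g. As g is symmetric, such a
  monomial may be replaced by a congruent combination of orbit sums, and these are again below
  lam.\<close>

lemma mspan_orthogonal_eq_0:
  assumes n: "0 < n" and lam: "lam \<in> dominant n" and g: "g \<in> mspan n (dominant_below n lam)"
    and orth: "\<And>\<gamma>. \<gamma> \<in> dominant_below n lam \<Longrightarrow> inner_qt n g (monom_sym n \<gamma>) = 0"
  shows "g = 0"
proof (rule inner_nondegenerate[OF n])
  have bw: "dominant_below n lam \<subseteq> weights n" by (auto simp: dominant_below_def intro: dominant_weights)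
  show "g \<in> laurent_ring n" by (rule mspan_laurent_ring[OF g bw])
  fix \<nu>
  assume "\<nu> \<in> Poly_Mapping.keys g"
  from mspan_keys[OF g this] obtain \<gamma> where \<gamma>: "\<gamma> \<in> dominant_below n lam" "\<nu> \<in> orbit n \<gamma>" by (elim bexE)
  have "\<gamma> \<in> weights n" using \<gamma>(1) bw by blast
  then have "\<nu> \<in> weights n" using orbit_weights \<gamma>(2) by blast
  from coinv_lmonom[OF this] obtain p where
    p: "p \<in> mspan n {\<gamma> \<in> dominant n. dle n \<gamma> \<nu> \<and> sqn n \<gamma> \<le> sqn n \<nu>}" "coinv n (lmonom \<nu>) p" by (elim bexE)
  have "{\<gamma> \<in> dominant n. dle n \<gamma> \<nu> \<and> sqn n \<gamma> \<le> sqn n \<nu>} \<subseteq> dominant_below n lam"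
    using dominant_below_if_dle[OF _ _ orbit_dle(1)[OF \<gamma>(2)] \<gamma>(1) lam] by auto
  from mspan_mono[OF this p(1)] have p1: "p \<in> mspan n (dominant_below n lam)" .
  have "inner_qt n g (lmonom \<nu>) = inner_qt n g p"
    by (rule coinv_inner(2)[OF n p(2)]) (rule mspan_symmetric[OF g simple_refl_permutes])
  also have "\<dots> = 0"
    using p1 by (induction p rule: mspan_induct)
      (simp_all add: orth inner_add_right[OF n] inner_scale_right[OF n])
  finally show "inner_qt n g (lmonom \<nu>) = 0" .
qed

theorem proposition6p3:
  fixes n :: nat and lam :: expo
  assumes "n \<ge> 1" and "lam \<in> dominant n"
  shows "{f \<in> sym_ring n.
            (\<exists>S c. finite S \<and> S \<subseteq> dominant_below n lam \<and>
                   f = monom_sym n lam + (\<Sum>\<gamma>\<in>S. lconst (c \<gamma>) * monom_sym n \<gamma>)) \<and>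
            (\<forall>\<gamma>\<in>dominant_below n lam. inner_qt n f (monom_sym n \<gamma>) = 0)}
         = {macdonald_P n lam}"
proof -
  have n: "0 < n" and lam: "lam \<in> dominant n" using assms by auto
  let ?P = "macdonald_P n lam" and ?B = "dominant_below n lam"
  obtain c where c: "?P - monom_sym n lam \<in> mspan n ?B" "coinv n (Emac n lam) (lconst c * ?P)" "c \<noteq> 0"
    using macdonald_P_mspan[OF n lam] by blast
  have Bw: "insert lam ?B \<subseteq> weights n"
    using lam by (auto simp: dominant_below_def intro: dominant_weights)
  have "(?P - monom_sym n lam) + lconst 1 * monom_sym n lam \<in> mspan n (insert lam ?B)"
    by (intro mspan_add mspan_monom_sym mspan_mono[OF subset_insertI c(1)]) simp
  then have Pm: "?P \<in> mspan n (insert lam ?B)" by simp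
  have P_orth: "inner_qt n ?P (monom_sym n \<gamma>) = 0" if "\<gamma> \<in> ?B" for \<gamma>
  proof -
    \<comment> \<open>\<open>E_lam\<close> and c \<open>P_lam\<close> are congruent, so they pair
      equally with a symmetric element.\<close>
    have "inner_qt n (Emac n lam) (monom_sym n \<gamma>) = inner_qt n (lconst c * ?P) (monom_sym n \<gamma>)"
      by (rule coinv_inner(1)[OF n c(2)]) (rule act_monom_sym[OF simple_refl_permutes])
    then have "K_to_fls c * inner_qt n ?P (monom_sym n \<gamma>) = 0"
      by (simp only: inner_Emac_monom_sym[OF n lam that] inner_scale_left[OF n])
    then show ?thesis using c(3) by simp
  qed
  have P_in: "?P \<in> sym_ring n"
    unfolding sym_ring_def using mspan_laurent_ring[OF Pm Bw] mspan_symmetric[OF Pm] by blast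
  obtain S d where S: "finite S" "S \<subseteq> ?B" "?P - monom_sym n lam = (\<Sum>\<gamma>\<in>S. lconst (d \<gamma>) * monom_sym n \<gamma>)"
    using c(1) unfolding mspan_def by blast
  then have P_tri: "?P = monom_sym n lam + (\<Sum>\<gamma>\<in>S. lconst (d \<gamma>) * monom_sym n \<gamma>)"
    by (simp add: algebra_simps)
  have unique: "f = ?P" if "f - monom_sym n lam \<in> mspan n ?B" "\<And>\<gamma>. \<gamma> \<in> ?B \<Longrightarrow> inner_qt n f (monom_sym n \<gamma>) = 0" for f
  proof -
    have "f - ?P = 0"
    proof (rule mspan_orthogonal_eq_0[OF n lam])
      show "f - ?P \<in> mspan n ?B" using mspan_diff[OF that(1) c(1)] by simp
      show "inner_qt n (f - ?P) (monom_sym n \<gamma>) = 0" if "\<gamma> \<in> ?B" for \<gamma>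
        using \<open>\<And>\<gamma>. \<gamma> \<in> ?B \<Longrightarrow> inner_qt n f (monom_sym n \<gamma>) = 0\<close>[OF that] P_orth[OF that]
        by (simp add: inner_diff_left[OF n])
    qed
    then show ?thesis by simp
  qed
  show ?thesis
  proof (rule set_eqI, rule iffI)
    fix f
    assume "f \<in> {f \<in> sym_ring n.
            (\<exists>S c. finite S \<and> S \<subseteq> ?B \<and> f = monom_sym n lam + (\<Sum>\<gamma>\<in>S. lconst (c \<gamma>) * monom_sym n \<gamma>)) \<and>
            (\<forall>\<gamma>\<in>?B. inner_qt n f (monom_sym n \<gamma>) = 0)}"
    then obtain S e where "finite S" "S \<subseteq> ?B" "f = monom_sym n lam + (\<Sum>\<gamma>\<in>S. lconst (e \<gamma>) * monom_sym n \<gamma>)"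
      and o: "\<forall>\<gamma>\<in>?B. inner_qt n f (monom_sym n \<gamma>) = 0" by blast
    then have "f - monom_sym n lam \<in> mspan n ?B" unfolding mspan_def by auto
    then have "f = ?P" using o by (intro unique) auto
    then show "f \<in> {?P}" by simp
  next
    fix f
    assume "f \<in> {?P}"
    then have f: "f = ?P" by simp
    show "f \<in> {f \<in> sym_ring n.
            (\<exists>S c. finite S \<and> S \<subseteq> ?B \<and> f = monom_sym n lam + (\<Sum>\<gamma>\<in>S. lconst (c \<gamma>) * monom_sym n \<gamma>)) \<and>
            (\<forall>\<gamma>\<in>?B. inner_qt n f (monom_sym n \<gamma>) = 0)}"
      unfolding f using P_in S(1,2) P_tri P_orth by blast
  qed
qed

end
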